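(* Let $p$ be a prime and $q=p^t$ with $t\geq 1$. The $p$-rank of the point-hyperplane incidence matrix $A_{11}$ for the dual Hermitian generalized quadrangle $DH(4,q^2)$ is as follows. (a) If $p>2$ then $$\mathrm{rank}_pA_{11}=1+\left[\frac{p(p+1)}{32}\binom{2p+2}{3}^2-\frac{p(p-1)}{32}\binom{2p}{3}^2+\frac{p}{2}\binom{p+1}{3}^2\right]^t.$$ (b) If $p=2$ then $\mathrm{rank}_2A_{11}=1+74^t$.
   Context: Let $V(q^2)$ be a $5$-dimensional vector space over $\mathbf{F}_{q^2}$ with a nondegenerate Hermitian form. The totally isotropic subspaces of dimensions one and two form the points and lines of the Hermitian generalized quadrangle. The dual quadrangle $DH(4,q^2)$ is obtained by interchanging the roles of points and lines: its points are the totally isotropic $2$-dimensional subspaces of $V(q^2)$, and its lines are the totally isotropic $1$-dimensional subspaces. A polar hyperplane in the dual quadrangle is the set of dual points which are collinear (in the dual quadrangle) with a given dual point, each point being regarded as collinear with itself; that is, for a totally isotropic $2$-subspace $Z$, it is the set of totally isotropic $2$-subspaces $Z'$ with $Z\cap Z'\neq 0$. $A_{11}$ is the $0$-$1$ incidence matrix with rows indexed by the points of $DH(4,q^2)$ and columns indexed by the polar hyperplanes, with entry $1$ exactly when the point belongs to the polar hyperplane. $\mathrm{rank}_p$ is the rank of the matrix regarded as having entries in the field of $p$ elements. *)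

theory Defs
  imports "HOL-Library.Cardinality" "Jordan_Normal_Form.DL_Rank"
begin

(* A nondegenerate Hermitian form over the field with q^2 elements. The involution is x |-> x^q;
   since it is additive, conjugate-linearity in the second argument follows from the axioms. *)
locale hermitian_space = vector_space scale
  for scale :: "'k :: {field, finite} \<Rightarrow> 'v :: ab_group_add \<Rightarrow> 'v" +
  fixes q :: nat
    and h :: "'v \<Rightarrow> 'v \<Rightarrow> 'k"
  assumes card_field: "CARD('k) = q ^ 2"
    and form_add_left: "h (x + y) z = h x z + h y z"
    and form_scale_left: "h (scale a x) z = a * h x z"
    and form_hermitian: "h y x = h x y ^ q"
    and form_nondegenerate: "(\<And>y. h x y = 0) \<Longrightarrow> x = 0"
begin

definition totally_isotropic :: "'v set \<Rightarrow> bool" where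
  "totally_isotropic W \<longleftrightarrow> subspace W \<and> (\<forall>x\<in>W. \<forall>y\<in>W. h x y = 0)"

definition dual_points :: "'v set set" where
  "dual_points = {Z. totally_isotropic Z \<and> dim Z = 2}"

definition dual_lines :: "'v set set" where
  "dual_lines = {L. totally_isotropic L \<and> dim L = 1}"

text \<open>A dual point \<open>Z\<close> lies on a dual line \<open>L\<close> iff \<open>L \<subseteq> Z\<close> as subspaces.\<close>

definition dual_collinear :: "'v set \<Rightarrow> 'v set \<Rightarrow> bool" where
  "dual_collinear Z Z' \<longleftrightarrow> Z = Z' \<or> (\<exists>L\<in>dual_lines. L \<subseteq> Z \<and> L \<subseteq> Z')"

definition polar_hyperplane :: "'v set \<Rightarrow> 'v set set" where
  "polar_hyperplane Z = {Z' \<in> dual_points. dual_collinear Z Z'}"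

definition polar_hyperplanes :: "'v set set set" where
  "polar_hyperplanes = polar_hyperplane ` dual_points"

lemma polar_hyperplane_eq:
  assumes Z: "Z \<in> dual_points"
  shows "polar_hyperplane Z = {Z' \<in> dual_points. Z \<inter> Z' \<noteq> {0}}"
proof -
  have "dual_collinear Z Z' \<longleftrightarrow> Z \<inter> Z' \<noteq> {0}" if Z': "Z' \<in> dual_points" for Z'
  proof
    have sub: "subspace Z" "subspace Z'" "dim Z = 2"
      and iso: "\<And>x y. x \<in> Z \<Longrightarrow> y \<in> Z \<Longrightarrow> h x y = 0"
      using Z Z' by (auto simp: dual_points_def totally_isotropic_def)
    have nontriv: "Y \<noteq> {0}" if "dim Y \<noteq> 0" for Y
      using that dim_span[of "{}"] dim_eq_card_independent[OF independent_empty] by auto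
    {
      assume "dual_collinear Z Z'"
      then consider "Z = Z'" | L where "L \<in> dual_lines" "L \<subseteq> Z" "L \<subseteq> Z'"
        by (auto simp: dual_collinear_def)
      then show "Z \<inter> Z' \<noteq> {0}"
      proof cases
        case 1
        then show ?thesis using nontriv[of Z] sub by simp
      next
        case 2
        then have "L \<noteq> {0}" "0 \<in> L"
          using nontriv[of L] by (auto simp: dual_lines_def totally_isotropic_def subspace_0)
        then show ?thesis using 2 by blast
      qed
    next
      assume "Z \<inter> Z' \<noteq> {0}"
      then obtain v where v: "v \<in> Z" "v \<in> Z'" "v \<noteq> 0"
        using sub subspace_0 by blast
      have "dim (span {v}) = 1"
        using v by (simp add: dim_eq_card_independent)
      moreover have sv: "span {v} \<subseteq> Z" "span {v} \<subseteq> Z'"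
        using v sub by (simp_all add: span_minimal)
      moreover have "\<forall>x\<in>span {v}. \<forall>y\<in>span {v}. h x y = 0"
        using sv iso by blast
      ultimately have "span {v} \<in> dual_lines"
        by (simp add: dual_lines_def totally_isotropic_def)
      with sv show "dual_collinear Z Z'"
        unfolding dual_collinear_def by blast
    }
  qed
  then show ?thesis by (auto simp: polar_hyperplane_def)
qed

end

text \<open>The incidence matrix for the finite sets enumerated without repetition by \<open>Ps\<close> (points, rows)
  and \<open>Hs\<close> (point sets, columns).\<close>

definition incidence_mat :: "'a list \<Rightarrow> 'a set list \<Rightarrow> 'f :: field mat" where
  "incidence_mat Ps Hs =
     mat (length Ps) (length Hs) (\<lambda>(i, j). if Ps ! i \<in> Hs ! j then 1 else 0)"

end

theory Submission
  imports Defs "HOL-Number_Theory.Number_Theory" "HOL-Library.Function_Algebras" "HOL-Library.Poly_Mapping"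
    "HOL-Computational_Algebra.Formal_Power_Series"
begin

text \<open>Let \<open>k\<close> be the field with \<open>q\<^sup>2\<close> elements. Two dual points with bases \<open>x\<^sub>0, x\<^sub>1\<close> and
  \<open>y\<^sub>0, y\<^sub>1\<close> are disjoint iff the determinant \<open>D\<close> of the \<open>h x\<^sub>i y\<^sub>j\<close> is nonzero, so the matrix of
  disjointness has the entries \<open>D ^ (q\<^sup>2 - 1)\<close>. Counting with transvections modulo \<open>p\<close> shows that all its row
  and column sums vanish and that the number of points is 1, whence \<open>A\<^sub>1\<^sub>1\<close> has rank one more.
  Since \<open>q\<^sup>2 - 1 = (q + 1) (p - 1) (1 + p + \<dots> + p ^ (t - 1))\<close>, the disjointness matrix is an entrywise product of \<open>t\<close> Frobenius
  twists of a matrix with entries \<open>D ^ ((q + 1) (p - 1))\<close>. Up to nonzero row and column factors the latter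
  is a pairing of vectors attached to Witt bases, which lie in the space \<open>EE\<close> of those polynomials in \<open>e\<^sub>0, y\<^sub>0, \<dots>, e\<^sub>4, y\<^sub>4\<close>,
  modulo \<open>p\<close>-th powers of the variables and of bidegree \<open>(2p - 2, 3p - 3)\<close>, that are invariant under \<open>e\<^sub>i \<mapsto> e\<^sub>i + y\<^sub>i\<close>.
  The dimension of \<open>EE\<close> is the number in square brackets of (a); for \<open>p = 2\<close> it is 75, and one
  dimension is lost to the radical of the pairing. Hence the rank is at most the \<open>t\<close>-th power. For equality,
  take a tensor that is orthogonal to all Witt bases, with its lowest term as high as possible. Averaging
  it over one-parameter families of unitary maps against power sums gives tensors with higher lowest terms,
  so the lowest term is killed by all raising operators in each slot. It is then the highest weight
  vector, which pairs nontrivially with the reversed basis.\<close>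

section \<open>Divided powers of a unipotent substitution\<close>

text \<open>Modulo p-th powers of the variables, the top coefficient of a product of five (p-1)-st
  powers of linear forms is the (p-1)-st power of a determinant. This is the origin of the bidegree:
  the plane spanned by \<open>b 0\<close>, \<open>b 1\<close> gives two factors in e, and its
  perpendicular space, spanned by \<open>b 0\<close>, \<open>b 1\<close>, \<open>b 2\<close>, gives
  three in y. Against a second basis with e and y exchanged, both sets of variables are filled up,
  and each set yields one of the determinants \<open>gram b b'\<close> and \<open>gram b' b\<close>.
  The obstacle to equality is that the unitary group has few unipotent elements: one parameter s
  moves two simple roots at once, with coefficients s and \<open>- (s ^ q)\<close>. In slot j of the
  tensor these appear as s to the powers p^j and p^(t+j). The 2t exponents so obtained are distinct
  and less than q^2 - 1, so that power sums over the field separate all slots and both roots, as if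
  every slot carried its own action of the upper triangular matrices.\<close>

text \<open>The list of the pairs \<open>(a\<^sub>i, b\<^sub>i)\<close> stands for the monomial \<open>\<Prod> e\<^sub>i ^ a\<^sub>i * y\<^sub>i ^ b\<^sub>i\<close>, and a function on such lists for the
  polynomial with these coefficients.\<close>

type_synonym exps = "(nat \<times> nat) list"

definition deg1 :: "exps \<Rightarrow> int" where "deg1 l = (\<Sum>x\<leftarrow>l. int (fst x))"
definition deg2 :: "exps \<Rightarrow> int" where "deg2 l = (\<Sum>x\<leftarrow>l. int (snd x))"

lemma deg_Nil [simp]: "deg1 [] = 0" "deg2 [] = 0"
  by (auto simp: deg1_def deg2_def)

lemma deg_Cons [simp]: "deg1 (x # l) = int (fst x) + deg1 l" "deg2 (x # l) = int (snd x) + deg2 l"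
  by (auto simp: deg1_def deg2_def)

lemma deg_nonneg [simp]: "deg1 l \<ge> 0" "deg2 l \<ge> 0"
  by (induction l) auto

text \<open>\<open>UT\<close>, \<open>LT\<close> and \<open>ST\<close> are the substitutions \<open>e \<mapsto> e + y\<close>, then \<open>y \<mapsto> y - e\<close>, and \<open>(e, y) \<mapsto> (y, y - e)\<close>;
  \<open>DU n\<close> is the part of \<open>UT\<close> that lowers the degree in \<open>e\<close> by \<open>n\<close>.\<close>

fun DU :: "nat \<Rightarrow> (exps \<Rightarrow> 'k) \<Rightarrow> exps \<Rightarrow> 'k :: comm_ring_1" where
  "DU n \<psi> [] = (if n = 0 then \<psi> [] else 0)"
| "DU n \<psi> (x # l) = (\<Sum>c\<le>min n (snd x). of_nat ((fst x + c) choose c)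
      * DU (n - c) (\<lambda>l'. \<psi> ((fst x + c, snd x - c) # l')) l)"

fun UT :: "(exps \<Rightarrow> 'k) \<Rightarrow> exps \<Rightarrow> 'k :: comm_ring_1" where
  "UT \<psi> [] = \<psi> []"
| "UT \<psi> (x # l) = (\<Sum>c\<le>snd x. of_nat ((fst x + c) choose c)
      * UT (\<lambda>l'. \<psi> ((fst x + c, snd x - c) # l')) l)"

fun LT :: "(exps \<Rightarrow> 'k) \<Rightarrow> exps \<Rightarrow> 'k :: comm_ring_1" where
  "LT \<psi> [] = \<psi> []"
| "LT \<psi> (x # l) = (\<Sum>c\<le>fst x. (-1) ^ c * of_nat ((snd x + c) choose c)
      * LT (\<lambda>l'. \<psi> ((fst x - c, snd x + c) # l')) l)"

fun ST :: "(exps \<Rightarrow> 'k) \<Rightarrow> exps \<Rightarrow> 'k :: comm_ring_1" where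
  "ST \<psi> [] = \<psi> []"
| "ST \<psi> (x # l) = (\<Sum>b\<le>fst x + snd x. (-1) ^ fst x * of_nat (b choose fst x)
      * ST (\<lambda>l'. \<psi> ((fst x + snd x - b, b) # l')) l)"

lemma DU_zero [simp]: "DU n (\<lambda>_. 0) l = 0"
  by (induction l arbitrary: n) auto

lemma DU_0 [simp]: "DU 0 \<psi> l = \<psi> l"
  by (induction l arbitrary: \<psi>) auto

lemma DU_add: "DU n (\<lambda>l. \<psi> l + \<phi> l) l = DU n \<psi> l + DU n \<phi> l"
  by (induction l arbitrary: n \<psi> \<phi>) (auto simp: sum.distrib algebra_simps)

lemma DU_scale: "DU n (\<lambda>l. a * \<psi> l) l = a * DU n \<psi> l"
  by (induction l arbitrary: n \<psi>) (auto simp: sum_distrib_left algebra_simps)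

lemma DU_diff: "DU n (\<lambda>l. \<psi> l - \<phi> l) l = DU n \<psi> l - DU n \<phi> l"
  using DU_add[of n \<psi> "\<lambda>l. (-1) * \<phi> l" l] DU_scale[of n "-1" \<phi> l] by simp

lemma DU_sum: "finite A \<Longrightarrow> DU n (\<lambda>l. \<Sum>i\<in>A. \<psi> i l) l = (\<Sum>i\<in>A. DU n (\<psi> i) l)"
  by (induction A rule: finite_induct) (auto simp: DU_add)

lemma LT_add: "LT (\<lambda>l. \<psi> l + \<phi> l) l = LT \<psi> l + LT \<phi> l"
  by (induction l arbitrary: \<psi> \<phi>) (auto simp: sum.distrib algebra_simps)

lemma LT_zero [simp]: "LT (\<lambda>_. 0) l = 0"
  by (induction l) auto

lemma LT_scale: "LT (\<lambda>l. a * \<psi> l) l = a * LT \<psi> l"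
  by (induction l arbitrary: \<psi>) (auto simp: sum_distrib_left algebra_simps)

lemma LT_sum: "finite A \<Longrightarrow> LT (\<lambda>l. \<Sum>i\<in>A. \<psi> i l) l = (\<Sum>i\<in>A. LT (\<psi> i) l)"
  by (induction A rule: finite_induct) (auto simp: LT_add)

text \<open>Comparison of the coefficients of x^a in (1+x)^(-b-1) (1+x)^(a+b-\<beta>) =
  (1+x)^(a-1-\<beta>), where binomials with negative upper index are rewritten with signs.\<close>

lemma binomial_alternating_Vandermonde:
  "(\<Sum>c\<le>a. (-1) ^ c * int ((b + c) choose c) * int ((a + b - \<beta>) choose (a - c)))
     = (-1) ^ a * int (\<beta> choose a)" if "\<beta> \<le> a + b"
proof -
  have g: "(-1) ^ c * real ((b + c) choose c) = (- (real b + 1)) gchoose c" for c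
  proof -
    have "(- (real b + 1)) gchoose c = (-1) ^ c * ((real b + 1 + real c - 1) gchoose c)"
      using gbinomial_minus[of "real b + 1" c] by simp
    also have "real b + 1 + real c - 1 = real (b + c)" by simp
    finally show ?thesis by (simp add: binomial_gbinomial)
  qed
  have "real_of_int (\<Sum>c\<le>a. (-1) ^ c * int ((b + c) choose c) * int ((a + b - \<beta>) choose (a - c)))
    = (\<Sum>c\<le>a. ((- (real b + 1)) gchoose c) * (real (a + b - \<beta>) gchoose (a - c)))"
    unfolding g[symmetric] by (simp add: binomial_gbinomial)
  also have "\<dots> = (- (real b + 1) + real (a + b - \<beta>)) gchoose a"
    using gbinomial_Vandermonde[of "- (real b + 1)" "real (a + b - \<beta>)" a] by (simp add: atLeast0AtMost)
  also have "- (real b + 1) + real (a + b - \<beta>) = - (real \<beta> - real a + 1)"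
    using that by (simp add: of_nat_diff)
  also have "\<dots> gchoose a = (-1) ^ a * (real \<beta> gchoose a)"
    using gbinomial_minus[of "real \<beta> - real a + 1" a] by simp
  also have "\<dots> = real_of_int ((-1) ^ a * int (\<beta> choose a))"
    by (simp add: binomial_gbinomial)
  finally show ?thesis using of_int_eq_iff by blast
qed

text \<open>Under the two substitutions e becomes e + y and then y, while y becomes y - e. The pairs
  of variables do not interact, and for a single pair the coefficients agree by the alternating
  Vandermonde identity.\<close>

lemma LT_UT: "LT (UT \<psi>) l = ST \<psi> l"
proof (induction l arbitrary: \<psi>)
  case Nil
  then show ?case by simp
next
  case (Cons x l)
  obtain a b where x: "x = (a, b)" by force
  let ?S = "\<lambda>\<beta>. ST (\<lambda>l'. \<psi> ((a + b - \<beta>, \<beta>) # l')) l"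
  have "LT (UT \<psi>) (x # l) = (\<Sum>c\<le>a. (-1) ^ c * of_nat ((b + c) choose c)
      * LT (\<lambda>l'. \<Sum>d\<le>b + c. of_nat ((a - c + d) choose d) * UT (\<lambda>l''. \<psi> ((a - c + d, b + c - d) # l'')) l') l)"
    by (simp add: x)
  also have "\<dots> = (\<Sum>c\<le>a. (-1) ^ c * of_nat ((b + c) choose c)
      * (\<Sum>d\<le>b + c. of_nat ((a - c + d) choose d) * ST (\<lambda>l''. \<psi> ((a - c + d, b + c - d) # l'')) l))"
    by (simp add: LT_sum LT_scale Cons.IH)
  also have "\<dots> = (\<Sum>c\<le>a. (-1) ^ c * of_nat ((b + c) choose c)
      * (\<Sum>\<beta>\<le>a + b. of_nat ((a + b - \<beta>) choose (a - c)) * ?S \<beta>))"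
  proof (intro sum.cong refl)
    fix c assume c: "c \<in> {..a}"
    have "(\<Sum>d\<le>b + c. of_nat ((a - c + d) choose d) * ST (\<lambda>l''. \<psi> ((a - c + d, b + c - d) # l'')) l)
      = (\<Sum>\<beta>\<le>b + c. of_nat ((a + b - \<beta>) choose (a - c)) * ?S \<beta>)"
    proof (rule sum.reindex_bij_witness[of _ "\<lambda>\<beta>. b + c - \<beta>" "\<lambda>d. b + c - d"], goal_cases)
      case (5 d)
      then have e: "a - c + d = a + b - (b + c - d)" using c by auto
      have "(a + b - (b + c - d)) choose (a - c) = (a - c + d) choose d"
        using binomial_symmetric[of d "a - c + d"] unfolding e[symmetric] by simp
      then show ?case using e by simp
    qed auto
    also have "\<dots> = (\<Sum>\<beta>\<le>a + b. of_nat ((a + b - \<beta>) choose (a - c)) * ?S \<beta>)"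
      using c by (intro sum.mono_neutral_left ballI) (auto simp: binomial_eq_0)
    finally show "(-1) ^ c * of_nat ((b + c) choose c) * (\<Sum>d\<le>b + c. of_nat ((a - c + d) choose d) * ST (\<lambda>l''. \<psi> ((a - c + d, b + c - d) # l'')) l)
      = (-1) ^ c * of_nat ((b + c) choose c) * (\<Sum>\<beta>\<le>a + b. of_nat ((a + b - \<beta>) choose (a - c)) * ?S \<beta>)"
      by (simp only:)
  qed
  also have "\<dots> = (\<Sum>\<beta>\<le>a + b. (\<Sum>c\<le>a. (-1) ^ c * of_nat ((b + c) choose c) * of_nat ((a + b - \<beta>) choose (a - c))) * ?S \<beta>)"
    unfolding sum_distrib_left sum_distrib_right by (subst sum.swap) (simp add: mult_ac)
  also have "\<dots> = (\<Sum>\<beta>\<le>a + b. (-1) ^ a * of_nat (\<beta> choose a) * ?S \<beta>)"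
  proof (intro sum.cong refl)
    fix \<beta> assume "\<beta> \<in> {..a + b}"
    then have "of_int (\<Sum>c\<le>a. (-1) ^ c * int ((b + c) choose c) * int ((a + b - \<beta>) choose (a - c)))
      = (of_int ((-1) ^ a * int (\<beta> choose a)) :: 'a)"
      by (subst binomial_alternating_Vandermonde) auto
    then show "(\<Sum>c\<le>a. (-1) ^ c * of_nat ((b + c) choose c) * of_nat ((a + b - \<beta>) choose (a - c))) * ?S \<beta>
      = (-1) ^ a * of_nat (\<beta> choose a) * ?S \<beta>" by simp
  qed
  also have "\<dots> = ST \<psi> (x # l)" by (simp add: x)
  finally show ?case .
qed

text \<open>For a form that is homogeneous in e, the drop in degree determines which divided power
  contributes.\<close>

lemma UT_eq_DU:
  assumes "\<And>l'. \<psi> l' \<noteq> 0 \<Longrightarrow> deg1 l' = A"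
  shows "UT \<psi> l = (if deg1 l \<le> A then DU (nat (A - deg1 l)) \<psi> l else 0)"
  using assms
proof (induction l arbitrary: \<psi> A)
  case Nil
  then show ?case using Nil[of "[]"] by (cases "\<psi> [] = 0") auto
next
  case (Cons x l)
  obtain a b where x: "x = (a, b)" by force
  have IH: "UT (\<lambda>l'. \<psi> ((a + c, b - c) # l')) l =
     (if deg1 l \<le> A - a - c then DU (nat (A - a - c - deg1 l)) (\<lambda>l'. \<psi> ((a + c, b - c) # l')) l else 0)" for c
    by (rule Cons.IH) (use Cons.prems in force)
  let ?n = "nat (A - deg1 (x # l))"
  show ?case
  proof (cases "deg1 (x # l) \<le> A")
    case True
    have "(\<Sum>c\<le>min ?n b. of_nat ((a + c) choose c) * DU (?n - c) (\<lambda>l'. \<psi> ((a + c, b - c) # l')) l)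
       = (\<Sum>c\<le>b. of_nat ((a + c) choose c) * UT (\<lambda>l'. \<psi> ((a + c, b - c) # l')) l)"
      unfolding IH
    proof (intro sum.mono_neutral_cong_left)
      show "\<forall>i\<in>{..b} - {..min ?n b}. of_nat ((a + i) choose i) *
       (if deg1 l \<le> A - int a - int i then DU (nat (A - int a - int i - deg1 l)) (\<lambda>l'. \<psi> ((a + i, b - i) # l')) l else 0) = 0"
        using True by (auto simp: x)
      fix c assume c: "c \<in> {..min ?n b}"
      then have "nat (A - int a - int c - deg1 l) = ?n - c" "deg1 l \<le> A - int a - int c"
        using True by (auto simp: x)
      then show "of_nat ((a + c) choose c) * DU (?n - c) (\<lambda>l'. \<psi> ((a + c, b - c) # l')) l =
         of_nat ((a + c) choose c) * (if deg1 l \<le> A - int a - int c then DU (nat (A - int a - int c - deg1 l)) (\<lambda>l'. \<psi> ((a + c, b - c) # l')) l else 0)"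
        by simp
    qed auto
    then show ?thesis using True by (simp add: x)
  next
    case False
    then show ?thesis by (auto simp: x IH intro!: sum.neutral)
  qed
qed

text \<open>The composition rule for the divided powers D^i/i! and D^n/n! of one derivation. As
  division is impossible in characteristic p, the two-step moves are sorted by their total amount e
  in the first pair, and Vandermonde sums over the ways to split it.\<close>

lemma DU_DU: "DU i (DU n \<psi>) l = of_nat ((i + n) choose i) * DU (i + n) \<psi> l"
proof (induction l arbitrary: i n \<psi>)
  case Nil
  then show ?case by simp
next
  case (Cons x l)
  obtain a b where x: "x = (a, b)" by force
  let ?D = "\<lambda>e. DU (i + n - e) (\<lambda>l'. \<psi> ((a + e, b - e) # l')) l"
  let ?T = "\<lambda>c d. of_nat ((a + c) choose c) * (of_nat ((a + c + d) choose d) *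
       (of_nat ((i - c + (n - d)) choose (i - c)) * ?D (c + d))) :: 'a"
  have "DU i (DU n \<psi>) (x # l) = (\<Sum>c\<le>min i b. of_nat ((a + c) choose c) *
     DU (i - c) (\<lambda>l'. \<Sum>d\<le>min n (b - c). of_nat ((a + c + d) choose d) * DU (n - d) (\<lambda>l''. \<psi> ((a + c + d, b - c - d) # l'')) l') l)"
    by (simp add: x)
  also have "\<dots> = (\<Sum>c\<le>min i b. \<Sum>d\<le>min n (b - c). ?T c d)"
    by (auto simp: DU_sum DU_scale Cons.IH sum_distrib_left add.assoc intro!: sum.cong)
  also have "\<dots> = (\<Sum>(c, d) \<in> (SIGMA c:{..min i b}. {..min n (b - c)}). ?T c d)"
    by (subst sum.Sigma) auto
  also have "\<dots> = (\<Sum>(e, c) \<in> (SIGMA e:{..min (i + n) b}. {c. c \<le> e \<and> c \<le> i \<and> e - c \<le> n}). ?T c (e - c))"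
    by (rule sum.reindex_bij_witness[of _ "\<lambda>(e, c). (c, e - c)" "\<lambda>(c, d). (c + d, c)"]) auto
  also have "\<dots> = (\<Sum>e\<le>min (i + n) b. \<Sum>c | c \<le> e \<and> c \<le> i \<and> e - c \<le> n. ?T c (e - c))"
    by (subst sum.Sigma) auto
  also have "\<dots> = (\<Sum>e\<le>min (i + n) b. of_nat ((i + n) choose i) * (of_nat ((a + e) choose e) * ?D e))"
  proof (intro sum.cong refl)
    fix e assume e: "e \<in> {..min (i + n) b}"
    have "(\<Sum>c | c \<le> e \<and> c \<le> i \<and> e - c \<le> n. ?T c (e - c))
      = (\<Sum>c | c \<le> e \<and> c \<le> i \<and> e - c \<le> n. of_nat (((a + e) choose e) * ((e choose c) * ((i + n - e) choose (i - c)))) * ?D e)"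
    proof (intro sum.cong refl)
      fix c assume "c \<in> {c. c \<le> e \<and> c \<le> i \<and> e - c \<le> n}"
      then have c: "c \<le> e" "c \<le> i" "e - c \<le> n" by auto
      then have ec: "c + (e - c) = e" by auto
      have "((a + c) choose c) * ((a + e) choose (e - c)) = ((a + e) choose e) * (e choose c)"
        using choose_mult_lemma[of c a "e - c"] binomial_symmetric[of c e] c by (simp add: ec add.commute mult.commute)
      moreover have "i - c + (n - (e - c)) = i + n - e" using c e by auto
      ultimately show "?T c (e - c) = of_nat (((a + e) choose e) * ((e choose c) * ((i + n - e) choose (i - c)))) * ?D e"
        by (simp add: ec add.assoc flip: of_nat_mult mult.assoc)
    qed
    also have "\<dots> = of_nat (((a + e) choose e) * (\<Sum>c | c \<le> e \<and> c \<le> i \<and> e - c \<le> n. (e choose c) * ((i + n - e) choose (i - c)))) * ?D e"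
      by (simp add: sum_distrib_left sum_distrib_right mult_ac)
    also have "(\<Sum>c | c \<le> e \<and> c \<le> i \<and> e - c \<le> n. (e choose c) * ((i + n - e) choose (i - c)))
      = (\<Sum>c\<le>i. (e choose c) * ((i + n - e) choose (i - c)))"
      using e by (intro sum.mono_neutral_left) (auto simp: binomial_eq_0)
    also have "\<dots> = (i + n) choose i"
      using vandermonde[of e "i + n - e" i] e by simp
    finally show "(\<Sum>c | c \<le> e \<and> c \<le> i \<and> e - c \<le> n. ?T c (e - c)) = of_nat ((i + n) choose i) * (of_nat ((a + e) choose e) * ?D e)"
      by (simp add: mult_ac)
  qed
  also have "\<dots> = of_nat ((i + n) choose i) * DU (i + n) \<psi> (x # l)"
    by (simp add: x sum_distrib_left)
  finally show ?case .
qed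

text \<open>Transports support conditions through \<open>DU\<close>: pair by pair, the source has
  larger exponents of e and smaller exponents of y.\<close>

lemma DU_nonzero_ex:
  assumes "DU n \<psi> l \<noteq> 0"
  shows "\<exists>l'. \<psi> l' \<noteq> 0 \<and> list_all2 (\<lambda>x y. fst x \<le> fst y \<and> snd y \<le> snd x) l l'
    \<and> deg1 l' = deg1 l + int n \<and> deg2 l' = deg2 l - int n"
  using assms
proof (induction l arbitrary: n \<psi>)
  case Nil
  then show ?case by (cases "n = 0") auto
next
  case (Cons x l)
  from Cons.prems have "(\<Sum>c\<le>min n (snd x). of_nat ((fst x + c) choose c)
      * DU (n - c) (\<lambda>l'. \<psi> ((fst x + c, snd x - c) # l')) l) \<noteq> 0" by simp
  then obtain c where "c \<in> {..min n (snd x)}"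
    "of_nat ((fst x + c) choose c) * DU (n - c) (\<lambda>l'. \<psi> ((fst x + c, snd x - c) # l')) l \<noteq> 0"
    by (rule sum.not_neutral_contains_not_neutral)
  then have c: "c \<le> n" "c \<le> snd x" "DU (n - c) (\<lambda>l'. \<psi> ((fst x + c, snd x - c) # l')) l \<noteq> 0"
    by (auto dest: mult_not_zero)
  from Cons.IH[OF c(3)] obtain l' where l': "\<psi> ((fst x + c, snd x - c) # l') \<noteq> 0"
    "list_all2 (\<lambda>x y. fst x \<le> fst y \<and> snd y \<le> snd x) l l'" "deg1 l' = deg1 l + int (n - c)" "deg2 l' = deg2 l - int (n - c)"
    by auto
  show ?case
    by (rule exI[of _ "(fst x + c, snd x - c) # l'"]) (use c l' in auto)
qed

lemma DU_cong:
  assumes "\<And>l'. list_all2 (\<lambda>x y. fst x \<le> fst y \<and> snd y \<le> snd x) l l' \<Longrightarrow> \<psi> l' = \<phi> l'"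
  shows "DU n \<psi> l = DU n \<phi> l"
  using assms
proof (induction l arbitrary: n \<psi> \<phi>)
  case (Cons x l)
  show ?case
    unfolding DU.simps
    by (intro sum.cong refl arg_cong[of _ _ "\<lambda>z. _ * z"] Cons.IH Cons.prems) auto
qed auto

lemma deg_swap [simp]: "deg1 (map prod.swap l) = deg2 l" "deg2 (map prod.swap l) = deg1 l"
  by (induction l) auto

lemma ST_zero [simp]: "ST (\<lambda>_. 0) l = 0"
  by (induction l) auto

text \<open>The factor \<open>\<beta> choose b\<close> forces the y-exponent \<beta> of the source
  to be at least b in every pair, and the total degree B leaves no room for a strict inequality.
  Hence a single monomial survives, as expected of a Weyl element on extremal weights.\<close>

lemma ST_swap:
  assumes "\<And>l'. \<chi> l' \<noteq> 0 \<Longrightarrow> deg2 l' = B" and "deg2 l \<ge> B"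
  shows "ST \<chi> (map prod.swap l) = (-1) ^ sum_list (map snd l) * (if deg2 l = B then \<chi> l else 0)"
  using assms
proof (induction l arbitrary: \<chi> B)
  case Nil
  then show ?case using Nil(1)[of "[]"] by auto
next
  case (Cons x l)
  obtain a b where x: "x = (a, b)" by force
  have *: "ST (\<lambda>l'. \<chi> ((a + b - \<beta>, \<beta>) # l')) (map prod.swap l) =
     (-1) ^ sum_list (map snd l) * (if deg2 l = B - \<beta> then \<chi> ((a + b - \<beta>, \<beta>) # l) else 0)"
    if "\<beta> \<ge> b" for \<beta>
  proof (rule Cons.IH)
    show "deg2 l' = B - \<beta>" if "\<chi> ((a + b - \<beta>, \<beta>) # l') \<noteq> 0" for l'
      using Cons.prems(1)[OF that] by simp
    show "B - \<beta> \<le> deg2 l" using Cons.prems(2) that by (simp add: x)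
  qed
  have "ST \<chi> (map prod.swap (x # l)) = (\<Sum>\<beta>\<le>a + b. (-1) ^ b * of_nat (\<beta> choose b)
      * ST (\<lambda>l'. \<chi> ((a + b - \<beta>, \<beta>) # l')) (map prod.swap l))"
    by (simp add: x add.commute)
  also have "\<dots> = (\<Sum>\<beta>\<le>a + b. if \<beta> = b then (-1) ^ b * ((-1) ^ sum_list (map snd l) * (if deg2 l = B - b then \<chi> ((a, b) # l) else 0)) else 0)"
  proof (intro sum.cong refl)
    fix \<beta> assume "\<beta> \<in> {..a + b}"
    consider "\<beta> < b" | "\<beta> = b" | "\<beta> > b" by linarith
    then show "(-1) ^ b * of_nat (\<beta> choose b) * ST (\<lambda>l'. \<chi> ((a + b - \<beta>, \<beta>) # l')) (map prod.swap l)
      = (if \<beta> = b then (-1) ^ b * ((-1) ^ sum_list (map snd l) * (if deg2 l = B - b then \<chi> ((a, b) # l) else 0)) else 0)"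
    proof cases
      case 1
      then show ?thesis by (simp add: binomial_eq_0)
    next
      case 2
      then show ?thesis using *[of b] by simp
    next
      case 3
      then have "deg2 l \<noteq> B - \<beta>" using Cons.prems(2) by (simp add: x)
      then show ?thesis using 3 *[of \<beta>] by simp
    qed
  qed
  also have "\<dots> = (-1) ^ sum_list (map snd (x # l)) * (if deg2 (x # l) = B then \<chi> (x # l) else 0)"
    by (simp add: x power_add algebra_simps)
  finally show ?case .
qed

section \<open>The dimension of the space of invariants\<close>

text \<open>All spaces are finite, so dimensions are compared through cardinalities; this is the
  rank-nullity inequality for an additive map.\<close>

lemma card_kernel_image:
  fixes G :: "'x :: ab_group_add set" and f :: "'x \<Rightarrow> 'y :: ab_group_add"
  assumes G: "\<And>x y. x \<in> G \<Longrightarrow> y \<in> G \<Longrightarrow> x - y \<in> G"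
    and f: "\<And>x y. x \<in> G \<Longrightarrow> y \<in> G \<Longrightarrow> f (x - y) = f x - f y"
    and M: "f ` G \<subseteq> M" "finite M" and K: "finite {x \<in> G. f x = 0}"
  shows "finite G \<and> card G \<le> card M * card {x \<in> G. f x = 0}"
proof -
  let ?K = "{x \<in> G. f x = 0}"
  have fib: "finite {x \<in> G. f x = y} \<and> card {x \<in> G. f x = y} \<le> card ?K" for y
  proof (cases "{x \<in> G. f x = y} = {}")
    case False
    then obtain x0 where x0: "x0 \<in> G" "f x0 = y" by auto
    have "inj_on (\<lambda>x. x - x0) {x \<in> G. f x = y}" by (auto simp: inj_on_def)
    moreover have "(\<lambda>x. x - x0) ` {x \<in> G. f x = y} \<subseteq> ?K" using x0 G f by auto
    ultimately show ?thesis using K by (meson card_inj_on_le inj_on_finite)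
  next
    case True
    then show ?thesis unfolding True by simp
  qed
  have fin: "finite (f ` G)" using M finite_subset by blast
  have eq: "G = (\<Union>y\<in>f ` G. {x \<in> G. f x = y})" by auto
  have "finite (\<Union>y\<in>f ` G. {x \<in> G. f x = y})" using fin fib by blast
  moreover have "card (\<Union>y\<in>f ` G. {x \<in> G. f x = y}) \<le> (\<Sum>y\<in>f ` G. card {x \<in> G. f x = y})"
    by (rule card_UN_le[OF fin])
  moreover have "\<dots> \<le> (\<Sum>y\<in>f ` G. card ?K)" by (intro sum_mono) (use fib in blast)
  moreover have "\<dots> \<le> card M * card ?K" using card_mono[OF M(2,1)] by simp
  ultimately show ?thesis unfolding eq[symmetric] by linarith
qed

text \<open>Iterates the previous bound along successive kernels: \<open>f i\<close> has to land in
  \<open>M i\<close> only on elements that all earlier maps annihilate.\<close>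

lemma card_filtration:
  fixes f :: "nat \<Rightarrow> 'x :: ab_group_add \<Rightarrow> 'y :: ab_group_add"
  assumes G: "\<And>x y. x \<in> G \<Longrightarrow> y \<in> G \<Longrightarrow> x - y \<in> G"
    and f: "\<And>i x y. x \<in> G \<Longrightarrow> y \<in> G \<Longrightarrow> f i (x - y) = f i x - f i y"
    and M: "\<And>i x. i < N \<Longrightarrow> x \<in> G \<Longrightarrow> (\<And>j. j < i \<Longrightarrow> f j x = 0) \<Longrightarrow> f i x \<in> M i"
    and fin: "\<And>i. i < N \<Longrightarrow> finite (M i)"
    and inj: "\<And>x. x \<in> G \<Longrightarrow> (\<And>j. j < N \<Longrightarrow> f j x = 0) \<Longrightarrow> x = 0"
  shows "finite G \<and> card G \<le> (\<Prod>i<N. card (M i))"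
proof -
  \<comment> \<open>The induction starts from the last kernel, which is trivial, and removes one map
    at a time from the end.\<close>
  have "i \<le> N \<Longrightarrow> finite {x \<in> G. \<forall>j<N - i. f j x = 0} \<and> card {x \<in> G. \<forall>j<N - i. f j x = 0} \<le> (\<Prod>j\<in>{N - i..<N}. card (M j))" for i
  proof (induction i)
    case 0
    have "{x \<in> G. \<forall>j<N. f j x = 0} \<subseteq> {0}" using inj by auto
    then show ?case using card_mono[of "{0}" "{x \<in> G. \<forall>j<N. f j x = 0}"] finite_subset[of _ "{0}"] by auto
  next
    case (Suc i)
    let ?G = "{x \<in> G. \<forall>j<N - Suc i. f j x = 0}" and ?n = "N - Suc i"
    have K: "{x \<in> ?G. f ?n x = 0} = {x \<in> G. \<forall>j<N - i. f j x = 0}"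
    proof -
      have "N - i = Suc (N - Suc i)" using Suc.prems by simp
      then show ?thesis by (auto simp: less_Suc_eq)
    qed
    have "finite ?G \<and> card ?G \<le> card (M ?n) * card {x \<in> ?G. f ?n x = 0}"
    proof (rule card_kernel_image)
      show "f ?n ` ?G \<subseteq> M ?n" using Suc.prems by (auto intro!: M)
      show "finite {x \<in> ?G. f ?n x = 0}" unfolding K using Suc by auto
    qed (use G f fin Suc.prems in auto)
    moreover have "card (M ?n) * card {x \<in> ?G. f ?n x = 0} \<le> card (M ?n) * (\<Prod>j\<in>{N - i..<N}. card (M j))"
      unfolding K using Suc by (intro mult_left_mono) simp_all
    moreover have "\<dots> = (\<Prod>j\<in>{N - Suc i..<N}. card (M j))"
    proof -
      have "N - i = Suc (N - Suc i)" "N - Suc i < N" using Suc.prems by simp_all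
      then show ?thesis by (simp add: prod.atLeast_Suc_lessThan[of "N - Suc i" N])
    qed
    ultimately show ?case by linarith
  qed
  from this[of N] show ?thesis by (simp add: atLeast0LessThan)
qed

lemma card_functions_with_support:
  assumes "finite S"
  shows "finite {\<psi> :: 'a \<Rightarrow> 'k :: {finite, zero}. \<forall>l. \<psi> l \<noteq> 0 \<longrightarrow> l \<in> S}"
    and "card {\<psi> :: 'a \<Rightarrow> 'k. \<forall>l. \<psi> l \<noteq> 0 \<longrightarrow> l \<in> S} = CARD('k) ^ card S"
proof -
  have b: "bij_betw (\<lambda>\<psi>. restrict \<psi> S) {\<psi> :: 'a \<Rightarrow> 'k. \<forall>l. \<psi> l \<noteq> 0 \<longrightarrow> l \<in> S} (S \<rightarrow>\<^sub>E UNIV)"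
    by (rule bij_betwI[where g = "\<lambda>\<psi> l. if l \<in> S then \<psi> l else 0"])
      (auto simp: fun_eq_iff PiE_def extensional_def restrict_def)
  then show "finite {\<psi> :: 'a \<Rightarrow> 'k. \<forall>l. \<psi> l \<noteq> 0 \<longrightarrow> l \<in> S}"
    using assms by (simp add: bij_betw_finite finite_PiE)
  show "card {\<psi> :: 'a \<Rightarrow> 'k. \<forall>l. \<psi> l \<noteq> 0 \<longrightarrow> l \<in> S} = CARD('k) ^ card S"
    using bij_betw_same_card[OF b] card_PiE[OF assms, of "\<lambda>_. UNIV :: 'k set"] by simp
qed

section \<open>Truncated polynomials in characteristic p\<close>

locale char_p =
  fixes p :: nat and ty :: "'k :: {field, finite} itself"
  assumes prime_p: "prime p" and char_k: "CHAR('k) = p"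
begin

lemma p_pos: "p > 0" "p \<ge> 2"
  using prime_p prime_gt_0_nat prime_ge_2_nat by auto

lemma of_nat_eq_0_iff': "(of_nat n :: 'k) = 0 \<longleftrightarrow> p dvd n"
  using of_nat_eq_0_iff_char_dvd[of n, where ?'a = 'k] char_k by simp

text \<open>The sum of two digits carries: p divides (b+c)! but neither b! nor c!.\<close>

lemma of_nat_binomial_carry:
  assumes "b < p" "c < p" "p \<le> b + c"
  shows "(of_nat ((b + c) choose c) :: 'k) = 0"
proof -
  have "p dvd fact c * fact (b + c - c) * ((b + c) choose c)"
    using binomial_fact_lemma[of c "b + c"] prime_dvd_fact_iff[OF prime_p] assms by simp
  then show ?thesis
    using assms prime_p by (simp add: of_nat_eq_0_iff' prime_dvd_mult_iff prime_dvd_fact_iff)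
qed

lemma of_nat_binomial_nonzero:
  assumes "c \<le> b" "b < p"
  shows "(of_nat (b choose c) :: 'k) \<noteq> 0"
proof -
  have "\<not> p dvd fact c * fact (b - c) * (b choose c)"
    using binomial_fact_lemma[of c b] prime_dvd_fact_iff[OF prime_p] assms by simp
  then show ?thesis unfolding of_nat_eq_0_iff' by (metis dvd_mult)
qed

definition trunc :: "exps \<Rightarrow> bool" where
  "trunc l \<longleftrightarrow> (\<forall>x\<in>set l. fst x < p \<and> snd x < p)"

lemma trunc_simps [simp]: "trunc []" "trunc (x # l) \<longleftrightarrow> fst x < p \<and> snd x < p \<and> trunc l"
  by (auto simp: trunc_def)

definition Tr :: "nat \<Rightarrow> int \<Rightarrow> int \<Rightarrow> (exps \<Rightarrow> 'k) set" where
  "Tr m A B = {\<psi>. \<forall>l. \<psi> l \<noteq> 0 \<longrightarrow> length l = m \<and> trunc l \<and> deg1 l = A \<and> deg2 l = B}"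

text \<open>Invariance is required at truncated exponents, that is, modulo p-th powers of the
  variables. All divided powers are listed because in characteristic p the first one does not
  generate the others.\<close>

definition Inv :: "nat \<Rightarrow> int \<Rightarrow> int \<Rightarrow> (exps \<Rightarrow> 'k) set" where
  "Inv m A B = {\<psi> \<in> Tr m A B. \<forall>n\<ge>1. \<forall>l. trunc l \<longrightarrow> DU n \<psi> l = 0}"

text \<open>\<open>LT\<close> collects values at lists whose degree in e is not greater. A source
  whose y-exponent reaches p comes with a binomial coefficient that vanishes, so only truncated
  sources count.\<close>

lemma LT_zero_below:
  fixes \<chi> :: "exps \<Rightarrow> 'k"
  assumes "trunc l" "\<And>l'. trunc l' \<Longrightarrow> deg1 l' \<le> deg1 l \<Longrightarrow> \<chi> l' = 0"
  shows "LT \<chi> l = 0"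
  using assms
proof (induction l arbitrary: \<chi>)
  case (Cons x l)
  have "of_nat ((snd x + c) choose c) * LT (\<lambda>l'. \<chi> ((fst x - c, snd x + c) # l')) l = 0"
    if c: "c \<le> fst x" for c
  proof (cases "snd x + c < p")
    case True
    have "LT (\<lambda>l'. \<chi> ((fst x - c, snd x + c) # l')) l = 0"
    proof (rule Cons.IH)
      show "trunc l" using Cons.prems(1) by simp
      fix l' assume "trunc l'" "deg1 l' \<le> deg1 l"
      then show "\<chi> ((fst x - c, snd x + c) # l') = 0"
        using Cons.prems(1) True c by (intro Cons.prems(2)) (auto simp: of_nat_diff)
    qed
    then show ?thesis by simp
  next
    case False
    then show ?thesis using of_nat_binomial_carry[of "snd x" c] Cons.prems c by auto
  qed
  then show ?case unfolding LT.simps by (intro sum.neutral ballI) (simp add: mult.assoc)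
qed (use assms in simp)

text \<open>The Weyl element \<open>ST\<close> carries the coefficient at l, up to sign, to the
  swapped list, whose degree in e is B. Computed as \<open>LT\<close> after \<open>UT\<close>, that
  value involves only components of degree at most B in e, and these are the divided powers with n
  \<ge> A - B.\<close>

lemma sl2_vanishing:
  assumes "\<psi> \<in> Tr m A B" and "\<And>n l. int n \<ge> A - B \<Longrightarrow> trunc l \<Longrightarrow> DU n \<psi> l = 0"
  shows "\<psi> = 0"
proof (rule ccontr)
  assume "\<psi> \<noteq> 0"
  then obtain l where l: "\<psi> l \<noteq> 0" by (auto simp: fun_eq_iff)
  then have l': "trunc l" "deg1 l = A" "deg2 l = B" and supp: "\<And>l. \<psi> l \<noteq> 0 \<Longrightarrow> deg1 l = A \<and> deg2 l = B"
    using assms(1) by (auto simp: Tr_def)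
  have "ST \<psi> (map prod.swap l) = (-1) ^ sum_list (map snd l) * \<psi> l"
    using ST_swap[of \<psi> B l] supp l' by auto
  moreover have "LT (UT \<psi>) (map prod.swap l) = 0"
  proof (rule LT_zero_below)
    show "trunc (map prod.swap l)" using l' by (auto simp: trunc_def)
    fix l'' assume "trunc l''" "deg1 l'' \<le> deg1 (map prod.swap l)"
    then show "UT \<psi> l'' = 0"
      using UT_eq_DU[of \<psi> A l''] supp assms(2)[of "nat (A - deg1 l'')" l''] l' by auto
  qed
  ultimately show False using l by (simp add: LT_UT)
qed

text \<open>The coefficient of \<open>x ^ A\<close> in \<open>(1 + x + \<dots> + x ^ (p - 1)) ^ m\<close>.\<close>

fun cc :: "nat \<Rightarrow> int \<Rightarrow> int" where
  "cc 0 A = (if A = 0 then 1 else 0)"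
| "cc (Suc m) A = (\<Sum>a<p. cc m (A - int a))"

lemma cc_nonneg: "cc m A \<ge> 0"
  by (induction m arbitrary: A) (auto intro!: sum_nonneg)

definition mon :: "nat \<Rightarrow> int \<Rightarrow> int \<Rightarrow> int" where "mon m A B = cc m A * cc m B"

lemma mon_Suc: "mon (Suc m) A B = (\<Sum>(a, b)\<in>{..<p} \<times> {..<p}. mon m (A - int a) (B - int b))"
  by (simp add: mon_def sum_product sum.cartesian_product)

definition LL :: "nat \<Rightarrow> int \<Rightarrow> int \<Rightarrow> exps set" where
  "LL m A B = {l. length l = m \<and> trunc l \<and> deg1 l = A \<and> deg2 l = B}"

lemma LL_Suc: "LL (Suc m) A B = (\<Union>x\<in>{..<p} \<times> {..<p}. (#) x ` LL m (A - int (fst x)) (B - int (snd x)))"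
proof (rule equalityI; rule subsetI)
  fix l assume "l \<in> LL (Suc m) A B"
  then show "l \<in> (\<Union>x\<in>{..<p} \<times> {..<p}. (#) x ` LL m (A - int (fst x)) (B - int (snd x)))"
    by (cases l) (force simp: LL_def)+
qed (auto simp: LL_def)

lemma card_LL: "finite (LL m A B) \<and> int (card (LL m A B)) = mon m A B"
proof (induction m arbitrary: A B)
  case 0
  have "LL 0 A B = (if A = 0 \<and> B = 0 then {[]} else {})" by (auto simp: LL_def)
  then show ?case by (auto simp: mon_def)
next
  case (Suc m)
  have "card (LL (Suc m) A B) = (\<Sum>x\<in>{..<p} \<times> {..<p}. card ((#) x ` LL m (A - int (fst x)) (B - int (snd x))))"
    unfolding LL_Suc by (subst card_UN_disjoint) (use Suc in auto)
  also have "\<dots> = (\<Sum>x\<in>{..<p} \<times> {..<p}. card (LL m (A - int (fst x)) (B - int (snd x))))"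
    by (intro sum.cong refl card_image) (auto simp: inj_on_def)
  finally have c: "card (LL (Suc m) A B) = (\<Sum>x\<in>{..<p} \<times> {..<p}. card (LL m (A - int (fst x)) (B - int (snd x))))" .
  have "finite (LL (Suc m) A B)" unfolding LL_Suc using Suc by blast
  moreover have "int (card (LL (Suc m) A B)) = mon (Suc m) A B"
    unfolding c of_nat_sum using Suc by (simp add: mon_Suc case_prod_beta)
  ultimately show ?case ..
qed

lemma Tr_eq: "Tr m A B = {\<psi>. \<forall>l. \<psi> l \<noteq> 0 \<longrightarrow> l \<in> LL m A B}"
  by (auto simp: Tr_def LL_def)

lemma card_Tr: "finite (Tr m A B)" "card (Tr m A B) = CARD('k) ^ nat (mon m A B)"
  unfolding Tr_eq using card_functions_with_support[of "LL m A B", where ?'k = 'k] card_LL[of m A B] by (auto simp del: of_nat_eq_iff) (metis nat_int)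

lemma Inv_finite: "finite (Inv m A B)"
  using card_Tr(1)[of m A B] by (rule rev_finite_subset) (auto simp: Inv_def)

text \<open>A difference of adjacent weight multiplicities: the number of highest weight vectors in
  a module for SL2 in characteristic 0 with the same weights. That the invariants in characteristic
  p have this dimension for 0 \<le> A \<le> B is the aim of this section.\<close>

definition ee :: "nat \<Rightarrow> int \<Rightarrow> int \<Rightarrow> int" where
  "ee m A B = mon m A B - mon m (A - 1) (B + 1)"

lemma ee_antisym: "ee m (B + 1) (A - 1) = - ee m A B"
  by (simp add: ee_def mon_def algebra_simps)

text \<open>The subtraction of naturals, cut off at 0, gives the least e-exponent of a truncated
  pair on the antidiagonal through x. A pair that violates the inequality cannot lead an invariant;
  see \<open>Inv_slice_bad\<close>.\<close>

definition good :: "int \<Rightarrow> int \<Rightarrow> nat \<times> nat \<Rightarrow> bool" where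
  "good A B x \<longleftrightarrow> A - int (fst x + snd x + 1 - p) \<le> B - int (snd x)"

text \<open>With d = B - A, the reflection of (a, b) to (b - d - 1, a + d + 1) permutes the bad
  pairs and changes the sign of the summand by \<open>ee_antisym\<close>, so their total
  contribution is 0.\<close>

lemma ee_Suc_good:
  assumes "A \<le> B"
  shows "ee (Suc m) A B = (\<Sum>x\<in>{x \<in> {..<p} \<times> {..<p}. good A B x}. ee m (A - int (fst x)) (B - int (snd x)))"
proof -
  let ?f = "\<lambda>x. ee m (A - int (fst x)) (B - int (snd x))"
  let ?P = "{..<p} \<times> {..<p}" and ?d = "nat (B - A)"
  let ?bad = "{x \<in> ?P. \<not> good A B x}"
  have bad: "(snd x - ?d - 1, fst x + ?d + 1) \<in> ?bad \<and> snd x \<ge> ?d + 1" if "x \<in> ?bad" for x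
    using that assms unfolding good_def by auto
  let ?i = "\<lambda>x :: nat \<times> nat. (snd x - ?d - 1, fst x + ?d + 1)"
  have ii: "?i (?i x) = x" if "x \<in> ?bad" for x
    using bad[OF that] by (cases x) simp
  have "sum ?f ?bad = (\<Sum>x\<in>?bad. - ?f x)"
  proof (rule sum.reindex_bij_witness[of _ ?i ?i])
    fix x assume x: "x \<in> ?bad"
    show "?i (?i x) = x" "?i (?i x) = x" by (rule ii[OF x])+
    show "?i x \<in> ?bad" "?i x \<in> ?bad" using bad[OF x] by blast+
    have "- ?f (?i x) = ee m (B + 1 - int (fst x + ?d + 1)) (A - 1 - int (snd x - ?d - 1))"
      using ee_antisym[of m "B - int (fst x + ?d + 1)" "A - int (snd x - ?d - 1)"] by (simp add: algebra_simps)
    also have "\<dots> = ?f x" using bad[OF x] assms by (simp add: of_nat_diff algebra_simps)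
    finally show "- ?f (?i x) = ?f x" .
  qed
  then have "sum ?f ?bad = 0" by (simp add: sum_negf)
  moreover have "sum ?f ?P = sum ?f {x \<in> ?P. good A B x} + sum ?f ?bad"
    by (subst sum.union_disjoint[symmetric]) (auto intro: sum.cong)
  moreover have "ee (Suc m) A B = sum ?f ?P"
    unfolding ee_def mon_Suc case_prod_beta sum_subtractf by (simp add: algebra_simps)
  ultimately show ?thesis by simp
qed

end

section \<open>Slices of invariants by the first pair of exponents\<close>

context char_p
begin

lemma Inv_DU: "\<psi> \<in> Inv m A B \<Longrightarrow> n \<ge> 1 \<Longrightarrow> trunc l \<Longrightarrow> DU n \<psi> l = 0"
  by (auto simp: Inv_def)

lemma Inv_support:
  assumes "\<psi> \<in> Inv m A B" "\<psi> l \<noteq> 0"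
  shows "length l = m" "trunc l" "deg1 l = A" "deg2 l = B"
  using assms by (auto simp: Inv_def Tr_def)

lemma Inv_diff:
  assumes a: "\<psi> \<in> Inv m A B" "\<phi> \<in> Inv m A B"
  shows "\<psi> - \<phi> \<in> Inv m A B"
proof -
  have "length l = m \<and> trunc l \<and> deg1 l = A \<and> deg2 l = B" if "(\<psi> - \<phi>) l \<noteq> 0" for l
  proof (cases "\<psi> l = 0")
    case True
    then have "\<phi> l \<noteq> 0" using that by simp
    then show ?thesis using Inv_support[OF a(2)] by blast
  qed (use Inv_support[OF a(1)] in blast)
  moreover have "DU n (\<psi> - \<phi>) l = DU n \<psi> l - DU n \<phi> l" for n l
    using DU_diff[of n \<psi> \<phi> l] by (simp add: fun_diff_def)
  ultimately show ?thesis using a unfolding Inv_def Tr_def by simp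
qed

lemma Tr_slice: "\<psi> \<in> Tr (Suc m) A B \<Longrightarrow> (\<lambda>l. \<psi> ((a, b) # l)) \<in> Tr m (A - int a) (B - int b)"
  unfolding Tr_def by fastforce

text \<open>In the invariance equation at (a, b), the terms that move exponents of the first pair
  vanish by \<open>top\<close>; what remains is the equation for the other pairs.\<close>

lemma Inv_slice_top:
  assumes \<psi>: "\<psi> \<in> Inv (Suc m) A B" and ab: "a < p" "b < p"
    and top: "\<And>c l. 0 < c \<Longrightarrow> c \<le> b \<Longrightarrow> \<psi> ((a + c, b - c) # l) = 0"
  shows "(\<lambda>l. \<psi> ((a, b) # l)) \<in> Inv m (A - int a) (B - int b)"
proof -
  have "DU n (\<lambda>l. \<psi> ((a, b) # l)) l = 0" if n: "n \<ge> 1" and l: "trunc l" for n l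
  proof -
    have "0 = DU n \<psi> ((a, b) # l)" using Inv_DU[OF \<psi> n, of "(a, b) # l"] l ab by simp
    also have "\<dots> = (\<Sum>c\<le>min n b. if c = 0 then DU n (\<lambda>l. \<psi> ((a, b) # l)) l else 0)"
      unfolding DU.simps by (intro sum.cong) (auto simp: top)
    also have "\<dots> = DU n (\<lambda>l. \<psi> ((a, b) # l)) l" by simp
    finally show ?thesis by simp
  qed
  then show ?thesis using \<psi> Tr_slice[of \<psi> m A B a b] by (auto simp: Inv_def)
qed

text \<open>Invariance means exp(D1) exp(D') = 1 on the form, with D1 acting on the first pair and
  D' on the others, so that D' acts as -D1 along an antidiagonal of the first pair. The bound on x
  keeps the exponent \<open>s - x\<close> below p, where the equation is available.\<close>

lemma DU_diagonal:
  assumes \<psi>: "\<psi> \<in> Inv (Suc m) A B" and l: "trunc l" and x: "s + 1 - p \<le> x"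
  shows "DU N (\<lambda>l. if x \<le> s then \<psi> ((x, s - x) # l) else 0) l
    = (-1) ^ N * of_nat ((x + N) choose N) * (if x + N \<le> s then \<psi> ((x + N, s - (x + N)) # l) else 0)"
  using x
proof (induction N arbitrary: x rule: less_induct)
  case (less N)
  let ?\<chi> = "\<lambda>x l. if x \<le> s then \<psi> ((x, s - x) # l) else 0"
  show ?case
  proof (cases "N = 0 \<or> x > s \<or> x \<ge> p")
    case True
    have z: "?\<chi> y = (\<lambda>_. 0)" if "y \<ge> p" for y
    proof
      fix l'
      show "?\<chi> y l' = 0" using Inv_support(2)[OF \<psi>, of "(y, s - y) # l'"] that by auto
    qed
    consider "N = 0" | "x > s" | "x \<ge> p" using True by blast
    then show ?thesis
    proof cases
      case 3
      show ?thesis unfolding z[OF 3] using fun_cong[OF z[of "x + N"], of l] 3 by simp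
    qed auto
  next
    case False
    have "0 = DU N \<psi> ((x, s - x) # l)"
    proof -
      have "s - x < p" using less.prems p_pos by arith
      then show ?thesis using Inv_DU[OF \<psi>, of N "(x, s - x) # l"] False l by simp
    qed
    also have "\<dots> = (\<Sum>c\<le>min N (s - x). of_nat ((x + c) choose c) * DU (N - c) (?\<chi> (x + c)) l)"
      unfolding DU.simps fst_conv snd_conv
    proof (intro sum.cong refl)
      fix c assume "c \<in> {..min N (s - x)}"
      then have "x + c \<le> s" "s - x - c = s - (x + c)" using False by auto
      then show "of_nat ((x + c) choose c) * DU (N - c) (\<lambda>l'. \<psi> ((x + c, s - x - c) # l')) l
        = of_nat ((x + c) choose c) * DU (N - c) (?\<chi> (x + c)) l" by simp
    qed
    also have "\<dots> = (\<Sum>c\<le>N. of_nat ((x + c) choose c) * DU (N - c) (?\<chi> (x + c)) l)"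
    proof (intro sum.mono_neutral_left ballI)
      fix c assume "c \<in> {..N} - {..min N (s - x)}"
      then have "\<not> x + c \<le> s" by auto
      then show "of_nat ((x + c) choose c) * DU (N - c) (?\<chi> (x + c)) l = 0" by simp
    qed auto
    also have "\<dots> = DU N (?\<chi> x) l + (\<Sum>c\<in>{1..N}. of_nat ((x + c) choose c) * DU (N - c) (?\<chi> (x + c)) l)"
      by (simp add: atMost_atLeast0 sum.atLeast_Suc_atMost cong: if_cong)
    also have "(\<Sum>c\<in>{1..N}. of_nat ((x + c) choose c) * DU (N - c) (?\<chi> (x + c)) l)
       = (\<Sum>c\<in>{1..N}. (of_nat ((x + N) choose N) * ?\<chi> (x + N) l) * ((-1) ^ N * ((-1) ^ c * of_nat (N choose c))))"
    proof (intro sum.cong refl)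
      fix c assume c: "c \<in> {1..N}"
      have "DU (N - c) (?\<chi> (x + c)) l = (-1) ^ (N - c) * of_nat ((x + c + (N - c)) choose (N - c)) * ?\<chi> (x + c + (N - c)) l"
        by (rule less.IH) (use c less.prems in auto)
      moreover have "x + c + (N - c) = x + N" using c by simp
      moreover have "((x + c) choose c) * ((x + N) choose (N - c)) = ((x + N) choose N) * (N choose c)"
        using choose_mult_lemma[of c x "N - c"] binomial_symmetric[of c N] c by (simp add: add.commute mult.commute)
      then have "of_nat ((x + c) choose c) * of_nat ((x + N) choose (N - c)) = (of_nat ((x + N) choose N) * of_nat (N choose c) :: 'k)"
        by (simp flip: of_nat_mult)
      moreover have "(-1) ^ (N - c) = ((-1) ^ N * (-1) ^ c :: 'k)"
      proof -
        have "(-1) ^ N = ((-1) ^ (N - c) * (-1) ^ c :: 'k)" using c by (simp flip: power_add)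
        then show ?thesis by (simp add: mult.assoc)
      qed
      ultimately show "of_nat ((x + c) choose c) * DU (N - c) (?\<chi> (x + c)) l
        = (of_nat ((x + N) choose N) * ?\<chi> (x + N) l) * ((-1) ^ N * ((-1) ^ c * of_nat (N choose c)))"
        by (simp add: mult_ac)
    qed
    also have "\<dots> = (of_nat ((x + N) choose N) * ?\<chi> (x + N) l) * ((-1) ^ N * (\<Sum>c\<in>{1..N}. (-1) ^ c * of_nat (N choose c)))"
      by (simp add: sum_distrib_left)
    also have "(\<Sum>c\<in>{1..N}. (-1) ^ c * of_nat (N choose c)) = (-1 :: 'k)"
    proof -
      have "0 = (\<Sum>c\<le>N. (-1) ^ c * of_nat (N choose c) :: 'k)"
        using choose_alternating_sum[of N, where ?'a = 'k] False by simp
      also have "\<dots> = 1 + (\<Sum>c\<in>{1..N}. (-1) ^ c * of_nat (N choose c))"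
        by (simp add: atMost_atLeast0 sum.atLeast_Suc_atMost)
      finally show ?thesis by (simp add: eq_neg_iff_add_eq_0 add.commute)
    qed
    finally show ?thesis by (simp add: algebra_simps eq_neg_iff_add_eq_0)
  qed
qed

text \<open>Through \<open>DU_diagonal\<close> the slice at the lowest point \<open>?lo\<close> of
  the antidiagonal determines the slices above it. Those beyond a vanish, hence so do its divided
  powers beyond \<open>a - ?lo\<close>, and badness of (a, b) makes this range large enough for
  \<open>sl2_vanishing\<close>.\<close>

lemma Inv_slice_bad:
  assumes \<psi>: "\<psi> \<in> Inv (Suc m) A B" and ab: "a < p" "b < p" and bad: "\<not> good A B (a, b)"
    and top: "\<And>c l. 0 < c \<Longrightarrow> c \<le> b \<Longrightarrow> \<psi> ((a + c, b - c) # l) = 0"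
  shows "(\<lambda>l. \<psi> ((a, b) # l)) = 0"
proof -
  let ?s = "a + b" and ?lo = "a + b + 1 - p"
  let ?G = "\<lambda>l. \<psi> ((?lo, ?s - ?lo) # l)"
  have lo: "?lo \<le> a" "?lo \<le> ?s" using ab by auto
  have D: "DU N ?G l = (-1) ^ N * of_nat ((?lo + N) choose N) * (if ?lo + N \<le> ?s then \<psi> ((?lo + N, ?s - (?lo + N)) # l) else 0)"
    if "trunc l" for N l
    using DU_diagonal[OF \<psi> that, of ?s ?lo N] lo by simp
  have "?G = 0"
  proof (rule sl2_vanishing)
    show "?G \<in> Tr m (A - int ?lo) (B - int (?s - ?lo))"
      using \<psi> Tr_slice by (auto simp: Inv_def)
    fix n l assume n: "int n \<ge> A - int ?lo - (B - int (?s - ?lo))" and l: "trunc l"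
    have "n > a - ?lo" using n bad lo by (auto simp: good_def)
    then have "(if ?lo + n \<le> ?s then \<psi> ((?lo + n, ?s - (?lo + n)) # l) else 0) = 0"
      using top[of "?lo + n - a" l] lo by (auto simp: algebra_simps)
    then show "DU n ?G l = 0" by (simp only: D[OF l] mult_zero_right)
  qed
  then have G: "DU (a - ?lo) ?G l = 0" for l by (simp add: zero_fun_def)
  have "\<psi> ((a, b) # l) = 0" if "trunc l" for l
    using G[of l] of_nat_binomial_nonzero[of "a - ?lo" a] D[OF that, of "a - ?lo"] lo ab by simp
  moreover have "\<psi> ((a, b) # l) = 0" if "\<not> trunc l" for l
    using \<psi> that by (auto simp: Inv_def Tr_def)
  ultimately show ?thesis by (auto simp: fun_eq_iff)
qed

text \<open>The pairs are enumerated by decreasing e-exponent, so that (a + c, b - c) with c > 0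
  comes before (a, b).\<close>

lemma pair_code:
  assumes "a < p" "b < p"
  shows "p - 1 - ((p - 1 - a) * p + b) div p = a" "((p - 1 - a) * p + b) mod p = b"
  using assms by auto

lemma sum_lessThan_square:
  fixes f :: "nat \<times> nat \<Rightarrow> 'x :: comm_monoid_add"
  shows "(\<Sum>i<p * p. f (p - 1 - i div p, i mod p)) = sum f ({..<p} \<times> {..<p})"
proof (rule sum.reindex_bij_witness[of _ "\<lambda>x. (p - 1 - fst x) * p + snd x" "\<lambda>i. (p - 1 - i div p, i mod p)"])
  fix i assume i: "i \<in> {..<p * p}"
  then have "i div p < p" by (simp add: less_mult_imp_div_less)
  then show "(p - 1 - fst (p - 1 - i div p, i mod p)) * p + snd (p - 1 - i div p, i mod p) = i"
    by simp
  show "(p - 1 - i div p, i mod p) \<in> {..<p} \<times> {..<p}" using p_pos by auto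
next
  fix x assume x: "x \<in> {..<p} \<times> {..<p}"
  show "(p - 1 - ((p - 1 - fst x) * p + snd x) div p, ((p - 1 - fst x) * p + snd x) mod p) = x"
    using x by (cases x) auto
  have "(p - 1 - fst x) * p + snd x < (p - 1 - fst x) * p + p" using x by auto
  also have "\<dots> \<le> (p - 1) * p + p" by (intro add_mono mult_le_mono) auto
  also have "\<dots> = p * p" using p_pos by (cases p) auto
  finally show "(p - 1 - fst x) * p + snd x \<in> {..<p * p}" by simp
qed auto

text \<open>Invariants are filtered by their slices. A leading slice is an invariant in one pair
  fewer, and it is 0 at a bad pair; the good pairs add up by \<open>ee_Suc_good\<close>.\<close>

lemma card_Inv_le:
  "A \<le> B \<Longrightarrow> ee m A B \<ge> 0 \<and> card (Inv m A B) \<le> CARD('k) ^ nat (ee m A B)"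
proof (induction m arbitrary: A B)
  case 0
  have "card (Inv 0 A B) \<le> card (Tr 0 A B)" by (intro card_mono card_Tr) (auto simp: Inv_def)
  then show ?case using 0 by (auto simp: card_Tr ee_def mon_def)
next
  case (Suc m)
  have IH: "ee m (A - int (fst x)) (B - int (snd x)) \<ge> 0 \<and>
      card (Inv m (A - int (fst x)) (B - int (snd x))) \<le> CARD('k) ^ nat (ee m (A - int (fst x)) (B - int (snd x)))"
    if "good A B x" "snd x < p" for x
    by (rule Suc.IH) (use that in \<open>auto simp: good_def\<close>)
  let ?a = "\<lambda>i. p - 1 - i div p" and ?b = "\<lambda>i. i mod p"
  let ?e = "\<lambda>x. if good A B x then ee m (A - int (fst x)) (B - int (snd x)) else 0"
  let ?M = "\<lambda>i. if good A B (?a i, ?b i) then Inv m (A - int (?a i)) (B - int (?b i)) else {0}"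
  define f :: "nat \<Rightarrow> (exps \<Rightarrow> 'k) \<Rightarrow> exps \<Rightarrow> 'k" where "f = (\<lambda>i \<psi> l. \<psi> ((?a i, ?b i) # l))"
  have "finite (Inv (Suc m) A B) \<and> card (Inv (Suc m) A B) \<le> (\<Prod>i<p * p. card (?M i))"
  proof (rule card_filtration[where f = f and M = ?M and G = "Inv (Suc m) A B" and N = "p * p"])
    fix i \<psi> assume i: "i < p * p" and \<psi>: "\<psi> \<in> Inv (Suc m) A B"
      and z': "\<And>j. j < i \<Longrightarrow> f j \<psi> = 0"
    have z: "(\<lambda>l. \<psi> ((?a j, ?b j) # l)) = 0" if "j < i" for j using z'[OF that] by (simp add: f_def)
    have lt: "?a i < p" "?b i < p" using p_pos by auto
    have top: "\<psi> ((?a i + c, ?b i - c) # l) = 0" if c: "0 < c" "c \<le> ?b i" for c l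
    proof (cases "?a i + c < p")
      case True
      \<comment> \<open>The position of the pair (a + c, b - c) in the enumeration, which precedes
        i.\<close>
      let ?j = "(p - 1 - (?a i + c)) * p + (?b i - c)"
      have ab: "?a ?j = ?a i + c" "?b ?j = ?b i - c"
        using pair_code[OF True, of "?b i - c"] lt by (simp_all add: less_imp_diff_less)
      have d: "i div p < p" using i by (simp add: less_mult_imp_div_less)
      have "p - 1 - (?a i + c) + 1 \<le> i div p" using True c d by auto
      then have "(p - 1 - (?a i + c) + 1) * p \<le> i div p * p" by (rule mult_le_mono1)
      also have "i div p * p \<le> i" by simp
      finally have "(p - 1 - (?a i + c)) * p + p \<le> i" by (simp only: add_mult_distrib mult_1)
      then have "?j < i" using lt(2) by linarith
      then have "(\<lambda>l. \<psi> ((?a ?j, ?b ?j) # l)) = 0" by (rule z)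
      then show ?thesis unfolding ab by (simp add: fun_eq_iff)
    next
      case False
      then show ?thesis using \<psi> by (auto simp: Inv_def Tr_def)
    qed
    show "f i \<psi> \<in> ?M i"
    proof (cases "good A B (?a i, ?b i)")
      case True
      then show ?thesis using Inv_slice_top[OF \<psi> lt top] by (simp only: f_def if_True)
    next
      case False
      then have "f i \<psi> = 0" unfolding f_def by (rule Inv_slice_bad[OF \<psi> lt _ top])
      then show ?thesis using False by simp
    qed
  next
    fix \<psi> assume \<psi>: "\<psi> \<in> Inv (Suc m) A B" and z': "\<And>j. j < p * p \<Longrightarrow> f j \<psi> = 0"
    have z: "(\<lambda>l. \<psi> ((?a j, ?b j) # l)) = 0" if "j < p * p" for j using z'[OF that] by (simp add: f_def)
    show "\<psi> = 0"
    proof (rule ccontr)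
      assume "\<psi> \<noteq> 0"
      then obtain l where l: "\<psi> l \<noteq> 0" by (auto simp: fun_eq_iff)
      then have tl: "length l = Suc m" "trunc l" using \<psi> by (auto simp: Inv_def Tr_def)
      then obtain a b l' where l': "l = (a, b) # l'" by (cases l) auto
      let ?j = "(p - 1 - a) * p + b"
      have ab: "a < p" "b < p" using tl l' by auto
      then have j: "?a ?j = a" "?b ?j = b" by auto
      have "?j < (p - 1 - a) * p + p" using ab by auto
      also have "\<dots> \<le> (p - 1) * p + p" by (intro add_mono mult_le_mono) auto
      also have "\<dots> = p * p" using p_pos by (cases p) auto
      finally have "(\<lambda>l. \<psi> ((?a ?j, ?b ?j) # l)) = 0" by (rule z)
      then show False using l unfolding j l' by (simp add: fun_eq_iff)
    qed
  next
    fix i \<psi> \<phi>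
    show "f i (\<psi> - \<phi>) = f i \<psi> - f i \<phi>"
      by (simp add: f_def fun_eq_iff)
  next
    fix \<psi> \<phi> assume "\<psi> \<in> Inv (Suc m) A B" "\<phi> \<in> Inv (Suc m) A B"
    then show "\<psi> - \<phi> \<in> Inv (Suc m) A B" by (rule Inv_diff)
  next
    fix i
    show "finite (?M i)" by (simp add: Inv_finite)
  qed
  then have le1: "card (Inv (Suc m) A B) \<le> (\<Prod>i<p * p. card (?M i))" by blast
  have le2: "(\<Prod>i<p * p. card (?M i)) \<le> (\<Prod>i<p * p. CARD('k) ^ nat (?e (?a i, ?b i)))"
  proof (rule prod_mono)
    fix i
    have "i mod p < p" using p_pos by simp
    then show "0 \<le> card (?M i) \<and> card (?M i) \<le> CARD('k) ^ nat (?e (?a i, ?b i))"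
      using IH[of "(?a i, ?b i)"] by simp
  qed
  have le: "card (Inv (Suc m) A B) \<le> CARD('k) ^ (\<Sum>i<p * p. nat (?e (?a i, ?b i)))"
    using le_trans[OF le1 le2] unfolding power_sum .
  have eq: "(\<Sum>i<p * p. nat (?e (?a i, ?b i))) = nat (ee (Suc m) A B)"
  proof -
    have "(\<Sum>i<p * p. nat (?e (?a i, ?b i))) = (\<Sum>x\<in>{..<p} \<times> {..<p}. nat (?e x))"
      by (rule sum_lessThan_square[of "\<lambda>x. nat (?e x)"])
    also have "\<dots> = nat (\<Sum>x\<in>{..<p} \<times> {..<p}. ?e x)"
    proof -
      have "int (\<Sum>x\<in>{..<p} \<times> {..<p}. nat (?e x)) = (\<Sum>x\<in>{..<p} \<times> {..<p}. ?e x)"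
        unfolding of_nat_sum
      proof (rule sum.cong[OF refl])
        fix x assume "x \<in> {..<p} \<times> {..<p}"
        then show "int (nat (?e x)) = ?e x" using IH[of x] by (cases "good A B x") auto
      qed
      from arg_cong[OF this, of nat] show ?thesis by (simp only: nat_int)
    qed
    finally show ?thesis
      unfolding ee_Suc_good[OF Suc.prems] by (subst sum.inter_filter) simp_all
  qed
  have "card (Inv (Suc m) A B) \<le> CARD('k) ^ nat (ee (Suc m) A B)" using le unfolding eq .
  moreover have "ee (Suc m) A B \<ge> 0"
    unfolding ee_Suc_good[OF Suc.prems]
  proof (rule sum_nonneg)
    fix x assume "x \<in> {x \<in> {..<p} \<times> {..<p}. good A B x}"
    then show "0 \<le> ee m (A - int (fst x)) (B - int (snd x))" using IH[of x] by auto
  qed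
  ultimately show ?case by simp
qed

lemma cc_neg: "A < 0 \<Longrightarrow> cc m A = 0"
  by (induction m arbitrary: A) auto

lemma sum_ee: "(\<Sum>j\<in>{1..n}. ee m (A - int j) (B + int j)) = mon m (A - 1) (B + 1) - mon m (A - 1 - int n) (B + 1 + int n)"
  by (induction n) (auto simp: ee_def algebra_simps)

text \<open>By \<open>DU_DU\<close>, the divided powers of the last nonvanishing divided power are
  multiples of higher ones, which vanish.\<close>

lemma Inv_DU_top:
  assumes \<psi>: "\<psi> \<in> Tr m A B" and top: "\<And>n l. n > j \<Longrightarrow> trunc l \<Longrightarrow> DU n \<psi> l = 0"
  shows "(\<lambda>l. if trunc l then DU j \<psi> l else 0) \<in> Inv m (A - int j) (B + int j)"
proof -
  let ?f = "\<lambda>l. if trunc l then DU j \<psi> l else 0"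
  have supp: "\<psi> l \<noteq> 0 \<Longrightarrow> length l = m \<and> trunc l \<and> deg1 l = A \<and> deg2 l = B" for l
    using \<psi> by (simp add: Tr_def)
  have "?f \<in> Tr m (A - int j) (B + int j)"
    unfolding Tr_def
  proof (intro CollectI allI impI)
    fix l assume l: "?f l \<noteq> 0"
    then have "DU j \<psi> l \<noteq> 0" "trunc l" by (auto split: if_splits)
    from DU_nonzero_ex[OF this(1)] obtain l' where l': "\<psi> l' \<noteq> 0"
      "list_all2 (\<lambda>x y. fst x \<le> fst y \<and> snd y \<le> snd x) l l'" "deg1 l' = deg1 l + int j" "deg2 l' = deg2 l - int j"
      by blast
    then show "length l = m \<and> trunc l \<and> deg1 l = A - int j \<and> deg2 l = B + int j"
      using supp[OF l'(1)] list_all2_lengthD[OF l'(2)] \<open>trunc l\<close> by auto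
  qed
  moreover have "DU n ?f l = 0" if n: "n \<ge> 1" and l: "trunc l" for n l
  proof -
    \<comment> \<open>Restricting to truncated lists changes nothing here: a list that lies between
      l and the support of \<psi> has its exponents bounded by truncated ones.\<close>
    have "DU n ?f l = DU n (DU j \<psi>) l"
    proof (rule DU_cong)
      fix l' assume l': "list_all2 (\<lambda>x y. fst x \<le> fst y \<and> snd y \<le> snd x) l l'"
      show "?f l' = DU j \<psi> l'"
      proof (cases "trunc l' \<or> DU j \<psi> l' = 0")
        case False
        then have "DU j \<psi> l' \<noteq> 0" by blast
        from DU_nonzero_ex[OF this] obtain l'' where l'': "\<psi> l'' \<noteq> 0"
          "list_all2 (\<lambda>x y. fst x \<le> fst y \<and> snd y \<le> snd x) l' l''" by blast
        then have t: "trunc l''" using supp by blast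
        have "trunc l'"
          unfolding trunc_def all_set_conv_all_nth
        proof (intro allI impI)
          fix i assume i: "i < length l'"
          then have "fst (l' ! i) \<le> fst (l'' ! i)" "snd (l' ! i) \<le> snd (l ! i)"
            "i < length l''" "i < length l"
            using l' l''(2) by (auto simp: list_all2_conv_all_nth)
          moreover have "fst (l'' ! i) < p" "snd (l ! i) < p"
            using t l calculation by (auto simp: trunc_def)
          ultimately show "fst (l' ! i) < p \<and> snd (l' ! i) < p" by linarith
        qed
        then show ?thesis using False by blast
      qed auto
    qed
    also have "\<dots> = of_nat ((n + j) choose n) * DU (n + j) \<psi> l" by (rule DU_DU)
    also have "DU (n + j) \<psi> l = 0" using n by (intro top l) auto
    finally show ?thesis by simp
  qed
  ultimately show ?thesis unfolding Inv_def by blast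
qed

text \<open>A form is detected by its divided powers, the last nonvanishing one of which lies in
  \<open>Inv\<close> at (A - j, B + j). The upper bounds for j \<ge> 1 telescope to
  \<open>mon m (A - 1) (B + 1)\<close>, so the factor for j = 0 must account for the rest of
  \<open>Tr m A B\<close>.\<close>

lemma card_Inv_ge:
  assumes "0 \<le> A" "A \<le> B"
  shows "CARD('k) ^ nat (ee m A B) \<le> card (Inv m A B)"
proof -
  define f :: "nat \<Rightarrow> (exps \<Rightarrow> 'k) \<Rightarrow> exps \<Rightarrow> 'k" where
    "f = (\<lambda>i \<psi> l. if trunc l then DU (nat A - i) \<psi> l else 0)"
  let ?M = "\<lambda>i. Inv m (A - int (nat A - i)) (B + int (nat A - i))"
  let ?Q = "CARD('k)"
  have Q: "?Q > 0" by (simp add: card_gt_0_iff)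
  have high: "DU n \<psi> l = 0" if "\<psi> \<in> Tr m A B" "int n > A" for \<psi> n l
  proof (rule ccontr)
    assume "DU n \<psi> l \<noteq> 0"
    from DU_nonzero_ex[OF this] obtain l' where "\<psi> l' \<noteq> 0" "deg1 l' = deg1 l + int n" by blast
    moreover from this have "deg1 l' = A" using that by (simp add: Tr_def)
    ultimately show False using that deg_nonneg(1)[of l] by linarith
  qed
  have "finite (Tr m A B) \<and> card (Tr m A B) \<le> (\<Prod>i<Suc (nat A). card (?M i))"
  proof (rule card_filtration[where f = f and M = ?M and G = "Tr m A B" and N = "Suc (nat A)"])
    fix i \<psi> assume i: "i < Suc (nat A)" and \<psi>: "\<psi> \<in> Tr m A B" and z: "\<And>j. j < i \<Longrightarrow> f j \<psi> = 0"
    show "f i \<psi> \<in> ?M i"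
      unfolding f_def
    proof (rule Inv_DU_top[OF \<psi>])
      fix n l assume n: "n > nat A - i" and l: "trunc l"
      show "DU n \<psi> l = 0"
      proof (cases "int n > A")
        case True
        then show ?thesis by (rule high[OF \<psi>])
      next
        case False
        have "nat A - n < i" using n i False by linarith
        from fun_cong[OF z[OF this], of l] show ?thesis
          using l False by (auto simp: f_def)
      qed
    qed
  next
    fix \<psi> assume \<psi>: "\<psi> \<in> Tr m A B" and z: "\<And>j. j < Suc (nat A) \<Longrightarrow> f j \<psi> = 0"
    show "\<psi> = 0"
    proof
      fix l
      show "\<psi> l = 0 l"
      proof (cases "trunc l")
        case True
        then show ?thesis using fun_cong[OF z[of "nat A"], of l] by (simp add: f_def)
      next
        case False
        then show ?thesis using \<psi> by (auto simp: Tr_def)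
      qed
    qed
  next
    fix i and \<psi> \<phi> :: "exps \<Rightarrow> 'k"
    have "DU n (\<psi> - \<phi>) l = DU n \<psi> l - DU n \<phi> l" for n l
      using DU_diff[of n \<psi> \<phi> l] by (simp add: fun_diff_def)
    then show "f i (\<psi> - \<phi>) = f i \<psi> - f i \<phi>" by (auto simp: f_def fun_eq_iff)
  next
    fix \<psi> \<phi> assume a: "\<psi> \<in> Tr m A B" "\<phi> \<in> Tr m A B"
    show "\<psi> - \<phi> \<in> Tr m A B"
      unfolding Tr_def
    proof (intro CollectI allI impI)
      fix l assume "(\<psi> - \<phi>) l \<noteq> 0"
      then have "\<psi> l \<noteq> 0 \<or> \<phi> l \<noteq> 0" by auto
      then show "length l = m \<and> trunc l \<and> deg1 l = A \<and> deg2 l = B" using a unfolding Tr_def by blast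
    qed
  qed (rule Inv_finite)
  then have "card (Tr m A B) \<le> (\<Prod>i<Suc (nat A). card (?M i))" by blast
  also have "(\<Prod>i<Suc (nat A). card (?M i)) = (\<Prod>j<Suc (nat A). card (Inv m (A - int j) (B + int j)))"
    by (rule prod.reindex_bij_witness[of _ "\<lambda>j. nat A - j" "\<lambda>j. nat A - j"]) auto
  also have "\<dots> = card (Inv m A B) * (\<Prod>j\<in>{1..nat A}. card (Inv m (A - int j) (B + int j)))"
    by (simp add: lessThan_Suc_atMost atMost_atLeast0 prod.atLeast_Suc_atMost)
  also have "\<dots> \<le> card (Inv m A B) * (\<Prod>j\<in>{1..nat A}. ?Q ^ nat (ee m (A - int j) (B + int j)))"
  proof (rule mult_left_mono[OF prod_mono])
    fix j assume "j \<in> {1..nat A}"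
    then have "A - int j \<le> B + int j" using assms by auto
    then show "0 \<le> card (Inv m (A - int j) (B + int j)) \<and>
       card (Inv m (A - int j) (B + int j)) \<le> ?Q ^ nat (ee m (A - int j) (B + int j))"
      using card_Inv_le by blast
  qed simp
  also have "(\<Prod>j\<in>{1..nat A}. ?Q ^ nat (ee m (A - int j) (B + int j))) = ?Q ^ nat (mon m (A - 1) (B + 1))"
  proof -
    have "int (\<Sum>j\<in>{1..nat A}. nat (ee m (A - int j) (B + int j))) = (\<Sum>j\<in>{1..nat A}. ee m (A - int j) (B + int j))"
      unfolding of_nat_sum
    proof (rule sum.cong[OF refl])
      fix j assume "j \<in> {1..nat A}"
      then have "A - int j \<le> B + int j" using assms by auto
      then show "int (nat (ee m (A - int j) (B + int j))) = ee m (A - int j) (B + int j)"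
        using card_Inv_le by simp
    qed
    also have "\<dots> = mon m (A - 1) (B + 1)"
      unfolding sum_ee using assms by (simp add: mon_def cc_neg)
    finally have "(\<Sum>j\<in>{1..nat A}. nat (ee m (A - int j) (B + int j))) = nat (mon m (A - 1) (B + 1))"
      by linarith
    then show ?thesis by (simp flip: power_sum)
  qed
  finally have le: "?Q ^ nat (mon m A B) \<le> card (Inv m A B) * ?Q ^ nat (mon m (A - 1) (B + 1))"
    by (simp add: card_Tr)
  have "ee m A B \<ge> 0" "mon m (A - 1) (B + 1) \<ge> 0"
    using card_Inv_le[OF assms(2)] by (auto simp: mon_def cc_nonneg)
  then have "nat (mon m A B) = nat (ee m A B) + nat (mon m (A - 1) (B + 1))"
    by (simp add: ee_def flip: nat_add_distrib)
  then show ?thesis using le Q by (simp add: power_add)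
qed

theorem card_Inv: "0 \<le> A \<Longrightarrow> A \<le> B \<Longrightarrow> card (Inv m A B) = CARD('k) ^ nat (ee m A B)"
  by (rule antisym) (simp_all add: card_Inv_le card_Inv_ge)

section \<open>Closed form of the dimension\<close>

lemma cc_symmetric: "cc m A = cc m (int m * (int p - 1) - A)"
proof (induction m arbitrary: A)
  case (Suc m)
  have "cc (Suc m) A = (\<Sum>a<p. cc m (int m * (int p - 1) - (A - int a)))"
    unfolding cc.simps by (rule sum.cong[OF refl]) (rule Suc)
  also have "\<dots> = (\<Sum>a<p. cc m (int (Suc m) * (int p - 1) - A - int a))"
    by (rule sum.reindex_bij_witness[of _ "\<lambda>a. p - 1 - a" "\<lambda>a. p - 1 - a"])
      (use p_pos in \<open>auto simp: of_nat_diff algebra_simps\<close>)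
  finally show ?case by simp
qed simp

text \<open>In terms of generating functions, multiplication by 1/(1 - x) is summation and
  multiplication by 1 - x^p is the difference.\<close>

lemma sum_cc:
  "(\<Sum>x\<le>A. cc m (int x)) - (if p \<le> A then \<Sum>x\<le>A - p. cc m (int x) else 0) = cc (Suc m) (int A)"
proof -
  have "cc (Suc m) (int A) = (\<Sum>a\<in>{..<p} \<inter> {..A}. cc m (int A - int a))"
    unfolding cc.simps
  proof (rule sum.mono_neutral_right)
    show "\<forall>i\<in>{..<p} - {..<p} \<inter> {..A}. cc m (int A - int i) = 0"
    proof
      fix i assume "i \<in> {..<p} - {..<p} \<inter> {..A}"
      then show "cc m (int A - int i) = 0" by (intro cc_neg) auto
    qed
  qed auto
  also have "\<dots> = (\<Sum>x\<in>{x. x \<le> A \<and> A < x + p}. cc m (int x))"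
    by (rule sum.reindex_bij_witness[of _ "\<lambda>x. A - x" "\<lambda>x. A - x"]) (auto simp: of_nat_diff)
  also have "\<dots> = (\<Sum>x\<le>A. cc m (int x)) - (\<Sum>x\<in>{x. x + p \<le> A}. cc m (int x))"
    by (subst sum_diff[symmetric]) (auto intro!: sum.cong)
  also have "(\<Sum>x\<in>{x. x + p \<le> A}. cc m (int x)) = (if p \<le> A then \<Sum>x\<le>A - p. cc m (int x) else 0)"
    by (auto intro!: sum.cong sum.neutral)
  finally show ?thesis by simp
qed

lemma sum_choose_col: "(\<Sum>x\<le>A. int ((x + m) choose m)) = int ((A + Suc m) choose Suc m)"
  by (induction A) (auto simp: algebra_simps)

text \<open>The first two terms in the expansion of (1 - x^p)^(m+1) (1 - x)^(-m-1); the next one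
  starts in degree 2p.\<close>

lemma cc_eq:
  "A < 2 * p \<Longrightarrow> cc (Suc m) (int A) = int ((A + m) choose m) - (if p \<le> A then int (Suc m) * int ((A - p + m) choose m) else 0)"
proof (induction m arbitrary: A)
  case 0
  have "(\<Sum>x\<le>n. cc 0 (int x)) = 1" for n :: nat by (simp add: sum.delta)
  then show ?case unfolding sum_cc[symmetric, of 0 A] by simp
next
  case (Suc m)
  have S: "(\<Sum>x\<le>n. cc (Suc m) (int x)) = int ((n + Suc m) choose Suc m) - (if p \<le> n then int (Suc m) * int ((n - p + Suc m) choose Suc m) else 0)"
    if n: "n < 2 * p" for n
  proof -
    have "(\<Sum>x\<le>n. cc (Suc m) (int x)) = (\<Sum>x\<le>n. int ((x + m) choose m) - (if p \<le> x then int (Suc m) * int ((x - p + m) choose m) else 0))"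
      by (rule sum.cong[OF refl], rule Suc.IH) (use n in auto)
    also have "\<dots> = int ((n + Suc m) choose Suc m) - (\<Sum>x\<le>n. if p \<le> x then int (Suc m) * int ((x - p + m) choose m) else 0)"
      by (simp only: sum_subtractf sum_choose_col)
    also have "(\<Sum>x\<le>n. if p \<le> x then int (Suc m) * int ((x - p + m) choose m) else 0)
      = (\<Sum>x\<in>{p..n}. int (Suc m) * int ((x - p + m) choose m))"
      by (rule sum.mono_neutral_cong_right) auto
    also have "\<dots> = (if p \<le> n then \<Sum>x\<le>n - p. int (Suc m) * int ((x + m) choose m) else 0)"
    proof (cases "p \<le> n")
      case True
      then have "(\<Sum>x\<in>{p..n}. int (Suc m) * int ((x - p + m) choose m)) = (\<Sum>x\<le>n - p. int (Suc m) * int ((x + m) choose m))"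
        by (intro sum.reindex_bij_witness[of _ "\<lambda>x. x + p" "\<lambda>x. x - p"]) auto
      then show ?thesis using True by simp
    qed auto
    also have "\<dots> = (if p \<le> n then int (Suc m) * int ((n - p + Suc m) choose Suc m) else 0)"
      by (simp only: sum_distrib_left[symmetric] sum_choose_col)
    finally show ?thesis .
  qed
  show ?case
  proof (cases "p \<le> A")
    case True
    then have "\<not> p \<le> A - p" "A - p < 2 * p" using Suc.prems by auto
    then show ?thesis
      using sum_cc[of "Suc m" A] S[OF Suc.prems] S[of "A - p"] True
      by (simp del: cc.simps(2) binomial_Suc_Suc add_Suc_right) (simp only: algebra_simps of_nat_Suc)
  next
    case False
    then show ?thesis
      using sum_cc[of "Suc m" A] S[OF Suc.prems] by (simp del: cc.simps(2) binomial_Suc_Suc add_Suc_right)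
  qed
qed

lemma real_choose_3: "real (n choose 3) = real n * (real n - 1) * (real n - 2) / 6"
  by (simp add: binomial_gbinomial gbinomial_prod_rev numeral_3_eq_3 prod.atLeast0_lessThan_Suc fact_numeral)

lemma real_choose_4: "real (n choose 4) = real n * (real n - 1) * (real n - 2) * (real n - 3) / 24"
proof -
  have 4: "4 = Suc (Suc (Suc (Suc 0)))" by simp
  show ?thesis unfolding 4 by (simp add: binomial_gbinomial gbinomial_prod_rev prod.atLeast0_lessThan_Suc)
qed

definition N0 :: nat where "N0 = nat (ee 5 (2 * int p - 2) (3 * int p - 3))"

lemma N0_eq: "real N0 = real p * (real p + 1) / 32 * (real ((2 * p + 2) choose 3))\<^sup>2
                  - real p * (real p - 1) / 32 * (real ((2 * p) choose 3))\<^sup>2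
                  + real p / 2 * (real ((p + 1) choose 3))\<^sup>2"
proof -
  have nonneg: "ee 5 (2 * int p - 2) (3 * int p - 3) \<ge> 0"
    by (rule conjunct1[OF card_Inv_le]) (use p_pos in auto)
  \<comment> \<open>The degrees 2p - 2 and 3p - 3 are complementary in 5(p - 1).\<close>
  have sym: "cc 5 (3 * int p - 3) = cc 5 (2 * int p - 2)" "cc 5 (3 * int p - 2) = cc 5 (2 * int p - 3)"
    using cc_symmetric[of 5 "3 * int p - 3"] cc_symmetric[of 5 "3 * int p - 2"] by (simp_all add: algebra_simps)
  have c: "cc 5 (2 * int p - 2) = int ((2 * p + 2) choose 4) - 5 * int ((p + 2) choose 4)"
    using cc_eq[of "2 * p - 2" 4] p_pos by (simp add: of_nat_diff)
  have d: "cc 5 (2 * int p - 3) = int ((2 * p + 1) choose 4) - 5 * int ((p + 1) choose 4)"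
  \<comment> \<open>For p = 2 the degree 2p - 3 = 1 is less than p and there is no correction term;
    the formula still holds because 3 choose 4 is 0.\<close>
  proof (cases "p = 2")
    case True
    have b: "(5 :: nat) choose 4 = 5" "(3 :: nat) choose 4 = 0" by (simp_all add: numeral_eq_Suc)
    moreover have "cc 5 1 = 5" using cc_eq[of 1 4] True b by simp
    ultimately show ?thesis using True by simp
  next
    case False
    have "2 * p - 3 - p + 4 = p + 1" "2 * p - 3 + 4 = 2 * p + 1" "p \<le> 2 * p - 3" "int (2 * p - 3) = 2 * int p - 3"
      using False p_pos by auto
    then show ?thesis
      using cc_eq[of "2 * p - 3" 4] p_pos by simp
  qed
  have "2 * int p - 2 - 1 = 2 * int p - 3" "3 * int p - 3 + 1 = 3 * int p - 2" by simp_all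
  then have "ee 5 (2 * int p - 2) (3 * int p - 3) = (cc 5 (2 * int p - 2))\<^sup>2 - (cc 5 (2 * int p - 3))\<^sup>2"
    unfolding ee_def mon_def by (simp only: sym power2_eq_square)
  then have "real N0 = real_of_int ((cc 5 (2 * int p - 2))\<^sup>2 - (cc 5 (2 * int p - 3))\<^sup>2)"
    using nonneg by (simp add: N0_def)
  also have "\<dots> = (real ((2 * p + 2) choose 4) - 5 * real ((p + 2) choose 4))\<^sup>2 - (real ((2 * p + 1) choose 4) - 5 * real ((p + 1) choose 4))\<^sup>2"
    unfolding c d by simp
  also have "\<dots> = real p * (real p + 1) / 32 * (real ((2 * p + 2) choose 3))\<^sup>2
                  - real p * (real p - 1) / 32 * (real ((2 * p) choose 3))\<^sup>2
                  + real p / 2 * (real ((p + 1) choose 3))\<^sup>2"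
    unfolding real_choose_3 real_choose_4 of_nat_add of_nat_mult of_nat_numeral of_nat_1
    by (simp add: field_simps power2_eq_square)
  finally show ?thesis .
qed

end

section \<open>Highest weight vectors\<close>

definition shift :: "nat \<Rightarrow> nat \<Rightarrow> (nat \<Rightarrow> int) \<Rightarrow> nat \<Rightarrow> int" where
  "shift i j \<alpha> = (\<lambda>x. \<alpha> x - (if x = i then 1 else 0) + (if x = j then 1 else 0))"

text \<open>The action of \<open>e\<^sub>i \<partial>/\<partial>e\<^sub>j + y\<^sub>i \<partial>/\<partial>y\<^sub>j\<close> on coefficients. Exponents are integers and coefficients vanish
  at negative ones, so that no case distinctions arise at the boundary.\<close>

definition raising :: "nat \<Rightarrow> nat \<Rightarrow> ((nat \<Rightarrow> int) \<Rightarrow> (nat \<Rightarrow> int) \<Rightarrow> 'k) \<Rightarrow> (nat \<Rightarrow> int) \<Rightarrow> (nat \<Rightarrow> int) \<Rightarrow> 'k :: comm_ring_1" where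
  "raising i j F \<alpha> \<beta> = of_int (\<alpha> j + 1) * F (shift i j \<alpha>) \<beta> + of_int (\<beta> j + 1) * F \<alpha> (shift i j \<beta>)"

definition ext :: "(exps \<Rightarrow> 'k) \<Rightarrow> (nat \<Rightarrow> int) \<Rightarrow> (nat \<Rightarrow> int) \<Rightarrow> 'k :: zero" where
  "ext \<psi> \<alpha> \<beta> = (if \<forall>x<5. 0 \<le> \<alpha> x \<and> 0 \<le> \<beta> x then \<psi> (map (\<lambda>x. (nat (\<alpha> x), nat (\<beta> x))) [0..<5]) else 0)"

lemma list5: "map f [0..<5] = [f 0, f 1, f 2, f 3, f (4 :: nat)]"
proof -
  have "[0..<5] = [0, 1, 2, 3, 4 :: nat]" by code_simp
  then show ?thesis by (simp only: list.map)
qed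

lemma all_less_5: "(\<forall>x<5. P x) \<longleftrightarrow> P 0 \<and> P 1 \<and> P 2 \<and> P 3 \<and> P (4 :: nat)"
proof -
  have "x < 5 \<longleftrightarrow> x = 0 \<or> x = 1 \<or> x = 2 \<or> x = 3 \<or> x = (4 :: nat)" for x by presburger
  then show ?thesis by (auto simp only:)
qed

context char_p
begin

abbreviation below :: "(nat \<Rightarrow> int) \<Rightarrow> bool" where "below \<alpha> \<equiv> \<forall>x. \<alpha> x < int p"

text \<open>The commutator relation [E_ij, E_jk] = E_ik on coefficients. Whenever a shift leaves the
  range below p, its factor is p and thus 0.\<close>

lemma raising_trans:
  fixes F :: "(nat \<Rightarrow> int) \<Rightarrow> (nat \<Rightarrow> int) \<Rightarrow> 'k"
  assumes ij: "\<And>\<alpha> \<beta>. below \<alpha> \<Longrightarrow> below \<beta> \<Longrightarrow> raising i j F \<alpha> \<beta> = 0"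
    and jk: "\<And>\<alpha> \<beta>. below \<alpha> \<Longrightarrow> below \<beta> \<Longrightarrow> raising j k F \<alpha> \<beta> = 0"
    and ne: "i \<noteq> j" "j \<noteq> k" "i \<noteq> k" and b: "below \<alpha>" "below \<beta>"
  shows "raising i k F \<alpha> \<beta> = 0"
proof -
  have bs: "below (shift i' j' \<gamma>) \<or> (of_int (\<gamma> j' + 1) :: 'k) = 0" if "below \<gamma>" for i' j' \<gamma>
  proof (cases "\<gamma> j' + 1 = int p")
    case True
    then show ?thesis using of_nat_eq_0_iff'[of p] by simp
  next
    case False
    then have "\<gamma> j' + 1 < int p" using that[rule_format, of j'] by linarith
    then have "\<gamma> x - (if x = i' then 1 else 0) + (if x = j' then 1 else 0) < int p" for x
      using that[rule_format, of x] by auto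
    then show ?thesis by (simp add: shift_def)
  qed
  have s: "shift i j (shift j k \<gamma>) = shift i k \<gamma>" "shift j k (shift i j \<gamma>) = shift i k \<gamma>" for \<gamma>
    by (auto simp: shift_def fun_eq_iff)
  have v: "shift i j \<gamma> k = \<gamma> k" "shift i j \<gamma> j = \<gamma> j + 1" "shift j k \<gamma> j = \<gamma> j - 1" "shift j k \<gamma> k = \<gamma> k + 1" for \<gamma>
    using ne by (auto simp: shift_def)
  let ?F = "\<lambda>\<gamma> \<delta>. F \<gamma> \<delta>"
  have 1: "of_int (\<alpha> j + 1) * raising j k F (shift i j \<alpha>) \<beta> = 0"
    using bs[OF b(1), of i j] jk[of "shift i j \<alpha>" \<beta>] b by auto
  have 2: "of_int (\<beta> j + 1) * raising j k F \<alpha> (shift i j \<beta>) = 0"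
    using bs[OF b(2), of i j] jk[of \<alpha> "shift i j \<beta>"] b by auto
  have 3: "of_int (\<alpha> k + 1) * raising i j F (shift j k \<alpha>) \<beta> = 0"
    using bs[OF b(1), of j k] ij[of "shift j k \<alpha>" \<beta>] b by auto
  have 4: "of_int (\<beta> k + 1) * raising i j F \<alpha> (shift j k \<beta>) = 0"
    using bs[OF b(2), of j k] ij[of \<alpha> "shift j k \<beta>"] b by auto
  have "raising i k F \<alpha> \<beta> =
     (of_int (\<alpha> j + 1) * raising j k F (shift i j \<alpha>) \<beta> + of_int (\<beta> j + 1) * raising j k F \<alpha> (shift i j \<beta>))
     - (of_int (\<alpha> k + 1) * raising i j F (shift j k \<alpha>) \<beta> + of_int (\<beta> k + 1) * raising i j F \<alpha> (shift j k \<beta>))"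
    unfolding raising_def s v by (simp add: algebra_simps)
  then show ?thesis unfolding 1 2 3 4 by simp
qed

abbreviation EE :: "(exps \<Rightarrow> 'k) set" where "EE \<equiv> Inv 5 (2 * int p - 2) (3 * int p - 3)"

text \<open>For p = 2 this is one of the monomials in the radical and the second candidate in
  \<open>two_weights\<close>.\<close>

definition iota1 :: exps where "iota1 = [(1, 0), (1, 0), (0, 1), (0, 1), (0, 1)]"
text \<open>The exponents of the monomial of highest weight, which is \<open>WW v\<close> for the
  reference basis v; \<open>alpha0\<close> below lists its e-exponents.\<close>

definition iota0 :: exps where "iota0 = [(p - 1, p - 1), (p - 1, p - 1), (0, p - 1), (0, 0), (0, 0)]"

definition alpha0 :: "nat \<Rightarrow> int" where
  "alpha0 x = (if x < 2 then int p - 1 else 0)"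

text \<open>In characteristic 2 the radical of the pairing on \<open>EE\<close> is spanned by the sum of all squarefree
  monomials of bidegree (2, 3) without a factor \<open>e\<^sub>i y\<^sub>i\<close>; the condition at \<open>iota1\<close> picks a complement.\<close>

definition EE0 :: "(exps \<Rightarrow> 'k) set" where "EE0 = {\<psi> \<in> EE. p = 2 \<longrightarrow> \<psi> iota1 = 0}"

lemma ext_support:
  assumes "\<psi> \<in> EE" "ext \<psi> \<alpha> \<beta> \<noteq> 0"
  shows "\<And>x. x < 5 \<Longrightarrow> 0 \<le> \<alpha> x \<and> \<alpha> x < int p \<and> 0 \<le> \<beta> x \<and> \<beta> x < int p"
    "\<alpha> 0 + \<alpha> 1 + \<alpha> 2 + \<alpha> 3 + \<alpha> 4 = 2 * int p - 2" "\<beta> 0 + \<beta> 1 + \<beta> 2 + \<beta> 3 + \<beta> 4 = 3 * int p - 3"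
proof -
  have nn: "\<forall>x<5. 0 \<le> \<alpha> x \<and> 0 \<le> \<beta> x" and nz: "\<psi> (map (\<lambda>x. (nat (\<alpha> x), nat (\<beta> x))) [0..<5]) \<noteq> 0"
    using assms(2) by (auto simp: ext_def split: if_splits)
  note s = Inv_support[OF assms(1) nz]
  show "\<And>x. x < 5 \<Longrightarrow> 0 \<le> \<alpha> x \<and> \<alpha> x < int p \<and> 0 \<le> \<beta> x \<and> \<beta> x < int p"
    using s(2) nn p_pos unfolding trunc_def by (force simp: nat_less_iff)
  show "\<alpha> 0 + \<alpha> 1 + \<alpha> 2 + \<alpha> 3 + \<alpha> 4 = 2 * int p - 2"
    using s(3) nn unfolding list5 all_less_5 by simp
  show "\<beta> 0 + \<beta> 1 + \<beta> 2 + \<beta> 3 + \<beta> 4 = 3 * int p - 3"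
    using s(4) nn unfolding list5 all_less_5 by simp
qed

text \<open>A raising operator that kills \<psi> trades one e_j for e_i against one y_i for y_j, at
  the cost of the factor -(\<beta>_j + 1)/\<alpha>_j. Repetition moves all e-exponents into the
  first two variables, and the factors accumulate to signed binomial coefficients.\<close>

lemma ext_formula:
  assumes \<psi>: "\<psi> \<in> EE"
    and D: "\<And>i j \<alpha> \<beta>. i < 2 \<Longrightarrow> 2 \<le> j \<Longrightarrow> j < 5 \<Longrightarrow> below \<alpha> \<Longrightarrow> below \<beta> \<Longrightarrow> raising i j (ext \<psi>) \<alpha> \<beta> = 0"
    and \<alpha>: "\<And>x. 0 \<le> \<alpha> x \<and> \<alpha> x < int p" "\<And>x. x \<ge> 5 \<Longrightarrow> \<alpha> x = 0" "\<alpha> 0 + \<alpha> 1 + \<alpha> 2 + \<alpha> 3 + \<alpha> 4 = 2 * int p - 2"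
    and \<beta>: "below \<beta>" "0 \<le> \<beta> 2" "0 \<le> \<beta> 3" "0 \<le> \<beta> 4"
  shows "ext \<psi> \<alpha> \<beta> = (-1) ^ nat (\<alpha> 2 + \<alpha> 3 + \<alpha> 4) *
     (\<Prod>j\<in>{2,3,4}. of_nat (nat (\<beta> j + \<alpha> j) choose nat (\<alpha> j))) * ext \<psi> alpha0 (\<lambda>x. \<alpha> x + \<beta> x - alpha0 x)"
  using \<alpha> \<beta>
proof (induction "nat (\<alpha> 2 + \<alpha> 3 + \<alpha> 4)" arbitrary: \<alpha> \<beta> rule: less_induct)
  case (less \<alpha> \<beta>)
  note a = less.prems(1) less.prems(2) less.prems(3)
  show ?case
  proof (cases "\<alpha> 2 + \<alpha> 3 + \<alpha> 4 = 0")
    case True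
    then have z: "\<alpha> 2 = 0" "\<alpha> 3 = 0" "\<alpha> 4 = 0" using a(1)[of 2] a(1)[of 3] a(1)[of 4] by auto
    then have "\<alpha> 0 = int p - 1" "\<alpha> 1 = int p - 1" using a(1)[of 0] a(1)[of 1] a(3) by auto
    moreover have "\<alpha> x = alpha0 x" for x
    proof -
      consider "x = 0" | "x = 1" | "x = 2" | "x = 3" | "x = 4" | "x \<ge> 5" by linarith
      then show ?thesis by cases (use calculation z a(2)[of x] in \<open>simp_all add: alpha0_def\<close>)
    qed
    then have "\<alpha> = alpha0" by blast
    then show ?thesis using z by simp
  next
    case False
    then obtain j where j: "j \<in> {2,3,4}" "\<alpha> j > 0"
      using a(1)[of 2] a(1)[of 3] a(1)[of 4] by (metis add.right_neutral insertCI less_le)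
    obtain i where i: "i < 2" "\<alpha> i < int p - 1"
    proof -
      have "\<alpha> 0 < int p - 1 \<or> \<alpha> 1 < int p - 1" using a(1)[of 2] a(1)[of 3] a(1)[of 4] a(3) False by linarith
      then show ?thesis using that[of 0] that[of 1] by auto
    qed
    have ij: "i \<noteq> j" using i j by auto
    define \<alpha>' where "\<alpha>' = shift j i \<alpha>"
    define \<beta>' where "\<beta>' = shift i j \<beta>"
    have avals: "\<alpha>' i = \<alpha> i + 1" "\<alpha>' j = \<alpha> j - 1" "\<And>x. x \<noteq> i \<Longrightarrow> x \<noteq> j \<Longrightarrow> \<alpha>' x = \<alpha> x"
      using ij by (auto simp: \<alpha>'_def shift_def)
    have bvals: "\<beta>' i = \<beta> i - 1" "\<beta>' j = \<beta> j + 1" "\<And>x. x \<noteq> i \<Longrightarrow> x \<noteq> j \<Longrightarrow> \<beta>' x = \<beta> x"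
      using ij by (auto simp: \<beta>'_def shift_def)
    have sback: "shift i j \<alpha>' = \<alpha>" by (auto simp: \<alpha>'_def shift_def fun_eq_iff)
    have a': "0 \<le> \<alpha>' x \<and> \<alpha>' x < int p" for x
      using a(1)[of x] i j avals by (cases "x = i"; cases "x = j") auto
    have rel: "of_int (\<alpha> j) * ext \<psi> \<alpha> \<beta> = - (of_int (\<beta> j + 1) * ext \<psi> \<alpha>' \<beta>')"
    proof -
      have "raising i j (ext \<psi>) \<alpha>' \<beta> = 0"
        by (rule D) (use i j a' less.prems(4) in auto)
      then have "of_int (\<alpha> j) * ext \<psi> \<alpha> \<beta> + of_int (\<beta> j + 1) * ext \<psi> \<alpha>' \<beta>' = 0"
        by (simp add: raising_def sback avals \<beta>'_def)
      then show ?thesis by (simp only: eq_neg_iff_add_eq_0)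
    qed
    have same: "(\<lambda>x. \<alpha>' x + \<beta>' x - alpha0 x) = (\<lambda>x. \<alpha> x + \<beta> x - alpha0 x)"
      by (auto simp: \<alpha>'_def \<beta>'_def shift_def fun_eq_iff)
    have aj: "(of_int (\<alpha> j) :: 'k) \<noteq> 0"
    proof -
      have "0 < nat (\<alpha> j)" "nat (\<alpha> j) < p" using a(1)[of j] j by auto
      then have "(of_nat (nat (\<alpha> j)) :: 'k) \<noteq> 0" unfolding of_nat_eq_0_iff' by (rule nat_dvd_not_less)
      then show ?thesis using j by (simp add: of_nat_nat)
    qed
    have bj: "0 \<le> \<beta> j" using j less.prems by auto
    show ?thesis
    \<comment> \<open>When the sum reaches p, the value on the right has a y_j-exponent outside the
      truncated range and is 0, so it has to be shown that the left-hand side vanishes.\<close>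
    proof (cases "\<beta> j + \<alpha> j \<ge> int p")
      case True
      have z: "ext \<psi> alpha0 (\<lambda>x. \<alpha> x + \<beta> x - alpha0 x) = 0"
      proof (rule ccontr)
        assume "ext \<psi> alpha0 (\<lambda>x. \<alpha> x + \<beta> x - alpha0 x) \<noteq> 0"
        from ext_support(1)[OF \<psi> this, of j] show False using True j by (auto simp: alpha0_def)
      qed
      have "of_int (\<beta> j + 1) * ext \<psi> \<alpha>' \<beta>' = 0"
      proof (cases "\<beta> j + 1 = int p")
        case True
        then show ?thesis using of_nat_eq_0_iff'[of p] by simp
      next
        case False
        have "ext \<psi> \<alpha>' \<beta>' = (-1) ^ nat (\<alpha>' 2 + \<alpha>' 3 + \<alpha>' 4) *
           (\<Prod>j\<in>{2,3,4}. of_nat (nat (\<beta>' j + \<alpha>' j) choose nat (\<alpha>' j))) * ext \<psi> alpha0 (\<lambda>x. \<alpha>' x + \<beta>' x - alpha0 x)"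
        proof (rule less.hyps)
          show "nat (\<alpha>' 2 + \<alpha>' 3 + \<alpha>' 4) < nat (\<alpha> 2 + \<alpha> 3 + \<alpha> 4)"
            using j i a(1)[of 2] a(1)[of 3] a(1)[of 4] by (auto simp: \<alpha>'_def shift_def)
          show "\<alpha>' x = 0" if "x \<ge> 5" for x using a(2)[OF that] i j that by (auto simp: \<alpha>'_def shift_def)
          show "\<alpha>' 0 + \<alpha>' 1 + \<alpha>' 2 + \<alpha>' 3 + \<alpha>' 4 = 2 * int p - 2"
            using a(3) i j by (auto simp: \<alpha>'_def shift_def less_2_cases_iff)
          show "below \<beta>'"
          proof
            fix x show "\<beta>' x < int p"
              using less.prems(4)[rule_format, of x] less.prems(4)[rule_format, of j] False bvals by (cases "x = i"; cases "x = j") auto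
          qed
          show "0 \<le> \<beta>' 2" "0 \<le> \<beta>' 3" "0 \<le> \<beta>' 4" using less.prems i by (auto simp: \<beta>'_def shift_def)
        qed (rule a')
        then show ?thesis unfolding same z by simp
      qed
      then have "of_int (\<alpha> j) * ext \<psi> \<alpha> \<beta> = 0" unfolding rel by simp
      then have "ext \<psi> \<alpha> \<beta> = 0" using aj by simp
      then show ?thesis unfolding z by simp
    next
      case False
      have IH: "ext \<psi> \<alpha>' \<beta>' = (-1) ^ nat (\<alpha>' 2 + \<alpha>' 3 + \<alpha>' 4) *
           (\<Prod>j\<in>{2,3,4}. of_nat (nat (\<beta>' j + \<alpha>' j) choose nat (\<alpha>' j))) * ext \<psi> alpha0 (\<lambda>x. \<alpha>' x + \<beta>' x - alpha0 x)"
      proof (rule less.hyps)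
        show "nat (\<alpha>' 2 + \<alpha>' 3 + \<alpha>' 4) < nat (\<alpha> 2 + \<alpha> 3 + \<alpha> 4)"
          using j i a(1)[of 2] a(1)[of 3] a(1)[of 4] by (auto simp: \<alpha>'_def shift_def)
        show "\<alpha>' x = 0" if "x \<ge> 5" for x using a(2)[OF that] i j that by (auto simp: \<alpha>'_def shift_def)
        show "\<alpha>' 0 + \<alpha>' 1 + \<alpha>' 2 + \<alpha>' 3 + \<alpha>' 4 = 2 * int p - 2"
          using a(3) i j by (auto simp: \<alpha>'_def shift_def less_2_cases_iff)
        show "below \<beta>'"
        proof
          fix x show "\<beta>' x < int p"
            using less.prems(4)[rule_format, of x] j False bvals by (cases "x = i"; cases "x = j") auto
        qed
        show "0 \<le> \<beta>' 2" "0 \<le> \<beta>' 3" "0 \<le> \<beta>' 4" using less.prems i by (auto simp: \<beta>'_def shift_def)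
      qed (rule a')
      \<comment> \<open>The absorption identity for binomials; it provides the factor
        \<open>\<alpha> j\<close> that is cancelled at the end.\<close>
      have absorb: "of_int (\<beta> j + 1) * of_nat (nat (\<beta>' j + \<alpha>' j) choose nat (\<alpha>' j))
         = (of_int (\<alpha> j) * of_nat (nat (\<beta> j + \<alpha> j) choose nat (\<alpha> j)) :: 'k)"
      proof -
        define b n where "b = nat (\<beta> j)" and "n = nat (\<alpha> j) - 1"
        then have b: "\<beta> j = int b" "\<alpha> j = int (Suc n)" using bj j by auto
        have "Suc b * ((b + Suc n) choose n) = Suc n * ((b + Suc n) choose Suc n)"
          using Suc_times_binomial_add[of n b] by (simp only: add_Suc_right add.commute[of b n])
        then have "(of_nat (Suc b) * of_nat ((b + Suc n) choose n) :: 'k) = of_nat (Suc n) * of_nat ((b + Suc n) choose Suc n)"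
          by (simp only: of_nat_mult[symmetric])
        moreover have "nat (\<beta>' j + \<alpha>' j) = b + Suc n" "nat (\<alpha>' j) = n" "nat (\<beta> j + \<alpha> j) = b + Suc n" "nat (\<alpha> j) = Suc n"
          "(of_int (\<beta> j + 1) :: 'k) = of_nat (Suc b)" "(of_int (\<alpha> j) :: 'k) = of_nat (Suc n)"
          using b avals bvals by auto
        ultimately show ?thesis by (simp only:)
      qed
      have P: "(\<Prod>k\<in>{2,3,4}. of_nat (nat (\<gamma> k + \<delta> k) choose nat (\<delta> k)) :: 'k)
         = of_nat (nat (\<gamma> j + \<delta> j) choose nat (\<delta> j)) * (\<Prod>k\<in>{2,3,4} - {j}. of_nat (nat (\<gamma> k + \<delta> k) choose nat (\<delta> k)))" for \<gamma> \<delta>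
        using j by (intro prod.remove) auto
      have R: "(\<Prod>k\<in>{2,3,4} - {j}. of_nat (nat (\<beta>' k + \<alpha>' k) choose nat (\<alpha>' k)) :: 'k)
          = (\<Prod>k\<in>{2,3,4} - {j}. of_nat (nat (\<beta> k + \<alpha> k) choose nat (\<alpha> k)))"
        using i by (intro prod.cong refl) (auto simp: \<alpha>'_def \<beta>'_def shift_def)
      have S: "nat (\<alpha> 2 + \<alpha> 3 + \<alpha> 4) = Suc (nat (\<alpha>' 2 + \<alpha>' 3 + \<alpha>' 4))"
        using j i a(1)[of 2] a(1)[of 3] a(1)[of 4] by (auto simp: \<alpha>'_def shift_def)
      let ?R = "\<Prod>k\<in>{2,3,4} - {j}. of_nat (nat (\<beta> k + \<alpha> k) choose nat (\<alpha> k)) :: 'k"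
      let ?X = "ext \<psi> alpha0 (\<lambda>x. \<alpha> x + \<beta> x - alpha0 x)"
      have "of_int (\<alpha> j) * ext \<psi> \<alpha> \<beta> = - ((of_int (\<beta> j + 1) * of_nat (nat (\<beta>' j + \<alpha>' j) choose nat (\<alpha>' j)))
          * ((-1) ^ nat (\<alpha>' 2 + \<alpha>' 3 + \<alpha>' 4) * ?R * ?X))"
        unfolding rel IH same P R by (simp only: mult_ac)
      also have "\<dots> = of_int (\<alpha> j) * ((-1) ^ nat (\<alpha> 2 + \<alpha> 3 + \<alpha> 4) * (of_nat (nat (\<beta> j + \<alpha> j) choose nat (\<alpha> j)) * ?R) * ?X)"
        unfolding absorb S by (simp add: mult_ac)
      finally show ?thesis unfolding P[of \<beta> \<alpha>] using aj by simp
    qed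
  qed
qed

end

lemma DU_1_Cons:
  "DU 1 \<psi> (x # l) = DU 1 (\<lambda>l'. \<psi> (x # l')) l
     + (if snd x > 0 then of_nat (fst x + 1) * \<psi> ((fst x + 1, snd x - 1) # l) else 0)"
proof -
  obtain a b where "x = (a, b)" by force
  then show ?thesis by (cases b) (simp_all add: min_def atMost_Suc)
qed

lemma DU_1_Nil: "DU 1 \<psi> [] = 0"
  by simp

context char_p
begin

text \<open>The first divided power rewritten for integer exponents; a term with an exhausted y_x
  drops out because \<open>ext\<close> vanishes at negative exponents.\<close>

lemma first_order:
  assumes \<psi>: "\<psi> \<in> EE" and ab: "\<And>x. x < 5 \<Longrightarrow> 0 \<le> \<alpha> x \<and> \<alpha> x < int p \<and> 0 \<le> \<beta> x \<and> \<beta> x < int p"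
  shows "(\<Sum>x\<in>{0,1,2,3,4}. of_int (\<alpha> x + 1) * ext \<psi> (\<alpha>(x := \<alpha> x + 1)) (\<beta>(x := \<beta> x - 1))) = 0"
proof -
  let ?l = "map (\<lambda>x. (nat (\<alpha> x), nat (\<beta> x))) [0..<5]"
  have t: "trunc ?l" using ab by (auto simp: trunc_def nat_less_iff)
  have a: "0 \<le> \<alpha> 0" "0 \<le> \<alpha> 1" "0 \<le> \<alpha> 2" "0 \<le> \<alpha> 3" "0 \<le> \<alpha> 4"
    "0 \<le> \<beta> 0" "0 \<le> \<beta> 1" "0 \<le> \<beta> 2" "0 \<le> \<beta> 3" "0 \<le> \<beta> 4"
    using ab[of 0] ab[of 1] ab[of 2] ab[of 3] ab[of 4] by auto
  have e: "of_int (\<alpha> x + 1) * ext \<psi> (\<alpha>(x := \<alpha> x + 1)) (\<beta>(x := \<beta> x - 1))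
     = (if nat (\<beta> x) > 0 then of_nat (nat (\<alpha> x) + 1) * \<psi> (map (\<lambda>y. (nat ((\<alpha>(x := \<alpha> x + 1)) y), nat ((\<beta>(x := \<beta> x - 1)) y))) [0..<5]) else 0)"
    if "x < 5" for x
  proof (cases "\<beta> x > 0")
    case True
    have "\<forall>y<5. 0 \<le> (\<alpha>(x := \<alpha> x + 1)) y \<and> 0 \<le> (\<beta>(x := \<beta> x - 1)) y"
      using ab True that by (simp add: order.trans[OF conjunct1[OF ab[OF that]]])
    moreover have "of_int (\<alpha> x + 1) = (of_nat (nat (\<alpha> x) + 1) :: 'k)"
      using ab[OF that] by (simp add: of_nat_nat)
    ultimately show ?thesis using True unfolding ext_def by simp
  next
    case False
    then have "\<not> (\<forall>y<5. 0 \<le> (\<alpha>(x := \<alpha> x + 1)) y \<and> 0 \<le> (\<beta>(x := \<beta> x - 1)) y)"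
      using that by (metis fun_upd_same diff_ge_0_iff_ge int_one_le_iff_zero_less)
    then have "ext \<psi> (\<alpha>(x := \<alpha> x + 1)) (\<beta>(x := \<beta> x - 1)) = 0"
      unfolding ext_def by (rule if_not_P)
    then show ?thesis using False by simp
  qed
  have n: "nat (\<alpha> x + 1) = nat (\<alpha> x) + 1" "nat (\<beta> x - 1) = nat (\<beta> x) - 1" if "x < 5" for x
    using ab[OF that] by auto
  have "0 = DU 1 \<psi> ?l" using Inv_DU[OF \<psi> _ t] by simp
  also have "\<dots> = (\<Sum>x\<in>{0,1,2,3,4}. of_int (\<alpha> x + 1) * ext \<psi> (\<alpha>(x := \<alpha> x + 1)) (\<beta>(x := \<beta> x - 1)))"
    unfolding list5 DU_1_Cons DU_1_Nil
    by (simp add: e[of 0, simplified] e[of 1, simplified] e[of 2, simplified] e[of 3, simplified] e[of 4, simplified] list5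
        n[of 0] n[of 1] n[of 2] n[of 3] n[of 4] n[of "Suc 0"] del: upt_Suc)
  finally show ?thesis by simp
qed

lemma of_nat_binomial_top: "c \<le> p - 1 \<Longrightarrow> of_nat ((p - 1) choose c) = ((-1) ^ c :: 'k)"
proof (induction c)
  case (Suc c)
  have "p choose Suc c = ((p - 1) choose c) + ((p - 1) choose Suc c)"
    using p_pos by (cases p) auto
  moreover have "p dvd p choose Suc c"
    using Suc.prems p_pos by (intro dvd_choose_prime prime_p) auto
  then have "(of_nat (p choose Suc c) :: 'k) = 0" by (simp add: of_nat_eq_0_iff')
  ultimately have "of_nat ((p - 1) choose c) + of_nat ((p - 1) choose Suc c) = (0 :: 'k)"
    by (metis of_nat_add)
  then show ?case using Suc by (simp add: eq_neg_iff_add_eq_0 add.commute)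
qed auto

section \<open>Possible weights of a vector killed by all raising operators\<close>

context
  fixes \<psi> :: "exps \<Rightarrow> 'k"
  assumes \<psi>: "\<psi> \<in> EE"
    and simple: "\<And>i \<alpha> \<beta>. i < 4 \<Longrightarrow> below \<alpha> \<Longrightarrow> below \<beta> \<Longrightarrow> raising i (Suc i) (ext \<psi>) \<alpha> \<beta> = 0"
begin

lemma raising_all:
  assumes "i < j" "j < 5" "below \<alpha>" "below \<beta>"
  shows "raising i j (ext \<psi>) \<alpha> \<beta> = 0"
  using assms
proof (induction j arbitrary: \<alpha> \<beta>)
  case (Suc j)
  show ?case
  proof (cases "i = j")
    case True
    then show ?thesis using simple[of i \<alpha> \<beta>] Suc.prems by simp
  next
    case False
    show ?thesis
      by (rule raising_trans[of i j "ext \<psi>" "Suc j"]) (use Suc simple False in auto)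
  qed
qed auto

lemma below_alpha0: "below alpha0" using p_pos by (auto simp: alpha0_def)

text \<open>At \<open>alpha0\<close> only the y-part of the raising operator remains: its e-part
  meets a negative exponent for i \<ge> 2 and the factor p for (i, j) = (0, 1). The equation would
  give \<open>\<beta> j\<close> times the value = 0, and it is available unless y_i already has
  exponent p - 1.\<close>

lemma adjacent:
  assumes nz: "ext \<psi> alpha0 \<beta> \<noteq> 0" and b: "\<forall>x. 5 \<le> x \<longrightarrow> \<beta> x = 0"
    and ij: "i < j" "j < 5" "(i, j) = (0, 1) \<or> 2 \<le> i" and j: "\<beta> j > 0"
  shows "\<beta> i = int p - 1"
proof (rule ccontr)
  assume i: "\<beta> i \<noteq> int p - 1"
  note s = ext_support(1)[OF \<psi> nz]
  have bb: "\<beta> x < int p" for x using s[of x] b p_pos by (cases "x < 5") auto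
  have "below (shift j i \<beta>)"
  proof
    fix x show "shift j i \<beta> x < int p" using bb[of x] i bb[of i] ij by (auto simp: shift_def)
  qed
  then have r: "raising i j (ext \<psi>) alpha0 (shift j i \<beta>) = 0"
    by (intro raising_all ij below_alpha0)
  have "of_int (alpha0 j + 1) * ext \<psi> (shift i j alpha0) (shift j i \<beta>) = 0"
  proof (cases "2 \<le> i")
    case True
    have "ext \<psi> (shift i j alpha0) (shift j i \<beta>) = 0"
    proof (rule ccontr)
      assume "ext \<psi> (shift i j alpha0) (shift j i \<beta>) \<noteq> 0"
      from ext_support(1)[OF \<psi> this, of i] show False using True ij by (auto simp: shift_def alpha0_def)
    qed
    then show ?thesis by simp
  next
    case False
    then have "alpha0 j + 1 = int p" using ij by (auto simp: alpha0_def)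
    then show ?thesis using of_nat_eq_0_iff'[of p] by simp
  qed
  moreover have "shift i j (shift j i \<beta>) = \<beta>" by (auto simp: shift_def fun_eq_iff)
  moreover have "shift j i \<beta> j + 1 = \<beta> j" using ij by (auto simp: shift_def)
  ultimately have "of_int (\<beta> j) * ext \<psi> alpha0 \<beta> = 0" using r by (simp only: raising_def add_0_left)
  then have "(of_int (\<beta> j) :: 'k) = 0" using nz by simp
  then have "(of_nat (nat (\<beta> j)) :: 'k) = 0" using j by (simp add: of_nat_nat)
  moreover have "0 < nat (\<beta> j)" "nat (\<beta> j) < p" using j bb[of j] by auto
  ultimately show False unfolding of_nat_eq_0_iff' using nat_dvd_not_less by blast
qed

text \<open>The first-order equation is taken at \<open>alpha0\<close> with one e_i exchanged for
  y_i. The terms with j \<ge> 2 are rewritten by raising operators, one of the first two has the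
  factor p - 1 and the other the factor p. Altogether the value is multiplied by -(1 + \<beta>_2 +
  \<beta>_3 + \<beta>_4).\<close>

lemma weight_condition:
  assumes nz: "ext \<psi> alpha0 \<beta> \<noteq> 0" and b: "\<forall>x. 5 \<le> x \<longrightarrow> \<beta> x = 0"
    and i: "i < 2" "\<beta> i \<noteq> int p - 1"
  shows "p dvd nat (\<beta> 2 + \<beta> 3 + \<beta> 4 + 1)"
proof -
  note s = ext_support(1)[OF \<psi> nz]
  have bb: "\<beta> x < int p" for x using s[of x] b p_pos by (cases "x < 5") auto
  have bi: "\<beta> i + 1 < int p" using i bb[of i] by linarith
  let ?A = "alpha0(i := int p - 2)" and ?B = "\<beta>(i := \<beta> i + 1)"
  let ?X = "ext \<psi> alpha0 \<beta>"
  let ?t = "\<lambda>x. of_int (?A x + 1) * ext \<psi> (?A(x := ?A x + 1)) (?B(x := ?B x - 1))"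
  have Ai: "?A(i := ?A i + 1) = alpha0" "?B(i := ?B i - 1) = \<beta>" using i by (auto simp: alpha0_def fun_eq_iff)
  have "sum ?t {0,1,2,3,4} = 0"
  proof (rule first_order[OF \<psi>])
    fix x :: nat assume "x < 5"
    then show "0 \<le> ?A x \<and> ?A x < int p \<and> 0 \<le> ?B x \<and> ?B x < int p"
      using s[of x] s[of i] i bi p_pos by (auto simp: alpha0_def)
  qed
  moreover have tj: "?t j = - of_int (\<beta> j) * ?X" if j: "j \<in> {2,3,4}" for j
  proof -
    have ne: "i \<noteq> j" "i < j" "j < 5" using i j by auto
    have "below (shift j i \<beta>)"
    proof
      fix x show "shift j i \<beta> x < int p" using bb[of x] bi ne by (auto simp: shift_def)
    qed
    then have r: "raising i j (ext \<psi>) alpha0 (shift j i \<beta>) = 0"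
      by (intro raising_all ne below_alpha0)
    have "shift i j (shift j i \<beta>) = \<beta>" "shift j i \<beta> j + 1 = \<beta> j" "alpha0 j = 0"
      "shift i j alpha0 = ?A(j := ?A j + 1)" "shift j i \<beta> = ?B(j := ?B j - 1)" "?A j = 0"
      using ne i j by (auto simp: shift_def fun_eq_iff alpha0_def)
    then show ?thesis using r unfolding raising_def by (simp add: eq_neg_iff_add_eq_0)
  qed
  moreover have "?t 0 + ?t 1 = - ?X"
  proof -
    have o: "?t x = 0" if "x < 2" "x \<noteq> i" for x
    proof -
      have "?A x + 1 = int p" using that by (auto simp: alpha0_def)
      then have "(of_int (?A x + 1) :: 'k) = 0" using of_nat_eq_0_iff'[of p] by simp
      then show ?thesis by simp
    qed
    have t: "?t i = - ?X"
    proof -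
      have "?A i + 1 = int p - 1" by simp
      then have "(of_int (?A i + 1) :: 'k) = -1" using of_nat_eq_0_iff'[of p] by simp
      then show ?thesis unfolding Ai by simp
    qed
    have "i = 0 \<or> i = 1" using i by auto
    then show ?thesis using o[of 0] o[of 1] t by auto
  qed
  moreover have "sum ?t {0,1,2,3,4} = (?t 0 + ?t 1) + (?t 2 + (?t 3 + ?t 4))" by (simp add: add.assoc)
  ultimately have "- ?X + (- of_int (\<beta> 2) * ?X + (- of_int (\<beta> 3) * ?X + - of_int (\<beta> 4) * ?X)) = 0"
    using tj[of 2] tj[of 3] tj[of 4] by (simp only: insert_iff simp_thms)
  then have "of_int (\<beta> 2 + \<beta> 3 + \<beta> 4 + 1) * ?X = 0" by (simp add: algebra_simps) (metis add.commute add.left_commute add_eq_0_iff neg_eq_iff_add_eq_0)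
  then have "(of_int (\<beta> 2 + \<beta> 3 + \<beta> 4 + 1) :: 'k) = 0" using nz by simp
  then have "(of_nat (nat (\<beta> 2 + \<beta> 3 + \<beta> 4 + 1)) :: 'k) = 0" using s[of 2] s[of 3] s[of 4] by (simp add: of_nat_nat)
  then show ?thesis by (simp only: of_nat_eq_0_iff')
qed

text \<open>By \<open>adjacent\<close> the exponents of y are filled from the left within {0, 1} and
  within {2, 3, 4}. If the first two are not both full, then \<beta>_2 + \<beta>_3 + \<beta>_4 + 1
  is a multiple of p strictly between p and 3p, hence 2p.\<close>

lemma two_weights:
  assumes nz: "ext \<psi> alpha0 \<beta> \<noteq> 0" and b: "\<forall>x. 5 \<le> x \<longrightarrow> \<beta> x = 0"
  shows "(\<beta> 0 = int p - 1 \<and> \<beta> 1 = int p - 1 \<and> \<beta> 2 = int p - 1 \<and> \<beta> 3 = 0 \<and> \<beta> 4 = 0)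
    \<or> (\<beta> 0 = int p - 2 \<and> \<beta> 1 = 0 \<and> \<beta> 2 = int p - 1 \<and> \<beta> 3 = int p - 1 \<and> \<beta> 4 = 1)"
proof -
  have s: "0 \<le> \<beta> x" "\<beta> x < int p" if "x < 5" for x
    using ext_support(1)[OF \<psi> nz that] by blast+
  have s: "0 \<le> \<beta> 0" "\<beta> 0 < int p" "0 \<le> \<beta> 1" "\<beta> 1 < int p" "0 \<le> \<beta> 2" "\<beta> 2 < int p"
    "0 \<le> \<beta> 3" "\<beta> 3 < int p" "0 \<le> \<beta> 4" "\<beta> 4 < int p"
    "\<beta> 0 + \<beta> 1 + \<beta> 2 + \<beta> 3 + \<beta> 4 = 3 * int p - 3"
    by (intro s ext_support(3)[OF \<psi> nz]; simp)+
  have a01: "\<beta> 1 > 0 \<Longrightarrow> \<beta> 0 = int p - 1" by (rule adjacent[OF nz b, of 0 1]) auto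
  have a23: "\<beta> 3 > 0 \<Longrightarrow> \<beta> 2 = int p - 1" by (rule adjacent[OF nz b, of 2 3]) auto
  have a34: "\<beta> 4 > 0 \<Longrightarrow> \<beta> 3 = int p - 1" by (rule adjacent[OF nz b, of 3 4]) auto
  show ?thesis
  proof (cases "\<beta> 0 = int p - 1 \<and> \<beta> 1 = int p - 1")
    case True
    then have "\<beta> 2 + \<beta> 3 + \<beta> 4 = int p - 1" using s by linarith
    then show ?thesis using True a23 a34 s p_pos by linarith
  next
    case False
    then have d: "p dvd nat (\<beta> 2 + \<beta> 3 + \<beta> 4 + 1)"
      using weight_condition[OF nz b, of 0] weight_condition[OF nz b, of 1] by auto
    then obtain k where k: "nat (\<beta> 2 + \<beta> 3 + \<beta> 4 + 1) = p * k" by (elim dvdE)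
    then have "int (nat (\<beta> 2 + \<beta> 3 + \<beta> 4 + 1)) = int p * int k" by simp
    then have k': "\<beta> 2 + \<beta> 3 + \<beta> 4 + 1 = int p * int k" using s by linarith
    have "\<beta> 2 + \<beta> 3 + \<beta> 4 + 1 > int p * 1" "\<beta> 2 + \<beta> 3 + \<beta> 4 + 1 < int p * 3"
      using s False by linarith+
    then have "int p * 1 < int p * int k" "int p * int k < int p * 3" unfolding k' .
    moreover have "0 < int p" using p_pos by simp
    ultimately have "1 < int k" "int k < 3" by (simp_all only: mult_less_cancel_left_pos)
    then have "k = 2" by linarith
    then have sum: "\<beta> 2 + \<beta> 3 + \<beta> 4 = 2 * int p - 1" using k' by simp
    then have "\<beta> 1 = 0" "\<beta> 0 = int p - 2" using a01 s by linarith+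
    moreover have "\<beta> 3 > 0"
    proof (rule ccontr)
      assume "\<not> \<beta> 3 > 0"
      then have "\<beta> 3 = 0" "\<not> \<beta> 4 > 0" using s a34 p_pos by linarith+
      then show False using sum s p_pos by linarith
    qed
    ultimately show ?thesis using a23 a34 sum s by linarith
  qed
qed

end

end

lemma DU_Cons_zero:
  "DU n \<psi> ((0, b) # l) = (\<Sum>c\<le>min n b. DU (n - c) (\<lambda>l'. \<psi> ((c, b - c) # l')) l)"
  by simp

text \<open>The coefficients of (1 - z)(1 + z + ... + z^(p-1)) = 1 - z^p.\<close>

lemma sum_two_deltas:
  fixes x :: "'a :: ab_group_add"
  assumes "n \<le> p" "2 \<le> p"
  shows "(\<Sum>c\<le>min n (p - 1). (if c = n then x else 0) - (if Suc c = n then x else 0))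
    = (if n = 0 then x else if n = p then - x else 0)"
proof (cases n)
  case (Suc m)
  have "(\<Sum>c\<le>min n (p - 1). if Suc c = n then x else 0) = (\<Sum>c\<le>min n (p - 1). if c = m then x else 0)"
    using Suc by (intro sum.cong) auto
  then have "(\<Sum>c\<le>min n (p - 1). (if c = n then x else 0) - (if Suc c = n then x else 0))
    = (if n \<le> min n (p - 1) then x else 0) - (if m \<le> min n (p - 1) then x else 0)"
    by (simp only: sum_subtractf sum.delta finite_atMost atMost_iff if_True)
  then show ?thesis using Suc assms by auto
qed simp

context char_p
begin

text \<open>The y-exponents of the second candidate in \<open>two_weights\<close>, which has to be
  excluded.\<close>

definition bstar :: "nat \<Rightarrow> int" where
  "bstar x = (if x = 0 then int p - 2 else if x = 2 \<or> x = 3 then int p - 1 else if x = 4 then 1 else 0)"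

context
  fixes \<psi> :: "exps \<Rightarrow> 'k"
  assumes \<psi>: "\<psi> \<in> EE"
    and simple: "\<And>i \<alpha> \<beta>. i < 4 \<Longrightarrow> below \<alpha> \<Longrightarrow> below \<beta> \<Longrightarrow> raising i (Suc i) (ext \<psi>) \<alpha> \<beta> = 0"
begin

lemma formula:
  assumes \<alpha>: "\<And>x. 0 \<le> \<alpha> x \<and> \<alpha> x < int p" "\<And>x. x \<ge> 5 \<Longrightarrow> \<alpha> x = 0" "\<alpha> 0 + \<alpha> 1 + \<alpha> 2 + \<alpha> 3 + \<alpha> 4 = 2 * int p - 2"
    and \<beta>: "below \<beta>" "0 \<le> \<beta> 2" "0 \<le> \<beta> 3" "0 \<le> \<beta> 4"
  shows "ext \<psi> \<alpha> \<beta> = (-1) ^ nat (\<alpha> 2 + \<alpha> 3 + \<alpha> 4) *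
     (\<Prod>j\<in>{2,3,4}. of_nat (nat (\<beta> j + \<alpha> j) choose nat (\<alpha> j))) * ext \<psi> alpha0 (\<lambda>x. \<alpha> x + \<beta> x - alpha0 x)"
  by (rule ext_formula[OF \<psi> _ \<alpha> \<beta>]) (rule raising_all[OF \<psi> simple], auto)

text \<open>All these monomials have the same weight as the one given by \<open>alpha0\<close> and
  \<open>bstar\<close>, so \<open>formula\<close> expresses them by its coefficient. The binomials
  with upper entry p - 1 are signs and cancel against the sign in the formula, except for the last
  variable.\<close>

lemma value_near_bstar:
  assumes c: "c0 \<le> 1" "c1 \<le> p - 1" "c2 \<le> p - 1" "c3 \<le> p - 1" "c4 \<le> 1" "c0 + c1 + c2 + c3 + c4 = p"
  shows "\<psi> [(p - 2 + c0, p - 1 - c0), (c1, p - 1 - c1), (c2, p - 1 - c2), (c3, p - 1 - c3), (c4, 1 - c4)]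
    = (-1) ^ c4 * ext \<psi> alpha0 bstar"
proof -
  define a where "a = [p - 2 + c0, c1, c2, c3, c4]"
  define b where "b = [p - 1 - c0, p - 1 - c1, p - 1 - c2, p - 1 - c3, 1 - c4]"
  define \<alpha> where "\<alpha> = (\<lambda>x. if x < 5 then int (a ! x) else 0)"
  define \<beta> where "\<beta> = (\<lambda>x. if x < 5 then int (b ! x) else 0)"
  have av: "\<alpha> 0 = int p - 2 + int c0" "\<alpha> 1 = int c1" "\<alpha> 2 = int c2" "\<alpha> 3 = int c3" "\<alpha> 4 = int c4"
    using p_pos by (simp_all add: \<alpha>_def a_def)
  have bv: "\<beta> 0 = int p - 1 - int c0" "\<beta> 1 = int p - 1 - int c1" "\<beta> 2 = int p - 1 - int c2"
      "\<beta> 3 = int p - 1 - int c3" "\<beta> 4 = 1 - int c4"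
    using p_pos c by (simp_all add: \<beta>_def b_def of_nat_diff)
  have five: "x = 0 \<or> x = 1 \<or> x = 2 \<or> x = 3 \<or> x = 4 \<or> x \<ge> 5" for x :: nat by linarith
  have ar: "0 \<le> \<alpha> x \<and> \<alpha> x < int p" for x
    using five[of x] av c p_pos by (elim disjE) (auto simp: \<alpha>_def)
  have br: "below \<beta>"
  proof
    fix x show "\<beta> x < int p" using five[of x] bv c p_pos by (elim disjE) (auto simp: \<beta>_def)
  qed
  have bs: "(\<lambda>x. \<alpha> x + \<beta> x - alpha0 x) = bstar"
  proof
    fix x show "\<alpha> x + \<beta> x - alpha0 x = bstar x"
      using five[of x] av bv by (elim disjE) (auto simp: alpha0_def bstar_def \<alpha>_def \<beta>_def)
  qed
  have "\<psi> [(p - 2 + c0, p - 1 - c0), (c1, p - 1 - c1), (c2, p - 1 - c2), (c3, p - 1 - c3), (c4, 1 - c4)] = ext \<psi> \<alpha> \<beta>"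
    unfolding ext_def list5 by (simp add: \<alpha>_def \<beta>_def a_def b_def nat_int_add)
  also have "\<dots> = (-1) ^ nat (\<alpha> 2 + \<alpha> 3 + \<alpha> 4) *
     (\<Prod>j\<in>{2,3,4}. of_nat (nat (\<beta> j + \<alpha> j) choose nat (\<alpha> j))) * ext \<psi> alpha0 (\<lambda>x. \<alpha> x + \<beta> x - alpha0 x)"
  proof (rule formula)
    show "\<alpha> 0 + \<alpha> 1 + \<alpha> 2 + \<alpha> 3 + \<alpha> 4 = 2 * int p - 2" unfolding av using c by simp
    show "0 \<le> \<beta> 2" "0 \<le> \<beta> 3" "0 \<le> \<beta> 4" unfolding bv using c p_pos by auto
  qed (use ar br in \<open>auto simp: \<alpha>_def\<close>)
  also have "(\<Prod>j\<in>{2,3,4}. of_nat (nat (\<beta> j + \<alpha> j) choose nat (\<alpha> j)))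
     = (of_nat ((p - 1) choose c2) * of_nat ((p - 1) choose c3) * of_nat (1 choose c4) :: 'k)"
  proof -
    have "nat (\<beta> 2 + \<alpha> 2) = p - 1" "nat (\<beta> 3 + \<alpha> 3) = p - 1" "nat (\<beta> 4 + \<alpha> 4) = 1"
      "nat (\<alpha> 2) = c2" "nat (\<alpha> 3) = c3" "nat (\<alpha> 4) = c4"
      unfolding av bv using p_pos by auto
    then show ?thesis by (simp add: mult.assoc)
  qed
  also have "(of_nat (1 choose c4) :: 'k) = 1" using c(5) by (cases c4) auto
  also have "nat (\<alpha> 2 + \<alpha> 3 + \<alpha> 4) = c2 + c3 + c4" unfolding av by simp
  finally show ?thesis
    unfolding bs of_nat_binomial_top[OF c(3)] of_nat_binomial_top[OF c(4)]
    by (simp add: power_add mult_ac)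
qed

text \<open>The p-th divided power is evaluated at the monomial with exponents (p-2, p-1), (0, p-1),
  (0, p-1), (0, p-1), (0, 1). By \<open>value_near_bstar\<close> the inner sums are multiples of the
  unknown value by coefficients of (1 - z^p)^3/(1 - z)^2: at z^p this is p - 2, at z^(p-1) it is p.
  Only -2 times the value remains, and 2 is invertible.\<close>

lemma ext_bstar_zero:
  assumes "p \<noteq> 2" shows "ext \<psi> alpha0 bstar = 0"
proof -
  have p3: "p \<ge> 3" using assms p_pos by simp
  let ?x = "ext \<psi> alpha0 bstar"
  let ?A = "\<lambda>c. (c, p - 1 - c)"
  let ?Z = "\<lambda>c. (p - 2 + c, p - 1 - c)"
  \<comment> \<open>From \<open>g4\<close> to \<open>g1\<close> one pair is added at a time; the
    generating functions are 1 - z, 1 - z^p, (1 - z^p)^2/(1 - z) and (1 - z^p)^3/(1 - z)^2.\<close>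
  have g4: "DU n (\<lambda>l. \<psi> (?Z c0 # ?A c1 # ?A c2 # ?A c3 # l)) [(0, 1)] = (if n = 0 then ?x else if n = 1 then - ?x else 0)"
    if "c0 \<le> 1" "c1 \<le> p - 1" "c2 \<le> p - 1" "c3 \<le> p - 1" "c0 + c1 + c2 + c3 + n = p" for n c0 c1 c2 c3
  proof -
    consider "n = 0" | "n = 1" | "n \<ge> 2" by linarith
    then show ?thesis
    proof cases
      case 1
      then show ?thesis using value_near_bstar[of c0 c1 c2 c3 0] that by simp
    next
      case 2
      then show ?thesis using value_near_bstar[of c0 c1 c2 c3 1] that by (simp add: atMost_Suc)
    next
      case 3
      then have "min n 1 = 1" by simp
      then show ?thesis using 3 by (simp add: atMost_Suc)
    qed
  qed
  have g3: "DU n (\<lambda>l. \<psi> (?Z c0 # ?A c1 # ?A c2 # l)) [(0, p - 1), (0, 1)] = (if n = 0 then ?x else if n = p then - ?x else 0)"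
    if c: "c0 \<le> 1" "c1 \<le> p - 1" "c2 \<le> p - 1" "c0 + c1 + c2 + n = p" for n c0 c1 c2
  proof -
    have "DU n (\<lambda>l. \<psi> (?Z c0 # ?A c1 # ?A c2 # l)) [(0, p - 1), (0, 1)]
      = (\<Sum>c\<le>min n (p - 1). DU (n - c) (\<lambda>l. \<psi> (?Z c0 # ?A c1 # ?A c2 # ?A c # l)) [(0, 1)])"
      by (rule DU_Cons_zero)
    also have "\<dots> = (\<Sum>c\<le>min n (p - 1). (if c = n then ?x else 0) - (if Suc c = n then ?x else 0))"
      by (rule sum.cong[OF refl], subst g4) (use c p3 in auto)
    also have "\<dots> = (if n = 0 then ?x else if n = p then - ?x else 0)"
      by (rule sum_two_deltas) (use c p3 in auto)
    finally show ?thesis .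
  qed
  have g2: "DU n (\<lambda>l. \<psi> (?Z c0 # ?A c1 # l)) [(0, p - 1), (0, p - 1), (0, 1)] = (if n = p then - ?x else ?x)"
    if c: "c0 \<le> 1" "c1 \<le> p - 1" "c0 + c1 + n = p" for n c0 c1
  proof -
    have "DU n (\<lambda>l. \<psi> (?Z c0 # ?A c1 # l)) [(0, p - 1), (0, p - 1), (0, 1)]
      = (\<Sum>c\<le>min n (p - 1). DU (n - c) (\<lambda>l. \<psi> (?Z c0 # ?A c1 # ?A c # l)) [(0, p - 1), (0, 1)])"
      by (rule DU_Cons_zero)
    also have "\<dots> = (\<Sum>c\<le>min n (p - 1). (if c = n then ?x else 0) - (if c = 0 then (if n = p then ?x else 0) else 0))"
      by (rule sum.cong[OF refl], subst g3) (use c p3 in auto)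
    also have "\<dots> = (if n \<le> min n (p - 1) then ?x else 0) - (if n = p then ?x else 0)"
      by (simp only: sum_subtractf sum.delta finite_atMost atMost_iff if_True zero_le)
    also have "\<dots> = (if n = p then - ?x else ?x)"
    proof -
      have "n \<le> p - 1 \<longleftrightarrow> n \<noteq> p" "n \<le> p" using c p3 by auto
      then show ?thesis by auto
    qed
    finally show ?thesis .
  qed
  have g1: "DU n (\<lambda>l. \<psi> (?Z c0 # l)) [(0, p - 1), (0, p - 1), (0, p - 1), (0, 1)] = (if c0 = 0 then - 2 * ?x else 0)"
    if c: "c0 \<le> 1" "c0 + n = p" for n c0
  proof -
    have n: "min n (p - 1) = p - 1" using c by auto
    have "DU n (\<lambda>l. \<psi> (?Z c0 # l)) [(0, p - 1), (0, p - 1), (0, p - 1), (0, 1)]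
      = (\<Sum>c\<le>p - 1. DU (n - c) (\<lambda>l. \<psi> (?Z c0 # ?A c # l)) [(0, p - 1), (0, p - 1), (0, 1)])"
      unfolding DU_Cons_zero[of n "\<lambda>l. \<psi> (?Z c0 # l)" "p - 1" "[(0, p - 1), (0, p - 1), (0, 1)]"] n by (rule refl)
    also have "\<dots> = (\<Sum>c\<le>p - 1. ?x - (if c = 0 then (if c0 = 0 then 2 * ?x else 0) else 0))"
      by (rule sum.cong[OF refl], subst g2) (use c p3 in auto)
    also have "\<dots> = of_nat p * ?x - (if c0 = 0 then 2 * ?x else 0)"
      using p3 by (simp add: sum_subtractf sum.delta)
    also have "\<dots> = (if c0 = 0 then - 2 * ?x else 0)"
      using of_nat_eq_0_iff'[of p] by simp
    finally show ?thesis .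
  qed
  have t: "trunc [(p - 2, p - 1), (0, p - 1), (0, p - 1), (0, p - 1), (0, 1)]" using p3 by auto
  have "0 = DU p \<psi> [(p - 2, p - 1), (0, p - 1), (0, p - 1), (0, p - 1), (0, 1)]"
    using Inv_DU[OF \<psi> _ t, of p] p_pos by simp
  also have "\<dots> = (\<Sum>c\<le>p - 1. of_nat ((p - 2 + c) choose c) *
      DU (p - c) (\<lambda>l. \<psi> (?Z c # l)) [(0, p - 1), (0, p - 1), (0, p - 1), (0, 1)])"
  proof -
    have "min p (p - 1) = p - 1" by simp
    then show ?thesis unfolding DU.simps(2)[of p \<psi> "(p - 2, p - 1)"] fst_conv snd_conv by (simp only:)
  qed
  also have "\<dots> = (\<Sum>c\<le>p - 1. if c = 0 then - 2 * ?x else 0)"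
  proof (rule sum.cong[OF refl])
    fix c assume c: "c \<in> {..p - 1}"
    show "of_nat ((p - 2 + c) choose c) * DU (p - c) (\<lambda>l. \<psi> (?Z c # l)) [(0, p - 1), (0, p - 1), (0, p - 1), (0, 1)]
       = (if c = 0 then - 2 * ?x else 0)"
    proof (cases "c \<le> 1")
      case True
      have g: "DU (p - c) (\<lambda>l. \<psi> (?Z c # l)) [(0, p - 1), (0, p - 1), (0, p - 1), (0, 1)] = (if c = 0 then - 2 * ?x else 0)"
        by (rule g1) (use True p3 in auto)
      show ?thesis unfolding g by simp
    next
      case False
      have "(\<lambda>l. \<psi> (?Z c # l)) = (\<lambda>_. 0)"
      proof
        fix l
        show "\<psi> (?Z c # l) = 0"
        proof (rule ccontr)
          assume "\<psi> (?Z c # l) \<noteq> 0"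
          then have "trunc (?Z c # l)" by (rule Inv_support(2)[OF \<psi>])
          then show False using False p3 by auto
        qed
      qed
      then show ?thesis using False by (simp del: DU.simps)
    qed
  qed
  also have "\<dots> = - 2 * ?x" by (simp add: sum.delta)
  finally have "(2 :: 'k) * ?x = 0" by simp
  moreover have "(2 :: 'k) \<noteq> 0"
    using of_nat_eq_0_iff'[of 2] p3 by (auto dest: dvd_imp_le)
  ultimately show ?thesis by simp
qed

end

text \<open>After the reduction to \<open>alpha0\<close> two candidates remain for the y-exponents
  \<open>?g\<close>. The second is excluded by \<open>ext_bstar_zero\<close> or, for p = 2, by the
  condition at \<open>iota1\<close>. For the first, the degrees and the truncation determine every
  single exponent.\<close>

theorem EE0_highest:
  assumes \<psi>: "\<psi> \<in> EE0"
    and simple: "\<And>i \<alpha> \<beta>. i < 4 \<Longrightarrow> below \<alpha> \<Longrightarrow> below \<beta> \<Longrightarrow> raising i (Suc i) (ext \<psi>) \<alpha> \<beta> = 0"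
    and l: "\<psi> l \<noteq> 0"
  shows "l = iota0"
proof -
  have E: "\<psi> \<in> EE" using \<psi> by (simp add: EE0_def)
  have len: "length l = 5" "trunc l" using Inv_support[OF E l] by auto
  define \<alpha> where "\<alpha> = (\<lambda>x. if x < 5 then int (fst (l ! x)) else 0)"
  define \<beta> where "\<beta> = (\<lambda>x. if x < 5 then int (snd (l ! x)) else 0)"
  have "map (\<lambda>x. (nat (\<alpha> x), nat (\<beta> x))) [0..<5] = l"
    using len by (intro nth_equalityI) (auto simp: \<alpha>_def \<beta>_def)
  then have e: "ext \<psi> \<alpha> \<beta> = \<psi> l" unfolding ext_def by (simp add: \<alpha>_def \<beta>_def)
  have nz: "ext \<psi> \<alpha> \<beta> \<noteq> 0" using e l by simp
  have s: "0 \<le> \<alpha> x" "\<alpha> x < int p" "0 \<le> \<beta> x" "\<beta> x < int p" if "x < 5" for x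
    using ext_support(1)[OF E nz that] by blast+
  note sums = ext_support(2,3)[OF E nz]
  have r: "0 \<le> \<alpha> x \<and> \<alpha> x < int p" "\<beta> x < int p" for x
    using s[of x] p_pos by (cases "x < 5"; auto simp: \<alpha>_def \<beta>_def)+
  let ?g = "\<lambda>x. \<alpha> x + \<beta> x - alpha0 x"
  have "ext \<psi> \<alpha> \<beta> = (-1) ^ nat (\<alpha> 2 + \<alpha> 3 + \<alpha> 4) *
     (\<Prod>j\<in>{2,3,4}. of_nat (nat (\<beta> j + \<alpha> j) choose nat (\<alpha> j))) * ext \<psi> alpha0 ?g"
  proof (rule formula[OF E simple])
    show "\<alpha> x = 0" if "5 \<le> x" for x using that by (simp add: \<alpha>_def)
    show "0 \<le> \<beta> 2" "0 \<le> \<beta> 3" "0 \<le> \<beta> 4" by (simp_all add: \<beta>_def)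
  qed (use r sums in blast)+
  then have gnz: "ext \<psi> alpha0 ?g \<noteq> 0" using nz by auto
  have g5: "\<forall>x. 5 \<le> x \<longrightarrow> ?g x = 0" by (auto simp: \<alpha>_def \<beta>_def alpha0_def)
  have tw: "(?g 0 = int p - 1 \<and> ?g 1 = int p - 1 \<and> ?g 2 = int p - 1 \<and> ?g 3 = 0 \<and> ?g 4 = 0)
    \<or> (?g 0 = int p - 2 \<and> ?g 1 = 0 \<and> ?g 2 = int p - 1 \<and> ?g 3 = int p - 1 \<and> ?g 4 = 1)"
    by (rule two_weights[OF E simple gnz g5])
  have n: "\<not> (?g 0 = int p - 2 \<and> ?g 1 = 0 \<and> ?g 2 = int p - 1 \<and> ?g 3 = int p - 1 \<and> ?g 4 = 1)"
  proof
    assume a: "?g 0 = int p - 2 \<and> ?g 1 = 0 \<and> ?g 2 = int p - 1 \<and> ?g 3 = int p - 1 \<and> ?g 4 = 1"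
    have "?g x = bstar x" for x
    proof -
      consider "x = 0" | "x = 1" | "x = 2" | "x = 3" | "x = 4" | "x \<ge> 5" by linarith
      then show ?thesis
      proof cases
        case 6
        then have "bstar x = 0" by (simp add: bstar_def)
        then show ?thesis using g5[rule_format, OF 6] by simp
      qed (use a in \<open>simp_all add: bstar_def\<close>)
    qed
    then have g: "?g = bstar" by (rule HOL.ext)
    have "ext \<psi> alpha0 bstar = 0"
    proof (cases "p = 2")
      case True
      have "ext \<psi> alpha0 bstar = \<psi> iota1"
        unfolding ext_def list5 all_less_5 alpha0_def bstar_def iota1_def using True by simp
      also have "\<psi> iota1 = 0" using \<psi> True unfolding EE0_def by blast
      finally show ?thesis .
    next
      case False
      show ?thesis by (rule ext_bstar_zero[OF E _ False]) (rule simple)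
    qed
    with gnz show False unfolding g by (rule notE)
  qed
  have "?g 0 = int p - 1 \<and> ?g 1 = int p - 1 \<and> ?g 2 = int p - 1 \<and> ?g 3 = 0 \<and> ?g 4 = 0"
    by (rule disjE[OF tw], assumption, rule notE[OF n], assumption)
  then have g: "?g 0 = int p - 1" "?g 1 = int p - 1" "?g 2 = int p - 1" "?g 3 = 0" "?g 4 = 0" by simp_all
  have "\<alpha> 0 = int p - 1" "\<beta> 0 = int p - 1" "\<alpha> 1 = int p - 1" "\<beta> 1 = int p - 1"
    using g(1,2) s[of 0] s[of 1] by (auto simp: alpha0_def)
  moreover from this have "\<alpha> 2 = 0" "\<beta> 2 = int p - 1" "\<alpha> 3 = 0" "\<beta> 3 = 0" "\<alpha> 4 = 0" "\<beta> 4 = 0"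
    using g(3,4,5) s[of 2] s[of 3] s[of 4] sums by (simp_all add: alpha0_def)
  ultimately have "map (\<lambda>x. (nat (\<alpha> x), nat (\<beta> x))) [0..<5] = iota0"
    unfolding list5 iota0_def using p_pos by (auto simp: nat_diff_distrib)
  then show ?thesis using \<open>map _ _ = l\<close> by simp
qed

end

section \<open>Interpolation, and the radical in characteristic two\<close>

text \<open>J is a smallest set of coordinates that separates S. By minimality each i in J has an
  element of S that vanishes on the rest of J but not at i; normalized, these elements form the dual
  basis.\<close>

lemma interpolation_set:
  fixes S :: "('a \<Rightarrow> 'k :: {field, finite}) set"
  assumes I: "finite I" and supp: "\<And>f x. f \<in> S \<Longrightarrow> f x \<noteq> 0 \<Longrightarrow> x \<in> I"
    and zero: "(\<lambda>_. 0) \<in> S"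
    and add: "\<And>f g. f \<in> S \<Longrightarrow> g \<in> S \<Longrightarrow> (\<lambda>x. f x + g x) \<in> S"
    and scale: "\<And>f c. f \<in> S \<Longrightarrow> (\<lambda>x. c * f x) \<in> S"
  obtains J b where "J \<subseteq> I" "card S = CARD('k) ^ card J" "\<And>i. i \<in> J \<Longrightarrow> b i \<in> S"
    "\<And>i j. i \<in> J \<Longrightarrow> j \<in> J \<Longrightarrow> b i j = (if i = j then 1 else 0)"
    "\<And>f x. f \<in> S \<Longrightarrow> f x = (\<Sum>i\<in>J. f i * b i x)"
proof -
  define P where "P J \<longleftrightarrow> J \<subseteq> I \<and> (\<forall>f\<in>S. (\<forall>i\<in>J. f i = 0) \<longrightarrow> (\<forall>x. f x = 0))" for J
  have "P I" unfolding P_def using supp by blast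
  then obtain J where J: "P J" and min: "\<And>J'. P J' \<Longrightarrow> card J \<le> card J'"
    using ex_has_least_nat[of P I card] by blast
  have fin: "finite J" using J I finite_subset unfolding P_def by blast
  have Jz: "f x = 0" if "f \<in> S" "\<And>j. j \<in> J \<Longrightarrow> f j = 0" for f x
  proof -
    have "\<forall>f\<in>S. (\<forall>i\<in>J. f i = 0) \<longrightarrow> (\<forall>x. f x = 0)" using J unfolding P_def by (rule conjunct2)
    from bspec[OF this that(1)] that(2) show ?thesis by simp
  qed
  have "\<exists>f\<in>S. (\<forall>j\<in>J. f j = (if i = j then 1 else 0))" if i: "i \<in> J" for i
  proof -
    have "card (J - {i}) < card J" by (rule card_Diff1_less[OF fin i])
    then have nP: "\<not> P (J - {i})" using min[of "J - {i}"] by linarith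
    have "J - {i} \<subseteq> I" using J unfolding P_def by blast
    then obtain f x where f: "f \<in> S" "\<forall>j\<in>J - {i}. f j = 0" "f x \<noteq> 0" using nP unfolding P_def by blast
    have fi: "f i \<noteq> 0"
    proof
      assume "f i = 0"
      then have "\<forall>j\<in>J. f j = 0" using f(2) by blast
      then have "f x = 0" using J f(1) unfolding P_def by blast
      then show False using f(3) by simp
    qed
    have "(\<lambda>x. inverse (f i) * f x) \<in> S" using f by (intro scale)
    then show ?thesis by (rule bexI[rotated]) (use f fi in auto)
  qed
  then obtain b where b: "\<And>i. i \<in> J \<Longrightarrow> b i \<in> S"
    "\<And>i j. i \<in> J \<Longrightarrow> j \<in> J \<Longrightarrow> b i j = (if i = j then 1 else 0)" by metis
  have sum_in: "(\<lambda>x. \<Sum>i\<in>A. c i * b i x) \<in> S" if "A \<subseteq> J" for A c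
    using finite_subset[OF that fin] that
  proof (induction A rule: finite_induct)
    case (insert i A)
    have "(\<lambda>x. c i * b i x + (\<Sum>i\<in>A. c i * b i x)) \<in> S"
      using insert by (intro add scale b) auto
    then show ?case using insert.hyps by simp
  qed (use zero in simp)
  have eq: "f x = (\<Sum>i\<in>J. f i * b i x)" if f: "f \<in> S" for f x
  proof -
    let ?g = "\<lambda>x. f x + (-1) * (\<Sum>i\<in>J. f i * b i x)"
    have g: "?g \<in> S" by (rule add[OF f scale[OF sum_in[OF subset_refl]]])
    have "(\<Sum>i\<in>J. f i * b i j) = f j" if "j \<in> J" for j
    proof -
      have "(\<Sum>i\<in>J. f i * b i j) = (\<Sum>i\<in>J. if i = j then f i else 0)"
        by (rule sum.cong[OF refl]) (simp add: b(2) that)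
      also have "\<dots> = f j" using that fin by simp
      finally show ?thesis .
    qed
    then have "?g j = 0" if "j \<in> J" for j by (simp only: that) simp
    then have "?g x = 0" by (rule Jz[OF g])
    then show ?thesis by simp
  qed
  have "bij_betw (\<lambda>f. restrict f J) S (J \<rightarrow>\<^sub>E UNIV)"
  proof (rule bij_betwI[where g = "\<lambda>c x. \<Sum>i\<in>J. c i * b i x"])
    show "(\<lambda>f. restrict f J) \<in> S \<rightarrow> (J \<rightarrow>\<^sub>E UNIV)" by auto
    show "(\<lambda>c x. \<Sum>i\<in>J. c i * b i x) \<in> (J \<rightarrow>\<^sub>E UNIV) \<rightarrow> S" by (intro funcsetI sum_in subset_refl)
    fix f assume f: "f \<in> S"
    have "(\<Sum>i\<in>J. restrict f J i * b i x) = f x" for x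
      unfolding eq[OF f, of x] by (rule sum.cong) auto
    then show "(\<lambda>x. \<Sum>i\<in>J. restrict f J i * b i x) = f" by blast
  next
    fix c assume c: "c \<in> J \<rightarrow>\<^sub>E (UNIV :: 'k set)"
    show "restrict (\<lambda>x. \<Sum>i\<in>J. c i * b i x) J = c"
    proof
      fix j
      show "restrict (\<lambda>x. \<Sum>i\<in>J. c i * b i x) J j = c j"
      proof (cases "j \<in> J")
        case True
        have "(\<Sum>i\<in>J. c i * b i j) = (\<Sum>i\<in>J. if i = j then c i else 0)"
          by (rule sum.cong[OF refl]) (simp add: b(2) True)
        then show ?thesis using True fin by simp
      next
        case False
        then show ?thesis using c by (auto simp: PiE_def extensional_def)
      qed
    qed
  qed
  then have "card S = CARD('k) ^ card J"
    using bij_betw_same_card[of _ S "J \<rightarrow>\<^sub>E (UNIV :: 'k set)"] card_PiE[OF fin, of "\<lambda>_. UNIV :: 'k set"] by simp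
  moreover have "J \<subseteq> I" using J unfolding P_def by blast
  ultimately show thesis using that[of J b, OF _ _ b eq] by simp
qed

section \<open>The radical in characteristic two\<close>

definition TT :: "nat \<Rightarrow> int \<Rightarrow> exps set" where
  "TT m A = {l. length l = m \<and> (\<forall>x\<in>set l. fst x + snd x = 1) \<and> deg1 l = A}"

lemma TT_Cons: "(a, b) # l \<in> TT m A \<longleftrightarrow> a + b = 1 \<and> m > 0 \<and> l \<in> TT (m - 1) (A - int a)"
  by (auto simp: TT_def)

lemma TT_0: "TT 0 A = (if A = 0 then {[]} else {})"
  by (auto simp: TT_def)

lemma TT_Suc: "TT (Suc m) A = (#) (0, 1) ` TT m A \<union> (#) (1, 0) ` TT m (A - 1)"
proof (rule equalityI; rule subsetI)
  fix l assume l: "l \<in> TT (Suc m) A"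
  then obtain a b l' where l': "l = (a, b) # l'" by (cases l) (auto simp: TT_def)
  then have "a + b = 1" "l' \<in> TT m (A - int a)" using l by (auto simp: TT_Cons)
  moreover from this(1) have "(a, b) = (0, 1) \<or> (a, b) = (1, 0)" by auto
  ultimately show "l \<in> (#) (0, 1) ` TT m A \<union> (#) (1, 0) ` TT m (A - 1)" using l' by auto
qed (auto simp: TT_Cons)

lemma finite_TT: "finite (TT m A)"
  by (induction m arbitrary: A) (auto simp: TT_0 TT_Suc)

text \<open>A monomial is reached from as many members of \<open>TT\<close> as there are ways to
  choose n of its y-variables that come from e-variables.\<close>

lemma DU_indicator:
  "DU n (\<lambda>l. if l \<in> TT m A then 1 else 0) l =
    (if l \<in> TT m (A - int n) then of_nat (nat (deg2 l) choose n) else 0)"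
proof (induction l arbitrary: n m A)
  case Nil
  then show ?case by (auto simp: TT_def binomial_eq_0)
next
  case (Cons x l)
  obtain a b where x: "x = (a, b)" by force
  have sl: "(\<lambda>l'. if (a + c, b - c) # l' \<in> TT m A then 1 else 0) =
     (\<lambda>l'. if a + c + (b - c) = 1 \<and> m > 0 then (if l' \<in> TT (m - 1) (A - int (a + c)) then 1 else 0) else 0)" for c
    by (auto simp: TT_Cons fun_eq_iff)
  have e: "DU n (\<lambda>l. if l \<in> TT m A then 1 else 0) (x # l) =
    (\<Sum>c\<le>min n b. of_nat ((a + c) choose c) * DU (n - c) (\<lambda>l'. if (a + c, b - c) # l' \<in> TT m A then 1 else 0) l)"
    by (simp add: x)
  show ?case
  proof (cases "a + b = 1 \<and> m > 0")
    case False
    have "DU (n - c) (\<lambda>l'. if (a + c, b - c) # l' \<in> TT m A then 1 else 0) l = (0 :: 'a)" if "c \<le> min n b" for c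
    proof -
      have "(\<lambda>l'. if (a + c, b - c) # l' \<in> TT m A then 1 else 0) = (\<lambda>_. 0 :: 'a)"
        using False that by (auto simp: TT_Cons fun_eq_iff)
      then show ?thesis by simp
    qed
    then show ?thesis unfolding e using False by (auto simp: x TT_Cons)
  next
    case True
    have I: "DU (n - c) (\<lambda>l'. if (a + c, b - c) # l' \<in> TT m A then 1 else 0) l =
        (if l \<in> TT (m - 1) (A - int (a + c) - int (n - c)) then of_nat (nat (deg2 l) choose (n - c)) else (0 :: 'a))"
      if "c \<le> min n b" for c
    proof -
      have "(\<lambda>l'. if (a + c, b - c) # l' \<in> TT m A then 1 else 0) =
          (\<lambda>l'. if l' \<in> TT (m - 1) (A - int (a + c)) then 1 else (0 :: 'a))"
        using True that by (simp add: TT_Cons fun_eq_iff)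
      then show ?thesis by (simp only: Cons.IH)
    qed
    have e2: "DU n (\<lambda>l. if l \<in> TT m A then 1 else 0) (x # l) =
      (\<Sum>c\<le>min n b. of_nat ((a + c) choose c) *
        (if l \<in> TT (m - 1) (A - int (a + c) - int (n - c)) then of_nat (nat (deg2 l) choose (n - c)) else (0 :: 'a)))"
      unfolding e by (rule sum.cong[OF refl]) (simp only: I atMost_iff)
    from True have "(a = 0 \<and> b = 1) \<or> (a = 1 \<and> b = 0)" by auto
    then consider (1) "a = 0" "b = 1" | (2) "a = 1" "b = 0" by blast
    then show ?thesis
    proof cases
      case 2
      have mm: "min n b = 0" using 2 by simp
      have eqA: "A - int n - int a = A - 1 - int n" using 2 by simp
      have mem: "x # l \<in> TT m (A - int n) \<longleftrightarrow> l \<in> TT (m - 1) (A - 1 - int n)"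
        unfolding x TT_Cons eqA using True by simp
      show ?thesis unfolding e2 mm mem using 2 by (simp add: x)
    next
      case 1
      have d: "nat (1 + deg2 l) = Suc (nat (deg2 l))" using deg_nonneg(2)[of l] by linarith
      show ?thesis
      proof (cases n)
        case 0
        then have mm: "min n b = 0" by simp
        show ?thesis unfolding e2 mm using True 1 0 by (simp add: x TT_Cons)
      next
        case (Suc n')
        have mm: "min n b = Suc 0" using Suc 1 by simp
        have eqA: "A - 1 - int n' = A - int n" using Suc by simp
        have mem: "x # l \<in> TT m (A - int n) \<longleftrightarrow> l \<in> TT (m - 1) (A - int n)"
          unfolding x TT_Cons using True 1 by simp
        show ?thesis
          unfolding e2 mm mem using 1 Suc by (simp add: x d atMost_Suc eqA[unfolded Suc])
      qed
    qed
  qed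
qed

text \<open>The product of all y-variables is reached from every member of \<open>TT m n\<close>,
  each time with coefficient 1.\<close>

lemma DU_replicate: "DU n \<psi> (replicate m (0, 1)) = (\<Sum>l\<in>TT m (int n). \<psi> l)"
proof (induction m arbitrary: n \<psi>)
  case 0
  then show ?case by (simp add: TT_0)
next
  case (Suc m)
  note IH = Suc.IH
  have "(\<Sum>l\<in>TT (Suc m) (int n). \<psi> l) = (\<Sum>l\<in>TT m (int n). \<psi> ((0, 1) # l)) + (\<Sum>l\<in>TT m (int n - 1). \<psi> ((1, 0) # l))"
    unfolding TT_Suc by (subst sum.union_disjoint) (auto simp: finite_TT sum.reindex)
  also have "(\<Sum>l\<in>TT m (int n - 1). \<psi> ((1, 0) # l)) = (if n = 0 then 0 else DU (n - 1) (\<lambda>l. \<psi> ((1, 0) # l)) (replicate m (0, 1)))"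
  proof (cases n)
    case 0
    have "deg1 l \<noteq> -1" for l using deg_nonneg(1)[of l] by linarith
    then have "TT m (-1) = {}" by (simp add: TT_def)
    then show ?thesis using 0 by simp
  next
    case (Suc n')
    then have "int n - 1 = int (n - 1)" by simp
    then show ?thesis using Suc by (simp only: IH) simp
  qed
  also have "(\<Sum>l\<in>TT m (int n). \<psi> ((0, 1) # l)) = DU n (\<lambda>l. \<psi> ((0, 1) # l)) (replicate m (0, 1))"
    by (simp only: IH)
  finally show ?case by (cases n) (simp_all add: atMost_Suc)
qed

context char_p
begin

lemma Inv_zero: "(\<lambda>_. 0) \<in> Inv m A B" by (simp add: Inv_def Tr_def)

lemma Inv_scale: "\<psi> \<in> Inv m A B \<Longrightarrow> (\<lambda>l. c * \<psi> l) \<in> Inv m A B"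
  unfolding Inv_def Tr_def by (auto simp: DU_scale)

lemma Inv_add:
  assumes "\<psi> \<in> Inv m A B" "\<phi> \<in> Inv m A B"
  shows "(\<lambda>l. \<psi> l + \<phi> l) \<in> Inv m A B"
proof -
  have "\<psi> - (\<lambda>l. (-1) * \<phi> l) \<in> Inv m A B" by (intro Inv_diff Inv_scale assms)
  then show ?thesis by (simp add: fun_diff_def)
qed

definition theta :: "exps \<Rightarrow> 'k" where
  "theta l = (if p = 2 \<and> l \<in> TT 5 2 then 1 else 0)"

text \<open>By \<open>DU_indicator\<close> the divided powers to be checked have the factors 4
  choose 1 and 5 choose 2, both of which are even.\<close>

lemma theta_EE: "theta \<in> EE"
proof (cases "p = 2")
  case False
  then have "theta = (\<lambda>_. 0)" by (simp add: theta_def fun_eq_iff)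
  then show ?thesis by (simp add: Inv_zero)
next
  case True
  have th: "theta = (\<lambda>l. if l \<in> TT 5 2 then 1 else 0)" by (rule HOL.ext, unfold theta_def) (simp add: True)
  have d: "deg1 l + deg2 l = int (length l)" if "\<forall>x\<in>set l. fst x + snd x = 1" for l
    using that by (induction l) auto
  have "DU n theta l = 0" if n: "n \<ge> 1" for n l
  proof (cases "l \<in> TT 5 (2 - int n)")
    case mem: True
    then have "deg1 l = 2 - int n" "deg2 l = 3 + int n" using d[of l] by (auto simp: TT_def)
    then have "n = 1 \<and> deg2 l = 4 \<or> n = 2 \<and> deg2 l = 5" using n deg_nonneg(1)[of l] by auto
    moreover have "(4 :: nat) choose 1 = 4" "(5 :: nat) choose 2 = 10" by (simp_all add: choose_two)
    ultimately have "even (nat (deg2 l) choose n)" by auto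
    then have "(of_nat (nat (deg2 l) choose n) :: 'k) = 0" unfolding of_nat_eq_0_iff' True .
    then show ?thesis unfolding th DU_indicator by simp
  next
    case False
    then show ?thesis unfolding th DU_indicator by simp
  qed
  moreover have "theta \<in> Tr 5 (2 * int p - 2) (3 * int p - 3)"
    unfolding Tr_def
  proof (intro CollectI allI impI)
    fix l assume "theta l \<noteq> 0"
    then have l: "length l = 5" "\<forall>x\<in>set l. fst x + snd x = 1" "deg1 l = 2" by (auto simp: th TT_def split: if_splits)
    moreover have "trunc l"
    proof -
      have "fst x < p \<and> snd x < p" if "x \<in> set l" for x using l(2) that p_pos(2) by fastforce
      then show ?thesis by (simp add: trunc_def)
    qed
    ultimately show "length l = 5 \<and> trunc l \<and> deg1 l = 2 * int p - 2 \<and> deg2 l = 3 * int p - 3"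
      using d[OF l(2)] True by auto
  qed
  ultimately show ?thesis by (simp add: Inv_def)
qed

lemma theta_iota1: "p = 2 \<Longrightarrow> theta iota1 = 1"
  by (unfold theta_def) (simp add: TT_def iota1_def)

text \<open>The sum is the second divided power of \<psi> at the product of all y-variables. It
  expresses that \<open>theta\<close> is orthogonal to all invariants.\<close>

lemma sum_TT_EE: assumes "p = 2" "\<psi> \<in> EE" shows "(\<Sum>l\<in>TT 5 2. \<psi> l) = 0"
proof -
  have "trunc (replicate 5 (0, 1))" using p_pos by (simp add: trunc_def)
  then have "DU 2 \<psi> (replicate 5 (0, 1)) = 0" by (intro Inv_DU[OF assms(2)]) simp
  then show ?thesis unfolding DU_replicate by simp
qed

lemma EE0_eq: "p \<noteq> 2 \<Longrightarrow> EE0 = EE" by (simp add: EE0_def)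

lemma EE0_add: "\<psi> \<in> EE0 \<Longrightarrow> \<phi> \<in> EE0 \<Longrightarrow> (\<lambda>l. \<psi> l + \<phi> l) \<in> EE0"
  by (simp add: EE0_def Inv_add)

lemma EE0_scale: "\<psi> \<in> EE0 \<Longrightarrow> (\<lambda>l. c * \<psi> l) \<in> EE0"
  by (simp add: EE0_def Inv_scale)

lemma EE0_zero: "(\<lambda>_. 0) \<in> EE0" by (simp add: EE0_def Inv_zero)

lemma EE_project: assumes "\<psi> \<in> EE" shows "(\<lambda>l. \<psi> l - \<psi> iota1 * theta l) \<in> EE0"
proof -
  have "\<psi> - (\<lambda>l. \<psi> iota1 * theta l) \<in> EE" by (intro Inv_diff Inv_scale theta_EE assms)
  moreover have "p = 2 \<longrightarrow> \<psi> iota1 - \<psi> iota1 * theta iota1 = 0"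
    by (intro impI, drule theta_iota1) (simp only: mult_1_right diff_self)
  ultimately show ?thesis by (simp only: EE0_def fun_diff_def mem_Collect_eq conj_assoc simp_thms)
qed

definition N1 :: nat where "N1 = (if p = 2 then 74 else N0)"

lemma N0_2: assumes "p = 2" shows "N0 = 75"
proof -
  have "real N0 = 75" unfolding N0_eq real_choose_3 using assms by (simp add: power2_eq_square)
  then show ?thesis by linarith
qed

lemma card_EE: "card EE = CARD('k) ^ N0"
  unfolding N0_def using card_Inv[of "2 * int p - 2" "3 * int p - 3" 5] p_pos by simp

text \<open>For p = 2 the invariants split into \<open>EE0\<close> and the multiples of
  \<open>theta\<close>, because \<open>theta iota1 = 1\<close>; this accounts for 74 in place of
  75.\<close>

lemma card_EE0: "card EE0 = CARD('k) ^ N1"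
proof (cases "p = 2")
  case False
  then show ?thesis by (simp add: EE0_eq card_EE N1_def)
next
  case True
  have "bij_betw (\<lambda>(\<psi>, c) l. \<psi> l + c * theta l) (EE0 \<times> UNIV) EE"
  proof (rule bij_betwI[where g = "\<lambda>\<psi>. ((\<lambda>l. \<psi> l - \<psi> iota1 * theta l), \<psi> iota1)"])
    show "(\<lambda>(\<psi>, c) l. \<psi> l + c * theta l) \<in> EE0 \<times> UNIV \<rightarrow> EE"
      using Inv_add[OF _ Inv_scale[OF theta_EE]] by (auto simp: EE0_def)
    show "(\<lambda>\<psi>. ((\<lambda>l. \<psi> l - \<psi> iota1 * theta l), \<psi> iota1)) \<in> EE \<rightarrow> EE0 \<times> UNIV"
      using EE_project by auto
  next
    fix x :: "(exps \<Rightarrow> 'k) \<times> 'k" assume "x \<in> EE0 \<times> UNIV"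
    then have "fst x iota1 = 0" using True unfolding EE0_def by auto
    then show "(\<lambda>\<psi>. (\<lambda>l. \<psi> l - \<psi> iota1 * theta l, \<psi> iota1)) ((\<lambda>(\<psi>, c) l. \<psi> l + c * theta l) x) = x"
      by (cases x) (simp only: prod.case fst_conv theta_iota1[OF True] add_0 mult_1_right add_diff_cancel_right')
  next
    fix y show "(\<lambda>(\<psi>, c) l. \<psi> l + c * theta l) ((\<lambda>\<psi>. (\<lambda>l. \<psi> l - \<psi> iota1 * theta l, \<psi> iota1)) y) = y"
      by simp
  qed
  from bij_betw_same_card[OF this] have "card EE0 * CARD('k) = CARD('k) ^ 75"
    by (simp add: card_cartesian_product card_EE N0_2[OF True])
  also have "\<dots> = CARD('k) ^ 74 * CARD('k)" by (simp flip: power_Suc2)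
  finally have "card EE0 = CARD('k) ^ 74" by simp
  moreover have "N1 = 74" unfolding N1_def using True by simp
  ultimately show ?thesis by metis
qed

lemma EE0_interpolation:
  obtains J b where "card J = N1" "finite J" "\<And>i. i \<in> J \<Longrightarrow> length i = 5" "\<And>i. i \<in> J \<Longrightarrow> b i \<in> EE0"
    "\<And>i j. i \<in> J \<Longrightarrow> j \<in> J \<Longrightarrow> b i j = (if i = j then 1 else 0)"
    "\<And>f x. f \<in> EE0 \<Longrightarrow> f x = (\<Sum>i\<in>J. f i * b i x)"
proof -
  let ?I = "LL 5 (2 * int p - 2) (3 * int p - 3)"
  have fin: "finite ?I" using card_LL by blast
  have supp: "x \<in> ?I" if "f \<in> EE0" "f x \<noteq> 0" for f x
  proof -
    have "f \<in> EE" using that(1) by (simp add: EE0_def)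
    from Inv_support[OF this that(2)] show ?thesis by (simp add: LL_def)
  qed
  show thesis
  proof (rule interpolation_set[OF fin supp EE0_zero EE0_add EE0_scale])
  fix J b assume J: "J \<subseteq> ?I" "card EE0 = CARD('k) ^ card J" "\<And>i. i \<in> J \<Longrightarrow> b i \<in> EE0"
    "\<And>i j. i \<in> J \<Longrightarrow> j \<in> J \<Longrightarrow> b i j = (if i = j then 1 else 0)"
    "\<And>f x. f \<in> EE0 \<Longrightarrow> f x = (\<Sum>i\<in>J. f i * b i x)"
  have "1 < CARD('k)"
  proof -
    have "card {0, 1 :: 'k} \<le> CARD('k)" by (rule card_mono) auto
    then show ?thesis by simp
  qed
  then have 1: "card J = N1" using J(2) unfolding card_EE0 by simp
  have 2: "finite J" by (rule finite_subset[OF J(1) fin])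
  have 3: "length i = 5" if "i \<in> J" for i
  proof -
    have "i \<in> ?I" using J(1) that by (rule subsetD)
    then show ?thesis by (simp add: LL_def)
  qed
  show thesis by (rule that[OF 1 2 3 J(3,4,5)])
  qed
qed

end

section \<open>Polynomials modulo powers of the variables\<close>

text \<open>The variable \<open>(i, False)\<close> is \<open>e\<^sub>i\<close> and \<open>(i, True)\<close> is \<open>y\<^sub>i\<close>.\<close>

type_synonym 'k mp = "(nat \<times> bool \<Rightarrow> nat) \<Rightarrow>\<^sub>0 'k"

abbreviation cf :: "('a \<Rightarrow>\<^sub>0 'b :: zero) \<Rightarrow> 'a \<Rightarrow> 'b" where "cf \<equiv> Poly_Mapping.lookup"
abbreviation kys :: "('a \<Rightarrow>\<^sub>0 'b :: zero) \<Rightarrow> 'a set" where "kys \<equiv> Poly_Mapping.keys"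

definition Vars :: "(nat \<times> bool) set" where "Vars = {..<5} \<times> UNIV"

lemma finite_Vars [simp]: "finite Vars" by (simp add: Vars_def)

lemma mem_Vars [simp]: "(i, b) \<in> Vars \<longleftrightarrow> i < 5" by (simp add: Vars_def)

lemma prod_Vars: "(\<Prod>x\<in>Vars. f x) = (\<Prod>i<5. f (i, False) * f (i, True))"
  for f :: "nat \<times> bool \<Rightarrow> 'a :: comm_monoid_mult"
  unfolding Vars_def by (simp add: UNIV_bool prod.cartesian_product' mult.commute)

definition Cn :: "'k \<Rightarrow> 'k :: comm_ring_1 mp" where "Cn c = Poly_Mapping.single 0 c"
definition MM :: "(nat \<times> bool \<Rightarrow> nat) \<Rightarrow> 'k :: comm_ring_1 mp" where "MM m = Poly_Mapping.single m 1"
definition dlt :: "nat \<times> bool \<Rightarrow> nat \<times> bool \<Rightarrow> nat" where "dlt x = (\<lambda>y. if y = x then 1 else 0)"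
definition XX :: "nat \<times> bool \<Rightarrow> 'k :: comm_ring_1 mp" where "XX x = MM (dlt x)"

lemma Cn_0 [simp]: "Cn 0 = 0" and Cn_1 [simp]: "Cn 1 = 1"
  and Cn_add: "Cn (a + b) = Cn a + Cn b" and Cn_mult: "Cn (a * b) = Cn a * Cn b"
  and Cn_minus: "Cn (- a) = - Cn a" and Cn_diff: "Cn (a - b) = Cn a - Cn b"
  and Cn_of_nat: "Cn (of_nat n) = of_nat n"
  by (simp_all add: Cn_def single_add mult_single single_uminus single_diff)

lemma Cn_eq_0_iff: "Cn c = 0 \<longleftrightarrow> c = 0"
  unfolding Cn_def by (metis lookup_single_eq lookup_zero single_zero)

lemma Cn_power: "Cn (a ^ n) = Cn a ^ n"
  by (induction n) (simp_all add: Cn_mult)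

lemma Cn_sum: "Cn (sum f A) = (\<Sum>x\<in>A. Cn (f x))"
  by (induction A rule: infinite_finite_induct) (simp_all add: Cn_add)

lemma MM_0 [simp]: "MM 0 = 1" by (simp add: MM_def)

lemma MM_add: "MM (m + n) = MM m * MM n" by (simp add: MM_def mult_single)

lemma MM_power: "MM m ^ n = MM (\<lambda>x. n * m x)"
  by (induction n) (simp_all add: MM_add[symmetric] plus_fun_def zero_fun_def[symmetric])

lemma XX_power: "XX x ^ n = MM (\<lambda>y. if y = x then n else 0)"
  by (simp add: XX_def MM_power dlt_def if_distrib cong: if_cong)

lemma Cn_MM: "Cn c * MM m = Poly_Mapping.single m c"
  by (simp add: Cn_def MM_def mult_single)

lemma mp_expand:
  assumes "finite A" "kys P \<subseteq> A"
  shows "P = (\<Sum>n\<in>A. Cn (cf P n) * MM n)"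
proof (rule poly_mapping_eqI)
  fix k
  have "(\<Sum>n\<in>A. cf (Poly_Mapping.single n (cf P n)) k) = (\<Sum>n\<in>A. if n = k then cf P n else 0)"
    by (rule sum.cong) (auto simp: lookup_single when_def)
  also have "\<dots> = cf P k" using assms by (auto simp: in_keys_iff)
  finally show "cf P k = cf (\<Sum>n\<in>A. Cn (cf P n) * MM n) k"
    unfolding Cn_MM lookup_sum by simp
qed

lemma mp_expand_keys: "P = (\<Sum>n\<in>kys P. Cn (cf P n) * MM n)"
  by (rule mp_expand) auto

lemma lookup_Cn_mult [simp]: "cf (Cn c * P) m = c * cf P m"
  unfolding Cn_def mult_map_scale_conv_mult[symmetric] by (simp add: map.rep_eq when_def)

lemma lookup_MM: "cf (MM n) m = (if m = n then 1 else 0)"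
  by (simp add: MM_def lookup_single when_def)

lemma lookup_MM_mult: "cf (MM m * P) (m + m') = cf P m'"
proof -
  have "MM m * P = (\<Sum>n\<in>kys P. Cn (cf P n) * MM (m + n))"
    by (subst mp_expand_keys[of P]) (simp add: sum_distrib_left MM_add mult_ac)
  then have "cf (MM m * P) (m + m') = (\<Sum>n\<in>kys P. cf P n * (if n = m' then 1 else 0))"
    by (auto simp: lookup_sum lookup_MM intro!: sum.cong)
  also have "\<dots> = (\<Sum>n\<in>kys P. if n = m' then cf P n else 0)"
    by (rule sum.cong) auto
  also have "\<dots> = cf P m'" by (auto simp: in_keys_iff)
  finally show ?thesis .
qed

lemma keys_Cn_mult: "kys (Cn c * P) \<subseteq> kys P" by (auto simp: in_keys_iff)

lemma keys_sum_subset: "kys (sum f A) \<subseteq> (\<Union>a\<in>A. kys (f a))"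
proof (induction A rule: infinite_finite_induct)
  case (insert x F)
  then show ?case using keys_add[of "f x" "sum f F"] by auto
qed simp_all

definition sbst :: "(nat \<times> bool \<Rightarrow> 'k :: comm_ring_1 mp) \<Rightarrow> 'k mp \<Rightarrow> 'k mp" where
  "sbst \<sigma> P = (\<Sum>m\<in>kys P. Cn (cf P m) * (\<Prod>x\<in>Vars. \<sigma> x ^ m x))"

lemma sbst_superset:
  assumes "finite A" "kys P \<subseteq> A"
  shows "sbst \<sigma> P = (\<Sum>m\<in>A. Cn (cf P m) * (\<Prod>x\<in>Vars. \<sigma> x ^ m x))"
  unfolding sbst_def using assms by (intro sum.mono_neutral_left) (auto simp: in_keys_iff)

lemma sbst_add: "sbst \<sigma> (P + Q) = sbst \<sigma> P + sbst \<sigma> Q"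
proof -
  let ?A = "kys P \<union> kys Q"
  have "sbst \<sigma> R = (\<Sum>m\<in>?A. Cn (cf R m) * (\<Prod>x\<in>Vars. \<sigma> x ^ m x))" if "kys R \<subseteq> ?A" for R
    using that by (intro sbst_superset) auto
  moreover have "kys (P + Q) \<subseteq> ?A" by (rule keys_add)
  ultimately show ?thesis by (simp add: lookup_add Cn_add distrib_right sum.distrib)
qed

lemma sbst_0 [simp]: "sbst \<sigma> 0 = 0" by (simp add: sbst_def)

lemma sbst_sum: "sbst \<sigma> (sum f A) = (\<Sum>x\<in>A. sbst \<sigma> (f x))"
  by (induction A rule: infinite_finite_induct) (simp_all add: sbst_add)

lemma sbst_term: "sbst \<sigma> (Cn c * MM m) = Cn c * (\<Prod>x\<in>Vars. \<sigma> x ^ m x)"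
proof -
  have "sbst \<sigma> (Poly_Mapping.single m c) = (\<Sum>m\<in>{m}. Cn c * (\<Prod>x\<in>Vars. \<sigma> x ^ m x))"
    by (subst sbst_superset[of "{m}"]) simp_all
  then show ?thesis by (simp add: Cn_MM)
qed

lemma sbst_MM: "sbst \<sigma> (MM m) = (\<Prod>x\<in>Vars. \<sigma> x ^ m x)"
  using sbst_term[of \<sigma> 1 m] by simp

lemma sbst_Cn [simp]: "sbst \<sigma> (Cn c) = Cn c"
  using sbst_term[of \<sigma> c 0] by simp

lemma sbst_1 [simp]: "sbst \<sigma> 1 = 1"
  using sbst_Cn[of \<sigma> 1] by simp

lemma sbst_XX: assumes "x \<in> Vars" shows "sbst \<sigma> (XX x) = \<sigma> x"
proof -
  have "(\<Prod>y\<in>Vars. \<sigma> y ^ dlt x y) = (\<Prod>y\<in>Vars. if y = x then \<sigma> y else 1)"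
    by (rule prod.cong) (auto simp: dlt_def)
  also have "\<dots> = \<sigma> x" using assms by simp
  finally show ?thesis by (simp add: XX_def sbst_MM)
qed

lemma sbst_mult: "sbst \<sigma> (P * Q) = sbst \<sigma> P * sbst \<sigma> Q"
proof -
  have "P * Q = (\<Sum>m\<in>kys P. \<Sum>n\<in>kys Q. Cn (cf P m * cf Q n) * MM (m + n))"
    by (subst mp_expand_keys[of P], subst mp_expand_keys[of Q])
      (simp add: sum_product MM_add Cn_mult mult_ac)
  then have "sbst \<sigma> (P * Q) = (\<Sum>m\<in>kys P. \<Sum>n\<in>kys Q. Cn (cf P m * cf Q n) * (\<Prod>x\<in>Vars. \<sigma> x ^ (m + n) x))"
    by (simp add: sbst_sum sbst_term)
  also have "\<dots> = sbst \<sigma> P * sbst \<sigma> Q"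
    unfolding sbst_def sum_product
    by (simp add: Cn_mult power_add prod.distrib mult_ac)
  finally show ?thesis .
qed

lemma sbst_power: "sbst \<sigma> (P ^ n) = sbst \<sigma> P ^ n"
  by (induction n) (simp_all add: sbst_mult)

lemma sbst_prod: "sbst \<sigma> (prod f A) = (\<Prod>x\<in>A. sbst \<sigma> (f x))"
  by (induction A rule: infinite_finite_induct) (simp_all add: sbst_mult)

lemma sbst_uminus: "sbst \<sigma> (- P) = - sbst \<sigma> P"
  using sbst_add[of \<sigma> P "- P"] by (simp add: eq_neg_iff_add_eq_0 add.commute)

lemma sbst_diff: "sbst \<sigma> (P - Q) = sbst \<sigma> P - sbst \<sigma> Q"
  using sbst_add[of \<sigma> P "- Q"] by (simp add: sbst_uminus)

lemma sbst_sbst: "sbst \<sigma> (sbst \<tau> P) = sbst (\<lambda>x. sbst \<sigma> (\<tau> x)) P"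
  unfolding sbst_def[of \<tau> P] sbst_def[of "\<lambda>x. sbst \<sigma> (\<tau> x)" P]
  by (simp add: sbst_sum sbst_mult sbst_prod sbst_power)

lemma sbst_cong: "(\<And>x. x \<in> Vars \<Longrightarrow> \<sigma> x = \<tau> x) \<Longrightarrow> sbst \<sigma> P = sbst \<tau> P"
  unfolding sbst_def by simp

definition linear_form :: "'k :: comm_ring_1 mp \<Rightarrow> bool" where
  "linear_form P \<longleftrightarrow> (\<exists>c. P = (\<Sum>x\<in>Vars. Cn (c x) * XX x))"

lemma linear_form_0: "linear_form 0"
  unfolding linear_form_def by (rule exI[of _ "\<lambda>_. 0"]) simp

lemma linear_form_add: assumes "linear_form P" "linear_form Q" shows "linear_form (P + Q)"
proof -
  from assms obtain c d where "P = (\<Sum>x\<in>Vars. Cn (c x) * XX x)" "Q = (\<Sum>x\<in>Vars. Cn (d x) * XX x)"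
    by (auto simp: linear_form_def)
  then have "P + Q = (\<Sum>x\<in>Vars. Cn (c x + d x) * XX x)" by (simp add: Cn_add distrib_right sum.distrib)
  then show ?thesis unfolding linear_form_def by (rule exI[of _ "\<lambda>x. c x + d x"])
qed

lemma linear_form_Cn_mult: assumes "linear_form P" shows "linear_form (Cn a * P)"
proof -
  from assms obtain c where "P = (\<Sum>x\<in>Vars. Cn (c x) * XX x)" by (auto simp: linear_form_def)
  then have "Cn a * P = (\<Sum>x\<in>Vars. Cn (a * c x) * XX x)" by (simp add: Cn_mult sum_distrib_left mult.assoc)
  then show ?thesis unfolding linear_form_def by (rule exI[of _ "\<lambda>x. a * c x"])
qed

lemma linear_form_XX: assumes "x \<in> Vars" shows "linear_form (XX x)"
proof -
  have "(\<Sum>y\<in>Vars. Cn (if y = x then 1 else 0) * XX y) = (\<Sum>y\<in>Vars. if y = x then XX y else 0)"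
    by (rule sum.cong) auto
  also have "\<dots> = XX x" using assms by simp
  finally have "XX x = (\<Sum>y\<in>Vars. Cn (if y = x then 1 else 0) * XX y)" by (rule sym)
  then show ?thesis unfolding linear_form_def by (rule exI[of _ "\<lambda>y. if y = x then 1 else 0"])
qed

lemma linear_form_sum: "(\<And>i. i \<in> A \<Longrightarrow> linear_form (f i)) \<Longrightarrow> linear_form (sum f A)"
proof (induction A rule: infinite_finite_induct)
  case (insert x F)
  then show ?case by (simp add: linear_form_add)
qed (simp_all add: linear_form_0)

definition bihom :: "nat \<Rightarrow> nat \<Rightarrow> 'k :: comm_ring_1 mp \<Rightarrow> bool" where
  "bihom a b P \<longleftrightarrow> (\<forall>m\<in>kys P. (\<forall>x. x \<notin> Vars \<longrightarrow> m x = 0) \<and> (\<Sum>i<5. m (i, False)) = a \<and> (\<Sum>i<5. m (i, True)) = b)"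

lemma bihom_mult: assumes "bihom a b P" "bihom a' b' Q" shows "bihom (a + a') (b + b') (P * Q)"
  unfolding bihom_def
proof
  fix m assume "m \<in> kys (P * Q)"
  then obtain m1 m2 where "m1 \<in> kys P" "m2 \<in> kys Q" "m = m1 + m2" using keys_mult[of P Q] by blast
  then show "(\<forall>x. x \<notin> Vars \<longrightarrow> m x = 0) \<and> (\<Sum>i<5. m (i, False)) = a + a' \<and> (\<Sum>i<5. m (i, True)) = b + b'"
    using assms unfolding bihom_def by (simp add: sum.distrib)
qed

lemma bihom_1: "bihom 0 0 1" by (simp add: bihom_def)

lemma bihom_power: "bihom a b P \<Longrightarrow> bihom (n * a) (n * b) (P ^ n)"
  by (induction n) (simp_all add: bihom_1 bihom_mult)

lemma bihom_prod: "(\<And>x. x \<in> A \<Longrightarrow> bihom (f x) (g x) (P x)) \<Longrightarrow> bihom (sum f A) (sum g A) (prod P A)"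
  by (induction A rule: infinite_finite_induct) (simp_all add: bihom_1 bihom_mult)

lemma bihom_add: "bihom a b P \<Longrightarrow> bihom a b Q \<Longrightarrow> bihom a b (P + Q)"
  unfolding bihom_def using keys_add[of P Q] by blast

lemma bihom_sum: "(\<And>x. x \<in> A \<Longrightarrow> bihom a b (P x)) \<Longrightarrow> bihom a b (sum P A)"
proof (induction A rule: infinite_finite_induct)
  case (insert x F)
  then show ?case by (simp add: bihom_add)
qed (simp_all add: bihom_def)

lemma bihom_Cn_mult: "bihom a b P \<Longrightarrow> bihom a b (Cn c * P)"
  unfolding bihom_def using keys_Cn_mult[of c P] by blast

lemma bihom_XX: "i < 5 \<Longrightarrow> bihom 1 0 (XX (i, False))" "i < 5 \<Longrightarrow> bihom 0 1 (XX (i, True))"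
  unfolding bihom_def XX_def MM_def dlt_def by (auto simp: if_distrib cong: if_cong)

lemma bihom_sbst:
  assumes F: "\<And>i. i < 5 \<Longrightarrow> bihom 1 0 (\<sigma> (i, False))" and T: "\<And>i. i < 5 \<Longrightarrow> bihom 0 1 (\<sigma> (i, True))"
    and P: "bihom a b P"
  shows "bihom a b (sbst \<sigma> P)"
  unfolding sbst_def
proof (rule bihom_sum, rule bihom_Cn_mult)
  fix m assume m: "m \<in> kys P"
  have "bihom (\<Sum>i<5. m (i, False) * 1 + m (i, True) * 0) (\<Sum>i<5. m (i, False) * 0 + m (i, True) * 1)
      (\<Prod>i<5. \<sigma> (i, False) ^ m (i, False) * \<sigma> (i, True) ^ m (i, True))"
    using F T by (intro bihom_prod bihom_mult bihom_power) auto
  then show "bihom a b (\<Prod>x\<in>Vars. \<sigma> x ^ m x)"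
    using P m unfolding prod_Vars bihom_def by simp
qed

section \<open>Congruence modulo p-th powers of the variables\<close>

context char_p
begin

definition Tm :: "(nat \<times> bool \<Rightarrow> nat) \<Rightarrow> bool" where "Tm m \<longleftrightarrow> (\<forall>x\<in>Vars. m x < p)"

lemma Tm_add: "Tm (m + n) \<Longrightarrow> Tm m" "Tm (m + n) \<Longrightarrow> Tm n"
  by (fastforce simp: Tm_def)+

text \<open>Congruence modulo the ideal generated by the p-th powers of the variables in
  \<open>Vars\<close>: its members are the polynomials without truncated monomials.\<close>

definition eqv :: "'k mp \<Rightarrow> 'k mp \<Rightarrow> bool" (infix \<open>\<approx>\<close> 50) where
  "P \<approx> Q \<longleftrightarrow> (\<forall>m. Tm m \<longrightarrow> cf P m = cf Q m)"

lemma eqv_refl [simp]: "P \<approx> P" by (simp add: eqv_def)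

lemma eqv_sym: "P \<approx> Q \<Longrightarrow> Q \<approx> P" by (simp add: eqv_def)

lemma eqv_trans [trans]: "P \<approx> Q \<Longrightarrow> Q \<approx> R \<Longrightarrow> P \<approx> R" by (simp add: eqv_def)

lemma eq_eqv_trans [trans]: "P = Q \<Longrightarrow> Q \<approx> R \<Longrightarrow> P \<approx> R" by simp

lemma eqv_eq_trans [trans]: "P \<approx> Q \<Longrightarrow> Q = R \<Longrightarrow> P \<approx> R" by simp

lemma eqv_add: "P \<approx> P' \<Longrightarrow> Q \<approx> Q' \<Longrightarrow> P + Q \<approx> P' + Q'" by (simp add: eqv_def lookup_add)

lemma eqv_iff: "P \<approx> Q \<longleftrightarrow> P - Q \<approx> 0" by (simp add: eqv_def lookup_minus)

lemma eqv_0_iff: "P \<approx> 0 \<longleftrightarrow> (\<forall>m\<in>kys P. \<not> Tm m)" by (auto simp: eqv_def in_keys_iff)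

lemma eqv_sum: "(\<And>x. x \<in> A \<Longrightarrow> f x \<approx> g x) \<Longrightarrow> sum f A \<approx> sum g A"
  by (simp add: eqv_def lookup_sum)

lemma eqv_0_mult: assumes "P \<approx> 0" shows "P * Q \<approx> 0"
  unfolding eqv_0_iff
proof
  fix m assume "m \<in> kys (P * Q)"
  then obtain a b where "a \<in> kys P" "m = a + b" using keys_mult[of P Q] by blast
  then show "\<not> Tm m" using assms Tm_add(1)[of a b] unfolding eqv_0_iff by blast
qed

lemma eqv_0_mult': assumes "P \<approx> 0" shows "Q * P \<approx> 0"
  by (subst mult.commute) (rule eqv_0_mult[OF assms])

lemma eqv_mult_right: assumes "P \<approx> P'" shows "P * Q \<approx> P' * Q"
  using eqv_0_mult[of "P - P'" Q] assms eqv_iff by (simp add: left_diff_distrib flip: eqv_iff)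

lemma eqv_mult_left: assumes "P \<approx> P'" shows "Q * P \<approx> Q * P'"
  using eqv_mult_right[OF assms, of Q] by (simp add: mult.commute)

lemma eqv_mult: assumes "P \<approx> P'" "Q \<approx> Q'" shows "P * Q \<approx> P' * Q'"
  using eqv_trans[OF eqv_mult_right[OF assms(1)] eqv_mult_left[OF assms(2)]] .

lemma CHAR_mp: "CHAR('k mp) = p"
proof (rule CHAR_eqI)
  have *: "(of_nat n :: 'k mp) = 0 \<longleftrightarrow> p dvd n" for n
  proof -
    have "(of_nat n :: 'k mp) = Cn (of_nat n)" by (simp add: Cn_of_nat)
    then show ?thesis by (simp only: Cn_eq_0_iff of_nat_eq_0_iff')
  qed
  show "of_nat p = (0 :: 'k mp)" by (simp add: *)
  show "p dvd x" if "of_nat x = (0 :: 'k mp)" for x using that by (simp add: *)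
qed

text \<open>The p-th power is additive in characteristic p, so it produces a combination of p-th
  powers of variables.\<close>

lemma linear_form_power: assumes "linear_form P" shows "P ^ p \<approx> 0"
proof -
  from assms obtain c where c: "P = (\<Sum>x\<in>Vars. Cn (c x) * XX x)" by (auto simp: linear_form_def)
  have "P ^ p = (\<Sum>x\<in>Vars. (Cn (c x) * XX x) ^ p)"
    unfolding c by (rule freshmans_dream_sum) (simp_all add: CHAR_mp prime_p)
  also have "\<dots> = (\<Sum>x\<in>Vars. Cn (c x ^ p) * XX x ^ p)"
    by (simp add: power_mult_distrib Cn_power)
  also have "\<dots> \<approx> (\<Sum>x\<in>Vars. 0)"
  proof (rule eqv_sum)
    fix x assume "x \<in> Vars"
    then have "\<not> Tm (\<lambda>y. if y = x then p else 0)" by (auto simp: Tm_def)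
    then have "XX x ^ p \<approx> 0" unfolding XX_power by (auto simp: eqv_def lookup_MM)
    then show "Cn (c x ^ p) * XX x ^ p \<approx> 0" by (rule eqv_0_mult')
  qed
  finally show ?thesis by simp
qed

text \<open>The p-th power of a variable goes to the p-th power of a linear form, which lies in the
  ideal again.\<close>

lemma sbst_eqv:
  assumes \<sigma>: "\<And>x. x \<in> Vars \<Longrightarrow> linear_form (\<sigma> x)" and PQ: "P \<approx> Q"
  shows "sbst \<sigma> P \<approx> sbst \<sigma> Q"
proof -
  have "sbst \<sigma> R \<approx> 0" if R: "R \<approx> 0" for R
  proof -
    have "sbst \<sigma> R \<approx> (\<Sum>m\<in>kys R. 0)"
      unfolding sbst_def
    proof (rule eqv_sum)
      fix m assume "m \<in> kys R"
      then obtain x where x: "x \<in> Vars" "m x \<ge> p" using R unfolding eqv_0_iff Tm_def by fastforce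
      have "(\<Prod>y\<in>Vars. \<sigma> y ^ m y) = \<sigma> x ^ m x * (\<Prod>y\<in>Vars - {x}. \<sigma> y ^ m y)"
        using x by (simp add: prod.remove)
      also have "\<sigma> x ^ m x = \<sigma> x ^ p * \<sigma> x ^ (m x - p)" using x by (simp flip: power_add)
      finally have "(\<Prod>y\<in>Vars. \<sigma> y ^ m y) \<approx> 0"
        using eqv_0_mult[OF linear_form_power[OF \<sigma>[OF x(1)]]] by (simp add: mult.assoc)
      then show "Cn (cf R m) * (\<Prod>y\<in>Vars. \<sigma> y ^ m y) \<approx> 0" by (rule eqv_0_mult')
    qed
    then show ?thesis by simp
  qed
  from this[of "P - Q"] show ?thesis using PQ eqv_iff[of P Q] eqv_iff[of "sbst \<sigma> P" "sbst \<sigma> Q"] by (simp add: sbst_diff)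
qed

end

section \<open>Translation between exponent lists and polynomials\<close>

fun MonL :: "('a \<times> 'a) list \<Rightarrow> exps \<Rightarrow> 'a :: comm_ring_1" where
  "MonL (x # xs) (z # l) = fst x ^ fst z * snd x ^ snd z * MonL xs l"
| "MonL _ _ = 1"

lemma MonL_nth:
  "length xs = length l \<Longrightarrow> MonL xs l = (\<Prod>i<length l. fst (xs ! i) ^ fst (l ! i) * snd (xs ! i) ^ snd (l ! i))"
  by (induction xs l rule: MonL.induct) (simp_all add: prod.lessThan_Suc_shift mult_ac del: prod.lessThan_Suc)

text \<open>Bounding the sum of a pair gives a finite set that the moves of \<open>UT\<close> do not
  leave, and thus a common range of summation for both sides of \<open>UT_step\<close>.\<close>

definition PP :: "nat \<Rightarrow> (nat \<times> nat) set" where "PP N = {x. fst x + snd x \<le> N}"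

lemma finite_PP: "finite (PP N)"
proof (rule finite_subset)
  show "PP N \<subseteq> {..N} \<times> {..N}" by (auto simp: PP_def)
qed simp

fun SS :: "nat \<Rightarrow> nat \<Rightarrow> exps set" where
  "SS 0 N = {[]}"
| "SS (Suc n) N = (\<lambda>(x, l). x # l) ` (PP N \<times> SS n N)"

lemma finite_SS: "finite (SS n N)"
  by (induction n) (auto simp: finite_PP)

lemma sum_SS_Suc: "(\<Sum>l\<in>SS (Suc n) N. f l) = (\<Sum>x\<in>PP N. \<Sum>l\<in>SS n N. f (x # l))"
proof -
  have "inj_on (\<lambda>(x, l). x # l) (PP N \<times> SS n N)" by (auto simp: inj_on_def)
  then show ?thesis by (simp add: sum.reindex sum.cartesian_product case_prod_unfold)
qed

lemma mem_SS: "l \<in> SS n N \<longleftrightarrow> length l = n \<and> (\<forall>x\<in>set l. fst x + snd x \<le> N)"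
proof (induction n arbitrary: l)
  case (Suc n)
  show ?case by (cases l) (use Suc in \<open>auto simp: PP_def\<close>)
qed auto

text \<open>The binomial expansion of (e + y)^a, reindexed by the exponents after the
  substitution.\<close>

lemma UT_step:
  fixes e y :: "'a :: comm_ring_1"
  shows "(\<Sum>x\<in>PP N. F x * ((e + y) ^ fst x * y ^ snd x)) =
    (\<Sum>x\<in>PP N. (\<Sum>c\<le>snd x. of_nat ((fst x + c) choose c) * F (fst x + c, snd x - c)) * (e ^ fst x * y ^ snd x))"
proof -
  have "(\<Sum>x\<in>PP N. F x * ((e + y) ^ fst x * y ^ snd x)) =
      (\<Sum>x\<in>PP N. \<Sum>k\<le>fst x. F x * (of_nat (fst x choose k) * e ^ k * y ^ (fst x - k) * y ^ snd x))"
    by (simp add: binomial_ring sum_distrib_left sum_distrib_right mult.assoc)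
  also have "\<dots> = (\<Sum>z\<in>(SIGMA x:PP N. {..fst x}). F (fst z) * (of_nat (fst (fst z) choose snd z) * e ^ snd z * y ^ (fst (fst z) - snd z) * y ^ snd (fst z)))"
    by (subst sum.Sigma) (auto simp: finite_PP case_prod_unfold)
  also have "\<dots> = (\<Sum>z\<in>(SIGMA x:PP N. {..snd x}). of_nat ((fst (fst z) + snd z) choose snd z) * F (fst (fst z) + snd z, snd (fst z) - snd z) * (e ^ fst (fst z) * y ^ snd (fst z)))"
  proof (rule sum.reindex_bij_witness[where i = "\<lambda>z. ((fst (fst z) + snd z, snd (fst z) - snd z), fst (fst z))"
      and j = "\<lambda>z. ((snd z, fst (fst z) - snd z + snd (fst z)), fst (fst z) - snd z)"])
    fix z assume z: "z \<in> (SIGMA x:PP N. {..fst x})"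
    obtain a b k where zz: "z = ((a, b), k)" by (metis surj_pair)
    have k: "k \<le> a" using z zz by auto
    have "a choose (a - k) = a choose k" using binomial_symmetric[OF k] by simp
    moreover have "y ^ (a - k + b) = y ^ (a - k) * y ^ b" by (rule power_add)
    ultimately show "of_nat ((fst (fst ((snd z, fst (fst z) - snd z + snd (fst z)), fst (fst z) - snd z)) + snd ((snd z, fst (fst z) - snd z + snd (fst z)), fst (fst z) - snd z)) choose snd ((snd z, fst (fst z) - snd z + snd (fst z)), fst (fst z) - snd z)) *
         F (fst (fst ((snd z, fst (fst z) - snd z + snd (fst z)), fst (fst z) - snd z)) + snd ((snd z, fst (fst z) - snd z + snd (fst z)), fst (fst z) - snd z), snd (fst ((snd z, fst (fst z) - snd z + snd (fst z)), fst (fst z) - snd z)) - snd ((snd z, fst (fst z) - snd z + snd (fst z)), fst (fst z) - snd z)) *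
         (e ^ fst (fst ((snd z, fst (fst z) - snd z + snd (fst z)), fst (fst z) - snd z)) * y ^ snd (fst ((snd z, fst (fst z) - snd z + snd (fst z)), fst (fst z) - snd z))) =
         F (fst z) * (of_nat (fst (fst z) choose snd z) * e ^ snd z * y ^ (fst (fst z) - snd z) * y ^ snd (fst z))"
      using k by (simp add: zz mult_ac)
  qed (auto simp: PP_def)
  also have "\<dots> = (\<Sum>x\<in>PP N. (\<Sum>c\<le>snd x. of_nat ((fst x + c) choose c) * F (fst x + c, snd x - c)) * (e ^ fst x * y ^ snd x))"
    by (simp add: sum_distrib_right, subst sum.Sigma) (auto simp: finite_PP case_prod_unfold)
  finally show ?thesis .
qed

lemma UT_sum:
  assumes "length xs = n"
  shows "(\<Sum>l\<in>SS n N. \<psi> l * MonL (map (\<lambda>z. (fst z + snd z, snd z)) xs) l) = (\<Sum>l\<in>SS n N. UT \<psi> l * MonL xs l)"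
  using assms
proof (induction n arbitrary: \<psi> xs)
  case 0
  then show ?case by simp
next
  case (Suc n)
  then obtain x xs' where xs: "xs = x # xs'" "length xs' = n" by (cases xs) auto
  let ?m = "map (\<lambda>z. (fst z + snd z, snd z))"
  have "(\<Sum>l\<in>SS (Suc n) N. \<psi> l * MonL (?m xs) l) =
     (\<Sum>z\<in>PP N. ((fst x + snd x) ^ fst z * snd x ^ snd z) * (\<Sum>l\<in>SS n N. \<psi> (z # l) * MonL (?m xs') l))"
    unfolding sum_SS_Suc xs by (simp add: sum_distrib_left mult_ac)
  also have "\<dots> = (\<Sum>z\<in>PP N. ((fst x + snd x) ^ fst z * snd x ^ snd z) * (\<Sum>l\<in>SS n N. UT (\<lambda>l. \<psi> (z # l)) l * MonL xs' l))"
    by (intro sum.cong refl arg_cong2[where f = "(*)"] Suc.IH[OF xs(2)])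
  also have "\<dots> = (\<Sum>l\<in>SS n N. MonL xs' l * (\<Sum>z\<in>PP N. UT (\<lambda>l. \<psi> (z # l)) l * ((fst x + snd x) ^ fst z * snd x ^ snd z)))"
    unfolding sum_distrib_left by (subst sum.swap) (simp add: mult_ac)
  also have "\<dots> = (\<Sum>l\<in>SS n N. MonL xs' l * (\<Sum>z\<in>PP N. UT \<psi> (z # l) * (fst x ^ fst z * snd x ^ snd z)))"
    by (subst UT_step) simp
  also have "\<dots> = (\<Sum>l\<in>SS (Suc n) N. UT \<psi> l * MonL xs l)"
    unfolding sum_SS_Suc xs sum_distrib_left by (subst sum.swap) (simp add: mult_ac)
  finally show ?case .
qed

lemma UT_Cn: "UT (\<lambda>l. Cn (\<psi> l)) l = Cn (UT \<psi> l)"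
proof (induction l arbitrary: \<psi>)
  case (Cons x l)
  show ?case using Cons.IH by (simp add: Cn_sum Cn_mult Cn_of_nat)
qed simp

definition expo :: "exps \<Rightarrow> nat \<times> bool \<Rightarrow> nat" where
  "expo l = (\<lambda>(i, b). if i < 5 then (if b then snd (l ! i) else fst (l ! i)) else 0)"

lemma expo_simps [simp]: "expo l (i, False) = (if i < 5 then fst (l ! i) else 0)"
  "expo l (i, True) = (if i < 5 then snd (l ! i) else 0)"
  by (simp_all add: expo_def)

lemma expo_outside: "x \<notin> Vars \<Longrightarrow> expo l x = 0"
  by (cases x) (auto simp: expo_def)

lemma expo_inj: assumes "expo l = expo l'" "length l = 5" "length l' = 5" shows "l = l'"
proof (rule nth_equalityI)
  fix i assume "i < length l"
  then have "i < 5" using assms by simp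
  moreover have "expo l (i, False) = expo l' (i, False)" "expo l (i, True) = expo l' (i, True)"
    using assms(1) by simp_all
  ultimately show "l ! i = l' ! i" by (simp add: prod_eq_iff)
qed (use assms in simp)

lemma expo_surj: assumes "\<And>x. x \<notin> Vars \<Longrightarrow> m x = 0"
  shows "m = expo (map (\<lambda>i. (m (i, False), m (i, True))) [0..<5])"
proof
  fix x :: "nat \<times> bool"
  obtain i b where x: "x = (i, b)" by force
  show "m x = expo (map (\<lambda>i. (m (i, False), m (i, True))) [0..<5]) x"
    using assms[of x] by (cases "i < 5"; cases b) (auto simp: x expo_def)
qed

lemma deg_expo:
  assumes "length l = 5"
  shows "int (\<Sum>i<5. expo l (i, False)) = deg1 l" "int (\<Sum>i<5. expo l (i, True)) = deg2 l"
  using assms by (simp_all add: deg1_def deg2_def sum_list_sum_nth atLeast0LessThan)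

lemma prod_XX: assumes "\<forall>x. x \<notin> Vars \<longrightarrow> m x = 0" shows "(\<Prod>x\<in>Vars. XX x ^ m x) = MM m"
proof -
  have "(\<Prod>x\<in>A. XX x ^ m x) = MM (\<lambda>y. if y \<in> A then m y else 0)" if "finite A" for A
    using that
  proof (induction A)
    case empty
    show ?case using MM_0 by (simp add: zero_fun_def)
  next
    case (insert x A)
    have "(\<lambda>y. if y = x then m x else 0) + (\<lambda>y. if y \<in> A then m y else 0) = (\<lambda>y. if y \<in> insert x A then m y else 0)"
      using insert.hyps by (auto simp: fun_eq_iff)
    then show ?case using insert by (simp add: XX_power flip: MM_add)
  qed
  from this[OF finite_Vars] have "(\<Prod>x\<in>Vars. XX x ^ m x) = MM (\<lambda>y. if y \<in> Vars then m y else 0)" .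
  also have "(\<lambda>y. if y \<in> Vars then m y else 0) = m" using assms by (auto simp: fun_eq_iff)
  finally show ?thesis .
qed

lemma sbst_expo:
  assumes "length l = 5"
  shows "sbst \<sigma> (MM (expo l)) = MonL (map (\<lambda>i. (\<sigma> (i, False), \<sigma> (i, True))) [0..<5]) l"
proof -
  have "(\<Prod>i<5. \<sigma> (i, False) ^ expo l (i, False) * \<sigma> (i, True) ^ expo l (i, True)) =
     (\<Prod>i<5. \<sigma> (i, False) ^ fst (l ! i) * \<sigma> (i, True) ^ snd (l ! i))"
    by (rule prod.cong) auto
  then show ?thesis unfolding sbst_MM prod_Vars by (subst MonL_nth) (use assms in auto)
qed

lemma MonL_XX: assumes "length l = 5" shows "MonL (map (\<lambda>i. (XX (i, False), XX (i, True))) [0..<5]) l = MM (expo l)"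
  unfolding sbst_expo[OF assms, symmetric] sbst_MM by (rule prod_XX) (simp add: expo_outside)

lemma cf_list_sum:
  assumes "finite S" "\<And>l. l \<in> S \<Longrightarrow> length l = 5" "length l0 = 5"
  shows "cf (\<Sum>l\<in>S. Cn (a l) * MM (expo l)) (expo l0) = (if l0 \<in> S then a l0 else 0)"
proof -
  have "cf (\<Sum>l\<in>S. Cn (a l) * MM (expo l)) (expo l0) = (\<Sum>l\<in>S. a l * (if expo l0 = expo l then 1 else 0))"
    by (simp add: lookup_sum lookup_MM)
  also have "\<dots> = (\<Sum>l\<in>S. if l = l0 then a l else 0)"
    by (rule sum.cong) (use expo_inj[OF _ assms(3)] assms(2) in auto)
  finally show ?thesis using assms(1) by simp
qed

lemma keys_list_sum: "kys (\<Sum>l\<in>S. Cn (a l) * MM (expo l)) \<subseteq> expo ` S"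
proof -
  have "kys (Cn (a l) * MM (expo l)) \<subseteq> {expo l}" for l unfolding Cn_MM by simp
  then show ?thesis using keys_sum_subset[of "\<lambda>l. Cn (a l) * MM (expo l)" S] by fastforce
qed

definition tau :: "nat \<times> bool \<Rightarrow> 'k :: comm_ring_1 mp" where
  "tau = (\<lambda>(i, b). if b then XX (i, True) else XX (i, False) + XX (i, True))"

context char_p
begin

abbreviation II :: "exps set" where "II \<equiv> LL 5 (2 * int p - 2) (3 * int p - 3)"

lemma II: "finite II" "l \<in> II \<Longrightarrow> length l = 5" "l \<in> II \<Longrightarrow> trunc l"
  using card_LL[of 5 "2 * int p - 2" "3 * int p - 3"] by (auto simp: LL_def)

lemma TT_II: assumes "p = 2" shows "TT 5 2 \<subseteq> II"
proof
  fix l :: exps assume "l \<in> TT 5 2"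
  then have "theta l \<noteq> 0" unfolding theta_def using assms by simp
  then show "l \<in> II" using Inv_support[OF theta_EE] by (simp add: LL_def)
qed

definition Ev :: "(exps \<Rightarrow> 'k) \<Rightarrow> 'k mp" where "Ev \<psi> = (\<Sum>l\<in>II. Cn (\<psi> l) * MM (expo l))"

definition cff :: "'k mp \<Rightarrow> exps \<Rightarrow> 'k" where "cff P l = (if l \<in> II then cf P (expo l) else 0)"

lemma Tm_expo: assumes "length l = 5" shows "Tm (expo l) \<longleftrightarrow> trunc l"
proof -
  have "trunc l \<longleftrightarrow> (\<forall>i<5. fst (l ! i) < p \<and> snd (l ! i) < p)"
    unfolding trunc_def using assms by (metis in_set_conv_nth)
  then show ?thesis unfolding Tm_def Vars_def by (auto simp: expo_def split: if_splits)
qed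

lemma bihom_expo: assumes "l \<in> II" shows "bihom (2 * p - 2) (3 * p - 3) (MM (expo l) :: 'k mp)"
proof -
  have "int (\<Sum>i<5. expo l (i, False)) = 2 * int p - 2" "int (\<Sum>i<5. expo l (i, True)) = 3 * int p - 3"
    using assms unfolding deg_expo[OF II(2)[OF assms]] LL_def by auto
  then have "(\<Sum>i<5. expo l (i, False)) = 2 * p - 2" "(\<Sum>i<5. expo l (i, True)) = 3 * p - 3"
    using p_pos by linarith+
  then show ?thesis unfolding bihom_def MM_def by (auto simp: expo_def)
qed

lemma bihom_Ev: "bihom (2 * p - 2) (3 * p - 3) (Ev \<psi>)"
  unfolding Ev_def by (intro bihom_sum bihom_Cn_mult bihom_expo)

lemma Ev_cff: assumes "bihom (2 * p - 2) (3 * p - 3) P" shows "Ev (cff P) \<approx> P"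
  unfolding eqv_def
proof (intro allI impI)
  fix m assume m: "Tm m"
  show "cf (Ev (cff P)) m = cf P m"
  proof (cases "\<exists>l\<in>II. m = expo l")
    case True
    then obtain l where l: "l \<in> II" "m = expo l" by blast
    then show ?thesis unfolding Ev_def using cf_list_sum[of II l "cff P"] II by (auto simp: cff_def)
  next
    case False
    then have "m \<notin> kys (Ev (cff P))" unfolding Ev_def using keys_list_sum by blast
    then have z: "cf (Ev (cff P)) m = 0" by (simp add: in_keys_iff)
    have "cf P m = 0"
    proof (rule ccontr)
      assume "cf P m \<noteq> 0"
      then have "m \<in> kys P" by (simp add: in_keys_iff)
      then have h: "\<And>x. x \<notin> Vars \<Longrightarrow> m x = 0" "(\<Sum>i<5. m (i, False)) = 2 * p - 2" "(\<Sum>i<5. m (i, True)) = 3 * p - 3"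
        using assms unfolding bihom_def by auto
      define l where "l = map (\<lambda>i. (m (i, False), m (i, True))) [0..<5]"
      have l: "m = expo l" "length l = 5" unfolding l_def by (rule expo_surj[OF h(1)]) simp_all
      have "trunc l" using m Tm_expo[OF l(2)] l(1) by simp
      moreover have "deg1 l = 2 * int p - 2" "deg2 l = 3 * int p - 3"
        using deg_expo[OF l(2)] h(2,3) p_pos unfolding l(1)[symmetric] by auto
      ultimately have "l \<in> II" using l(2) by (simp add: LL_def)
      then show False using False l(1) by blast
    qed
    then show ?thesis using z by simp
  qed
qed

lemma sbst_tau_Ev:
  assumes supp: "\<And>l. \<psi> l \<noteq> 0 \<Longrightarrow> l \<in> II"
  shows "sbst tau (Ev \<psi>) = (\<Sum>l\<in>SS 5 (2 * p). Cn (UT \<psi> l) * MM (expo l))"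
proof -
  let ?xs = "map (\<lambda>i. (XX (i, False), XX (i, True))) [0..<5] :: ('k mp \<times> 'k mp) list"
  have map: "map (\<lambda>i. (tau (i, False), tau (i, True))) [0..<5] = map (\<lambda>z. (fst z + snd z, snd z)) ?xs"
    by (simp add: tau_def)
  have sub: "II \<subseteq> SS 5 (2 * p)"
  proof
    fix l assume l: "l \<in> II"
    have "fst x + snd x \<le> 2 * p" if "x \<in> set l" for x
      using II(3)[OF l] that unfolding trunc_def by fastforce
    then show "l \<in> SS 5 (2 * p)" unfolding mem_SS using II(2)[OF l] by blast
  qed
  have "sbst tau (Ev \<psi>) = (\<Sum>l\<in>II. Cn (\<psi> l) * MonL (map (\<lambda>z. (fst z + snd z, snd z)) ?xs) l)"
    unfolding Ev_def sbst_sum sbst_mult sbst_Cn map[symmetric] by (rule sum.cong) (simp_all add: sbst_expo II)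
  also have "\<dots> = (\<Sum>l\<in>SS 5 (2 * p). Cn (\<psi> l) * MonL (map (\<lambda>z. (fst z + snd z, snd z)) ?xs) l)"
  proof (intro sum.mono_neutral_left sub finite_SS ballI)
    fix l assume "l \<in> SS 5 (2 * p) - II"
    then have "\<psi> l = 0" using supp[of l] by blast
    then show "Cn (\<psi> l) * MonL (map (\<lambda>z. (fst z + snd z, snd z)) ?xs) l = 0" by simp
  qed
  also have "\<dots> = (\<Sum>l\<in>SS 5 (2 * p). UT (\<lambda>l. Cn (\<psi> l)) l * MonL ?xs l)"
    by (rule UT_sum) simp
  also have "\<dots> = (\<Sum>l\<in>SS 5 (2 * p). Cn (UT \<psi> l) * MM (expo l))"
    by (rule sum.cong) (simp_all add: UT_Cn MonL_XX mem_SS)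
  finally show ?thesis .
qed

text \<open>\<open>UT\<close> computes the coefficients of the substitution \<open>tau\<close>, and
  the degree in e separates them: each lower degree sees exactly one divided power.\<close>

lemma EE_iff:
  assumes "\<psi> \<in> Tr 5 (2 * int p - 2) (3 * int p - 3)"
  shows "\<psi> \<in> EE \<longleftrightarrow> sbst tau (Ev \<psi>) \<approx> Ev \<psi>"
proof -
  let ?A = "2 * int p - 2"
  have supp: "\<And>l. \<psi> l \<noteq> 0 \<Longrightarrow> l \<in> II" using assms by (simp add: Tr_eq)
  have dA: "\<And>l. \<psi> l \<noteq> 0 \<Longrightarrow> deg1 l = ?A" using supp by (simp add: LL_def)
  have UTD: "UT \<psi> l = (if deg1 l \<le> ?A then DU (nat (?A - deg1 l)) \<psi> l else 0)" for l
    by (rule UT_eq_DU) (rule dA)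
  have tE: "sbst tau (Ev \<psi>) = (\<Sum>l\<in>SS 5 (2 * p). Cn (UT \<psi> l) * MM (expo l))"
    by (rule sbst_tau_Ev) (rule supp)
  have c1: "cf (sbst tau (Ev \<psi>)) (expo l) = UT \<psi> l" if "length l = 5" "trunc l" for l
  proof -
    have "fst x + snd x \<le> 2 * p" if "x \<in> set l" for x
      using \<open>trunc l\<close> that unfolding trunc_def by fastforce
    then have "l \<in> SS 5 (2 * p)" unfolding mem_SS using that by blast
    moreover have "cf (\<Sum>l\<in>SS 5 (2 * p). Cn (UT \<psi> l) * MM (expo l)) (expo l) = (if l \<in> SS 5 (2 * p) then UT \<psi> l else 0)"
      by (rule cf_list_sum) (use that in \<open>auto simp: finite_SS mem_SS\<close>)
    ultimately show ?thesis by (simp only: tE if_True)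
  qed
  have c2: "cf (Ev \<psi>) (expo l) = \<psi> l" if "length l = 5" for l
    unfolding Ev_def by (subst cf_list_sum) (use II supp[of l] that in auto)
  show ?thesis
  proof
    assume \<psi>: "\<psi> \<in> EE"
    show "sbst tau (Ev \<psi>) \<approx> Ev \<psi>"
      unfolding eqv_def
    proof (intro allI impI)
      fix m assume m: "Tm m"
      show "cf (sbst tau (Ev \<psi>)) m = cf (Ev \<psi>) m"
      proof (cases "\<exists>l. length l = 5 \<and> m = expo l")
        case True
        then obtain l where l: "length l = 5" "m = expo l" by blast
        have t: "trunc l" using m Tm_expo[OF l(1)] l(2) by simp
        have "UT \<psi> l = \<psi> l"
        proof (cases "deg1 l < ?A")
          case True
          then have "DU (nat (?A - deg1 l)) \<psi> l = 0" using Inv_DU[OF \<psi> _ t, of "nat (?A - deg1 l)"] by simp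
          moreover have "\<psi> l = 0" using dA[of l] True by auto
          ultimately show ?thesis unfolding UTD by simp
        next
          case False
          then show ?thesis unfolding UTD using dA[of l] by (cases "deg1 l = ?A") auto
        qed
        then show ?thesis using c1[OF l(1) t] c2[OF l(1)] l(2) by simp
      next
        case False
        then have "m \<notin> expo ` SS 5 (2 * p)" "m \<notin> expo ` II" using II(2) by (auto simp: mem_SS)
        then have "m \<notin> kys (sbst tau (Ev \<psi>))" "m \<notin> kys (Ev \<psi>)"
          unfolding tE using keys_list_sum unfolding Ev_def by blast+
        then show ?thesis by (simp add: in_keys_iff)
      qed
    qed
  next
    assume e: "sbst tau (Ev \<psi>) \<approx> Ev \<psi>"
    have "DU n \<psi> l = 0" if n: "n \<ge> 1" and t: "trunc l" for n l
    proof (rule ccontr)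
      assume nz: "DU n \<psi> l \<noteq> 0"
      from DU_nonzero_ex[OF nz] obtain l' where l': "\<psi> l' \<noteq> 0"
        "list_all2 (\<lambda>x y. fst x \<le> fst y \<and> snd y \<le> snd x) l l'" "deg1 l' = deg1 l + int n" by auto
      have len: "length l = 5" using list_all2_lengthD[OF l'(2)] II(2)[OF supp[OF l'(1)]] by simp
      have d: "deg1 l = ?A - int n" using dA[OF l'(1)] l'(3) by simp
      then have "UT \<psi> l = DU n \<psi> l" unfolding UTD by simp
      moreover have "\<psi> l = 0" using dA[of l] d n by auto
      moreover have "UT \<psi> l = \<psi> l"
        using e c1[OF len t] c2[OF len] Tm_expo[OF len] t unfolding eqv_def by simp
      ultimately show False using nz by simp
    qed
    then show "\<psi> \<in> EE" using assms by (simp add: Inv_def)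
  qed
qed

end

section \<open>Polynomials attached to Witt bases\<close>

lemma lessThan_5: "{..<5} = {0, 1, 2, 3, 4 :: nat}" by auto

lemma linear_form_sum_Cn: "(\<And>i. i \<in> A \<Longrightarrow> linear_form (f i)) \<Longrightarrow> linear_form (\<Sum>i\<in>A. Cn (c i) * f i)"
  by (intro linear_form_sum linear_form_Cn_mult)

context hermitian_space
begin

text \<open>A Witt basis: \<open>b 0\<close> and \<open>b 1\<close> span a totally isotropic plane
  in duality with the span of \<open>b 4\<close> and \<open>b 3\<close>, and \<open>b 2\<close>
  completes it by a vector of norm 1.\<close>

definition frame :: "(nat \<Rightarrow> 'v) \<Rightarrow> bool" where
  "frame b \<longleftrightarrow> (\<forall>i<5. \<forall>j<5. h (b i) (b j) = (if i + j = 4 then 1 else 0))"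

lemma form_zero_left [simp]: "h 0 z = 0"
  using form_scale_left[of 0 0 z] by simp

lemma form_sum_left: "h (sum f A) z = (\<Sum>x\<in>A. h (f x) z)"
  by (induction A rule: infinite_finite_induct) (simp_all add: form_add_left)

definition gram :: "(nat \<Rightarrow> 'v) \<Rightarrow> (nat \<Rightarrow> 'v) \<Rightarrow> 'k" where
  "gram b b' = h (b 0) (b' 0) * h (b 1) (b' 1) - h (b 0) (b' 1) * h (b 1) (b' 0)"

end

text \<open>The property \<open>expansion\<close> says that Witt bases span. It is an assumption
  here and is supplied by \<open>frame_expansion\<close>, which rests on the count of vectors in the
  space.\<close>

locale witt = hermitian_space scale q h + char_p p ty
  for scale :: "'k :: {field, finite} \<Rightarrow> 'v :: ab_group_add \<Rightarrow> 'v" and q :: nat and h and p :: nat and ty :: "'k itself" +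
  fixes t :: nat and v :: "nat \<Rightarrow> 'v"
  assumes q: "q = p ^ t" and t: "t \<ge> 1" and v: "frame v"
    and expansion: "\<And>b x. frame b \<Longrightarrow> x = (\<Sum>i<5. scale (h x (b (4 - i))) (b i))"
begin

text \<open>The coordinate of x along \<open>v i\<close> is \<open>h x (v (4 - i))\<close>; thus x
  is read as a linear form in which the variables of kind \<beta> stand for the vectors of
  v.\<close>

definition lf :: "bool \<Rightarrow> 'v \<Rightarrow> 'k mp" where
  "lf \<beta> x = (\<Sum>i<5. Cn (h x (v (4 - i))) * XX (i, \<beta>))"

lemma lf_add: "lf \<beta> (x + y) = lf \<beta> x + lf \<beta> y"
  by (simp add: lf_def form_add_left Cn_add distrib_right sum.distrib)

lemma lf_scale: "lf \<beta> (scale a x) = Cn a * lf \<beta> x"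
  by (simp add: lf_def form_scale_left Cn_mult sum_distrib_left mult.assoc)

lemma lf_0 [simp]: "lf \<beta> 0 = 0" by (simp add: lf_def)

lemma lf_sum: "lf \<beta> (sum f A) = (\<Sum>x\<in>A. lf \<beta> (f x))"
  by (induction A rule: infinite_finite_induct) (simp_all add: lf_add)

lemma lf_v: assumes "i < 5" shows "lf \<beta> (v i) = XX (i, \<beta>)"
proof -
  have "lf \<beta> (v i) = (\<Sum>j<5. if j = i then XX (j, \<beta>) else 0)"
    unfolding lf_def using v assms unfolding frame_def by (intro sum.cong) auto
  then show ?thesis using assms by simp
qed

lemma lf_expansion: "frame b \<Longrightarrow> lf \<beta> x = (\<Sum>i<5. Cn (h x (b (4 - i))) * lf \<beta> (b i))"
  using arg_cong[OF expansion[of b x], of "lf \<beta>"] by (simp add: lf_sum lf_scale)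

lemma form_expansion: "frame b \<Longrightarrow> (\<Sum>i<5. h x (b (4 - i)) * h (b i) z) = h x z"
  using arg_cong[OF expansion[of b x], of "\<lambda>x. h x z"] by (simp add: form_sum_left form_scale_left)

lemma linear_form_lf: "linear_form (lf \<beta> x)"
  unfolding lf_def by (intro linear_form_sum_Cn linear_form_XX) auto

lemma lf_power: "lf \<beta> x ^ p \<approx> 0" by (rule linear_form_power[OF linear_form_lf])

lemma bihom_lf: "bihom 1 0 (lf False x)" "bihom 0 1 (lf True x)"
  unfolding lf_def by (rule bihom_sum, rule bihom_Cn_mult, rule bihom_XX, simp)+

definition WW :: "(nat \<Rightarrow> 'v) \<Rightarrow> 'k mp" where
  "WW b = (lf False (b 0) * lf False (b 1) * (lf True (b 0) * lf True (b 1) * lf True (b 2))) ^ (p - 1)"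

lemma bihom_WW: "bihom (2 * p - 2) (3 * p - 3) (WW b)"
proof -
  have "bihom ((p - 1) * (1 + 1 + (0 + 0 + 0))) ((p - 1) * (0 + 0 + (1 + 1 + 1))) (WW b)"
    unfolding WW_def by (intro bihom_power bihom_mult bihom_lf)
  moreover have "(p - 1) * (1 + 1 + (0 + 0 + 0)) = 2 * p - 2" "(p - 1) * (0 + 0 + (1 + 1 + 1)) = 3 * p - 3"
    by (simp_all add: algebra_simps diff_mult_distrib2)
  ultimately show ?thesis by (simp only:)
qed

text \<open>Every additional factor Q completes \<open>Q ^ (p - 1)\<close> to \<open>Q ^ p\<close>.
  This is the analogue of adding a multiple of one row of a determinant to another.\<close>

lemma add_kill:
  assumes "Q ^ p \<approx> 0"
  shows "(P + Cn c * Q) ^ n * Q ^ (p - 1) \<approx> P ^ n * Q ^ (p - 1)"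
proof (induction n)
  case (Suc n)
  have QQ: "Q * Q ^ (p - 1) = Q ^ p" using p_pos by (simp flip: power_Suc)
  have "(P + Cn c * Q) ^ Suc n * Q ^ (p - 1) = (P + Cn c * Q) * ((P + Cn c * Q) ^ n * Q ^ (p - 1))"
    by (simp add: mult.assoc)
  also have "\<dots> \<approx> (P + Cn c * Q) * (P ^ n * Q ^ (p - 1))" by (rule eqv_mult_left[OF Suc.IH])
  also have "(P + Cn c * Q) * (P ^ n * Q ^ (p - 1)) = P ^ Suc n * Q ^ (p - 1) + (Cn c * P ^ n) * Q ^ p"
    unfolding QQ[symmetric] by (simp add: algebra_simps)
  also have "\<dots> \<approx> P ^ Suc n * Q ^ (p - 1) + 0" by (intro eqv_add eqv_refl eqv_0_mult' assms)
  finally show ?case by simp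
qed simp

definition cb :: "(nat \<Rightarrow> 'v) \<Rightarrow> exps \<Rightarrow> 'k" where "cb b = cff (WW b)"

lemma Ev_cb: "Ev (cb b) \<approx> WW b"
  unfolding cb_def by (rule Ev_cff[OF bihom_WW])

lemma cff_Tr: "cff P \<in> Tr 5 (2 * int p - 2) (3 * int p - 3)"
  by (simp add: Tr_eq cff_def)

lemma linear_form_tau: "x \<in> Vars \<Longrightarrow> linear_form (tau x)"
  unfolding tau_def by (cases x) (auto intro!: linear_form_add linear_form_XX)

lemma sbst_lf: "sbst \<sigma> (lf \<beta> x) = (\<Sum>i<5. Cn (h x (v (4 - i))) * \<sigma> (i, \<beta>))"
  unfolding lf_def sbst_sum sbst_mult sbst_Cn by (rule sum.cong[OF refl]) (simp add: sbst_XX)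

lemma tau_lf: "sbst tau (lf True x) = lf True x" "sbst tau (lf False x) = lf False x + lf True x"
  unfolding sbst_lf by (simp_all add: lf_def tau_def distrib_left sum.distrib)

lemma cff_EE: assumes "bihom (2 * p - 2) (3 * p - 3) P" "sbst tau P \<approx> P" shows "cff P \<in> EE"
proof -
  have "sbst tau (Ev (cff P)) \<approx> sbst tau P"
    by (rule sbst_eqv[OF linear_form_tau Ev_cff[OF assms(1)]])
  also have "sbst tau P \<approx> P" by (rule assms)
  also have "P \<approx> Ev (cff P)" by (rule eqv_sym[OF Ev_cff[OF assms(1)]])
  finally show ?thesis using EE_iff[OF cff_Tr] by simp
qed

text \<open>\<open>tau\<close> adds to the e-form of \<open>b 0\<close> or \<open>b 1\<close> its
  y-form, whose (p-1)-st power is already present in \<open>WW b\<close> and absorbs the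
  change.\<close>

lemma cb_EE: "cb b \<in> EE"
  unfolding cb_def
proof (rule cff_EE[OF bihom_WW])
  let ?n = "p - 1"
  have k: "(lf False x + lf True x) ^ ?n * lf True x ^ ?n \<approx> lf False x ^ ?n * lf True x ^ ?n" for x
    using add_kill[where P = "lf False x" and Q = "lf True x" and c = 1 and n = ?n, OF lf_power] by simp
  have "sbst tau (WW b) = ((lf False (b 0) + lf True (b 0)) ^ ?n * lf True (b 0) ^ ?n) *
     ((lf False (b 1) + lf True (b 1)) ^ ?n * lf True (b 1) ^ ?n) * lf True (b 2) ^ ?n"
    unfolding WW_def by (simp only: sbst_power sbst_mult tau_lf) (simp only: power_mult_distrib mult_ac)
  also have "\<dots> \<approx> (lf False (b 0) ^ ?n * lf True (b 0) ^ ?n) * (lf False (b 1) ^ ?n * lf True (b 1) ^ ?n) * lf True (b 2) ^ ?n"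
    by (rule eqv_mult[OF eqv_mult[OF k k] eqv_refl])
  also have "\<dots> = WW b" unfolding WW_def by (simp only: power_mult_distrib mult_ac)
  finally show "sbst tau (WW b) \<approx> WW b" .
qed

definition sw :: "nat \<times> bool \<Rightarrow> 'k mp" where "sw = (\<lambda>(i, b). XX (i, \<not> b))"

lemma sw_lf: "sbst sw (lf \<beta> x) = lf (\<not> \<beta>) x"
  unfolding sbst_lf by (simp add: lf_def sw_def)

definition TopF :: "nat \<times> bool \<Rightarrow> nat" where "TopF = (\<lambda>(i, b). if i < 5 \<and> \<not> b then p - 1 else 0)"
definition TopT :: "nat \<times> bool \<Rightarrow> nat" where "TopT = (\<lambda>(i, b). if i < 5 \<and> b then p - 1 else 0)"
definition TopE :: "nat \<times> bool \<Rightarrow> nat" where "TopE = (\<lambda>(i, b). if i < 5 then p - 1 else 0)"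

lemma TopE_eq: "TopE = TopF + TopT"
  by (auto simp: TopE_def TopF_def TopT_def fun_eq_iff)

lemma full_degree:
  fixes f :: "nat \<Rightarrow> nat"
  assumes "\<And>i. i < 5 \<Longrightarrow> f i < p" "(\<Sum>i<5. f i) = 5 * (p - 1)" "i < 5" shows "f i = p - 1"
proof (rule ccontr)
  assume "f i \<noteq> p - 1"
  then have i: "f i < p - 1" using assms(1)[OF assms(3)] by simp
  have "(\<Sum>i<5. f i) = f i + sum f ({..<5} - {i})" using assms(3) by (intro sum.remove) auto
  also have "sum f ({..<5} - {i}) \<le> (\<Sum>j\<in>{..<5} - {i}. p - 1)"
  proof (rule sum_mono)
    fix j assume "j \<in> {..<5} - {i}"
    then show "f j \<le> p - 1" using assms(1)[of j] by simp
  qed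
  also have "(\<Sum>j\<in>{..<5} - {i}. p - 1) = 4 * (p - 1)" using assms(3) by simp
  finally show False using assms(2) i by simp
qed

lemma Tm_Tops: "Tm TopF" "Tm TopT" "Tm TopE"
  using p_pos by (auto simp: Tm_def TopF_def TopT_def TopE_def)

lemma top_only:
  assumes P: "bihom a b P" and m: "\<And>m'. Tm m' \<Longrightarrow> (\<And>x. x \<notin> Vars \<Longrightarrow> m' x = 0) \<Longrightarrow>
     (\<Sum>i<5. m' (i, False)) = a \<Longrightarrow> (\<Sum>i<5. m' (i, True)) = b \<Longrightarrow> m' = m"
  shows "P \<approx> Cn (cf P m) * MM m"
  unfolding eqv_def
proof (intro allI impI)
  fix m' assume t: "Tm m'"
  show "cf P m' = cf (Cn (cf P m) * MM m) m'"
  proof (cases "m' = m")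
    case False
    have "cf P m' = 0"
    proof (rule ccontr)
      assume "cf P m' \<noteq> 0"
      then have "m' \<in> kys P" by (simp add: in_keys_iff)
      then have "m' = m" using P unfolding bihom_def by (intro m t) auto
      then show False using False by simp
    qed
    then show ?thesis using False by (simp add: lookup_MM)
  qed (simp add: lookup_MM)
qed

lemma top_only_F: assumes "bihom (5 * (p - 1)) 0 P" shows "P \<approx> Cn (cf P TopF) * MM TopF"
proof (rule top_only[OF assms])
  fix m assume m: "Tm m" "\<And>x. x \<notin> Vars \<Longrightarrow> m x = 0" "(\<Sum>i<5. m (i, False)) = 5 * (p - 1)" "(\<Sum>i<5. m (i, True)) = 0"
  have "m (i, False) = p - 1" if "i < 5" for i
    using full_degree[of "\<lambda>i. m (i, False)" i] m that by (auto simp: Tm_def)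
  moreover have "m (i, True) = 0" for i using m(2)[of "(i, True)"] m(4) by (cases "i < 5") auto
  ultimately show "m = TopF" using m(2) by (auto simp: TopF_def fun_eq_iff)
qed

lemma top_only_T: assumes "bihom 0 (5 * (p - 1)) P" shows "P \<approx> Cn (cf P TopT) * MM TopT"
proof (rule top_only[OF assms])
  fix m assume m: "Tm m" "\<And>x. x \<notin> Vars \<Longrightarrow> m x = 0" "(\<Sum>i<5. m (i, False)) = 0" "(\<Sum>i<5. m (i, True)) = 5 * (p - 1)"
  have "m (i, True) = p - 1" if "i < 5" for i
    using full_degree[of "\<lambda>i. m (i, True)" i] m that by (auto simp: Tm_def)
  moreover have "m (i, False) = 0" for i using m(2)[of "(i, False)"] m(3) by (cases "i < 5") auto
  ultimately show "m = TopT" using m(2) by (auto simp: TopT_def fun_eq_iff)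
qed

lemma top_only_E: assumes "bihom (5 * (p - 1)) (5 * (p - 1)) P" shows "P \<approx> Cn (cf P TopE) * MM TopE"
proof (rule top_only[OF assms])
  fix m assume m: "Tm m" "\<And>x. x \<notin> Vars \<Longrightarrow> m x = 0" "(\<Sum>i<5. m (i, False)) = 5 * (p - 1)" "(\<Sum>i<5. m (i, True)) = 5 * (p - 1)"
  have "m (i, b) = p - 1" if "i < 5" for i b
    using full_degree[of "\<lambda>i. m (i, b)" i] m that by (cases b) (auto simp: Tm_def)
  then show "m = TopE" using m(2) by (auto simp: TopE_def fun_eq_iff)
qed

definition PB :: "bool \<Rightarrow> (nat \<Rightarrow> 'v) \<Rightarrow> 'k mp" where "PB \<beta> b = (\<Prod>r<5. lf \<beta> (b r) ^ (p - 1))"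

text \<open>The (p-1)-st power of the determinant of b in one set of variables, read off as the top
  coefficient.\<close>

definition gg :: "bool \<Rightarrow> (nat \<Rightarrow> 'v) \<Rightarrow> 'k" where "gg \<beta> b = cf (PB \<beta> b) (if \<beta> then TopT else TopF)"

lemma PB_eqv: "PB \<beta> b \<approx> Cn (gg \<beta> b) * MM (if \<beta> then TopT else TopF)"
proof (cases \<beta>)
  case True
  have "bihom (\<Sum>r<(5::nat). (p - 1) * 0) (\<Sum>r<(5::nat). (p - 1) * 1) (PB True b)"
    unfolding PB_def by (intro bihom_prod bihom_power bihom_lf)
  then show ?thesis using top_only_T[of "PB True b"] True by (simp add: gg_def)
next
  case False
  have "bihom (\<Sum>r<(5::nat). (p - 1) * 1) (\<Sum>r<(5::nat). (p - 1) * 0) (PB False b)"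
    unfolding PB_def by (intro bihom_prod bihom_power bihom_lf)
  then show ?thesis using top_only_F[of "PB False b"] False by (simp add: gg_def)
qed

text \<open>The substitution \<sigma> takes the form of \<open>b j\<close> to the variable with
  index j and hence \<open>PB \<beta> b\<close> to the top monomial. A congruence of
  \<open>PB \<beta> b\<close> to 0 would be inherited by the latter.\<close>

lemma gg_nonzero: assumes b: "frame b" shows "gg \<beta> b \<noteq> 0"
proof
  assume z: "gg \<beta> b = 0"
  then have P0: "PB \<beta> b \<approx> 0" using PB_eqv[of \<beta> b] by simp
  define \<sigma> where "\<sigma> = (\<lambda>(i, \<gamma>). \<Sum>r<5. Cn (h (v i) (b (4 - r))) * (XX (r, \<gamma>) :: 'k mp))"
  have lin: "linear_form (\<sigma> x)" for x
    unfolding \<sigma>_def by (cases x) (auto intro!: linear_form_sum_Cn linear_form_XX)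
  have s: "sbst \<sigma> (lf \<beta> x) = (\<Sum>r<5. Cn (h x (b (4 - r))) * XX (r, \<beta>))" for x
  proof -
    have "sbst \<sigma> (lf \<beta> x) = (\<Sum>i<5. Cn (h x (v (4 - i))) * (\<Sum>r<5. Cn (h (v i) (b (4 - r))) * XX (r, \<beta>)))"
      unfolding lf_def by (simp add: sbst_sum sbst_mult sbst_XX \<sigma>_def)
    also have "\<dots> = (\<Sum>r<5. Cn (\<Sum>i<5. h x (v (4 - i)) * h (v i) (b (4 - r))) * XX (r, \<beta>))"
      unfolding Cn_sum Cn_mult sum_distrib_left sum_distrib_right by (subst sum.swap) (simp add: mult.assoc)
    finally show ?thesis unfolding form_expansion[OF v] .
  qed
  have "sbst \<sigma> (lf \<beta> (b j)) = XX (j, \<beta>)" if "j < 5" for j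
  proof -
    have "sbst \<sigma> (lf \<beta> (b j)) = (\<Sum>r<5. if r = j then XX (r, \<beta>) else 0)"
      unfolding s using b that unfolding frame_def by (intro sum.cong) auto
    then show ?thesis using that by simp
  qed
  then have "sbst \<sigma> (PB \<beta> b) = PB \<beta> v" unfolding PB_def by (simp add: sbst_prod sbst_power lf_v)
  moreover have "sbst \<sigma> (PB \<beta> b) \<approx> sbst \<sigma> 0" by (rule sbst_eqv[OF lin P0])
  ultimately have "PB \<beta> v \<approx> 0" by simp
  moreover have "PB \<beta> v = MM (if \<beta> then TopT else TopF)"
  proof -
    let ?m = "if \<beta> then TopT else TopF"
    have "MM ?m = (\<Prod>x\<in>Vars. XX x ^ ?m x)"
      by (rule prod_XX[symmetric]) (auto simp: TopT_def TopF_def)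
    also have "\<dots> = PB \<beta> v"
      unfolding prod_Vars PB_def by (rule prod.cong) (auto simp: TopT_def TopF_def lf_v)
    finally show ?thesis by simp
  qed
  ultimately show False using Tm_Tops by (auto simp: eqv_def lookup_MM split: if_splits)
qed

lemma minus_power: "(- x) ^ (p - 1) = (x :: 'k) ^ (p - 1)"
  using of_nat_binomial_top[of "p - 1"] power_minus[of x "p - 1"] by simp

text \<open>Gaussian elimination on a 2 by 2 determinant, with \<open>add_kill\<close> for the row
  operations.\<close>

lemma two_forms:
  assumes A: "linear_form A" and B: "linear_form B"
  shows "(Cn a * A + Cn b * B) ^ (p - 1) * (Cn c * A + Cn d * B) ^ (p - 1) \<approx>
     Cn ((a * d - b * c) ^ (p - 1)) * (A ^ (p - 1) * B ^ (p - 1))"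
proof (cases "a = 0")
  case True
  let ?n = "p - 1"
  have "(Cn c * A + Cn d * B) ^ ?n * B ^ ?n \<approx> (Cn c * A) ^ ?n * B ^ ?n"
    by (rule add_kill[OF linear_form_power[OF B]])
  then have "Cn b ^ ?n * ((Cn c * A + Cn d * B) ^ ?n * B ^ ?n) \<approx> Cn b ^ ?n * ((Cn c * A) ^ ?n * B ^ ?n)"
    by (rule eqv_mult_left)
  then show ?thesis using True minus_power[of "b * c"]
    by (simp add: power_mult_distrib Cn_power Cn_mult mult_ac)
next
  case False
  let ?n = "p - 1" and ?P = "Cn a * A + Cn b * B"
  define e where "e = d - b * c / a"
  have e: "a * e = a * d - b * c" using False by (simp add: e_def field_simps)
  have lP: "linear_form ?P" by (intro linear_form_add linear_form_Cn_mult A B)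
  have Q: "Cn c * A + Cn d * B = Cn e * B + Cn (c / a) * ?P"
  proof -
    have ca: "c / a * a = c" using False by simp
    have "Cn (c / a) * ?P = Cn (c / a * a) * A + Cn (c / a * b) * B"
      by (simp only: Cn_mult distrib_left mult.assoc)
    then have 1: "Cn (c / a) * ?P = Cn c * A + Cn (c / a * b) * B" unfolding ca .
    have 2: "Cn d = Cn e + Cn (c / a * b)" unfolding Cn_add[symmetric] by (simp add: e_def mult.commute)
    show ?thesis unfolding 1 2 by (simp only: distrib_right distrib_left ac_simps)
  qed
  have "?P ^ ?n * (Cn c * A + Cn d * B) ^ ?n = (Cn e * B + Cn (c / a) * ?P) ^ ?n * ?P ^ ?n"
    unfolding Q by (rule mult.commute)
  also have "\<dots> \<approx> (Cn e * B) ^ ?n * ?P ^ ?n" by (rule add_kill[OF linear_form_power[OF lP]])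
  also have "(Cn e * B) ^ ?n * ?P ^ ?n = Cn e ^ ?n * (?P ^ ?n * B ^ ?n)" by (simp add: power_mult_distrib mult_ac)
  also have "\<dots> \<approx> Cn e ^ ?n * ((Cn a * A) ^ ?n * B ^ ?n)"
    by (rule eqv_mult_left[OF add_kill[OF linear_form_power[OF B]]])
  also have "\<dots> = Cn ((a * d - b * c) ^ ?n) * (A ^ ?n * B ^ ?n)"
    unfolding e[symmetric] by (simp add: power_mult_distrib Cn_power Cn_mult mult_ac)
  finally show ?thesis .
qed

lemma eqv_context: "X * z \<approx> Y * z \<Longrightarrow> X * (z * w) \<approx> Y * (z * w)"
  using eqv_mult_right[of "X * z" "Y * z" w] by (simp add: mult.assoc)

lemma add_kill3:
  assumes Q: "Q0 ^ p \<approx> 0" "Q1 ^ p \<approx> 0" "Q2 ^ p \<approx> 0"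
  shows "(P + Cn c0 * Q0 + Cn c1 * Q1 + Cn c2 * Q2) ^ n * (Q0 ^ (p - 1) * Q1 ^ (p - 1) * Q2 ^ (p - 1)) \<approx>
    P ^ n * (Q0 ^ (p - 1) * Q1 ^ (p - 1) * Q2 ^ (p - 1))"
proof -
  define X2 X1 X0 z0 z1 z2 where "X2 = P + Cn c0 * Q0 + Cn c1 * Q1" and "X1 = P + Cn c0 * Q0"
    and "X0 = P" and "z0 = Q0 ^ (p - 1)" and "z1 = Q1 ^ (p - 1)" and "z2 = Q2 ^ (p - 1)"
  note defs = this
  have r: "z0 * z1 * z2 = z2 * (z0 * z1)" "z0 * z1 * z2 = z1 * (z0 * z2)" "z0 * z1 * z2 = z0 * (z1 * z2)"
    by (simp_all only: mult_ac)
  have "(X2 + Cn c2 * Q2) ^ n * (z2 * (z0 * z1)) \<approx> X2 ^ n * (z2 * (z0 * z1))"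
    unfolding defs(6) by (rule eqv_context[OF add_kill[OF Q(3)]])
  then have 1: "(X2 + Cn c2 * Q2) ^ n * (z0 * z1 * z2) \<approx> X2 ^ n * (z0 * z1 * z2)" unfolding r(1) .
  have "(X1 + Cn c1 * Q1) ^ n * (z1 * (z0 * z2)) \<approx> X1 ^ n * (z1 * (z0 * z2))"
    unfolding defs(5) by (rule eqv_context[OF add_kill[OF Q(2)]])
  then have 2: "X2 ^ n * (z0 * z1 * z2) \<approx> X1 ^ n * (z0 * z1 * z2)" unfolding r(2) by (simp only: defs(1,2))
  have "(X0 + Cn c0 * Q0) ^ n * (z0 * (z1 * z2)) \<approx> X0 ^ n * (z0 * (z1 * z2))"
    unfolding defs(4) by (rule eqv_context[OF add_kill[OF Q(1)]])
  then have 3: "X1 ^ n * (z0 * z1 * z2) \<approx> X0 ^ n * (z0 * z1 * z2)" unfolding r(3) by (simp only: defs(2,3))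
  show ?thesis using eqv_trans[OF 1 eqv_trans[OF 2 3]] unfolding defs .
qed

text \<open>Next to the (p-1)-st powers of the forms of \<open>b' 0\<close>, \<open>b' 1\<close>,
  \<open>b' 2\<close>, the vectors \<open>b 0\<close> and \<open>b 1\<close> may be replaced by
  their components along \<open>b' 3\<close> and \<open>b' 4\<close>. The coefficients there are the
  entries of \<open>gram b b'\<close>.\<close>

lemma half_pairing:
  assumes b': "frame b'"
  shows "lf \<beta> (b 0) ^ (p - 1) * lf \<beta> (b 1) ^ (p - 1) * (lf \<beta> (b' 0) ^ (p - 1) * lf \<beta> (b' 1) ^ (p - 1) * lf \<beta> (b' 2) ^ (p - 1))
    \<approx> Cn (gram b b' ^ (p - 1)) * PB \<beta> b'"
proof -
  let ?n = "p - 1"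
  let ?Z = "lf \<beta> (b' 0) ^ ?n * lf \<beta> (b' 1) ^ ?n * lf \<beta> (b' 2) ^ ?n"
  let ?P = "\<lambda>x. Cn (h x (b' 1)) * lf \<beta> (b' 3) + Cn (h x (b' 0)) * lf \<beta> (b' 4)"
  have k: "lf \<beta> x ^ ?n * ?Z \<approx> ?P x ^ ?n * ?Z" for x
  proof -
    let ?c = "\<lambda>i. h x (b' i)"
    have x: "lf \<beta> x = ?P x + Cn (?c 4) * lf \<beta> (b' 0) + Cn (?c 3) * lf \<beta> (b' 1) + Cn (?c 2) * lf \<beta> (b' 2)"
      unfolding lf_expansion[OF b', of \<beta> x] lessThan_5 by (simp add: algebra_simps)
    show ?thesis unfolding x by (rule add_kill3) (rule lf_power)+
  qed
  define Z A B C D where "Z = ?Z" and "A = lf \<beta> (b 0) ^ ?n" and "B = lf \<beta> (b 1) ^ ?n"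
    and "C = ?P (b 0) ^ ?n" and "D = ?P (b 1) ^ ?n"
  note defs = this
  have k0: "A * Z \<approx> C * Z" and k1: "B * Z \<approx> D * Z" unfolding defs by (rule k)+
  have gr: "(h (b 0) (b' 1) * h (b 1) (b' 0) - h (b 0) (b' 0) * h (b 1) (b' 1)) ^ ?n = gram b b' ^ ?n"
    using minus_power[of "gram b b'"] by (simp add: gram_def)
  have tf: "C * D \<approx> Cn (gram b b' ^ ?n) * (lf \<beta> (b' 3) ^ ?n * lf \<beta> (b' 4) ^ ?n)"
    unfolding defs gr[symmetric] by (rule two_forms[OF linear_form_lf linear_form_lf])
  have "A * B * Z = A * (B * Z)" by (rule mult.assoc)
  also have "\<dots> \<approx> A * (D * Z)" by (rule eqv_mult_left[OF k1])
  also have "\<dots> = D * (A * Z)" by (rule mult.left_commute)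
  also have "\<dots> \<approx> D * (C * Z)" by (rule eqv_mult_left[OF k0])
  also have "\<dots> = (C * D) * Z" by (simp only: mult_ac)
  also have "\<dots> \<approx> (Cn (gram b b' ^ ?n) * (lf \<beta> (b' 3) ^ ?n * lf \<beta> (b' 4) ^ ?n)) * Z"
    by (rule eqv_mult_right[OF tf])
  also have "(Cn (gram b b' ^ ?n) * (lf \<beta> (b' 3) ^ ?n * lf \<beta> (b' 4) ^ ?n)) * Z = Cn (gram b b' ^ ?n) * PB \<beta> b'"
    unfolding PB_def lessThan_5 Z_def by (simp add: mult_ac)
  finally show ?thesis unfolding defs .
qed

lemma pairing_WW:
  assumes b: "frame b" and b': "frame b'"
  shows "cf (WW b * sbst sw (WW b')) TopE = (gram b b' * gram b' b) ^ (p - 1) * (gg False b' * gg True b)"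
proof -
  let ?n = "p - 1"
  have "WW b * sbst sw (WW b') =
     (lf False (b 0) ^ ?n * lf False (b 1) ^ ?n * (lf False (b' 0) ^ ?n * lf False (b' 1) ^ ?n * lf False (b' 2) ^ ?n)) *
     (lf True (b' 0) ^ ?n * lf True (b' 1) ^ ?n * (lf True (b 0) ^ ?n * lf True (b 1) ^ ?n * lf True (b 2) ^ ?n))"
    unfolding WW_def by (simp only: sbst_power sbst_mult sw_lf) (simp only: power_mult_distrib mult_ac not_True_eq_False not_False_eq_True)
  also have "\<dots> \<approx> (Cn (gram b b' ^ ?n) * PB False b') * (Cn (gram b' b ^ ?n) * PB True b)"
    by (rule eqv_mult[OF half_pairing[OF b'] half_pairing[OF b]])
  also have "\<dots> \<approx> (Cn (gram b b' ^ ?n) * (Cn (gg False b') * MM TopF)) * (Cn (gram b' b ^ ?n) * (Cn (gg True b) * MM TopT))"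
    using PB_eqv[of False b'] PB_eqv[of True b] by (intro eqv_mult[OF eqv_mult_left eqv_mult_left]) simp_all
  also have "\<dots> = Cn ((gram b b' * gram b' b) ^ ?n * (gg False b' * gg True b)) * MM TopE"
    unfolding TopE_eq MM_add by (simp add: Cn_mult Cn_power power_mult_distrib mult_ac)
  finally show ?thesis using Tm_Tops(3) by (simp add: eqv_def lookup_MM)
qed

end

section \<open>The pairing\<close>

definition flip :: "(nat \<times> bool \<Rightarrow> nat) \<Rightarrow> nat \<times> bool \<Rightarrow> nat" where "flip m = (\<lambda>(i, b). m (i, \<not> b))"

lemma flip_flip [simp]: "flip (flip m) = m" by (auto simp: flip_def fun_eq_iff)

context witt
begin

definition db :: "(nat \<Rightarrow> 'v) \<Rightarrow> exps \<Rightarrow> 'k" where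
  "db b l = cf (MM (expo l) * sbst sw (WW b)) TopE"

lemma sum_db: "(\<Sum>l\<in>II. \<psi> l * db b l) = cf (Ev \<psi> * sbst sw (WW b)) TopE"
  unfolding Ev_def db_def by (simp add: sum_distrib_right lookup_sum mult.assoc)

lemma cf_TopE_eqv: "P \<approx> Q \<Longrightarrow> cf P TopE = cf Q TopE"
  using Tm_Tops(3) by (simp add: eqv_def)

lemma pairing_cb:
  assumes "frame b" "frame b'"
  shows "(\<Sum>l\<in>II. cb b l * db b' l) = (gram b b' * gram b' b) ^ (p - 1) * (gg False b' * gg True b)"
  unfolding sum_db pairing_WW[OF assms, symmetric]
  by (rule cf_TopE_eqv[OF eqv_mult_right[OF Ev_cb]])

lemma sbst_sw_MM: assumes "\<forall>x. x \<notin> Vars \<longrightarrow> m x = 0" shows "sbst sw (MM m) = MM (flip m)"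
proof -
  have "sbst sw (MM m) = (\<Prod>x\<in>Vars. XX x ^ flip m x)"
    unfolding sbst_MM prod_Vars by (rule prod.cong) (simp_all add: sw_def flip_def mult.commute)
  also have "\<dots> = MM (flip m)"
  proof (rule prod_XX, intro allI impI)
    fix x :: "nat \<times> bool" assume "x \<notin> Vars"
    then show "flip m x = 0" using assms by (cases x) (auto simp: flip_def)
  qed
  finally show ?thesis .
qed

lemma cf_sw: assumes "bihom a b Q" shows "cf (sbst sw Q) (flip n) = cf Q n"
proof -
  have inj: "flip n = flip m \<longleftrightarrow> n = m" for m by (metis flip_flip)
  have "sbst sw Q = (\<Sum>m\<in>kys Q. Cn (cf Q m) * sbst sw (MM m))"
    by (subst mp_expand_keys) (simp add: sbst_sum sbst_mult)
  also have "\<dots> = (\<Sum>m\<in>kys Q. Cn (cf Q m) * MM (flip m))"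
  proof (rule sum.cong[OF refl])
    fix m assume "m \<in> kys Q"
    then have "\<forall>x. x \<notin> Vars \<longrightarrow> m x = 0" using assms unfolding bihom_def by blast
    from sbst_sw_MM[OF this] show "Cn (cf Q m) * sbst sw (MM m) = Cn (cf Q m) * MM (flip m)"
      by (simp only:)
  qed
  finally have "cf (sbst sw Q) (flip n) = (\<Sum>m\<in>kys Q. cf Q m * (if n = m then 1 else 0))"
    by (simp add: lookup_sum lookup_MM inj)
  also have "\<dots> = (\<Sum>m\<in>kys Q. if m = n then cf Q m else 0)" by (rule sum.cong) auto
  also have "\<dots> = cf Q n" by (auto simp: in_keys_iff)
  finally show ?thesis .
qed

text \<open>For p = 2 the complement of such a monomial in the top monomial is the monomial itself
  with e and y exchanged, and \<open>sw\<close> undoes the exchange.\<close>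

lemma db_TT: assumes p2: "p = 2" and l: "l \<in> TT 5 2" shows "db b l = cb b l"
proof -
  have lII: "l \<in> II" using TT_II[OF p2] l by blast
  have len: "length l = 5" using II(2)[OF lII] .
  have s: "fst (l ! i) + snd (l ! i) = 1" if "i < 5" for i
    using l that len by (auto simp: TT_def)
  have top: "TopE = expo l + flip (expo l)"
  proof
    fix x :: "nat \<times> bool"
    obtain i c where x: "x = (i, c)" by force
    have "TopE (i, c) = (if i < 5 then 1 else 0)" unfolding TopE_def using p2 by simp
    then show "TopE x = (expo l + flip (expo l)) x"
      using s[of i] by (cases c) (auto simp: x expo_def flip_def)
  qed
  have "db b l = cf (sbst sw (WW b)) (flip (expo l))" unfolding db_def top by (rule lookup_MM_mult)
  also have "\<dots> = cf (WW b) (expo l)" by (rule cf_sw[OF bihom_WW])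
  finally show ?thesis using lII by (simp add: cb_def cff_def)
qed

text \<open>For p = 2, \<open>db_TT\<close> turns this into the sum of \<open>cb b\<close> over
  \<open>TT 5 2\<close>, which is 0 because \<open>cb b\<close> is invariant. So
  \<open>theta\<close> lies in the radical.\<close>

lemma theta_db: "(\<Sum>l\<in>II. theta l * db b l) = 0"
proof (cases "p = 2")
  case False
  then have "theta l = 0" for l by (simp add: theta_def)
  then show ?thesis by simp
next
  case True
  have th: "theta l = (if l \<in> TT 5 2 then 1 else 0)" for l unfolding theta_def using True by simp
  have "(\<Sum>l\<in>II. theta l * db b l) = (\<Sum>l\<in>II. if l \<in> TT 5 2 then db b l else 0)"
    by (rule sum.cong) (simp_all add: th)
  also have "\<dots> = (\<Sum>l\<in>TT 5 2. db b l)"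
    using TT_II[OF True] by (simp add: sum.If_cases II Int_absorb1)
  also have "\<dots> = (\<Sum>l\<in>TT 5 2. cb b l)" by (rule sum.cong) (simp_all add: db_TT[OF True])
  also have "\<dots> = 0" by (rule sum_TT_EE[OF True cb_EE])
  finally show ?thesis .
qed

section \<open>The unitary action\<close>

definition unitary :: "('v \<Rightarrow> 'v) \<Rightarrow> bool" where
  "unitary g \<longleftrightarrow> (\<forall>x y. g (x + y) = g x + g y) \<and> (\<forall>a x. g (scale a x) = scale a (g x)) \<and>
     (\<forall>x y. h (g x) (g y) = h x y)"

definition sg :: "('v \<Rightarrow> 'v) \<Rightarrow> nat \<times> bool \<Rightarrow> 'k mp" where "sg g = (\<lambda>(i, \<beta>). lf \<beta> (g (v i)))"

lemma linear_form_sg: "linear_form (sg g x)"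
  unfolding sg_def by (cases x) (simp add: linear_form_lf)

lemma bihom_sg: assumes "bihom a b P" shows "bihom a b (sbst (sg g) P)"
  by (rule bihom_sbst[OF _ _ assms]) (simp_all only: sg_def prod.case bihom_lf)

lemma unitary_sum: assumes "unitary g" shows "g (\<Sum>i\<in>A. scale (c i) (f i)) = (\<Sum>i\<in>A. scale (c i) (g (f i)))"
proof -
  have "g (scale 0 0) = scale 0 (g 0)" using assms unfolding unitary_def by blast
  then have "g 0 = 0" by simp
  then show ?thesis using assms
    by (induction A rule: infinite_finite_induct) (simp_all add: unitary_def)
qed

lemma sbst_sg_lf: assumes "unitary g" shows "sbst (sg g) (lf \<beta> x) = lf \<beta> (g x)"
proof -
  have "g x = (\<Sum>i<5. scale (h x (v (4 - i))) (g (v i)))"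
    using arg_cong[OF expansion[OF v, of x], of g] by (simp only: unitary_sum[OF assms])
  then show ?thesis by (simp add: sbst_lf sg_def lf_sum lf_scale)
qed

lemma sbst_sg_WW: "unitary g \<Longrightarrow> sbst (sg g) (WW b) = WW (g \<circ> b)"
  by (simp add: WW_def sbst_power sbst_mult sbst_sg_lf)

lemma frame_unitary: "unitary g \<Longrightarrow> frame b \<Longrightarrow> frame (g \<circ> b)"
  by (simp add: frame_def unitary_def)

lemma tau_apply: "tau (i, True) = XX (i, True)" "tau (i, False) = XX (i, False) + XX (i, True)"
  by (simp_all add: tau_def)

lemma sw_apply: "sw (i, \<beta>) = XX (i, \<not> \<beta>)"
  by (simp add: sw_def)

text \<open>The unitary map acts on the index of a variable and \<open>tau\<close> on its kind, so
  the two commute.\<close>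

lemma tau_sg: "sbst tau (sbst (sg g) P) = sbst (sg g) (sbst tau P)"
  unfolding sbst_sbst
proof (rule sbst_cong)
  fix x assume "x \<in> Vars"
  moreover obtain i \<beta> where "x = (i, \<beta>)" by force
  ultimately show "sbst tau (sg g x) = sbst (sg g) (tau x)"
    by (cases \<beta>) (simp_all add: sg_def tau_lf tau_apply sbst_XX sbst_add)
qed

lemma sw_sg: "sbst sw (sbst (sg g) P) = sbst (sg g) (sbst sw P)"
  unfolding sbst_sbst
proof (rule sbst_cong)
  fix x assume "x \<in> Vars"
  moreover obtain i \<beta> where "x = (i, \<beta>)" by force
  ultimately show "sbst sw (sg g x) = sbst (sg g) (sw x)"
    by (simp add: sg_def sw_lf sw_apply sbst_XX)
qed

definition ker :: "('v \<Rightarrow> 'v) \<Rightarrow> exps \<Rightarrow> exps \<Rightarrow> 'k" where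
  "ker g l' l = cff (sbst (sg g) (MM (expo l'))) l"

lemma cff_sg_Ev: "cff (sbst (sg g) (Ev \<psi>)) l = (\<Sum>l'\<in>II. \<psi> l' * ker g l' l)"
  by (simp add: Ev_def ker_def cff_def sbst_sum sbst_mult lookup_sum)

lemma ker_EE: assumes "\<psi> \<in> EE" shows "(\<lambda>l. \<Sum>l'\<in>II. \<psi> l' * ker g l' l) \<in> EE"
proof -
  have T: "\<psi> \<in> Tr 5 (2 * int p - 2) (3 * int p - 3)" using assms by (simp add: Inv_def)
  have "cff (sbst (sg g) (Ev \<psi>)) \<in> EE"
  proof (rule cff_EE[OF bihom_sg[OF bihom_Ev]])
    have "sbst tau (sbst (sg g) (Ev \<psi>)) = sbst (sg g) (sbst tau (Ev \<psi>))" by (rule tau_sg)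
    also have "\<dots> \<approx> sbst (sg g) (Ev \<psi>)"
      using EE_iff[OF T] assms by (intro sbst_eqv linear_form_sg) simp
    finally show "sbst tau (sbst (sg g) (Ev \<psi>)) \<approx> sbst (sg g) (Ev \<psi>)" .
  qed
  moreover have "cff (sbst (sg g) (Ev \<psi>)) = (\<lambda>l. \<Sum>l'\<in>II. \<psi> l' * ker g l' l)"
    by (rule HOL.ext) (rule cff_sg_Ev)
  ultimately show ?thesis by simp
qed

lemma bihom_sw_WW: "bihom (3 * p - 3) (2 * p - 2) (sbst sw (WW b))"
proof -
  have "bihom ((p - 1) * (0 + 0 + (1 + 1 + 1))) ((p - 1) * (1 + 1 + (0 + 0 + 0))) (sbst sw (WW b))"
    unfolding WW_def sbst_power sbst_mult sw_lf not_True_eq_False not_False_eq_True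
    by (intro bihom_power bihom_mult bihom_lf)
  moreover have "(p - 1) * (1 + 1 + (0 + 0 + 0)) = 2 * p - 2" "(p - 1) * (0 + 0 + (1 + 1 + 1)) = 3 * p - 3"
    by (simp_all add: algebra_simps diff_mult_distrib2)
  ultimately show ?thesis by (simp only:)
qed

text \<open>The product with \<open>sbst sw (WW b)\<close> has top bidegree and is congruent to a
  multiple of the top monomial. By \<open>unip\<close> the action of g preserves the coefficient of
  that monomial, so the pairing is invariant.\<close>

lemma ker_db:
  assumes g: "unitary g" and unip: "cf (sbst (sg g) (MM TopE)) TopE = 1" and l': "l' \<in> II"
  shows "(\<Sum>l\<in>II. ker g l' l * db (g \<circ> b) l) = db b l'"
proof -
  let ?S = "sbst (sg g) (MM (expo l'))" and ?P = "MM (expo l') * sbst sw (WW b)"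
  have K: "(\<lambda>l. ker g l' l) = cff ?S" by (rule HOL.ext) (rule ker_def)
  have "(\<Sum>l\<in>II. ker g l' l * db (g \<circ> b) l) = cf (Ev (cff ?S) * sbst sw (WW (g \<circ> b))) TopE"
    unfolding K[symmetric] sum_db ..
  also have "\<dots> = cf (?S * sbst sw (WW (g \<circ> b))) TopE"
    by (rule cf_TopE_eqv[OF eqv_mult_right[OF Ev_cff[OF bihom_sg[OF bihom_expo[OF l']]]]])
  also have "?S * sbst sw (WW (g \<circ> b)) = sbst (sg g) ?P"
    unfolding sbst_sg_WW[OF g, symmetric] sw_sg sbst_mult ..
  also have "cf (sbst (sg g) ?P) TopE = cf (sbst (sg g) (Cn (cf ?P TopE) * MM TopE)) TopE"
  proof (rule cf_TopE_eqv, rule sbst_eqv[OF linear_form_sg], rule top_only_E)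
    have "bihom (2 * p - 2 + (3 * p - 3)) (3 * p - 3 + (2 * p - 2)) ?P"
      by (rule bihom_mult[OF bihom_expo[OF l'] bihom_sw_WW])
    moreover have "2 * p - 2 + (3 * p - 3) = 5 * (p - 1)" "3 * p - 3 + (2 * p - 2) = 5 * (p - 1)"
      using p_pos by auto
    ultimately show "bihom (5 * (p - 1)) (5 * (p - 1)) ?P" by (simp only:)
  qed
  also have "\<dots> = cf ?P TopE" unfolding sbst_mult sbst_Cn lookup_Cn_mult unip by simp
  finally show ?thesis unfolding db_def .
qed

end

section \<open>Heights\<close>

text \<open>The weights are chosen so that lowering the index of one variable by one raises the
  height by one.\<close>

definition hgt :: "(nat \<times> bool \<Rightarrow> nat) \<Rightarrow> nat" where "hgt m = (\<Sum>x\<in>Vars. (4 - fst x) * m x)"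

lemma hgt_add: "hgt (m + n) = hgt m + hgt n"
  by (simp add: hgt_def distrib_left sum.distrib)

lemma hgt_dlt: "x \<in> Vars \<Longrightarrow> hgt (dlt x) = 4 - fst x"
  by (simp add: hgt_def dlt_def if_distrib cong: if_cong)

definition HH :: "nat \<Rightarrow> 'k :: comm_ring_1 mp \<Rightarrow> bool" where "HH n P \<longleftrightarrow> (\<forall>m\<in>kys P. n \<le> hgt m)"

lemma HH_add: "HH n P \<Longrightarrow> HH n Q \<Longrightarrow> HH n (P + Q)"
  using keys_add[of P Q] by (auto simp: HH_def)

lemma HH_0: "HH n 0" by (simp add: HH_def)

lemma HH_mono: "HH n P \<Longrightarrow> n' \<le> n \<Longrightarrow> HH n' P"
  by (auto simp: HH_def)

lemma HH_mult: assumes "HH a P" "HH b Q" shows "HH (a + b) (P * Q)"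
  unfolding HH_def
proof
  fix m assume "m \<in> kys (P * Q)"
  then obtain m1 m2 where "m1 \<in> kys P" "m2 \<in> kys Q" "m = m1 + m2" using keys_mult[of P Q] by blast
  then show "a + b \<le> hgt m" using assms unfolding HH_def by (simp only: hgt_add) (simp add: add_mono)
qed

lemma HH_Cn_mult: "HH n P \<Longrightarrow> HH n (Cn c * P)"
  using keys_Cn_mult[of c P] by (auto simp: HH_def)

lemma HH_MM: "HH (hgt m) (MM m)"
  by (simp add: HH_def MM_def)

lemma HH_cf: "HH n P \<Longrightarrow> hgt m < n \<Longrightarrow> cf P m = 0"
  unfolding HH_def by (auto simp: in_keys_iff not_le[symmetric])

text \<open>A first-order Taylor expansion with respect to the filtration by height; A takes the
  part of the derivative, and \<open>FO_mult\<close> is the product rule.\<close>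

definition FO :: "nat \<Rightarrow> 'k :: comm_ring_1 mp \<Rightarrow> 'k mp \<Rightarrow> 'k mp \<Rightarrow> bool" where
  "FO n P A S \<longleftrightarrow> HH n P \<and> HH (Suc n) A \<and> (\<exists>R. HH (n + 2) R \<and> S = P + A + R)"

lemma FO_1: "FO 0 1 0 1"
  unfolding FO_def by (intro conjI exI[of _ 0]) (simp_all add: HH_0 HH_def)

lemma FO_mult:
  assumes "FO n P A S" "FO n' P' A' S'"
  shows "FO (n + n') (P * P') (A * P' + P * A') (S * S')"
proof -
  from assms obtain R R' where R: "HH n P" "HH (Suc n) A" "HH (n + 2) R" "S = P + A + R"
    and R': "HH n' P'" "HH (Suc n') A'" "HH (n' + 2) R'" "S' = P' + A' + R'"
    unfolding FO_def by auto
  let ?R = "A * A' + (P + A) * R' + R * S'"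
  have PA: "HH n (P + A)" by (rule HH_add[OF R(1) HH_mono[OF R(2)]]) simp
  have S': "HH n' S'" unfolding R'(4)
    by (intro HH_add R'(1) HH_mono[OF R'(2)] HH_mono[OF R'(3)]) simp_all
  have "HH (n + n' + 2) ?R"
  proof (intro HH_add)
    show "HH (n + n' + 2) (A * A')" using HH_mult[OF R(2) R'(2)] by simp
    show "HH (n + n' + 2) ((P + A) * R')" using HH_mult[OF PA R'(3)] by (simp add: add.assoc)
    show "HH (n + n' + 2) (R * S')" using HH_mult[OF R(3) S'] by (simp add: ac_simps)
  qed
  moreover have "HH (Suc (n + n')) (A * P' + P * A')"
    using HH_mult[OF R(2) R'(1)] HH_mult[OF R(1) R'(2)] by (intro HH_add) simp_all
  moreover have "S * S' = P * P' + (A * P' + P * A') + ?R"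
    unfolding R(4) by (simp add: R'(4) algebra_simps)
  ultimately show ?thesis unfolding FO_def using HH_mult[OF R(1) R'(1)] by blast
qed

lemma FO_power: assumes "FO n P A S" shows "FO (k * n) (P ^ k) (of_nat k * P ^ (k - 1) * A) (S ^ k)"
proof (induction k)
  case 0
  then show ?case using FO_1 by simp
next
  case (Suc k)
  have "FO (n + k * n) (P * P ^ k) (A * P ^ k + P * (of_nat k * P ^ (k - 1) * A)) (S * S ^ k)"
    by (rule FO_mult[OF assms Suc.IH])
  moreover have "A * P ^ k + P * (of_nat k * P ^ (k - 1) * A) = of_nat (Suc k) * P ^ (Suc k - 1) * A"
    by (cases k) (simp_all add: algebra_simps)
  ultimately show ?case by simp
qed

lemma FO_prod:
  assumes "finite F" "\<And>x. x \<in> F \<Longrightarrow> FO (n x) (P x) (A x) (S x)"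
  shows "FO (sum n F) (prod P F) (\<Sum>x\<in>F. A x * prod P (F - {x})) (prod S F)"
  using assms
proof (induction F)
  case empty
  then show ?case using FO_1 by simp
next
  case (insert y F)
  have "FO (n y + sum n F) (P y * prod P F) (A y * prod P F + P y * (\<Sum>x\<in>F. A x * prod P (F - {x}))) (S y * prod S F)"
    using insert by (intro FO_mult) auto
  moreover have "(\<Sum>x\<in>insert y F. A x * prod P (insert y F - {x})) = A y * prod P F + P y * (\<Sum>x\<in>F. A x * prod P (F - {x}))"
  proof -
    have "A x * prod P (insert y F - {x}) = P y * (A x * prod P (F - {x}))" if "x \<in> F" for x
    proof -
      have "insert y F - {x} = insert y (F - {x})" using that insert.hyps by auto
      then show ?thesis using insert.hyps by (simp add: mult_ac)
    qed
    then have "(\<Sum>x\<in>F. A x * prod P (insert y F - {x})) = P y * (\<Sum>x\<in>F. A x * prod P (F - {x}))"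
      unfolding sum_distrib_left by (rule sum.cong[OF refl])
    moreover have "insert y F - {y} = F" using insert.hyps by auto
    ultimately show ?thesis using insert.hyps by simp
  qed
  ultimately show ?case using insert.hyps by simp
qed

definition low :: "nat \<times> bool \<Rightarrow> nat \<times> bool" where "low x = (fst x - 1, snd x)"

text \<open>The derivation that sends a variable of index i to \<open>r i\<close> times the variable
  of the same kind of index i - 1. Where the subtraction of \<open>dlt x\<close> is cut off at 0,
  the factor \<open>m x\<close> is 0.\<close>

definition DD :: "(nat \<Rightarrow> 'k :: comm_ring_1) \<Rightarrow> (nat \<times> bool \<Rightarrow> nat) \<Rightarrow> 'k mp" where
  "DD r m = (\<Sum>x\<in>Vars. Cn (of_nat (m x) * r (fst x)) * MM (\<lambda>y. m y - dlt x y + dlt (low x) y))"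

lemma DD_derivation:
  fixes r :: "nat \<Rightarrow> 'k :: comm_ring_1"
  assumes m: "\<forall>x. x \<notin> Vars \<longrightarrow> m x = 0"
  shows "(\<Sum>x\<in>Vars. (of_nat (m x) * XX x ^ (m x - 1) * (Cn (r (fst x)) * XX (low x))) * (\<Prod>y\<in>Vars - {x}. XX y ^ m y)) = DD r m"
  unfolding DD_def
proof (rule sum.cong[OF refl])
  fix x assume x: "x \<in> Vars"
  show "(of_nat (m x) * XX x ^ (m x - 1) * (Cn (r (fst x)) * XX (low x))) * (\<Prod>y\<in>Vars - {x}. XX y ^ m y) =
    Cn (of_nat (m x) * r (fst x)) * MM (\<lambda>y. m y - dlt x y + dlt (low x) y)"
  proof (cases "m x = 0")
    case False
    have "XX x ^ (m x - 1) * (\<Prod>y\<in>Vars - {x}. XX y ^ m y) = (\<Prod>y\<in>Vars. XX y ^ (m y - dlt x y) :: 'k mp)"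
    proof -
      have "(\<Prod>y\<in>Vars. XX y ^ (m y - dlt x y) :: 'k mp) = XX x ^ (m x - dlt x x) * (\<Prod>y\<in>Vars - {x}. XX y ^ (m y - dlt x y))"
        using x by (simp add: prod.remove)
      also have "(\<Prod>y\<in>Vars - {x}. XX y ^ (m y - dlt x y)) = (\<Prod>y\<in>Vars - {x}. XX y ^ m y)"
        by (rule prod.cong) (auto simp: dlt_def)
      finally have *: "(\<Prod>y\<in>Vars. XX y ^ (m y - dlt x y) :: 'k mp) = XX x ^ (m x - dlt x x) * (\<Prod>y\<in>Vars - {x}. XX y ^ m y)" .
      have "dlt x x = 1" by (simp add: dlt_def)
      then show ?thesis unfolding * by simp
    qed
    also have "\<dots> = MM (\<lambda>y. m y - dlt x y)" by (rule prod_XX) (simp add: m)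
    finally have e: "XX x ^ (m x - 1) * (\<Prod>y\<in>Vars - {x}. XX y ^ m y) = (MM (\<lambda>y. m y - dlt x y) :: 'k mp)" .
    have "(\<lambda>y. m y - dlt x y + dlt (low x) y) = (\<lambda>y. m y - dlt x y) + dlt (low x)"
      by (simp add: fun_eq_iff)
    then have "(MM (\<lambda>y. m y - dlt x y + dlt (low x) y) :: 'k mp) = MM (\<lambda>y. m y - dlt x y) * XX (low x)"
      by (simp only: MM_add XX_def)
    then have "(MM (\<lambda>y. m y - dlt x y + dlt (low x) y) :: 'k mp) = (XX x ^ (m x - 1) * (\<Prod>y\<in>Vars - {x}. XX y ^ m y)) * XX (low x)"
      unfolding e .
    then show ?thesis by (simp add: Cn_mult Cn_of_nat mult_ac)
  qed simp
qed

context witt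
begin

text \<open>g is unitriangular with respect to v, with the entries r next to the diagonal; R
  collects what gains at least two in height.\<close>

definition up :: "('v \<Rightarrow> 'v) \<Rightarrow> (nat \<Rightarrow> 'k) \<Rightarrow> bool" where
  "up g r \<longleftrightarrow> r 0 = 0 \<and> (\<forall>i<5. \<forall>\<beta>. \<exists>R. HH (4 - i + 2) R \<and>
     lf \<beta> (g (v i)) = XX (i, \<beta>) + Cn (r i) * XX (i - 1, \<beta>) + R)"

lemma FO_sg:
  assumes up: "up g r" and m: "\<forall>x. x \<notin> Vars \<longrightarrow> m x = 0"
  shows "FO (hgt m) (MM m) (DD r m) (sbst (sg g) (MM m))"
proof -
  have one: "FO (4 - fst x) (XX x) (Cn (r (fst x)) * XX (low x)) (sg g x)" if x: "x \<in> Vars" for x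
  proof -
    obtain i \<beta> where i: "x = (i, \<beta>)" "i < 5" using x by (cases x) auto
    obtain R where R: "HH (4 - i + 2) R" "lf \<beta> (g (v i)) = XX (i, \<beta>) + Cn (r i) * XX (i - 1, \<beta>) + R"
      using up i unfolding up_def by blast
    have "HH (4 - i) (XX (i, \<beta>) :: 'k mp)" using HH_MM[of "dlt (i, \<beta>)"] i by (simp add: XX_def hgt_dlt)
    moreover have "HH (Suc (4 - i)) (Cn (r i) * XX (i - 1, \<beta>))"
    proof (cases "i = 0")
      case True
      then show ?thesis using up by (simp add: up_def HH_0)
    next
      case False
      then have "Suc (4 - i) = 4 - (i - 1)" using i by simp
      then show ?thesis using HH_Cn_mult[OF HH_MM[of "dlt (i - 1, \<beta>)"]] i by (simp add: XX_def hgt_dlt)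
    qed
    ultimately show ?thesis unfolding FO_def using R i by (auto simp: sg_def low_def)
  qed
  have "FO (\<Sum>x\<in>Vars. m x * (4 - fst x)) (\<Prod>x\<in>Vars. XX x ^ m x)
    (\<Sum>x\<in>Vars. (of_nat (m x) * XX x ^ (m x - 1) * (Cn (r (fst x)) * XX (low x))) * (\<Prod>y\<in>Vars - {x}. XX y ^ m y))
    (\<Prod>x\<in>Vars. sg g x ^ m x)"
    by (rule FO_prod[OF finite_Vars]) (rule FO_power[OF one])
  then show ?thesis unfolding DD_derivation[OF m] prod_XX[OF m] sbst_MM hgt_def by (simp add: mult.commute)
qed

lemma cf_sg:
  assumes up: "up g r" and m: "\<forall>x. x \<notin> Vars \<longrightarrow> m x = 0"
  shows "hgt n \<le> hgt m \<Longrightarrow> cf (sbst (sg g) (MM m)) n = (if n = m then 1 else 0)"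
    "hgt n = Suc (hgt m) \<Longrightarrow> cf (sbst (sg g) (MM m)) n = cf (DD r m) n"
    "hgt n \<noteq> Suc (hgt m) \<Longrightarrow> hgt n \<le> hgt m \<Longrightarrow> cf (DD r m) n = 0"
proof -
  obtain R where R: "HH (Suc (hgt m)) (DD r m)" "HH (hgt m + 2) R" "sbst (sg g) (MM m) = MM m + DD r m + R"
    using FO_sg[OF assms] unfolding FO_def by blast
  show "cf (sbst (sg g) (MM m)) n = (if n = m then 1 else 0)" if "hgt n \<le> hgt m"
    unfolding R(3) lookup_add using HH_cf[OF R(1), of n] HH_cf[OF R(2), of n] that by (simp add: lookup_MM)
  show "cf (sbst (sg g) (MM m)) n = cf (DD r m) n" if "hgt n = Suc (hgt m)"
    unfolding R(3) lookup_add using HH_cf[OF R(2), of n] that by (auto simp: lookup_MM)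
  show "cf (DD r m) n = 0" if "hgt n \<le> hgt m"
    using HH_cf[OF R(1), of n] that by simp
qed

end

section \<open>Frobenius twists and the matrices of the raising operators\<close>

context char_p
begin

lemma frobenius_sum: "(\<Sum>x\<in>A. f x :: 'k) ^ (p ^ n) = (\<Sum>x\<in>A. f x ^ (p ^ n))"
  by (rule freshmans_dream_sum') (simp_all add: char_k prime_p)

lemma frobenius_add: "(a + b :: 'k) ^ (p ^ n) = a ^ (p ^ n) + b ^ (p ^ n)"
  by (rule freshmans_dream') (simp_all add: char_k prime_p)

lemma frobenius_minus: "(- a :: 'k) ^ (p ^ n) = - (a ^ (p ^ n))"
  using frobenius_add[of a "- a" n] p_pos by (simp add: eq_neg_iff_add_eq_0 add.commute power_0_left)

lemma frobenius_diff: "(a - b :: 'k) ^ (p ^ n) = a ^ (p ^ n) - b ^ (p ^ n)"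
  using frobenius_add[of a "- b" n] by (simp add: frobenius_minus)

lemma of_nat_frobenius: "(of_nat m :: 'k) ^ (p ^ n) = of_nat m"
proof (induction m)
  case 0
  then show ?case using p_pos by (simp add: power_0_left)
next
  case (Suc m)
  then show ?case by (simp add: frobenius_add)
qed

lemma DU_frobenius: "DU n (\<lambda>l. \<psi> l ^ (p ^ j)) l = (DU n \<psi> l :: 'k) ^ (p ^ j)"
proof (induction l arbitrary: n \<psi>)
  case Nil
  then show ?case using p_pos by (simp add: power_0_left)
next
  case (Cons x l)
  show ?case by (simp add: Cons.IH frobenius_sum power_mult_distrib of_nat_frobenius)
qed

text \<open>The linear equations that define \<open>EE0\<close> have coefficients in the prime
  field.\<close>

lemma EE0_frobenius:
  assumes "\<psi> \<in> EE0" shows "(\<lambda>l. \<psi> l ^ (p ^ j)) \<in> EE0"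
proof -
  have z: "(x :: 'k) ^ (p ^ j) = 0 \<longleftrightarrow> x = 0" for x using p_pos by simp
  have "\<psi> \<in> EE" "p = 2 \<longrightarrow> \<psi> iota1 = 0" using assms by (simp_all add: EE0_def)
  then have "(\<lambda>l. \<psi> l ^ (p ^ j)) \<in> EE" unfolding Inv_def Tr_def mem_Collect_eq DU_frobenius z by blast
  moreover have "p = 2 \<longrightarrow> \<psi> iota1 ^ (p ^ j) = 0" unfolding z by fact
  ultimately show ?thesis unfolding EE0_def by blast
qed

lemma EE0_II: assumes "\<psi> \<in> EE0" "\<psi> l \<noteq> 0" shows "l \<in> II"
proof -
  have "\<psi> \<in> EE" using assms(1) by (simp add: EE0_def)
  from Inv_support[OF this assms(2)] show ?thesis by (simp add: LL_def)
qed

definition II0 :: "exps set" where "II0 = {l \<in> II. p = 2 \<longrightarrow> l \<noteq> iota1}"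

lemma II0_subset: "II0 \<subseteq> II" by (auto simp: II0_def)

lemma finite_II0: "finite II0" using II0_subset II(1) finite_subset by blast

lemma EE0_II0: assumes "\<psi> \<in> EE0" "\<psi> l \<noteq> 0" shows "l \<in> II0"
proof -
  have "p = 2 \<longrightarrow> \<psi> iota1 = 0" using assms(1) unfolding EE0_def by blast
  then show ?thesis using EE0_II[OF assms] assms(2) unfolding II0_def by auto
qed

lemma sum_II0:
  assumes "\<And>l. l \<in> II \<Longrightarrow> l \<notin> II0 \<Longrightarrow> f l = 0"
  shows "(\<Sum>l\<in>II. f l) = (\<Sum>l\<in>II0. f l)"
  by (rule sum.mono_neutral_right[OF II(1) II0_subset]) (use assms in blast)

definition ht :: "exps \<Rightarrow> nat" where "ht l = hgt (expo l)"

lemma ht_eq: assumes "length l = 5" shows "ht l = (\<Sum>i<5. (4 - i) * (fst (l ! i) + snd (l ! i)))"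
proof -
  have "(\<Sum>x\<in>Vars. f x) = (\<Sum>i<5. f (i, False) + f (i, True))" for f :: "nat \<times> bool \<Rightarrow> nat"
    unfolding Vars_def by (simp add: UNIV_bool sum.cartesian_product' add.commute)
  then show ?thesis by (simp add: ht_def hgt_def distrib_left)
qed

text \<open>With exponents at most p - 1 and both degrees fixed, the weights 4, 3, 2, 1, 0 are
  exploited best by filling the variables of lowest index, two of kind e and three of kind
  y.\<close>

lemma ht_max: assumes "l \<in> II" shows "ht l \<le> ht iota0"
proof -
  have len: "length l = 5" "trunc l" using II assms by auto
  have d: "deg1 l = 2 * int p - 2" "deg2 l = 3 * int p - 3" using assms by (auto simp: LL_def)
  have b: "fst (l ! i) \<le> p - 1 \<and> snd (l ! i) \<le> p - 1" if "i < 5" for i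
  proof -
    have "l ! i \<in> set l" using that len by simp
    then have "fst (l ! i) < p" "snd (l ! i) < p" using len(2) unfolding trunc_def by auto
    then show ?thesis by linarith
  qed
  have s: "(\<Sum>i<5. int (fst (l ! i))) = 2 * int p - 2" "(\<Sum>i<5. int (snd (l ! i))) = 3 * int p - 3"
    using d len by (simp_all add: deg1_def deg2_def sum_list_sum_nth atLeast0LessThan)
  have b': "int (fst (l ! i)) \<le> int p - 1 \<and> int (snd (l ! i)) \<le> int p - 1" if "i < 5" for i
    using b[OF that] p_pos by auto
  have s': "int (fst (l ! 0)) + int (fst (l ! 1)) + int (fst (l ! 2)) + int (fst (l ! 3)) + int (fst (l ! 4)) = 2 * int p - 2"
    "int (snd (l ! 0)) + int (snd (l ! 1)) + int (snd (l ! 2)) + int (snd (l ! 3)) + int (snd (l ! 4)) = 3 * int p - 3"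
    using s unfolding lessThan_5 by simp_all
  have "int (ht l) = 4 * (int (fst (l ! 0)) + int (snd (l ! 0))) + 3 * (int (fst (l ! 1)) + int (snd (l ! 1))) +
      2 * (int (fst (l ! 2)) + int (snd (l ! 2))) + (int (fst (l ! 3)) + int (snd (l ! 3)))"
    using len by (simp add: ht_eq lessThan_5)
  moreover have "int (ht iota0) = 16 * int p - 16"
    using p_pos by (simp add: ht_eq iota0_def lessThan_5 of_nat_diff)
  ultimately have "int (ht l) \<le> int (ht iota0)"
    using b'[of 0] b'[of 1] b'[of 2] b'[of 3] b'[of 4] s' by simp
  then show ?thesis by simp
qed

lemma ht_theta: assumes "theta l \<noteq> 0" shows "ht l = ht iota1"
proof -
  have p2: "p = 2" "l \<in> TT 5 2" using assms by (auto simp: theta_def split: if_splits)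
  then have len: "length l = 5" and s: "\<And>i. i < 5 \<Longrightarrow> fst (l ! i) + snd (l ! i) = 1"
    by (auto simp: TT_def)
  show ?thesis using s[of 0] s[of 1] s[of 2] s[of 3] s[of 4] len by (simp add: ht_eq iota1_def lessThan_5)
qed

text \<open>The matrix of the raising operator from index i to i - 1 on monomials, with natural
  numbers as entries; \<open>cf_DD\<close> splits \<open>DD\<close> into these matrices.\<close>

definition NN :: "nat \<Rightarrow> (nat \<times> bool \<Rightarrow> nat) \<Rightarrow> (nat \<times> bool \<Rightarrow> nat) \<Rightarrow> nat" where
  "NN i m n = (\<Sum>c\<in>UNIV. m (i, c) * (if n = (\<lambda>y. m y - dlt (i, c) y + dlt (i - 1, c) y) then 1 else 0))"

lemma cf_DD: "cf (DD r m) n = (\<Sum>i<5. r i * of_nat (NN i m n) :: 'k)"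
  unfolding DD_def NN_def lookup_sum lookup_Cn_mult lookup_MM Vars_def low_def
  by (simp add: sum.cartesian_product' UNIV_bool sum.distrib distrib_left)
    (rule arg_cong2[where f = "(+)"]; rule sum.cong; simp)

lemma sum_NN_term:
  fixes c :: bool and l :: exps and i :: nat and \<psi> :: "exps \<Rightarrow> 'k"
  assumes supp: "\<forall>l. \<psi> l \<noteq> 0 \<longrightarrow> l \<in> II" and i: "0 < i" "i < 5"
  defines "m \<equiv> \<lambda>z. int (expo l z) + int (dlt (i, c) z) - int (dlt (i - 1, c) z)"
  shows "(\<Sum>l'\<in>II. \<psi> l' * of_nat (expo l' (i, c) * (if expo l = (\<lambda>y. expo l' y - dlt (i, c) y + dlt (i - 1, c) y) then 1 else 0)))
    = of_nat (expo l (i, c) + 1) * (ext \<psi> (\<lambda>y. m (y, False)) (\<lambda>y. m (y, True)) :: 'k)"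
proof -
  let ?L = "map (\<lambda>y. (nat (m (y, False)), nat (m (y, True)))) [0..<5]"
  let ?nn = "\<forall>x<5. 0 \<le> m (x, False) \<and> 0 \<le> m (x, True)"
  let ?e = "\<lambda>l'. expo l = (\<lambda>y. expo l' y - dlt (i, c) y + dlt (i - 1, c) y)"
  have ne: "(i - 1, c) \<noteq> (i, c)" using i by simp
  have key: "expo l' (i, c) \<ge> 1 \<and> ?e l' \<longleftrightarrow> ?nn \<and> l' = ?L" if len: "length l' = 5" for l'
  proof
    assume a: "expo l' (i, c) \<ge> 1 \<and> ?e l'"
    have z: "int (expo l' z) = m z" for z
      using fun_cong[OF conjunct2[OF a], of z] a ne unfolding m_def dlt_def by (cases "z = (i, c)") auto
    have "0 \<le> m z" for z unfolding z[symmetric] by simp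
    moreover have "l' = ?L"
    proof (rule nth_equalityI)
      fix y assume "y < length l'"
      then have y: "y < 5" using len by simp
      show "l' ! y = ?L ! y" using y unfolding z[symmetric] by simp
    qed (use len in simp)
    ultimately show "?nn \<and> l' = ?L" by blast
  next
    assume a: "?nn \<and> l' = ?L"
    have z: "int (expo l' z) = m z" for z
    proof -
      obtain y b where yb: "z = (y, b)" by force
      show ?thesis
      proof (cases "y < 5")
        case True
        then show ?thesis using a unfolding yb by (cases b) auto
      next
        case False
        then show ?thesis using i unfolding yb m_def by (auto simp: expo_def dlt_def)
      qed
    qed
    have "expo l' (i, c) \<ge> 1" using z[of "(i, c)"] ne unfolding m_def dlt_def by simp
    moreover have "?e l'"
    proof
      fix y show "expo l y = expo l' y - dlt (i, c) y + dlt (i - 1, c) y"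
        using z[of y] ne unfolding m_def dlt_def by (auto split: if_splits)
    qed
    ultimately show "expo l' (i, c) \<ge> 1 \<and> ?e l'" by blast
  qed
  have val: "expo l' (i, c) = expo l (i, c) + 1" if "expo l' (i, c) \<ge> 1" "?e l'" for l'
    using fun_cong[OF that(2), of "(i, c)"] that(1) ne by (simp add: dlt_def)
  have "(\<Sum>l'\<in>II. \<psi> l' * of_nat (expo l' (i, c) * (if ?e l' then 1 else 0)))
     = (\<Sum>l'\<in>II. if l' = ?L then (if ?nn then of_nat (expo l (i, c) + 1) * \<psi> l' else 0) else 0)"
  proof (rule sum.cong[OF refl])
    fix l' assume "l' \<in> II"
    then have k: "expo l' (i, c) \<ge> 1 \<and> ?e l' \<longleftrightarrow> ?nn \<and> l' = ?L" using II(2) by (intro key)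
    show "\<psi> l' * of_nat (expo l' (i, c) * (if ?e l' then 1 else 0)) =
      (if l' = ?L then (if ?nn then of_nat (expo l (i, c) + 1) * \<psi> l' else 0) else 0)"
    proof (cases "expo l' (i, c) \<ge> 1 \<and> ?e l'")
      case True
      then have "?nn" "l' = ?L" using k by blast+
      moreover have "expo l' (i, c) = expo l (i, c) + 1" using val True by blast
      ultimately show ?thesis using True by simp
    next
      case False
      then have "\<not> (?nn \<and> l' = ?L)" using k by blast
      moreover have "expo l' (i, c) * (if ?e l' then 1 else 0) = 0" using False by auto
      ultimately show ?thesis by auto
    qed
  qed
  also have "\<dots> = (if ?nn then of_nat (expo l (i, c) + 1) * \<psi> ?L else 0)"
    using spec[OF supp, of ?L] II(1) by (auto simp: sum.delta)
  also have "\<dots> = of_nat (expo l (i, c) + 1) * ext \<psi> (\<lambda>y. m (y, False)) (\<lambda>y. m (y, True))"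
  proof -
    have "(if P then c * a else 0) = c * (if P then a else (0 :: 'k))" for P c a by simp
    then show ?thesis unfolding ext_def .
  qed
  finally show ?thesis .
qed

abbreviation al :: "exps \<Rightarrow> nat \<Rightarrow> int" where "al l \<equiv> \<lambda>x. int (expo l (x, False))"
abbreviation be :: "exps \<Rightarrow> nat \<Rightarrow> int" where "be l \<equiv> \<lambda>x. int (expo l (x, True))"

lemma sum_NN:
  assumes supp: "\<forall>l. \<psi> l \<noteq> 0 \<longrightarrow> l \<in> II" and i: "0 < i" "i < 5"
  shows "(\<Sum>l'\<in>II. \<psi> l' * of_nat (NN i (expo l') (expo l))) = (raising (i - 1) i (ext \<psi>) (al l) (be l) :: 'k)"
proof -
  have s: "(\<lambda>y. int (expo l (y, b)) + int (dlt (i, c) (y, b)) - int (dlt (i - 1, c) (y, b))) =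
     (if b = c then shift (i - 1) i (\<lambda>y. int (expo l (y, b))) else (\<lambda>y. int (expo l (y, b))))" for b c
    using i by (auto simp: dlt_def shift_def fun_eq_iff)
  have "(\<Sum>l'\<in>II. \<psi> l' * of_nat (NN i (expo l') (expo l))) =
     (\<Sum>c\<in>UNIV. \<Sum>l'\<in>II. \<psi> l' * of_nat (expo l' (i, c) * (if expo l = (\<lambda>y. expo l' y - dlt (i, c) y + dlt (i - 1, c) y) then 1 else 0)))"
    unfolding NN_def of_nat_sum sum_distrib_left by (rule sum.swap)
  also have "\<dots> = (\<Sum>c\<in>UNIV. of_nat (expo l (i, c) + 1) * ext \<psi>
     (\<lambda>y. int (expo l (y, False)) + int (dlt (i, c) (y, False)) - int (dlt (i - 1, c) (y, False)))
     (\<lambda>y. int (expo l (y, True)) + int (dlt (i, c) (y, True)) - int (dlt (i - 1, c) (y, True))))"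
    by (rule sum.cong[OF refl], rule sum_NN_term[OF supp i])
  also have "\<dots> = raising (i - 1) i (ext \<psi>) (al l) (be l)"
    unfolding s raising_def UNIV_bool using i by (simp add: add.commute del: expo_simps)
  finally show ?thesis .
qed

text \<open>The raising operator followed by the projection along \<open>theta\<close> that makes
  the coordinate at \<open>iota1\<close> vanish for p = 2. Its entries lie in the prime field, which
  makes it insensitive to the twists.\<close>

definition aa :: "nat \<Rightarrow> exps \<Rightarrow> exps \<Rightarrow> 'k" where
  "aa i l' l = of_nat (NN i (expo l') (expo l)) - theta l * of_nat (NN i (expo l') (expo iota1))"

lemma aa_frobenius: "aa i l' l ^ (p ^ j) = aa i l' l"
proof -
  have "theta l ^ (p ^ j) = theta l" using p_pos by (auto simp: theta_def power_0_left)
  then show ?thesis by (simp add: aa_def frobenius_diff power_mult_distrib of_nat_frobenius)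
qed

lemma iota1_II: "p = 2 \<Longrightarrow> iota1 \<in> II"
  by (rule subsetD[OF TT_II]) (simp_all add: TT_def iota1_def)

text \<open>For p = 2 the hypothesis determines the raised polynomial only up to a multiple of
  \<open>theta\<close>; a coordinate in \<open>TT 5 2\<close> where the raised value is
  automatically 0 shows that the multiple is 0.\<close>

lemma raising_vanish:
  assumes \<psi>: "\<psi> \<in> EE0" and i: "0 < i" "i < 5"
    and z: "\<And>l. l \<in> II0 \<Longrightarrow> (\<Sum>l'\<in>II0. \<psi> l' * aa i l' l) = 0"
    and b: "below \<alpha>" "below \<beta>"
  shows "raising (i - 1) i (ext \<psi>) \<alpha> \<beta> = 0"
proof -
  have supp: "\<forall>l. \<psi> l \<noteq> 0 \<longrightarrow> l \<in> II" using EE0_II[OF \<psi>] by blast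
  have E: "\<psi> \<in> EE" using \<psi> by (simp add: EE0_def)
  let ?D = "\<lambda>l. raising (i - 1) i (ext \<psi>) (al l) (be l)"
  have s: "(\<Sum>l'\<in>II0. \<psi> l' * aa i l' l) = ?D l - theta l * ?D iota1" for l
  proof -
    have "(\<Sum>l'\<in>II0. \<psi> l' * aa i l' l) = (\<Sum>l'\<in>II. \<psi> l' * aa i l' l)"
    proof (rule sum_II0[symmetric])
      fix l' assume "l' \<notin> II0"
      then have "\<psi> l' = 0" using EE0_II0[OF \<psi>, of l'] by blast
      then show "\<psi> l' * aa i l' l = 0" by simp
    qed
    also have "\<dots> = (\<Sum>l'\<in>II. \<psi> l' * of_nat (NN i (expo l') (expo l))) -
        theta l * (\<Sum>l'\<in>II. \<psi> l' * of_nat (NN i (expo l') (expo iota1)))"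
      by (simp add: aa_def algebra_simps sum_subtractf sum_distrib_left)
    also have "\<dots> = ?D l - theta l * ?D iota1" 
      unfolding sum_NN[OF supp i] ..
    finally show ?thesis .
  qed
  have D1: "?D iota1 = 0" if p2: "p = 2"
  proof -
    \<comment> \<open>In this monomial the indices i and i - 1 both carry e. Its raised value would
      come from e_i^2, with the factor 2 = 0, or from a negative power of y_(i-1); so it is 0,
      whereas \<open>theta l\<close> is 1.\<close>
    define l :: exps where "l = map (\<lambda>y. if y = i \<or> y = i - 1 then (1, 0) else (0, 1)) [0..<5]"
    have len: "length l = 5" by (simp add: l_def)
    have "i = 1 \<or> i = 2 \<or> i = 3 \<or> i = 4" using i by auto
    then have "deg1 l = 2" by (auto simp: l_def list5 deg1_def)
    then have T: "l \<in> TT 5 2" by (auto simp: TT_def l_def)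
    then have th: "theta l = 1" unfolding theta_def using p2 by simp
    have lI: "l \<in> II" using TT_II[OF p2] T by blast
    have "?D l = 0"
    proof -
      have e: "expo l (i, False) = 1" "expo l (i - 1, True) = 0" using i by (simp_all add: l_def)
      have "(2 :: 'k) = 0" using of_nat_eq_0_iff'[of 2] p2 by simp
      then have c0: "(of_int (int (expo l (i, False)) + 1) :: 'k) = 0" unfolding e(1) by simp
      have x0: "ext \<psi> (al l) (shift (i - 1) i (be l)) = 0"
      proof -
        have "shift (i - 1) i (be l) (i - 1) < 0" using i e by (simp add: shift_def)
        moreover have "i - 1 < 5" using i by simp
        ultimately show ?thesis unfolding ext_def by (metis leD)
      qed
      show ?thesis unfolding raising_def c0 x0 by simp
    qed
    show ?thesis
    proof (cases "l = iota1")
      case True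
      then show ?thesis using \<open>?D l = 0\<close> by (simp only:)
    next
      case False
      then have "l \<in> II0" using lI unfolding II0_def by blast
      then have "?D l - theta l * ?D iota1 = 0" using z s by (simp only:)
      then show ?thesis unfolding \<open>?D l = 0\<close> th by simp
    qed
  qed
  have Dl: "?D l = 0" if l: "l \<in> II" for l
  proof (cases "p = 2 \<and> l = iota1")
    case True
    then show ?thesis using D1 by (simp only:)
  next
    case False
    then have "l \<in> II0" using l unfolding II0_def by blast
    then have e: "?D l - theta l * ?D iota1 = 0" using z s by (simp only:)
    have "theta l * ?D iota1 = 0"
    proof (cases "p = 2")
      case True
      then show ?thesis by (simp only: D1 mult_zero_right)
    next
      case False
      then have "theta l = 0" by (simp add: theta_def)
      then show ?thesis by simp
    qed
    then show ?thesis using e by (simp only: diff_0_right)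
  qed
  \<comment> \<open>From lists in \<open>II\<close> to arbitrary integer exponents: at a nonzero
    raised value one of the two sources lies in the support of \<psi>, which forces nonnegative
    exponents of the right degrees.\<close>
  show ?thesis
  proof (rule ccontr)
    assume nz: "raising (i - 1) i (ext \<psi>) \<alpha> \<beta> \<noteq> 0"
    let ?l = "map (\<lambda>x. (nat (\<alpha> x), nat (\<beta> x))) [0..<5]"
    have "of_int (\<alpha> i + 1) * ext \<psi> (shift (i - 1) i \<alpha>) \<beta> \<noteq> 0 \<or> of_int (\<beta> i + 1) * ext \<psi> \<alpha> (shift (i - 1) i \<beta>) \<noteq> 0"
      using nz unfolding raising_def by auto
    then have nn: "\<forall>x<5. 0 \<le> \<alpha> x \<and> 0 \<le> \<beta> x" and d: "\<alpha> 0 + \<alpha> 1 + \<alpha> 2 + \<alpha> 3 + \<alpha> 4 = 2 * int p - 2"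
        "\<beta> 0 + \<beta> 1 + \<beta> 2 + \<beta> 3 + \<beta> 4 = 3 * int p - 3"
    proof -
      have i4: "i = 1 \<or> i = 2 \<or> i = 3 \<or> i = 4" using i by auto
      assume "of_int (\<alpha> i + 1) * ext \<psi> (shift (i - 1) i \<alpha>) \<beta> \<noteq> 0 \<or> of_int (\<beta> i + 1) * ext \<psi> \<alpha> (shift (i - 1) i \<beta>) \<noteq> 0"
      moreover have imp: "k \<noteq> 0 \<and> X \<noteq> 0" if "(of_int k * X :: 'k) \<noteq> 0" for k X using that by auto
      ultimately consider (1) "\<alpha> i + 1 \<noteq> 0" "ext \<psi> (shift (i - 1) i \<alpha>) \<beta> \<noteq> 0" | (2) "\<beta> i + 1 \<noteq> 0" "ext \<psi> \<alpha> (shift (i - 1) i \<beta>) \<noteq> 0"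
        by meson
      then have "(\<forall>x<5. 0 \<le> \<alpha> x \<and> 0 \<le> \<beta> x) \<and> \<alpha> 0 + \<alpha> 1 + \<alpha> 2 + \<alpha> 3 + \<alpha> 4 = 2 * int p - 2 \<and>
        \<beta> 0 + \<beta> 1 + \<beta> 2 + \<beta> 3 + \<beta> 4 = 3 * int p - 3"
      proof cases
        case 1
        note e = ext_support[OF E 1(2)]
        have "0 \<le> \<alpha> x \<and> 0 \<le> \<beta> x" if "x < 5" for x
          using e(1)[OF that] 1(1) unfolding shift_def by (auto split: if_splits)
        then show ?thesis using e(2,3) i4 unfolding shift_def by auto
      next
        case 2
        note e = ext_support[OF E 2(2)]
        have "0 \<le> \<alpha> x \<and> 0 \<le> \<beta> x" if "x < 5" for x
          using e(1)[OF that] 2(1) unfolding shift_def by (auto split: if_splits)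
        then show ?thesis using e(2,3) i4 unfolding shift_def by auto
      qed
      then show "\<forall>x<5. 0 \<le> \<alpha> x \<and> 0 \<le> \<beta> x" "\<alpha> 0 + \<alpha> 1 + \<alpha> 2 + \<alpha> 3 + \<alpha> 4 = 2 * int p - 2"
        "\<beta> 0 + \<beta> 1 + \<beta> 2 + \<beta> 3 + \<beta> 4 = 3 * int p - 3" by blast+
    qed
    have "trunc ?l" unfolding trunc_def using b nn p_pos by (auto simp: nat_less_iff)
    moreover have "deg1 ?l = 2 * int p - 2" "deg2 ?l = 3 * int p - 3"
      using nn d unfolding list5 deg1_def deg2_def all_less_5 by simp_all
    ultimately have "?l \<in> II" by (simp add: LL_def)
    then have "?D ?l = 0" by (rule Dl)
    moreover have "?D ?l = raising (i - 1) i (ext \<psi>) \<alpha> \<beta>"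
    proof -
      have cong: "ext \<psi> f g = ext \<psi> f' g'" if "\<forall>x<5. f x = f' x \<and> g x = g' x" for f g f' g'
      proof -
        have m: "map (\<lambda>x. (nat (f x), nat (g x))) [0..<5] = map (\<lambda>x. (nat (f' x), nat (g' x))) [0..<5]"
          using that by auto
        have c: "(\<forall>x<5. 0 \<le> f x \<and> 0 \<le> g x) \<longleftrightarrow> (\<forall>x<5. 0 \<le> f' x \<and> 0 \<le> g' x)" using that by simp
        show ?thesis unfolding ext_def c m ..
      qed
      have eq: "al ?l x = \<alpha> x" "be ?l x = \<beta> x" if "x < 5" for x using nn that by simp_all
      have "ext \<psi> (shift (i - 1) i (al ?l)) (be ?l) = ext \<psi> (shift (i - 1) i \<alpha>) \<beta>"
        "ext \<psi> (al ?l) (shift (i - 1) i (be ?l)) = ext \<psi> \<alpha> (shift (i - 1) i \<beta>)"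
        by (rule cong; use eq in \<open>simp add: shift_def\<close>)+
      then show ?thesis unfolding raising_def using eq[OF i(2)] by simp
    qed
    ultimately show False using nz by simp
  qed
qed

end

context witt
begin

lemma ker_ht:
  assumes up: "up g r" and l: "l' \<in> II" "l \<in> II"
  shows "ht l \<le> ht l' \<Longrightarrow> ker g l' l = (if l = l' then 1 else 0)"
    "ht l = Suc (ht l') \<Longrightarrow> ker g l' l = (\<Sum>i<5. r i * of_nat (NN i (expo l') (expo l)))"
proof -
  have supp: "\<forall>x. x \<notin> Vars \<longrightarrow> expo l' x = 0" by (simp add: expo_outside)
  have inj: "expo l = expo l' \<longleftrightarrow> l = l'" using expo_inj[OF _ II(2)[OF l(2)] II(2)[OF l(1)]] by blast
  show "ker g l' l = (if l = l' then 1 else 0)" if "ht l \<le> ht l'"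
    using cf_sg(1)[OF up supp, of "expo l"] that l(2) unfolding ker_def cff_def ht_def inj by simp
  show "ker g l' l = (\<Sum>i<5. r i * of_nat (NN i (expo l') (expo l)))" if "ht l = Suc (ht l')"
    using cf_sg(2)[OF up supp, of "expo l"] that l(2) unfolding ker_def cff_def ht_def cf_DD by simp
qed

text \<open>The correction by \<open>theta\<close> makes the kernel act on \<open>EE0\<close>, the quotient of \<open>EE\<close> by the radical.\<close>

definition kr :: "('v \<Rightarrow> 'v) \<Rightarrow> exps \<Rightarrow> exps \<Rightarrow> 'k" where
  "kr g l' l = ker g l' l - theta l * ker g l' iota1"

lemma theta_nonzero_p: "theta l \<noteq> 0 \<Longrightarrow> p = 2"
  by (auto simp: theta_def split: if_splits)

text \<open>The correction respects the triangular shape because all monomials of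
  \<open>theta\<close> have the height of \<open>iota1\<close>, and \<open>iota1\<close> itself is
  excluded from \<open>II0\<close> for p = 2.\<close>

lemma kr_ht:
  assumes up: "up g r" and l: "l' \<in> II0" "l \<in> II0"
  shows "ht l \<le> ht l' \<Longrightarrow> kr g l' l = (if l = l' then 1 else 0)"
    "ht l = Suc (ht l') \<Longrightarrow> kr g l' l = (\<Sum>i<5. r i * aa i l' l)"
proof -
  have lI: "l' \<in> II" "l \<in> II" using l II0_subset by blast+
  show "kr g l' l = (if l = l' then 1 else 0)" if h: "ht l \<le> ht l'"
  proof (cases "theta l = 0")
    case True
    then show ?thesis using ker_ht(1)[OF up lI h] by (simp add: kr_def)
  next
    case False
    note p2 = theta_nonzero_p[OF False]
    have "l' \<noteq> iota1" using l(1) p2 unfolding II0_def by blast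
    moreover have "ht iota1 \<le> ht l'" using ht_theta[OF False] h by simp
    ultimately have "ker g l' iota1 = 0" using ker_ht(1)[OF up lI(1) iota1_II[OF p2]] by simp
    then show ?thesis using ker_ht(1)[OF up lI h] by (simp add: kr_def)
  qed
  show "kr g l' l = (\<Sum>i<5. r i * aa i l' l)" if h: "ht l = Suc (ht l')"
  proof -
    have "theta l * ker g l' iota1 = theta l * (\<Sum>i<5. r i * of_nat (NN i (expo l') (expo iota1)))"
    proof (cases "theta l = 0")
      case False
      have "ht iota1 = Suc (ht l')" using ht_theta[OF False] h by simp
      then show ?thesis using ker_ht(2)[OF up lI(1) iota1_II[OF theta_nonzero_p[OF False]]] by simp
    qed simp
    then show ?thesis unfolding kr_def aa_def ker_ht(2)[OF up lI h]
      by (simp add: right_diff_distrib sum_subtractf sum_distrib_left mult_ac)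
  qed
qed

lemma kr_EE0: assumes \<psi>: "\<psi> \<in> EE0" shows "(\<lambda>l. \<Sum>l'\<in>II0. \<psi> l' * kr g l' l) \<in> EE0"
proof -
  let ?\<Phi> = "\<lambda>l. \<Sum>l'\<in>II. \<psi> l' * ker g l' l"
  have "\<psi> \<in> EE" using \<psi> by (simp add: EE0_def)
  then have "(\<lambda>l. ?\<Phi> l - ?\<Phi> iota1 * theta l) \<in> EE0" by (rule EE_project[OF ker_EE])
  moreover have "(\<Sum>l'\<in>II0. \<psi> l' * kr g l' l) = ?\<Phi> l - ?\<Phi> iota1 * theta l" for l
  proof -
    have "(\<Sum>l'\<in>II0. \<psi> l' * kr g l' l) = (\<Sum>l'\<in>II. \<psi> l' * kr g l' l)"
    proof (rule sum_II0[symmetric])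
      fix l' assume "l' \<notin> II0"
      then have "\<psi> l' = 0" using EE0_II0[OF \<psi>, of l'] by blast
      then show "\<psi> l' * kr g l' l = 0" by simp
    qed
    also have "\<dots> = (\<Sum>l'\<in>II. \<psi> l' * ker g l' l - \<psi> l' * ker g l' iota1 * theta l)"
      by (rule sum.cong[OF refl]) (simp add: kr_def right_diff_distrib)
    finally show ?thesis by (simp only: sum_subtractf sum_distrib_right)
  qed
  ultimately show ?thesis by simp
qed

text \<open>The correction contributes a multiple of the pairing with \<open>theta\<close>, which is
  0 by \<open>theta_db\<close>. For p = 2 the term at \<open>iota1\<close> may be omitted because
  \<open>kr\<close> vanishes there.\<close>

lemma kr_db:
  assumes g: "unitary g" and up: "up g r" and l': "l' \<in> II"
  shows "(\<Sum>l\<in>II0. kr g l' l * db (g \<circ> b) l) = db b l'"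
proof -
  have "\<forall>x. x \<notin> Vars \<longrightarrow> TopE x = 0" by (auto simp: TopE_def)
  then have unip: "cf (sbst (sg g) (MM TopE)) TopE = 1" using cf_sg(1)[OF up, of TopE TopE] by simp
  have "(\<Sum>l\<in>II0. kr g l' l * db (g \<circ> b) l) = (\<Sum>l\<in>II. kr g l' l * db (g \<circ> b) l)"
  proof (rule sum_II0[symmetric])
    fix l assume "l \<in> II" "l \<notin> II0"
    then have l: "p = 2" "l = iota1" unfolding II0_def by blast+
    then have "kr g l' l = 0" unfolding kr_def l(2) using theta_iota1[OF l(1)] by (simp only: mult_1_left diff_self)
    then show "kr g l' l * db (g \<circ> b) l = 0" by simp
  qed
  also have "\<dots> = (\<Sum>l\<in>II. ker g l' l * db (g \<circ> b) l - ker g l' iota1 * (theta l * db (g \<circ> b) l))"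
    by (rule sum.cong[OF refl]) (simp add: kr_def left_diff_distrib)
  also have "\<dots> = (\<Sum>l\<in>II. ker g l' l * db (g \<circ> b) l) - ker g l' iota1 * (\<Sum>l\<in>II. theta l * db (g \<circ> b) l)"
    by (simp only: sum_subtractf sum_distrib_left)
  also have "\<dots> = db b l'" unfolding ker_db[OF g unip l'] theta_db by simp
  finally show ?thesis .
qed

section \<open>Two one-parameter families of unitary maps\<close>

lemma q_power_add: "(a + b :: 'k) ^ q = a ^ q + b ^ q"
  unfolding q by (rule frobenius_add)

lemma q_power_minus: "(- a :: 'k) ^ q = - (a ^ q)"
  unfolding q by (rule frobenius_minus)

lemma form_add_right: "h x (y + z) = h x y + h x z"
  by (metis form_add_left form_hermitian q_power_add)

lemma form_scale_right: "h x (scale a y) = a ^ q * h x y"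
  by (metis form_scale_left form_hermitian power_mult_distrib)

text \<open>Exchanging the arguments of \<open>h (scale a (v 0)) (v 4)\<close> twice applies the
  involution twice to a.\<close>

lemma power_q_q: "(a :: 'k) ^ q ^ 2 = a"
proof -
  have "h (scale a (v 0)) (v 4) = a" using v form_scale_left by (simp add: frame_def)
  then have "(a ^ q) ^ q = a" using form_hermitian by metis
  then show ?thesis by (simp add: power2_eq_square power_mult)
qed

lemma power_q_q': "((a :: 'k) ^ q) ^ q = a"
  using power_q_q[of a] by (simp add: power2_eq_square power_mult)

text \<open>Adds s times v_0 to v_1 and, as unitarity then requires, -(s^q) times v_3 to v_4: the
  two outer simple roots.\<close>

definition g1 :: "'k \<Rightarrow> 'v \<Rightarrow> 'v" where
  "g1 s x = x + scale (s * h x (v 3)) (v 0) + scale (- (s ^ q) * h x (v 0)) (v 3)"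

text \<open>Adds s times v_2 to v_3 and -(s^q) times v_1 to v_2: the two inner simple roots. The
  term with e keeps the image of v_3 isotropic, which requires e + e^q = -1.\<close>

definition g2 :: "'k \<Rightarrow> 'k \<Rightarrow> 'v \<Rightarrow> 'v" where
  "g2 e s x = x + scale (s * h x (v 1)) (v 2) + scale (- (s ^ q) * h x (v 2)) (v 1) + scale (e * (s * s ^ q) * h x (v 1)) (v 1)"

lemma hv: "i < 5 \<Longrightarrow> j < 5 \<Longrightarrow> h (v i) (v j) = (if i + j = 4 then 1 else 0)"
  using v unfolding frame_def by blast

lemma form_diff_left: "h (x - y) z = h x z - h y z"
  using form_add_left[of "x - y" y z] by simp

lemma form_diff_right: "h x (y - z) = h x y - h x z"
  using form_add_right[of x "y - z" z] by simp

lemmas form_simps = form_add_left form_scale_left form_add_right form_scale_right form_diff_left form_diff_right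

lemma unitary_g1: "unitary (g1 s)"
  unfolding unitary_def
proof (intro conjI allI)
  fix x y a
  show "g1 s (x + y) = g1 s x + g1 s y"
    unfolding g1_def form_add_left distrib_left scale_left_distrib by (simp only: add_ac)
  show "g1 s (scale a x) = scale a (g1 s x)"
    unfolding g1_def form_scale_left scale_right_distrib scale_scale by (simp only: mult_ac)
  have f: "h (v 0) y = h y (v 0) ^ q" "h (v 3) y = h y (v 3) ^ q" by (rule form_hermitian)+
  show "h (g1 s x) (g1 s y) = h x y"
    unfolding g1_def by (simp add: form_simps f hv power_mult_distrib q_power_minus power_q_q' algebra_simps)
qed

lemma unitary_g2: assumes e: "e + e ^ q = -1" shows "unitary (g2 e s)"
  unfolding unitary_def
proof (intro conjI allI)
  fix x y a
  show "g2 e s (x + y) = g2 e s x + g2 e s y"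
    unfolding g2_def form_add_left distrib_left scale_left_distrib by (simp only: add_ac)
  show "g2 e s (scale a x) = scale a (g2 e s x)"
    unfolding g2_def form_scale_left scale_right_distrib scale_scale by (simp only: mult_ac)
  have f: "h (v 1) y = h y (v 1) ^ q" "h (v 2) y = h y (v 2) ^ q" by (rule form_hermitian)+
  let ?z = "s * s ^ q * h x (v 1) * h y (v 1) ^ q"
  have "h (g2 e s x) (g2 e s y) = h x y + ?z * (e + e ^ q) + ?z"
    unfolding g2_def by (simp add: form_simps f f[unfolded One_nat_def] hv power_mult_distrib q_power_minus power_q_q' algebra_simps)
  then show "h (g2 e s x) (g2 e s y) = h x y" unfolding e by simp
qed

lemma up_g1: "up (g1 s) (\<lambda>i. if i = 1 then s else if i = 4 then - (s ^ q) else 0)"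
  unfolding up_def
proof (intro conjI allI impI)
  fix i :: nat and \<beta> assume i: "i < 5"
  have "lf \<beta> (g1 s (v i)) = XX (i, \<beta>) + Cn (if i = 1 then s else if i = 4 then - (s ^ q) else 0) * XX (i - 1, \<beta>) + 0"
    unfolding g1_def lf_add lf_scale using i by (auto simp: hv lf_v Cn_minus)
  then show "\<exists>R. HH (4 - i + 2) R \<and> lf \<beta> (g1 s (v i)) =
      XX (i, \<beta>) + Cn (if i = 1 then s else if i = 4 then - (s ^ q) else 0) * XX (i - 1, \<beta>) + R"
    using HH_0 by blast
qed simp

lemma up_g2: "up (g2 e s) (\<lambda>i. if i = 3 then s else if i = 2 then - (s ^ q) else 0)"
  unfolding up_def
proof (intro conjI allI impI)
  fix i :: nat and \<beta> assume i: "i < 5"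
  \<comment> \<open>The quadratic term leads from index 3 to index 1, gains two in height and thus
    belongs to the remainder.\<close>
  let ?R = "Cn (if i = 3 then e * (s * s ^ q) else 0) * XX (1, \<beta>)"
  have "lf \<beta> (g2 e s (v i)) = XX (i, \<beta>) + Cn (if i = 3 then s else if i = 2 then - (s ^ q) else 0) * XX (i - 1, \<beta>) + ?R"
    unfolding g2_def lf_add lf_scale using i by (auto simp: hv lf_v Cn_minus)
  moreover have "HH (4 - i + 2) ?R"
  proof (cases "i = 3")
    case True
    have "HH 3 (XX (1, \<beta>) :: 'k mp)" using HH_MM[of "dlt (1, \<beta>)"] by (simp add: XX_def hgt_dlt)
    then show ?thesis using True HH_Cn_mult by (simp add: numeral_3_eq_3)
  next
    case False
    then show ?thesis by (simp add: HH_0)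
  qed
  ultimately show "\<exists>R. HH (4 - i + 2) R \<and> lf \<beta> (g2 e s (v i)) =
      XX (i, \<beta>) + Cn (if i = 3 then s else if i = 2 then - (s ^ q) else 0) * XX (i - 1, \<beta>) + R"
    by blast
qed simp

definition vop :: "nat \<Rightarrow> 'v" where "vop r = v (4 - r)"

lemma frame_vop: "frame vop"
  unfolding frame_def vop_def by (auto simp: hv)

text \<open>For the reversed basis, \<open>WW\<close> with e and y exchanged is the monomial
  complementary to \<open>iota0\<close> in the top monomial.\<close>

lemma db_vop: "db vop iota0 = 1"
proof -
  let ?n = "p - 1"
  define m :: "nat \<times> bool \<Rightarrow> nat" where "m = (\<lambda>(i, b). if i = 4 \<or> i = 3 \<or> (i = 2 \<and> \<not> b) then ?n else 0)"
  have dl: "(\<lambda>y. ?n * (dlt (4, True) + dlt (3, True) + (dlt (4, False) + dlt (3, False) + dlt (2, False))) y) = m"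
    by (auto simp: m_def dlt_def fun_eq_iff)
  have "sbst sw (WW vop) = (XX (4, True) * XX (3, True) * (XX (4, False) * XX (3, False) * XX (2, False))) ^ ?n"
    unfolding WW_def sbst_power sbst_mult sw_lf vop_def by (simp add: lf_v)
  also have "\<dots> = MM m" unfolding XX_def MM_add[symmetric] MM_power dl ..
  finally have "db vop iota0 = cf (MM (expo iota0 + m)) TopE" unfolding db_def MM_add by simp
  moreover have "expo iota0 + m = TopE"
  proof
    fix x :: "nat \<times> bool"
    obtain i b where x: "x = (i, b)" by force
    consider "i = 0" | "i = 1" | "i = 2" | "i = 3" | "i = 4" | "i \<ge> 5" by linarith
    then show "(expo iota0 + m) x = TopE x"
      by cases (cases b; simp add: x expo_def iota0_def m_def TopE_def)+
  qed
  ultimately show ?thesis by (simp add: lookup_MM)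
qed

end

section \<open>Tensors orthogonal to all Witt bases\<close>

text \<open>The moves of \<open>DU\<close> preserve the sum of the exponents in every pair, and Q
  depends on these sums alone.\<close>

lemma DU_cut:
  "DU n (\<lambda>l. if Q (map (\<lambda>x. fst x + snd x) l) then \<psi> l else 0) l =
    (if Q (map (\<lambda>x. fst x + snd x) l) then DU n \<psi> l else 0)"
proof (induction l arbitrary: n \<psi> Q)
  case Nil
  then show ?case by simp
next
  case (Cons x l)
  let ?m = "map (\<lambda>x. fst x + snd x)"
  have "DU (n - c) (\<lambda>l'. if Q (?m ((fst x + c, snd x - c) # l')) then \<psi> ((fst x + c, snd x - c) # l') else 0) l =
      (if Q (?m (x # l)) then DU (n - c) (\<lambda>l'. \<psi> ((fst x + c, snd x - c) # l')) l else 0)"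
    if "c \<le> min n (snd x)" for c
  proof -
    have s: "fst x + c + (snd x - c) = fst x + snd x" using that by simp
    show ?thesis
      using Cons.IH[of "n - c" "\<lambda>k. Q ((fst x + snd x) # k)" "\<lambda>l'. \<psi> ((fst x + c, snd x - c) # l')"]
      by (simp only: list.map fst_conv snd_conv s)
  qed
  then have "DU n (\<lambda>l. if Q (?m l) then \<psi> l else 0) (x # l) =
      (\<Sum>c\<le>min n (snd x). of_nat ((fst x + c) choose c) *
        (if Q (?m (x # l)) then DU (n - c) (\<lambda>l'. \<psi> ((fst x + c, snd x - c) # l')) l else 0))"
    unfolding DU.simps by (intro sum.cong refl arg_cong2[where f = "(*)"]) auto
  then show ?case by (cases "Q (?m (x # l))") simp_all
qed

lemma sum_PiE_slot:
  assumes j: "j \<in> J" and fin: "finite J" "finite A"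
  shows "(\<Sum>N\<in>(J \<rightarrow>\<^sub>E A). F N) = (\<Sum>N\<in>(J - {j} \<rightarrow>\<^sub>E A). \<Sum>l\<in>A. F (N(j := l)))"
proof -
  have J: "J = insert j (J - {j})" using j by auto
  have inj: "inj_on (\<lambda>(y, g). g(j := y)) (A \<times> (J - {j} \<rightarrow>\<^sub>E A))"
    using inj_combinator[of j "J - {j}" "\<lambda>_. A"] by simp
  have "(\<Sum>N\<in>(J \<rightarrow>\<^sub>E A). F N) = (\<Sum>N\<in>(\<lambda>(y, g). g(j := y)) ` (A \<times> (J - {j} \<rightarrow>\<^sub>E A)). F N)"
    using PiE_insert_eq[of j "J - {j}" "\<lambda>_. A"] J by simp
  also have "\<dots> = (\<Sum>(y, g)\<in>A \<times> (J - {j} \<rightarrow>\<^sub>E A). F (g(j := y)))"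
    by (subst sum.reindex[OF inj]) (simp add: case_prod_unfold)
  also have "\<dots> = (\<Sum>y\<in>A. \<Sum>g\<in>(J - {j} \<rightarrow>\<^sub>E A). F (g(j := y)))"
    by (simp add: sum.cartesian_product)
  finally show ?thesis by (simp only: sum.swap[of _ A])
qed

context witt
begin

lemma EE0_sum: "finite A \<Longrightarrow> (\<And>a. a \<in> A \<Longrightarrow> F a \<in> EE0) \<Longrightarrow> (\<lambda>l. \<Sum>a\<in>A. c a * F a l) \<in> EE0"
proof (induction A rule: finite_induct)
  case empty
  then show ?case using EE0_zero by simp
next
  case (insert a A)
  have "(\<lambda>l. c a * F a l + (\<Sum>a\<in>A. c a * F a l)) \<in> EE0"
    by (intro EE0_add EE0_scale insert) simp_all
  then show ?case using insert.hyps by simp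
qed

text \<open>Both variables of a pair have the same weight in the height, so the homogeneous parts
  are cut out by the sums of the pairs.\<close>

lemma EE0_cut:
  assumes "\<psi> \<in> EE0" shows "(\<lambda>l. if ht l = n then \<psi> l else 0) \<in> EE0"
proof -
  define Q where "Q k \<longleftrightarrow> (\<Sum>i<5. (4 - i) * (k ! i)) = n" for k :: "nat list"
  let ?\<phi> = "\<lambda>l. if Q (map (\<lambda>x. fst x + snd x) l) then \<psi> l else 0"
  have E: "\<psi> \<in> EE" using assms by (simp add: EE0_def)
  have "?\<phi> \<in> EE"
    using E unfolding Inv_def Tr_def mem_Collect_eq DU_cut by auto
  moreover have "p = 2 \<longrightarrow> ?\<phi> iota1 = 0" using assms unfolding EE0_def by simp
  moreover have "?\<phi> l = (if ht l = n then \<psi> l else 0)" for l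
  proof (cases "\<psi> l = 0")
    case False
    then have "length l = 5" using Inv_support(1)[OF E] by blast
    then have "Q (map (\<lambda>x. fst x + snd x) l) \<longleftrightarrow> ht l = n" unfolding Q_def by (simp add: ht_eq)
    then show ?thesis by simp
  qed simp
  ultimately show ?thesis unfolding EE0_def by simp
qed

lemma power_card: "(x :: 'k) ^ (p ^ (2 * t)) = x"
  using power_q_q[of x] by (simp add: q power_mult[symmetric] mult.commute)

text \<open>The p^j-th root of a value is its power with exponent p^(2t-j). The slice is untwisted
  by this root, moved by \<open>kr\<close>, and twisted again.\<close>

lemma kr_frobenius_EE0:
  assumes \<psi>: "\<psi> \<in> EE0" and j: "j < t"
  shows "(\<lambda>l. \<Sum>l'\<in>II0. \<psi> l' * kr g l' l ^ (p ^ j)) \<in> EE0"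
proof -
  let ?\<phi> = "\<lambda>l. \<psi> l ^ (p ^ (2 * t - j))"
  have "(\<lambda>l. (\<Sum>l'\<in>II0. ?\<phi> l' * kr g l' l) ^ (p ^ j)) \<in> EE0"
    by (rule EE0_frobenius[OF kr_EE0[OF EE0_frobenius[OF \<psi>]]])
  moreover have "(\<Sum>l'\<in>II0. ?\<phi> l' * kr g l' l) ^ (p ^ j) = (\<Sum>l'\<in>II0. \<psi> l' * kr g l' l ^ (p ^ j))" for l
  proof -
    have "(\<psi> l' ^ (p ^ (2 * t - j))) ^ (p ^ j) = \<psi> l'" for l'
      using power_card[of "\<psi> l'"] j by (simp add: power_mult[symmetric] power_add[symmetric])
    then show ?thesis by (simp add: frobenius_sum power_mult_distrib)
  qed
  ultimately show ?thesis by simp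
qed

definition TP :: "(nat \<Rightarrow> exps) set" where "TP = ({..<t} \<rightarrow>\<^sub>E II0)"

lemma finite_TP: "finite TP" unfolding TP_def by (intro finite_PiE finite_II0) simp_all

lemma TP_upd: "M \<in> TP \<Longrightarrow> j < t \<Longrightarrow> M(j := l) \<in> TP \<longleftrightarrow> l \<in> II0"
  unfolding TP_def by (auto simp: PiE_iff extensional_def split: if_splits)

lemma TP_mem: "M \<in> TP \<Longrightarrow> j < t \<Longrightarrow> M j \<in> II0"
  unfolding TP_def by auto

text \<open>The t-fold tensor power of \<open>EE0\<close> in coordinates: a tensor belongs to it
  when all its slices in one slot belong to \<open>EE0\<close>.\<close>

definition tgood :: "((nat \<Rightarrow> exps) \<Rightarrow> 'k) \<Rightarrow> bool" where
  "tgood f \<longleftrightarrow> (\<forall>M. f M \<noteq> 0 \<longrightarrow> M \<in> TP) \<and> (\<forall>M\<in>TP. \<forall>j<t. (\<lambda>l. f (M(j := l))) \<in> EE0)"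

definition pr :: "((nat \<Rightarrow> exps) \<Rightarrow> 'k) \<Rightarrow> (nat \<Rightarrow> 'v) \<Rightarrow> 'k" where
  "pr f b = (\<Sum>M\<in>TP. f M * (\<Prod>j<t. db b (M j) ^ (p ^ j)))"

definition TG :: "('v \<Rightarrow> 'v) \<Rightarrow> ((nat \<Rightarrow> exps) \<Rightarrow> 'k) \<Rightarrow> (nat \<Rightarrow> exps) \<Rightarrow> 'k" where
  "TG g f M = (if M \<in> TP then \<Sum>N\<in>TP. f N * (\<Prod>j<t. kr g (N j) (M j) ^ (p ^ j)) else 0)"

lemma tgood_TG: assumes f: "tgood f" shows "tgood (TG g f)"
  unfolding tgood_def
proof (intro conjI allI impI ballI)
  show "M \<in> TP" if "TG g f M \<noteq> 0" for M using that by (auto simp: TG_def split: if_splits)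
  fix M j assume M: "M \<in> TP" and j: "j < t"
  let ?J = "{..<t} - {j}"
  \<comment> \<open>\<open>c N\<close> collects the slots other than j, and \<open>F N\<close> is
    the action in slot j alone.\<close>
  define c where "c N = (\<Prod>i\<in>?J. kr g (N i) (M i) ^ (p ^ i))" for N
  define F where "F N l = (\<Sum>l'\<in>II0. f (N(j := l')) * kr g l' l ^ (p ^ j))" for N l
  have F: "F N \<in> EE0" if N: "N \<in> ?J \<rightarrow>\<^sub>E II0" for N
  proof (cases "II0 = {}")
    case True
    then have "F N = (\<lambda>_. 0)" by (simp add: F_def fun_eq_iff)
    then show ?thesis using EE0_zero by simp
  next
    case False
    then obtain l0 where l0: "l0 \<in> II0" by blast
    then have "N(j := l0) \<in> TP" using N j unfolding TP_def by (auto simp: PiE_iff extensional_def)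
    then have "(\<lambda>l. f ((N(j := l0))(j := l))) \<in> EE0" using f j unfolding tgood_def by blast
    then have "(\<lambda>l. f (N(j := l))) \<in> EE0" by simp
    from kr_frobenius_EE0[OF this j] show ?thesis unfolding F_def .
  qed
  have "(\<lambda>l. \<Sum>N\<in>?J \<rightarrow>\<^sub>E II0. c N * F N l) \<in> EE0"
    by (rule EE0_sum) (use F in \<open>auto intro!: finite_PiE finite_II0\<close>)
  moreover have "TG g f (M(j := l)) = (\<Sum>N\<in>?J \<rightarrow>\<^sub>E II0. c N * F N l)" for l
  proof (cases "l \<in> II0")
    case True
    have "TG g f (M(j := l)) = (\<Sum>N\<in>TP. f N * (\<Prod>i<t. kr g (N i) ((M(j := l)) i) ^ (p ^ i)))"
      using TP_upd[OF M j] True by (simp add: TG_def)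
    also have "\<dots> = (\<Sum>N\<in>?J \<rightarrow>\<^sub>E II0. \<Sum>l'\<in>II0. f (N(j := l')) * (\<Prod>i<t. kr g ((N(j := l')) i) ((M(j := l)) i) ^ (p ^ i)))"
      unfolding TP_def by (rule sum_PiE_slot) (use j finite_II0 in auto)
    also have "\<dots> = (\<Sum>N\<in>?J \<rightarrow>\<^sub>E II0. \<Sum>l'\<in>II0. c N * (f (N(j := l')) * kr g l' l ^ (p ^ j)))"
    proof (intro sum.cong refl)
      fix N l'
      have "(\<Prod>i<t. kr g ((N(j := l')) i) ((M(j := l)) i) ^ (p ^ i)) =
          kr g l' l ^ (p ^ j) * (\<Prod>i\<in>?J. kr g ((N(j := l')) i) ((M(j := l)) i) ^ (p ^ i))"
        using j by (subst prod.remove[of _ j]) auto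
      also have "(\<Prod>i\<in>?J. kr g ((N(j := l')) i) ((M(j := l)) i) ^ (p ^ i)) = c N"
        unfolding c_def by (rule prod.cong) auto
      finally show "f (N(j := l')) * (\<Prod>i<t. kr g ((N(j := l')) i) ((M(j := l)) i) ^ (p ^ i)) = c N * (f (N(j := l')) * kr g l' l ^ (p ^ j))"
        by (simp only: mult_ac)
    qed
    finally show ?thesis by (simp add: F_def sum_distrib_left)
  next
    case False
    have "F N l = 0" if "N \<in> ?J \<rightarrow>\<^sub>E II0" for N using EE0_II0[OF F[OF that], of l] False by blast
    then show ?thesis using TP_upd[OF M j] False by (simp add: TG_def)
  qed
  ultimately show "(\<lambda>l. TG g f (M(j := l))) \<in> EE0" by simp
qed

lemma pr_TG:
  assumes g: "unitary g" and up: "up g r"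
  shows "pr (TG g f) (g \<circ> b) = pr f b"
proof -
  have key: "(\<Sum>M\<in>TP. \<Prod>j<t. kr g (N j) (M j) ^ (p ^ j) * db (g \<circ> b) (M j) ^ (p ^ j)) = (\<Prod>j<t. db b (N j) ^ (p ^ j))"
    if N: "N \<in> TP" for N
  proof -
    have "(\<Sum>M\<in>TP. \<Prod>j<t. kr g (N j) (M j) ^ (p ^ j) * db (g \<circ> b) (M j) ^ (p ^ j)) =
        (\<Prod>j<t. \<Sum>l\<in>II0. kr g (N j) l ^ (p ^ j) * db (g \<circ> b) l ^ (p ^ j))"
      unfolding TP_def by (rule prod_sum_PiE[symmetric]) (use finite_II0 in auto)
    also have "\<dots> = (\<Prod>j<t. db b (N j) ^ (p ^ j))"
    proof (rule prod.cong[OF refl])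
      fix j assume "j \<in> {..<t}"
      then have "N j \<in> II" using TP_mem[OF N] II0_subset by blast
      from kr_db[OF g up this, of b]
      show "(\<Sum>l\<in>II0. kr g (N j) l ^ (p ^ j) * db (g \<circ> b) l ^ (p ^ j)) = db b (N j) ^ (p ^ j)"
        by (simp only: power_mult_distrib[symmetric] frobenius_sum[symmetric])
    qed
    finally show ?thesis .
  qed
  have "pr (TG g f) (g \<circ> b) = (\<Sum>M\<in>TP. \<Sum>N\<in>TP. f N * (\<Prod>j<t. kr g (N j) (M j) ^ (p ^ j) * db (g \<circ> b) (M j) ^ (p ^ j)))"
    unfolding pr_def TG_def by (simp add: sum_distrib_right prod.distrib mult.assoc)
  also have "\<dots> = (\<Sum>N\<in>TP. f N * (\<Sum>M\<in>TP. \<Prod>j<t. kr g (N j) (M j) ^ (p ^ j) * db (g \<circ> b) (M j) ^ (p ^ j)))"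
    unfolding sum_distrib_left by (rule sum.swap)
  also have "\<dots> = pr f b" unfolding pr_def by (rule sum.cong[OF refl]) (simp only: key)
  finally show ?thesis .
qed

definition YY :: "((nat \<Rightarrow> exps) \<Rightarrow> 'k) set" where
  "YY = {f. tgood f \<and> (\<forall>b. frame b \<longrightarrow> pr f b = 0)}"

text \<open>The image of v under g is a Witt basis and spans by \<open>expansion\<close>, so g is
  surjective; a right inverse preserves the form.\<close>

lemma frame_preimage:
  assumes g: "unitary g" and b: "frame b" obtains b' where "frame b'" "b = g \<circ> b'"
proof -
  have "frame (g \<circ> v)" by (rule frame_unitary[OF g v])
  from expansion[OF this] have "\<exists>y. x = g y" for x
  proof -
    have "x = (\<Sum>i<5. scale (h x ((g \<circ> v) (4 - i))) (g (v i)))" using expansion[OF \<open>frame (g \<circ> v)\<close>, of x] by simp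
    also have "\<dots> = g (\<Sum>i<5. scale (h x ((g \<circ> v) (4 - i))) (v i))" by (rule unitary_sum[OF g, symmetric])
    finally show ?thesis by blast
  qed
  then obtain k where k: "\<And>x. x = g (k x)" by metis
  have "b = g \<circ> (k \<circ> b)" using k by (auto simp: fun_eq_iff)
  moreover have "frame (k \<circ> b)"
  proof -
    have "h (k (b i)) (k (b j)) = h (b i) (b j)" for i j
      using g k unfolding unitary_def by metis
    then show ?thesis using b by (simp add: frame_def)
  qed
  ultimately show thesis using that by blast
qed

lemma YY_TG: assumes "unitary g" "up g r" "f \<in> YY" shows "TG g f \<in> YY"
  unfolding YY_def
proof (intro CollectI conjI allI impI)
  show "tgood (TG g f)" using assms(3) by (auto simp: YY_def intro: tgood_TG)
  fix b assume "frame b"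
  then obtain b' where b': "frame b'" "b = g \<circ> b'" by (rule frame_preimage[OF assms(1)])
  then show "pr (TG g f) b = 0" using assms(3) pr_TG[OF assms(1,2)] by (simp add: YY_def)
qed

lemma YY_sum:
  assumes "finite A" "\<And>s. s \<in> A \<Longrightarrow> F s \<in> YY" shows "(\<lambda>M. \<Sum>s\<in>A. c s * F s M) \<in> YY"
  unfolding YY_def tgood_def
proof (intro CollectI conjI allI impI ballI)
  fix M assume "(\<Sum>s\<in>A. c s * F s M) \<noteq> 0"
  then obtain s where "s \<in> A" "c s * F s M \<noteq> 0" by (rule sum.not_neutral_contains_not_neutral)
  then show "M \<in> TP" using assms(2)[of s] by (auto simp: YY_def tgood_def)
next
  fix M j assume "M \<in> TP" "j < t"
  then show "(\<lambda>l. \<Sum>s\<in>A. c s * F s (M(j := l))) \<in> EE0"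
    by (intro EE0_sum assms(1)) (use assms(2) in \<open>auto simp: YY_def tgood_def\<close>)
next
  fix b assume b: "frame b"
  have "pr (\<lambda>M. \<Sum>s\<in>A. c s * F s M) b = (\<Sum>s\<in>A. c s * pr (F s) b)"
    unfolding pr_def by (subst sum_distrib_left, subst sum.swap) (simp add: sum_distrib_left sum_distrib_right mult.assoc)
  then show "pr (\<lambda>M. \<Sum>s\<in>A. c s * F s M) b = 0" using assms(2) b by (simp add: YY_def)
qed

end

context char_p
begin

lemma NN_height:
  assumes "0 < i" "i < 5" "NN i m n \<noteq> 0"
  shows "hgt n = Suc (hgt m)"
proof -
  from assms(3) obtain c where c: "m (i, c) * (if n = (\<lambda>y. m y - dlt (i, c) y + dlt (i - 1, c) y) then 1 else 0) \<noteq> 0"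
    unfolding NN_def by (rule sum.not_neutral_contains_not_neutral)
  then have mc: "m (i, c) > 0" and n: "n = (\<lambda>y. m y - dlt (i, c) y + dlt (i - 1, c) y)" by (auto split: if_splits)
  have "n + dlt (i, c) = m + dlt (i - 1, c)"
    using mc by (auto simp: n dlt_def fun_eq_iff)
  from arg_cong[OF this, of hgt] have "hgt n + (4 - i) = hgt m + (4 - (i - 1))"
    unfolding hgt_add using assms(1,2) by (simp add: hgt_dlt)
  then show ?thesis using assms(1,2) by linarith
qed

lemma aa_height:
  assumes "0 < i" "i < 5" "aa i l' l \<noteq> 0"
  shows "ht l = Suc (ht l')"
proof (cases "NN i (expo l') (expo l) = 0")
  case False
  then show ?thesis using NN_height[OF assms(1,2)] unfolding ht_def by blast
next
  case True
  then have "theta l \<noteq> 0" "NN i (expo l') (expo iota1) \<noteq> 0"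
    using assms(3) unfolding aa_def by (metis diff_0_right mult_zero_left of_nat_0, metis diff_self mult_zero_right of_nat_0)
  then show ?thesis using NN_height[OF assms(1,2)] ht_theta[of l] unfolding ht_def by simp
qed

end

section \<open>Separation of slots and roots by power sums\<close>

context witt
begin

abbreviation QQ :: nat where "QQ \<equiv> p ^ (2 * t)"

lemma card_k: "CARD('k) = QQ"
  by (simp add: card_field q power_mult[symmetric] mult.commute)

lemma QQ_bound: assumes "i < 2 * t" shows "p ^ i < QQ - 1" "0 < p ^ i"
proof -
  have "p ^ i \<le> p ^ (2 * t - 1)" using assms p_pos by (intro power_increasing) auto
  moreover have "QQ = p * p ^ (2 * t - 1)" using t by (simp flip: power_Suc)
  moreover have "2 * p ^ (2 * t - 1) \<le> p * p ^ (2 * t - 1)" using p_pos by simp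
  moreover have "2 ^ 1 \<le> p ^ (2 * t - 1)"
  proof -
    have "(2 :: nat) ^ 1 \<le> 2 ^ (2 * t - 1)" using t by (intro power_increasing) auto
    also have "\<dots> \<le> p ^ (2 * t - 1)" using p_pos by (intro power_mono) auto
    finally show ?thesis .
  qed
  ultimately have "p ^ i \<le> p ^ (2 * t - 1)" "2 * p ^ (2 * t - 1) \<le> QQ" "2 \<le> p ^ (2 * t - 1)" by simp_all
  then have "p ^ i + 1 < QQ" by linarith
  then show "p ^ i < QQ - 1" by simp
qed (use p_pos in simp)

lemma power_QQ: assumes "(s :: 'k) \<noteq> 0" shows "s ^ (QQ - 1) = 1"
proof -
  have "s * s ^ (QQ - 1) = s * 1" using power_card[of s] p_pos by (simp flip: power_Suc)
  then show ?thesis using assms by simp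
qed

text \<open>Unless e = QQ - 1, replacing s by a s multiplies the sum by a^e, and some nonzero a has
  a^e \<noteq> 1: with r the remainder of e modulo QQ - 1, the polynomial x^r - 1 has at most r
  roots.\<close>

lemma sum_powers:
  assumes "0 < e" "e < 2 * (QQ - 1)"
  shows "(\<Sum>s\<in>(UNIV :: 'k set). s ^ e) = (if e = QQ - 1 then -1 else 0)"
proof (cases "e = QQ - 1")
  case True
  have "(\<Sum>s\<in>(UNIV :: 'k set). s ^ e) = (\<Sum>s\<in>(UNIV :: 'k set). if s = 0 then 0 else 1 :: 'k)"
    by (rule sum.cong) (use True assms power_QQ in auto)
  also have "\<dots> = of_nat (card (UNIV - {0 :: 'k}))"
    by (simp add: sum.If_cases Compl_eq_Diff_UNIV)
  also have "card (UNIV - {0 :: 'k}) = QQ - 1" by (simp add: card_Diff_singleton card_k)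
  also have "of_nat (QQ - 1) = (-1 :: 'k)"
  proof -
    have "of_nat (QQ - 1 + 1) = (0 :: 'k)" using of_nat_eq_0_iff'[of QQ] t p_pos by simp
    then have "of_nat (QQ - 1) + 1 = (0 :: 'k)" by (simp only: of_nat_add of_nat_1)
    then show ?thesis by (simp only: eq_neg_iff_add_eq_0)
  qed
  finally show ?thesis using True by simp
next
  case False
  define r where "r = e mod (QQ - 1)"
  have Q1: "QQ - 1 > 0" using assms by simp
  have r: "0 < r" "r < QQ - 1"
  proof -
    show "r < QQ - 1" using Q1 by (simp add: r_def)
    have "\<not> (QQ - 1) dvd e"
    proof
      assume "(QQ - 1) dvd e"
      then obtain k where "e = (QQ - 1) * k" by (auto elim: dvdE)
      moreover have "(QQ - 1) * 2 \<le> (QQ - 1) * k" if "k \<ge> 2" using that by (rule mult_le_mono2)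
      ultimately have "\<not> k \<ge> 2" using assms by linarith
      then have "k = 0 \<or> k = 1" by auto
      then show False using \<open>e = (QQ - 1) * k\<close> assms False by auto
    qed
    then show "0 < r" by (simp add: r_def mod_greater_zero_iff_not_dvd)
  qed
  obtain a :: 'k where a: "a \<noteq> 0" "a ^ e \<noteq> 1"
  proof -
    have er: "a ^ e = a ^ r" if "a \<noteq> 0" for a :: 'k
    proof -
      have "a ^ e = a ^ ((QQ - 1) * (e div (QQ - 1)) + r)" by (simp add: r_def)
      also have "\<dots> = a ^ r" unfolding power_add power_mult[of a "QQ - 1"] power_QQ[OF that] by simp
      finally show ?thesis .
    qed
    let ?P = "Polynomial.monom 1 r - 1 :: 'k poly"
    have "Polynomial.coeff ?P r = 1" using r(1) by simp
    then have nz: "?P \<noteq> 0" by force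
    have "Polynomial.degree ?P \<le> r" by (rule degree_diff_le) (simp_all add: degree_monom_le)
    then have "card {x. poly ?P x = 0} \<le> r" using card_poly_roots_bound[OF nz] by linarith
    then have "card {x. poly ?P x = 0} < card (UNIV - {0 :: 'k})" using r(2) by (simp add: card_Diff_singleton card_k)
    then have "\<not> UNIV - {0} \<subseteq> {x. poly ?P x = 0}"
      using card_mono[of "{x. poly ?P x = 0}" "UNIV - {0}"] by auto
    then obtain a where "a \<in> UNIV - {0}" "a \<notin> {x. poly ?P x = 0}" by blast
    then have a: "a \<noteq> 0" "a ^ r \<noteq> 1" by (simp_all add: Polynomial.poly_monom)
    show thesis using that[of a] a er[OF a(1)] by simp
  qed
  have "(\<Sum>s\<in>(UNIV :: 'k set). s ^ e) = (\<Sum>s\<in>UNIV. (a * s) ^ e)"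
    by (rule sum.reindex_bij_witness[where i = "\<lambda>s. a * s" and j = "\<lambda>s. inverse a * s"])
      (use a in \<open>simp_all flip: mult.assoc\<close>)
  also have "\<dots> = a ^ e * (\<Sum>s\<in>UNIV. s ^ e)" by (simp add: power_mult_distrib sum_distrib_left)
  finally have "(1 - a ^ e) * (\<Sum>s\<in>(UNIV :: 'k set). s ^ e) = 0" by (simp add: algebra_simps)
  then show ?thesis using a False by simp
qed

text \<open>Weights that extract the coefficient of s^(p^i) from a combination of 1 and the powers
  s^(p^i') with i' < 2t.\<close>

definition lam :: "nat \<Rightarrow> 'k \<Rightarrow> 'k" where "lam i s = - (s ^ (QQ - 1 - p ^ i))"

lemma sum_lam: assumes "i < 2 * t" shows "(\<Sum>s\<in>UNIV. lam i s) = 0"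
proof -
  have "(\<Sum>s\<in>(UNIV :: 'k set). s ^ (QQ - 1 - p ^ i)) = 0"
  proof -
    have a: "0 < QQ - 1 - p ^ i" "QQ - 1 - p ^ i < 2 * (QQ - 1)" "QQ - 1 - p ^ i \<noteq> QQ - 1"
      using QQ_bound[OF assms] by linarith+
    show ?thesis unfolding sum_powers[OF a(1,2)] using a(3) by (simp only: if_False)
  qed
  then show ?thesis by (simp add: lam_def sum_negf)
qed

lemma sum_lam_power:
  assumes "i < 2 * t" "i' < 2 * t"
  shows "(\<Sum>s\<in>UNIV. lam i s * s ^ (p ^ i')) = (if i = i' then 1 else 0)"
proof -
  have e: "QQ - 1 - p ^ i + p ^ i' = QQ - 1 \<longleftrightarrow> i = i'"
  proof -
    have "QQ - 1 - p ^ i + p ^ i' = QQ - 1 \<longleftrightarrow> p ^ i = p ^ i'" using QQ_bound[OF assms(1)] by auto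
    then show ?thesis using p_pos by (simp add: power_inject_exp)
  qed
  have "(\<Sum>s\<in>UNIV. lam i s * s ^ (p ^ i')) = - (\<Sum>s\<in>UNIV. s ^ (QQ - 1 - p ^ i + p ^ i'))"
    by (simp add: lam_def sum_negf power_add)
  also have "(\<Sum>s\<in>(UNIV :: 'k set). s ^ (QQ - 1 - p ^ i + p ^ i')) = (if QQ - 1 - p ^ i + p ^ i' = QQ - 1 then -1 else 0)"
    using QQ_bound[OF assms(1)] QQ_bound[OF assms(2)] by (intro sum_powers) auto
  finally show ?thesis unfolding e by simp
qed

definition HT :: "(nat \<Rightarrow> exps) \<Rightarrow> nat" where "HT M = (\<Sum>j<t. ht (M j))"

lemma HT_upd: assumes "j < t" shows "HT (M(j := l)) + ht (M j) = HT M + ht l"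
proof -
  have "HT (M(j := l)) = ht l + (\<Sum>i\<in>{..<t} - {j}. ht (M i))"
    unfolding HT_def using assms by (subst sum.remove[of _ j]) auto
  moreover have "HT M = ht (M j) + (\<Sum>i\<in>{..<t} - {j}. ht (M i))"
    unfolding HT_def using assms by (subst sum.remove[of _ j]) auto
  ultimately show ?thesis by simp
qed

text \<open>For M \<noteq> N some slot has distinct entries without a gain in height, and there
  \<open>kr\<close> is 0 by triangularity.\<close>

lemma kr_prod_le:
  assumes up: "up g r" and N: "N \<in> TP" and M: "M \<in> TP" and h: "HT M \<le> HT N"
  shows "(\<Prod>j<t. kr g (N j) (M j) ^ (p ^ j)) = (if M = N then 1 else 0)"
proof (cases "M = N")
  case True
  then show ?thesis using kr_ht(1)[OF up] TP_mem[OF N] by simp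
next
  case False
  have "\<exists>j<t. ht (M j) \<le> ht (N j) \<and> M j \<noteq> N j"
  proof (rule ccontr)
    assume a: "\<not> ?thesis"
    have le: "ht (N j) \<le> ht (M j)" if "j < t" for j
    proof (rule ccontr)
      assume c: "\<not> ht (N j) \<le> ht (M j)"
      then have "ht (M j) \<le> ht (N j)" by simp
      moreover have "M j \<noteq> N j" using c by force
      ultimately show False using a that by blast
    qed
    have "\<exists>j<t. M j \<noteq> N j"
    proof (rule ccontr)
      assume "\<not> ?thesis"
      then have "M = N" using M N unfolding TP_def by (intro PiE_ext) auto
      then show False using False by simp
    qed
    then obtain j where j: "j < t" "M j \<noteq> N j" by blast
    then have "\<not> ht (M j) \<le> ht (N j)" using a by blast
    then have "ht (N j) < ht (M j)" by simp
    then have "(\<Sum>j<t. ht (N j)) < (\<Sum>j<t. ht (M j))"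
      using le j by (intro sum_strict_mono_ex1) auto
    then show False using h unfolding HT_def by simp
  qed
  then obtain j where j: "j < t" "ht (M j) \<le> ht (N j)" "M j \<noteq> N j" by blast
  then have "kr g (N j) (M j) = 0" using kr_ht(1)[OF up TP_mem[OF N j(1)] TP_mem[OF M j(1)] j(2)] by simp
  then have "kr g (N j) (M j) ^ (p ^ j) = 0" using p_pos by simp
  then show ?thesis using j(1) False by (simp add: prod_zero_iff) blast
qed

text \<open>A gain of one in total height is spent in a single slot, and triangularity forces all
  other slots to agree.\<close>

lemma kr_prod_Suc:
  assumes up: "up g r" and r0: "r 0 = 0" and N: "N \<in> TP" and M: "M \<in> TP" and h: "HT M = Suc (HT N)"
  shows "(\<Prod>j<t. kr g (N j) (M j) ^ (p ^ j)) =
    (\<Sum>j<t. if N = M(j := N j) then (\<Sum>i<5. r i * aa i (N j) (M j)) ^ (p ^ j) else 0)"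
proof (cases "\<exists>j<t. N = M(j := N j)")
  case False
  have "\<exists>j<t. ht (M j) \<le> ht (N j) \<and> M j \<noteq> N j"
  proof (rule ccontr)
    assume a: "\<not> ?thesis"
    have le: "ht (N j) \<le> ht (M j)" if "j < t" for j
    proof (rule ccontr)
      assume c: "\<not> ht (N j) \<le> ht (M j)"
      then have "ht (M j) \<le> ht (N j)" by simp
      moreover have "M j \<noteq> N j" using c by force
      ultimately show False using a that by blast
    qed
    have "\<exists>j<t. ht (N j) < ht (M j)"
    proof (rule ccontr)
      assume "\<not> ?thesis"
      then have "ht (M j) \<le> ht (N j)" if "j < t" for j using that by (meson not_le)
      then have "HT M \<le> HT N" unfolding HT_def by (intro sum_mono) simp
      then show False using h by simp
    qed
    then obtain j where j: "j < t" "ht (N j) < ht (M j)" by blast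
    have "N i = M i" if i: "i < t" "i \<noteq> j" for i
    proof (rule ccontr)
      assume ne: "N i \<noteq> M i"
      then have "M i \<noteq> N i" by (rule not_sym)
      then have "\<not> ht (M i) \<le> ht (N i)" using a i(1) by blast
      then have lt: "ht (N i) < ht (M i)" by simp
      have "HT (M(j := N j)) + ht (M j) = HT M + ht (N j)" by (rule HT_upd[OF j(1)])
      moreover have "HT N < HT (M(j := N j))"
        unfolding HT_def using le i lt by (intro sum_strict_mono_ex1) auto
      ultimately show False using h j(2) by simp
    qed
    note same = this
    have "N = M(j := N j)"
    proof
      fix x
      have "N x = M x" if "x \<noteq> j" 
      proof (cases "x < t")
        case True
        then show ?thesis using that by (rule same)
      next
        case False
        then have "N x = undefined" "M x = undefined" using N M unfolding TP_def by auto
        then show ?thesis by simp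
      qed
      then show "N x = (M(j := N j)) x" by simp
    qed
    then show False using False j(1) by blast
  qed
  then obtain j where j: "j < t" "ht (M j) \<le> ht (N j)" "M j \<noteq> N j" by blast
  then have "kr g (N j) (M j) = 0" using kr_ht(1)[OF up TP_mem[OF N j(1)] TP_mem[OF M j(1)] j(2)] by simp
  then have "kr g (N j) (M j) ^ (p ^ j) = 0" using p_pos by simp
  then have "(\<Prod>j<t. kr g (N j) (M j) ^ (p ^ j)) = 0" using j(1) by (simp add: prod_zero_iff) blast
  moreover have "(\<Sum>j<t. if N = M(j := N j) then (\<Sum>i<5. r i * aa i (N j) (M j)) ^ (p ^ j) else 0) = 0"
    by (rule sum.neutral) (use False in auto)
  ultimately show ?thesis by simp
next
  case True
  then obtain j where j: "j < t" "N = M(j := N j)" by blast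
  have ne: "N j \<noteq> M j"
  proof
    assume "N j = M j"
    then have "N = M" using j(2) by simp
    then show False using h by simp
  qed
  have hj: "ht (M j) = Suc (ht (N j))"
    using HT_upd[OF j(1), of M "N j"] h j(2) by simp
  have uniq: "N = M(i := N i) \<longleftrightarrow> i = j" for i
  proof
    assume a: "N = M(i := N i)"
    show "i = j"
    proof (rule ccontr)
      assume "i \<noteq> j"
      then have "N j = M j" using fun_cong[OF a, of j] by simp
      then show False using ne by simp
    qed
  qed (use j(2) in simp)
  have "(\<Prod>j<t. kr g (N j) (M j) ^ (p ^ j)) = kr g (N j) (M j) ^ (p ^ j) * (\<Prod>i\<in>{..<t} - {j}. kr g (N i) (M i) ^ (p ^ i))"
    using j(1) by (intro prod.remove) auto
  also have "(\<Prod>i\<in>{..<t} - {j}. kr g (N i) (M i) ^ (p ^ i)) = 1"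
  proof (rule prod.neutral, intro ballI)
    fix i assume i: "i \<in> {..<t} - {j}"
    then have "N i = M i" using fun_cong[OF j(2), of i] by simp
    then show "kr g (N i) (M i) ^ (p ^ i) = 1" using kr_ht(1)[OF up TP_mem[OF N] TP_mem[OF M], of i i] i by simp
  qed
  also have "kr g (N j) (M j) = (\<Sum>i<5. r i * aa i (N j) (M j))"
    by (rule kr_ht(2)[OF up TP_mem[OF N j(1)] TP_mem[OF M j(1)] hj])
  finally show ?thesis unfolding uniq using j(1) by simp
qed

text \<open>One level above n, the averaged action consists of first-order terms in single slots, as
  the identity part is annihilated by \<open>sum_lam\<close>. In slot j such a term is a combination
  of s^(p^j), from \<open>i1\<close>, and s^(p^(t+j)), from \<open>i2\<close>; the weight
  \<open>lam e\<close> selects one of these 2t powers.\<close>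

lemma extraction:
  assumes up: "\<And>s. up (g s) (\<lambda>i. if i = i1 then s else if i = i2 then - (s ^ q) else 0)"
    and i12: "0 < i1" "i1 < 5" "0 < i2" "i2 < 5" "i1 \<noteq> i2"
    and f: "\<forall>N. f N \<noteq> 0 \<longrightarrow> N \<in> TP \<and> n \<le> HT N" and M: "M \<in> TP" "HT M = Suc n" and e: "e < 2 * t"
  shows "(\<Sum>s\<in>UNIV. lam e s * TG (g s) f M) =
    (if e < t then (\<Sum>l\<in>II0. f (M(e := l)) * aa i1 l (M e))
     else - (\<Sum>l\<in>II0. f (M(e - t := l)) * aa i2 l (M (e - t))))"
proof -
  let ?r = "\<lambda>s i. if i = i1 then s else if i = i2 then - (s ^ q) else 0 :: 'k"
  let ?X = "\<lambda>j l. (if e = j then aa i1 l (M j) else 0) - (if e = t + j then aa i2 l (M j) else 0)"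
  have rs: "(\<Sum>i<5. ?r s i * aa i l' l) = s * aa i1 l' l - s ^ q * aa i2 l' l" for s l' l
  proof -
    have "(\<Sum>i<5. ?r s i * aa i l' l) = (\<Sum>i<5. (if i = i1 then s * aa i l' l else 0) + (if i = i2 then - (s ^ q) * aa i l' l else 0))"
      by (rule sum.cong) (use i12 in auto)
    also have "\<dots> = s * aa i1 l' l - s ^ q * aa i2 l' l"
      using i12 by (simp add: sum.distrib)
    finally show ?thesis .
  qed
  have ls: "(\<Sum>s\<in>UNIV. lam e s * (s * aa i1 l (M j) - s ^ q * aa i2 l (M j)) ^ (p ^ j)) = ?X j l" if j: "j < t" for j l
  proof -
    have sq: "(s ^ q) ^ (p ^ j) = s ^ (p ^ (t + j))" for s :: 'k by (simp add: q power_mult[symmetric] power_add)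
    have "lam e s * (s * aa i1 l (M j) - s ^ q * aa i2 l (M j)) ^ (p ^ j) =
        lam e s * s ^ (p ^ j) * aa i1 l (M j) - lam e s * s ^ (p ^ (t + j)) * aa i2 l (M j)" for s
      unfolding frobenius_diff power_mult_distrib sq aa_frobenius by (simp add: algebra_simps)
    then have "(\<Sum>s\<in>UNIV. lam e s * (s * aa i1 l (M j) - s ^ q * aa i2 l (M j)) ^ (p ^ j)) =
        (\<Sum>s\<in>UNIV. lam e s * s ^ (p ^ j)) * aa i1 l (M j) - (\<Sum>s\<in>UNIV. lam e s * s ^ (p ^ (t + j))) * aa i2 l (M j)"
      by (simp add: sum_subtractf sum_distrib_right)
    then show ?thesis using e j by (simp add: sum_lam_power)
  qed
  have per: "f N * (\<Sum>s\<in>UNIV. lam e s * (\<Prod>j<t. kr (g s) (N j) (M j) ^ (p ^ j))) =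
      (\<Sum>j<t. if N = M(j := N j) then f N * ?X j (N j) else 0)" if N: "N \<in> TP" for N
  proof (cases "f N = 0")
    case True
    then show ?thesis by simp
  next
    case False
    then have hN: "n \<le> HT N" using f by blast
    show ?thesis
    proof (cases "HT N = n")
      case True
      then have h: "HT M = Suc (HT N)" using M by simp
      have "(\<Sum>s\<in>UNIV. lam e s * (\<Prod>j<t. kr (g s) (N j) (M j) ^ (p ^ j))) =
         (\<Sum>s\<in>UNIV. \<Sum>j<t. if N = M(j := N j) then lam e s * (s * aa i1 (N j) (M j) - s ^ q * aa i2 (N j) (M j)) ^ (p ^ j) else 0)"
      proof (rule sum.cong[OF refl])
        fix s
        have r0: "?r s 0 = 0" using i12 by simp
        show "lam e s * (\<Prod>j<t. kr (g s) (N j) (M j) ^ (p ^ j)) = (\<Sum>j<t. if N = M(j := N j) then lam e s * (s * aa i1 (N j) (M j) - s ^ q * aa i2 (N j) (M j)) ^ (p ^ j) else 0)"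
          unfolding kr_prod_Suc[OF up r0 N M(1) h] rs sum_distrib_left by (rule sum.cong) auto
      qed
      also have "\<dots> = (\<Sum>j<t. if N = M(j := N j) then ?X j (N j) else 0)"
        by (subst sum.swap) (rule sum.cong, use ls in auto)
      finally have E: "(\<Sum>s\<in>UNIV. lam e s * (\<Prod>j<t. kr (g s) (N j) (M j) ^ (p ^ j))) =
          (\<Sum>j<t. if N = M(j := N j) then ?X j (N j) else 0)" .
      show ?thesis unfolding E sum_distrib_left by (rule sum.cong[OF refl]) simp
    next
      case False
      then have h: "HT M \<le> HT N" using hN M by simp
      have "(\<Sum>s\<in>UNIV. lam e s * (\<Prod>j<t. kr (g s) (N j) (M j) ^ (p ^ j))) = 0"
        unfolding kr_prod_le[OF up N M(1) h] using sum_lam[OF e] by (simp add: sum_distrib_right[symmetric])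
      moreover have "?X j (N j) = 0" if j: "j < t" "N = M(j := N j)" for j
      proof -
        have "ht (M j) \<noteq> Suc (ht (N j))"
          using HT_upd[OF j(1), of M "N j"] j(2) h by simp
        then have "aa i1 (N j) (M j) = 0" "aa i2 (N j) (M j) = 0"
          using aa_height[OF i12(1,2), of "N j" "M j"] aa_height[OF i12(3,4), of "N j" "M j"] by blast+
        then show ?thesis by simp
      qed
      ultimately show ?thesis by (auto intro!: sum.neutral)
    qed
  qed
  have "(\<Sum>s\<in>UNIV. lam e s * TG (g s) f M) = (\<Sum>N\<in>TP. f N * (\<Sum>s\<in>UNIV. lam e s * (\<Prod>j<t. kr (g s) (N j) (M j) ^ (p ^ j))))"
    unfolding TG_def using M(1) by (simp add: sum_distrib_left) (subst sum.swap, simp add: mult_ac)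
  also have "\<dots> = (\<Sum>N\<in>TP. \<Sum>j<t. if N = M(j := N j) then f N * ?X j (N j) else 0)"
    by (rule sum.cong[OF refl]) (rule per)
  also have "\<dots> = (\<Sum>j<t. \<Sum>N\<in>TP. if N = M(j := N j) then f N * ?X j (N j) else 0)" by (rule sum.swap)
  also have "\<dots> = (\<Sum>j<t. \<Sum>l\<in>II0. f (M(j := l)) * ?X j l)"
  proof (rule sum.cong[OF refl])
    fix j assume "j \<in> {..<t}"
    then have j: "j < t" by simp
    have "(\<Sum>N\<in>TP. if N = M(j := N j) then f N * ?X j (N j) else 0) = (\<Sum>N\<in>{N \<in> TP. N = M(j := N j)}. f N * ?X j (N j))"
      by (rule sum.inter_filter[OF finite_TP, symmetric])
    also have "\<dots> = (\<Sum>l\<in>II0. f (M(j := l)) * ?X j l)"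
    proof (rule sum.reindex_bij_witness[where i = "\<lambda>l. M(j := l)" and j = "\<lambda>N. N j"])
      fix N assume N: "N \<in> {N \<in> TP. N = M(j := N j)}"
      then have e: "M(j := N j) = N" by (metis (mono_tags, lifting) mem_Collect_eq)
      show "M(j := N j) = N" by (rule e)
      show "N j \<in> II0" using N TP_mem[OF _ j] by blast
      show "f (M(j := N j)) * ?X j (N j) = f N * ?X j (N j)" by (simp only: e)
    next
      fix l assume "l \<in> II0"
      then show "M(j := l) \<in> {N \<in> TP. N = M(j := N j)}" using TP_upd[OF M(1) j] by simp
    qed simp
    finally show "(\<Sum>N\<in>TP. if N = M(j := N j) then f N * ?X j (N j) else 0) = (\<Sum>l\<in>II0. f (M(j := l)) * ?X j l)" .
  qed
  also have "\<dots> = (if e < t then (\<Sum>l\<in>II0. f (M(e := l)) * aa i1 l (M e))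
     else - (\<Sum>l\<in>II0. f (M(e - t := l)) * aa i2 l (M (e - t))))"
  proof -
    let ?j = "if e < t then e else e - t"
    have "(\<Sum>j<t. \<Sum>l\<in>II0. f (M(j := l)) * ?X j l) = (\<Sum>j<t. if j = ?j then (\<Sum>l\<in>II0. f (M(j := l)) * ?X j l) else 0)"
      by (rule sum.cong[OF refl]) (auto intro!: sum.neutral)
    also have "\<dots> = (\<Sum>l\<in>II0. f (M(?j := l)) * ?X ?j l)" using e by simp
    finally have E: "(\<Sum>j<t. \<Sum>l\<in>II0. f (M(j := l)) * ?X j l) = (\<Sum>l\<in>II0. f (M(?j := l)) * ?X ?j l)" .
    have "e \<noteq> e - t" if "\<not> e < t" using that t by simp
    then show ?thesis unfolding E using e t by (cases "e < t") (simp_all add: sum_negf)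
  qed
  finally show ?thesis .
qed

text \<open>Up to height n the action on f is the identity for every s, and the weights sum to
  0.\<close>

lemma extraction_below:
  assumes up: "\<And>s. up (g s) (r s)" and f: "\<forall>N. f N \<noteq> 0 \<longrightarrow> N \<in> TP \<and> n \<le> HT N"
    and h: "HT M \<le> n" and e: "e < 2 * t"
  shows "(\<Sum>s\<in>UNIV. lam e s * TG (g s) f M) = 0"
proof (cases "M \<in> TP")
  case False
  then show ?thesis by (simp add: TG_def)
next
  case True
  have T: "TG (g s) f M = (\<Sum>N\<in>TP. f N * (if M = N then 1 else 0))" for s
  proof -
    have E: "f N * (\<Prod>j<t. kr (g s) (N j) (M j) ^ (p ^ j)) = f N * (if M = N then 1 else 0)" if N: "N \<in> TP" for N
    proof (cases "f N = 0")
      case False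
      then have "HT M \<le> HT N" using f h by fastforce
      then show ?thesis using kr_prod_le[OF up N True] by simp
    qed simp
    show ?thesis unfolding TG_def if_P[OF True] by (rule sum.cong[OF refl]) (rule E)
  qed
  show ?thesis unfolding T sum_distrib_right[symmetric] sum_lam[OF e] by simp
qed

lemma HT_le: assumes "M \<in> TP" shows "HT M \<le> t * ht iota0"
proof -
  have "HT M \<le> (\<Sum>j<t. ht iota0)" unfolding HT_def
  proof (rule sum_mono)
    fix j assume "j \<in> {..<t}"
    then have "M j \<in> II" using TP_mem[OF assms] II0_subset by blast
    then show "ht (M j) \<le> ht iota0" by (rule ht_max)
  qed
  then show ?thesis by simp
qed

lemma slice_EE0:
  assumes f: "tgood f" and M: "M \<in> TP" and j: "j < t"
  shows "(\<lambda>l. if HT (M(j := l)) = n then f (M(j := l)) else 0) \<in> EE0"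
proof (cases "HT M \<le> n + ht (M j)")
  case True
  have "(\<lambda>l. if ht l = n + ht (M j) - HT M then f (M(j := l)) else 0) \<in> EE0"
    by (rule EE0_cut) (use f M j in \<open>auto simp: tgood_def\<close>)
  moreover have "HT (M(j := l)) = n \<longleftrightarrow> ht l = n + ht (M j) - HT M" for l
    using HT_upd[OF j, of M l] True by auto
  ultimately show ?thesis by simp
next
  case False
  then have "HT (M(j := l)) \<noteq> n" for l using HT_upd[OF j, of M l] by auto
  then show ?thesis using EE0_zero by simp
qed

lemma YY_zero:
  assumes trace: "\<exists>e. e + e ^ q = (-1 :: 'k)" and f: "f \<in> YY"
  shows "f M = 0"
proof (rule ccontr)
  assume nz: "f M \<noteq> 0"
  obtain \<epsilon> :: 'k where \<epsilon>: "\<epsilon> + \<epsilon> ^ q = -1" using trace by blast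
  \<comment> \<open>The levels below which some nonzero tensor of \<open>YY\<close> has no term.
    They are bounded by the height of the tensor with \<open>iota0\<close> in all slots, so a
    greatest one exists.\<close>
  define S where "S = {n. \<exists>f\<in>YY. (\<exists>M. f M \<noteq> 0) \<and> (\<forall>M. f M \<noteq> 0 \<longrightarrow> n \<le> HT M)}"
  have TPI: "M \<in> TP" if "f \<in> YY" "f M \<noteq> 0" for f M using that by (auto simp: YY_def tgood_def)
  have "S \<subseteq> {..t * ht iota0}"
  proof
    fix n assume "n \<in> S"
    then obtain f M where "f \<in> YY" "f M \<noteq> 0" "n \<le> HT M" unfolding S_def by blast
    then show "n \<in> {..t * ht iota0}" using HT_le[OF TPI] by fastforce
  qed
  then have finS: "finite S" using finite_subset by blast
  have "0 \<in> S" unfolding S_def using f nz by auto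
  define n where "n = Max S"
  have "n \<in> S" unfolding n_def using finS \<open>0 \<in> S\<close> by (intro Max_in) auto
  have max: "Suc n \<notin> S"
  proof
    assume "Suc n \<in> S"
    then have "Suc n \<le> n" unfolding n_def using finS by (intro Max_ge)
    then show False by simp
  qed
  from \<open>n \<in> S\<close> obtain f M1 where f: "f \<in> YY" and M1: "f M1 \<noteq> 0" and supp0: "\<forall>M. f M \<noteq> 0 \<longrightarrow> n \<le> HT M"
    unfolding S_def by blast
  have supp: "N \<in> TP \<and> n \<le> HT N" if "f N \<noteq> 0" for N using TPI[OF f that] supp0 that by blast
  have suppA: "\<forall>N. f N \<noteq> 0 \<longrightarrow> N \<in> TP \<and> n \<le> HT N" using supp by blast
  \<comment> \<open>An average stays in \<open>YY\<close> and has all its terms above level n, so a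
    nonzero one would contradict the choice of n.\<close>
  have van: "(\<Sum>s\<in>UNIV. lam e s * TG (g s) f M) = 0"
    if un: "\<And>s. unitary (g s)" and up: "\<And>s. up (g s) (r s)" and e: "e < 2 * t" for g r e M
  proof (rule ccontr)
    let ?G = "\<lambda>M. \<Sum>s\<in>UNIV. lam e s * TG (g s) f M"
    assume a: "?G M \<noteq> 0"
    have G: "?G \<in> YY" by (rule YY_sum) (simp, rule YY_TG[OF un up f])
    have hG: "Suc n \<le> HT N" if "?G N \<noteq> 0" for N
    proof (rule ccontr)
      assume "\<not> Suc n \<le> HT N"
      then have "HT N \<le> n" by simp
      from extraction_below[of g r f n, OF up suppA this e] that show False by simp
    qed
    have "\<exists>f\<in>YY. (\<exists>M. f M \<noteq> 0) \<and> (\<forall>M. f M \<noteq> 0 \<longrightarrow> Suc n \<le> HT M)"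
    proof (rule bexI[OF _ G], intro conjI exI allI impI)
      show "?G M \<noteq> 0" by (rule a)
    qed (rule hG)
    then have "Suc n \<in> S" unfolding S_def by (rule CollectI)
    then show False using max by simp
  qed
  define fn where "fn M = (if HT M = n then f M else 0)" for M
  have good: "tgood f" using f by (simp add: YY_def)
  have slice: "(\<lambda>l. fn (M(j := l))) \<in> EE0" if "M \<in> TP" "j < t" for M j
    unfolding fn_def by (rule slice_EE0[OF good that])
  have z: "(\<Sum>l'\<in>II0. fn (M(j := l')) * aa i l' l) = 0"
    if M: "M \<in> TP" and j: "j < t" and i: "0 < i" "i < 5" and l: "l \<in> II0" for M j i l
  proof (cases "HT (M(j := l)) = Suc n")
    case False
    have "fn (M(j := l')) * aa i l' l = 0" for l'
    proof (rule ccontr)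
      assume a: "fn (M(j := l')) * aa i l' l \<noteq> 0"
      then have "ht l = Suc (ht l')" using aa_height[OF i] by auto
      moreover have "HT (M(j := l')) = n" using a by (auto simp: fn_def split: if_splits)
      ultimately show False using False HT_upd[OF j, of M l] HT_upd[OF j, of M l'] by simp
    qed
    then show ?thesis by simp
  next
    case True
    let ?M = "M(j := l)"
    have M': "?M \<in> TP" using TP_upd[OF M j] l by simp
    have conv: "fn (M(j := l')) * aa i l' l = f (?M(j := l')) * aa i l' (?M j)" for l'
    proof (cases "aa i l' l = 0")
      case nz: False
      then have "ht l = Suc (ht l')" using aa_height[OF i] by blast
      then have "HT (M(j := l')) = n" using True HT_upd[OF j, of M l] HT_upd[OF j, of M l'] by simp
      then show ?thesis by (simp add: fn_def)
    qed simp
    have j2: "j < 2 * t" "t + j < 2 * t" using j by simp_all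
    \<comment> \<open>With the weight index j the first root of a family is isolated in slot j, with
      t + j the second one: 1 and 4 come from \<open>g1\<close>, 3 and 2 from
      \<open>g2\<close>.\<close>
    note x1 = extraction[of g1 1 4 f n ?M, OF up_g1 _ _ _ _ _ suppA M' True]
    note x2 = extraction[of "g2 \<epsilon>" 3 2 f n ?M, OF up_g2 _ _ _ _ _ suppA M' True]
    have "(\<Sum>l'\<in>II0. f (?M(j := l')) * aa i l' (?M j)) = 0"
    proof -
      have "i = 1 \<or> i = 2 \<or> i = 3 \<or> i = 4" using i by auto
      moreover have "(\<Sum>l'\<in>II0. f (?M(j := l')) * aa 1 l' (?M j)) = 0"
        using x1[OF _ _ _ _ _ j2(1)] van[of g1, OF unitary_g1 up_g1 j2(1), of ?M] j by simp
      moreover have "(\<Sum>l'\<in>II0. f (?M(j := l')) * aa 4 l' (?M j)) = 0"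
        using x1[OF _ _ _ _ _ j2(2)] van[of g1, OF unitary_g1 up_g1 j2(2), of ?M] j by simp
      moreover have "(\<Sum>l'\<in>II0. f (?M(j := l')) * aa 3 l' (?M j)) = 0"
        using x2[OF _ _ _ _ _ j2(1)] van[of "g2 \<epsilon>", OF unitary_g2[OF \<epsilon>] up_g2 j2(1), of ?M] j by simp
      moreover have "(\<Sum>l'\<in>II0. f (?M(j := l')) * aa 2 l' (?M j)) = 0"
        using x2[OF _ _ _ _ _ j2(2)] van[of "g2 \<epsilon>", OF unitary_g2[OF \<epsilon>] up_g2 j2(2), of ?M] j by simp
      ultimately show ?thesis by blast
    qed
    then show ?thesis unfolding conv .
  qed
  have iota: "l = iota0" if M: "M \<in> TP" and j: "j < t" and nz: "fn (M(j := l)) \<noteq> 0" for M j l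
  proof (rule EE0_highest[OF slice[OF M j] _ nz])
    fix i :: nat and \<alpha> \<beta> assume i: "i < 4" and b: "below \<alpha>" "below \<beta>"
    have "raising (Suc i - 1) (Suc i) (ext (\<lambda>l. fn (M(j := l)))) \<alpha> \<beta> = 0"
      by (rule raising_vanish[OF slice[OF M j] _ _ _ b]) (use z[OF M j] i in auto)
    then show "raising i (Suc i) (ext (\<lambda>l. fn (M(j := l)))) \<alpha> \<beta> = 0" by simp
  qed
  have all: "M j = iota0" if "f M \<noteq> 0" "HT M = n" "j < t" for M j
    using iota[of M j "M j"] TPI[OF f that(1)] that by (simp add: fn_def)
  obtain M0 where M0: "f M0 \<noteq> 0" "HT M0 = n"
  proof -
    have "\<exists>M. f M \<noteq> 0 \<and> HT M = n"
    proof (rule ccontr)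
      assume a: "\<not> ?thesis"
      have "Suc n \<le> HT M" if "f M \<noteq> 0" for M using supp[OF that] a that by (metis Suc_leI le_neq_implies_less)
      then have "\<forall>M. f M \<noteq> 0 \<longrightarrow> Suc n \<le> HT M" by blast
      then have "\<exists>f\<in>YY. (\<exists>M. f M \<noteq> 0) \<and> (\<forall>M. f M \<noteq> 0 \<longrightarrow> Suc n \<le> HT M)"
        using f M1 by blast
      then have "Suc n \<in> S" unfolding S_def by (rule CollectI)
      then show False using max by simp
    qed
    then show thesis using that by blast
  qed
  \<comment> \<open>The least height of f equals the greatest possible height, so f has the single
    term \<open>M0\<close>, which the reversed basis detects.\<close>
  have n_eq: "n = t * ht iota0" using all[OF M0] M0(2) unfolding HT_def by simp
  have uniq: "N = M0" if "f N \<noteq> 0" for N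
  proof -
    have "HT N = n" using supp[OF that] HT_le[of N] n_eq by simp
    then have "N j = M0 j" if "j < t" for j using all[OF \<open>f N \<noteq> 0\<close> _ that] all[OF M0 that] by simp
    then show ?thesis using TPI[OF f that] TPI[OF f M0(1)] unfolding TP_def by (intro PiE_ext) auto
  qed
  have "pr f vop = (\<Sum>N\<in>TP. if N = M0 then f N else 0)"
    unfolding pr_def
  proof (rule sum.cong[OF refl])
    fix N assume "N \<in> TP"
    show "f N * (\<Prod>j<t. db vop (N j) ^ p ^ j) = (if N = M0 then f N else 0)"
    proof (cases "N = M0")
      case True
      then show ?thesis using all[OF M0] db_vop by simp
    next
      case False
      then show ?thesis using uniq[of N] by auto
    qed
  qed
  also have "\<dots> = f M0" using TPI[OF f M0(1)] finite_TP by simp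
  finally show False using f M0(1) frame_vop by (simp add: YY_def)
qed

end

section \<open>Witt bases and dual points\<close>

locale herm5 = hermitian_space scale q h + char_p p ty
  for scale :: "'k :: {field, finite} \<Rightarrow> 'v :: ab_group_add \<Rightarrow> 'v" and q :: nat and h and p :: nat and ty :: "'k itself" +
  fixes t :: nat
  assumes q: "q = p ^ t" and t: "t \<ge> 1" and dim5: "dim (UNIV :: 'v set) = 5"
begin

lemma q_add: "(a + b :: 'k) ^ q = a ^ q + b ^ q" unfolding q by (rule frobenius_add)
lemma q_minus: "(- a :: 'k) ^ q = - (a ^ q)" unfolding q by (rule frobenius_minus)
lemma q_diff: "(a - b :: 'k) ^ q = a ^ q - b ^ q" unfolding q by (rule frobenius_diff)

lemma q_ge: "q \<ge> 2"
proof -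
  have "p ^ 1 \<le> p ^ t" using t p_pos by (intro power_increasing) auto
  then show ?thesis using p_pos q by simp
qed

lemma form_right_simps:
  "h x (y + z) = h x y + h x z" "h x (scale a y) = a ^ q * h x y"
  "h (x - y) z = h x z - h y z" "h x (y - z) = h x y - h x z" "h x 0 = 0"
proof -
  show a: "h x (y + z) = h x y + h x z" for x y z by (metis form_add_left form_hermitian q_add)
  show "h x (scale a y) = a ^ q * h x y" by (metis form_scale_left form_hermitian power_mult_distrib)
  show "h (x - y) z = h x z - h y z" using form_add_left[of "x - y" y z] by simp
  show "h x (y - z) = h x y - h x z" using a[of x "y - z" z] by simp
  have "h x 0 = h 0 x ^ q" by (rule form_hermitian)
  then show "h x 0 = 0" using q_ge by simp
qed

lemmas fs = form_add_left form_scale_left form_right_simps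

lemma field_power: "(a :: 'k) ^ (q ^ 2) = a"
proof (cases "a = 0")
  case False
  let ?U = "UNIV - {0 :: 'k}"
  have c: "card ?U = q ^ 2 - 1" by (simp add: card_Diff_singleton card_field)
  have "(\<Prod>x\<in>?U. x) = (\<Prod>x\<in>?U. a * x)"
    by (rule prod.reindex_bij_witness[where i = "\<lambda>x. a * x" and j = "\<lambda>x. x / a"]) (use False in auto)
  also have "\<dots> = a ^ (q ^ 2 - 1) * (\<Prod>x\<in>?U. x)" by (simp add: prod.distrib c)
  finally have "a ^ (q ^ 2 - 1) = 1" by (simp add: prod_zero_iff)
  then have "a * a ^ (q ^ 2 - 1) = a" by simp
  moreover have "Suc (q ^ 2 - 1) = q ^ 2" using q_ge by simp
  ultimately show ?thesis by (metis power_Suc)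
qed (use q_ge in simp)

lemma qq: "((a :: 'k) ^ q) ^ q = a"
  using field_power[of a] by (simp add: power2_eq_square power_mult)

lemma root_bound:
  assumes "n \<ge> 2" shows "card {x :: 'k. x ^ n + a * x + b = 0} \<le> n"
proof -
  let ?P = "Polynomial.monom 1 n + [:b, a:] :: 'k poly"
  have "Polynomial.coeff [:b, a:] n = 0" using assms by (intro coeff_eq_0) auto
  then have "Polynomial.coeff ?P n = 1" by simp
  then have nz: "?P \<noteq> 0" by force
  have "Polynomial.degree ?P \<le> n" using assms by (intro degree_add_le) (auto simp: degree_monom_le)
  moreover have "{x. poly ?P x = 0} = {x. x ^ n + a * x + b = 0}"
    by (auto simp: Polynomial.poly_monom algebra_simps)
  ultimately show ?thesis using card_poly_roots_bound[OF nz] by simp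
qed

definition FF :: "'k set" where "FF = {c. c ^ q = c}"

lemma card_FF: "card FF \<le> q"
proof -
  have "FF = {x. x ^ q + (-1) * x + 0 = 0}" by (auto simp: FF_def)
  then show ?thesis using root_bound[OF q_ge, of "-1" 0] by simp
qed

definition TR :: "'k set" where "TR = {s. s + s ^ q = 0}"

text \<open>The image lies in \<open>FF\<close> and the kernel is \<open>TR\<close>, both of at most
  q elements by \<open>root_bound\<close>, while the product of their orders is at least q^2. So
  equality holds throughout.\<close>

lemma trace_surj: "FF \<subseteq> (\<lambda>e. e + e ^ q) ` UNIV" and card_TR: "card TR = q"
proof -
  let ?f = "\<lambda>e :: 'k. e + e ^ q"
  have T: "TR = {x. x ^ q + 1 * x + 0 = 0}" by (auto simp: TR_def add.commute)
  have T2: "card TR \<le> q" unfolding T by (rule root_bound[OF q_ge])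
  have im: "?f ` UNIV \<subseteq> FF" by (auto simp: FF_def q_add qq add.commute)
  have "card (UNIV :: 'k set) \<le> card (?f ` UNIV) * card {x \<in> UNIV. ?f x = 0}"
    using card_kernel_image[of "UNIV :: 'k set" ?f "?f ` UNIV"] by (simp add: q_diff)
  moreover have "{x \<in> UNIV. ?f x = 0} = TR" by (simp add: TR_def)
  ultimately have le: "q * q \<le> card (?f ` UNIV) * card TR" by (simp add: card_field power2_eq_square)
  have i1: "card (?f ` UNIV) \<le> q" using card_mono[OF _ im] card_FF by (simp add: order_trans)
  have "q * q \<le> q * card TR" using le i1 by (meson mult_le_mono1 order_trans)
  then show "card TR = q" using T2 q_ge by simp
  have "q * q \<le> card (?f ` UNIV) * q" using le T2 by (meson mult_le_mono2 order_trans)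
  then have "q \<le> card (?f ` UNIV)" using q_ge by simp
  then have "card FF \<le> card (?f ` UNIV)" using card_FF by simp
  then have "?f ` UNIV = FF" using im by (intro card_seteq) auto
  then show "FF \<subseteq> ?f ` UNIV" by simp
qed

lemma trace_ex: assumes "c ^ q = c" obtains e where "e + e ^ q = (c :: 'k)"
  using trace_surj assms by (auto simp: FF_def)

lemma trace_minus_one: "\<exists>e. e + e ^ q = (-1 :: 'k)"
  using trace_ex[of "-1"] by (auto simp: q_minus)

text \<open>Fibres of the norm have at most q + 1 elements, so the q^2 - 1 nonzero scalars have at
  least q - 1 distinct norms; \<open>FF - {0}\<close> has no more elements than that.\<close>

lemma norm_ex: assumes c: "c ^ q = c" "c \<noteq> 0" obtains a where "a * a ^ q = (c :: 'k)"
proof -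
  let ?N = "\<lambda>a :: 'k. a * a ^ q" and ?U = "UNIV - {0 :: 'k}"
  have im: "?N ` ?U \<subseteq> FF - {0}" by (auto simp: FF_def power_mult_distrib qq mult.commute)
  have fib: "card {a \<in> ?U. ?N a = c} \<le> q + 1" for c
  proof -
    have "card {a \<in> ?U. ?N a = c} \<le> card {x :: 'k. x ^ (q + 1) + 0 * x + (- c) = 0}"
      by (rule card_mono) (auto simp: algebra_simps)
    also have "\<dots> \<le> q + 1" using q_ge by (intro root_bound) simp
    finally show ?thesis .
  qed
  have u: "?U = (\<Union>c\<in>?N ` ?U. {a \<in> ?U. ?N a = c})" by blast
  have "card ?U \<le> (\<Sum>c\<in>?N ` ?U. card {a \<in> ?U. ?N a = c})"
    by (subst (1) u, rule card_UN_le) simp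
  also have "\<dots> \<le> (\<Sum>c\<in>?N ` ?U. q + 1)" by (intro sum_mono fib)
  finally have "q ^ 2 - 1 \<le> card (?N ` ?U) * (q + 1)" by (simp add: card_Diff_singleton card_field)
  moreover have "q ^ 2 - 1 = (q - 1) * (q + 1)"
    using q_ge by (simp add: power2_eq_square diff_mult_distrib)
  ultimately have "(q - 1) * (q + 1) \<le> card (?N ` ?U) * (q + 1)" by (simp only:)
  then have ge: "q - 1 \<le> card (?N ` ?U)" unfolding mult_le_cancel2 by simp
  have le: "card (FF - {0}) \<le> q - 1"
  proof -
    have "0 \<in> FF" using q_ge by (simp add: FF_def)
    then show ?thesis using card_FF by (simp add: card_Diff_singleton)
  qed
  have "?N ` ?U = FF - {0}" using le ge by (intro card_seteq[OF _ im]) simp_all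
  moreover have "c \<in> FF - {0}" using c by (simp add: FF_def)
  ultimately have "c \<in> ?N ` ?U" by simp
  then obtain a where "c = a * a ^ q" by (rule imageE)
  from this[symmetric] show thesis by (rule that)
qed

lemma card_V: "finite (UNIV :: 'v set)" "CARD('v) = (q ^ 2) ^ 5"
proof -
  obtain B where B: "independent B" "span B = UNIV" "card B = 5"
  proof -
    obtain B where B: "independent B" "UNIV \<subseteq> span B" "card B = dim UNIV"
      by (rule basis_exists[of UNIV])
    have "span B = UNIV" using B(2) by blast
    then show thesis by (intro that[of B] B(1)) (simp_all add: B(3) dim5)
  qed
  have fB: "finite B" by (rule card_ge_0_finite) (simp add: B(3))
  let ?f = "\<lambda>c. \<Sum>b\<in>B. scale (c b) b"
  have "bij_betw ?f (B \<rightarrow>\<^sub>E (UNIV :: 'k set)) UNIV"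
    unfolding bij_betw_def
  proof
    show "inj_on ?f (B \<rightarrow>\<^sub>E UNIV)"
    proof (rule inj_onI)
      fix c d assume c: "c \<in> B \<rightarrow>\<^sub>E UNIV" and d: "d \<in> B \<rightarrow>\<^sub>E UNIV" and e: "?f c = ?f d"
      have "(\<Sum>b\<in>B. scale (c b - d b) b) = 0" using e by (simp add: scale_left_diff_distrib sum_subtractf)
      then have "c b - d b = 0" if "b \<in> B" for b
        using independentD[OF B(1) fB subset_refl, of "\<lambda>b. c b - d b"] that by blast
      then show "c = d" using c d by (intro PiE_ext) auto
    qed
    show "?f ` (B \<rightarrow>\<^sub>E UNIV) = UNIV"
    proof (rule UNIV_eq_I[symmetric])
      fix x
      have "x \<in> span B" using B by simp
      then obtain u where "x = (\<Sum>b\<in>B. scale (u b) b)" unfolding span_finite[OF fB] by (rule imageE)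
      then have "x = ?f (restrict u B)" by simp
      then show "x \<in> ?f ` (B \<rightarrow>\<^sub>E UNIV)" by (rule image_eqI[where x = "restrict u B"]) simp
    qed
  qed
  moreover have "finite (B \<rightarrow>\<^sub>E (UNIV :: 'k set))" using fB by (intro finite_PiE) simp_all
  ultimately have "finite (UNIV :: 'v set) \<and> CARD('v) = card (B \<rightarrow>\<^sub>E (UNIV :: 'k set))"
    using bij_betw_finite[of ?f] bij_betw_same_card[of ?f] by simp
  then show "finite (UNIV :: 'v set)" "CARD('v) = (q ^ 2) ^ 5"
    using fB B(3) by (simp_all add: card_PiE card_field)
qed

text \<open>Spans of lists, in a recursive form from which the bound on the cardinality is
  immediate; \<open>ex_outside\<close> finds new vectors by this bound.\<close>

primrec comb :: "'v list \<Rightarrow> 'v set" where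
  comb_Nil: "comb [] = {0}"
| comb_Suc: "comb (x # xs) = (\<lambda>(a, y). scale a x + y) ` (UNIV \<times> comb xs)"

lemma card_comb: "finite (comb xs) \<and> card (comb xs) \<le> (q ^ 2) ^ length xs"
proof (induction xs)
  case Nil
  then show ?case by (simp add: comb_Nil)
next
  case (Cons x xs)
  have "card (comb (x # xs)) \<le> card ((UNIV :: 'k set) \<times> comb xs)"
    unfolding comb_Suc using Cons by (intro card_image_le) auto
  also have "\<dots> \<le> q ^ 2 * (q ^ 2) ^ length xs"
    using Cons by (simp add: card_cartesian_product card_field)
  finally show ?case unfolding comb_Suc using Cons by simp
qed

lemma ex_outside: assumes "length xs < 5" obtains x where "x \<notin> comb xs"
proof -
  have "2 ^ 2 \<le> q ^ 2" by (rule power_mono[OF q_ge]) simp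
  then have "1 < q ^ 2" by simp
  then have "(q ^ 2) ^ length xs < (q ^ 2) ^ 5" using assms by (intro power_strict_increasing) auto
  then have "card (comb xs) < CARD('v)" using card_comb[of xs] card_V(2) by linarith
  then have "comb xs \<noteq> UNIV" by auto
  then show thesis using that by blast
qed

lemma comb2: "x \<in> comb [a, b] \<longleftrightarrow> (\<exists>\<alpha> \<beta>. x = scale \<alpha> a + scale \<beta> b)"
  by (auto simp: image_iff)

lemma comb3: "x \<in> comb [a, b, c] \<longleftrightarrow> (\<exists>\<alpha> \<beta> \<gamma>. x = scale \<alpha> a + scale \<beta> b + scale \<gamma> c)"
  by (auto simp: image_iff add.assoc)

lemma comb4: "x \<in> comb [a, b, c, d] \<longleftrightarrow> (\<exists>\<alpha> \<beta> \<gamma> \<delta>. x = scale \<alpha> a + scale \<beta> b + scale \<gamma> c + scale \<delta> d)"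
  by (auto simp: image_iff add.assoc)

lemma h_self: "(h x x) ^ q = h x x" using form_hermitian[of x x] by simp

text \<open>Adding l times a changes the norm of c by the trace of l, and every scalar fixed by the
  involution is a trace.\<close>

lemma isotropic_adjust:
  assumes "h a a = 0" "h a c = 1"
  obtains l where "h (c + scale l a) (c + scale l a) = 0"
proof -
  have ca: "h c a = 1" using form_hermitian[where x = a and y = c] assms by simp
  have "(- h c c) ^ q = - h c c" by (simp add: q_minus h_self)
  then obtain l where l: "l + l ^ q = - h c c" by (rule trace_ex)
  have "h (c + scale l a) (c + scale l a) = h c c + (l + l ^ q)"
    using assms ca by (simp add: fs algebra_simps)
  then show thesis using that[of l] l by simp
qed

text \<open>With y orthogonalized to w, the vector x + a w is isotropic as soon as a has norm - h x
  x / h w w, a nonzero scalar fixed by the involution.\<close>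

lemma isotropic_in_pair:
  assumes ind: "\<And>\<alpha> \<beta>. scale \<alpha> x + scale \<beta> y = 0 \<Longrightarrow> \<alpha> = 0 \<and> \<beta> = 0"
  obtains \<alpha> \<beta> where "\<alpha> \<noteq> 0 \<or> \<beta> \<noteq> 0" "h (scale \<alpha> x + scale \<beta> y) (scale \<alpha> x + scale \<beta> y) = 0"
proof (cases "h x x = 0")
  case True
  then show thesis using that[of 1 0] by simp
next
  case x0: False
  define c where "c = h y x / h x x"
  define w where "w = y - scale c x"
  have wx: "h w x = 0" using x0 by (simp add: w_def c_def fs)
  then have xw: "h x w = 0" using form_hermitian[where x = w and y = x] q_ge by simp
  show thesis
  proof (cases "h w w = 0")
    case True
    have "w = scale (- c) x + scale 1 y" by (simp add: w_def)
    then show thesis using that[of "- c" 1] True by simp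
  next
    case w0: False
    have "(- h x x / h w w) ^ q = - h x x / h w w" by (simp add: power_divide q_minus h_self)
    moreover have "- h x x / h w w \<noteq> 0" using x0 w0 by simp
    ultimately obtain a where a: "a * a ^ q = - h x x / h w w" by (rule norm_ex)
    have "h (x + scale a w) (x + scale a w) = h x x + a * a ^ q * h w w"
      by (simp add: fs wx xw mult_ac)
    also have "\<dots> = 0" unfolding a using w0 by simp
    finally have z: "h (x + scale a w) (x + scale a w) = 0" .
    have e: "x + scale a w = scale (1 - a * c) x + scale a y"
      by (simp add: w_def scale_right_diff_distrib scale_left_diff_distrib algebra_simps)
    have "1 - a * c \<noteq> 0 \<or> a \<noteq> 0" by auto
    then show thesis using that z unfolding e by blast
  qed
qed

end

section \<open>Extension of isotropic planes to Witt bases\<close>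

context herm5
begin

lemma TR_0: "0 \<in> TR" using q_ge by (simp add: TR_def)

lemma form_sym0: "h x y = 0 \<Longrightarrow> h y x = 0" using form_hermitian[where x = x and y = y] q_ge by simp
lemma form_sym1: "h x y = 1 \<Longrightarrow> h y x = 1" using form_hermitian[where x = x and y = y] by simp

text \<open>Five independent vectors have (q^2)^5 distinct combinations, as many as there are
  vectors in the space.\<close>

lemma five_spanning:
  assumes ind: "\<And>c. (\<Sum>i<5::nat. scale (c i) (b i)) = 0 \<Longrightarrow> \<forall>i<5::nat. c i = 0"
  obtains c where "x = (\<Sum>i<5::nat. scale (c i) (b i))"
proof -
  let ?f = "\<lambda>c. \<Sum>i<5. scale (c i) (b i)" and ?C = "{..<5 :: nat} \<rightarrow>\<^sub>E (UNIV :: 'k set)"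
  have "inj_on ?f ?C"
  proof (rule inj_onI)
    fix c d assume c: "c \<in> ?C" and d: "d \<in> ?C" and e: "?f c = ?f d"
    have "(\<Sum>i<5. scale (c i - d i) (b i)) = 0"
      using e by (simp add: scale_left_diff_distrib sum_subtractf)
    then have "\<forall>i<5. c i - d i = 0" by (rule ind)
    then show "c = d" using c d by (intro PiE_ext) auto
  qed
  then have "card (?f ` ?C) = CARD('v)" by (simp add: card_image card_PiE card_field card_V(2))
  then have "?f ` ?C = UNIV" using card_V(1) by (intro card_subset_eq) simp_all
  then have "x \<in> ?f ` ?C" by simp
  then obtain c where "x = ?f c" by (rule imageE)
  then show thesis by (rule that)
qed

lemma frame_coord:
  assumes "frame b" "j < 5" shows "h (\<Sum>i<5. scale (c i) (b i)) (b (4 - j)) = c j"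
proof -
  have "h (\<Sum>i<5. scale (c i) (b i)) (b (4 - j)) = (\<Sum>i<5. if i = j then c i else 0)"
    unfolding form_sum_left using assms by (intro sum.cong) (auto simp: form_scale_left frame_def)
  then show ?thesis using assms(2) by simp
qed

lemma frame_expansion:
  assumes b: "frame b" shows "x = (\<Sum>i<5. scale (h x (b (4 - i))) (b i))"
proof -
  obtain c where c: "x = (\<Sum>i<5. scale (c i) (b i))"
  proof (rule five_spanning[of b x])
    fix c assume "(\<Sum>i<5. scale (c i) (b i)) = 0"
    then show "\<forall>i<5. c i = 0" using frame_coord[OF b, of _ c] by simp
  qed
  show ?thesis
    by (subst (1) c, rule sum.cong[OF refl]) (simp add: c frame_coord[OF b])
qed

definition indep2 :: "'v \<Rightarrow> 'v \<Rightarrow> bool" where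
  "indep2 a b \<longleftrightarrow> (\<forall>\<alpha> \<beta>. scale \<alpha> a + scale \<beta> b = 0 \<longrightarrow> \<alpha> = 0 \<and> \<beta> = 0)"

lemma indep2_commute: "indep2 a b \<Longrightarrow> indep2 b a"
  unfolding indep2_def by (metis add.commute)

lemma dual_vector1: assumes "b \<noteq> 0" obtains y where "h y b = 1"
proof -
  have "\<not> (\<forall>y. h b y = 0)" using form_nondegenerate[of b] assms by blast
  then obtain y where "h b y \<noteq> 0" by blast
  then have "h y b \<noteq> 0" using form_sym0[of y b] by blast
  then have "h (scale (1 / h y b) y) b = 1" by (simp add: form_scale_left)
  then show thesis by (rule that)
qed

text \<open>If all vectors orthogonal to b were orthogonal to a as well, a would be a multiple of b
  by nondegeneracy.\<close>

lemma dual_vector2: assumes "indep2 a b" obtains x where "h x a = 1" "h x b = 0"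
proof -
  have b0: "b \<noteq> 0"
  proof
    assume "b = 0"
    then have "scale 0 a + scale 1 b = 0" by simp
    then show False using assms unfolding indep2_def by (metis zero_neq_one)
  qed
  obtain y where y: "h y b = 1" by (rule dual_vector1[OF b0])
  have "\<exists>x. h x b = 0 \<and> h x a \<noteq> 0"
  proof (rule ccontr)
    assume none: "\<nexists>x. h x b = 0 \<and> h x a \<noteq> 0"
    define s where "s = h a y"
    have sq: "s ^ q = h y a" using form_hermitian[where x = a and y = y] by (simp add: s_def)
    have "h x (a - scale s b) = 0" for x
    proof -
      have "h (x - scale (h x b) y) b = 0" using y by (simp add: fs)
      then have "h (x - scale (h x b) y) a = 0" using none by blast
      then have "h x a = h x b * h y a" by (simp add: fs)
      then show ?thesis by (simp add: fs sq mult.commute)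
    qed
    then have "a - scale s b = 0" using form_sym0 by (intro form_nondegenerate) blast
    then have "scale 1 a + scale (- s) b = 0" by simp
    then show False using assms unfolding indep2_def by (metis zero_neq_one)
  qed
  then obtain x where x: "h x b = 0" "h x a \<noteq> 0" by blast
  show thesis by (rule that[of "scale (1 / h x a) x"]) (use x in \<open>simp_all add: form_scale_left\<close>)
qed

text \<open>The vectors c and d are isotropic partners dual to a and b. A fifth vector orthogonal to
  these four is anisotropic, since otherwise it would lie in the radical of the form, and
  surjectivity of the norm scales it to norm 1.\<close>

lemma pair_frame:
  assumes iso: "h a a = 0" "h b b = 0" "h a b = 0" and ind: "indep2 a b"
  obtains v where "frame v" "v 0 = a" "v 1 = b"
proof -
  have ba: "h b a = 0" by (rule form_sym0[OF iso(3)])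
  obtain c0 where c0: "h c0 a = 1" "h c0 b = 0" by (rule dual_vector2[OF ind])
  obtain l where l: "h (c0 + scale l a) (c0 + scale l a) = 0"
    by (rule isotropic_adjust[OF iso(1) form_sym1[OF c0(1)]])
  define c where "c = c0 + scale l a"
  have c: "h c c = 0" "h c a = 1" "h c b = 0" using l c0 iso by (simp_all add: c_def fs)
  note c' = form_sym1[OF c(2)] form_sym0[OF c(3)]
  obtain d0 where d0: "h d0 b = 1" "h d0 a = 0" by (rule dual_vector2[OF indep2_commute[OF ind]])
  define d1 where "d1 = d0 - scale (h d0 c) a"
  have d1: "h d1 c = 0" "h d1 b = 1" "h d1 a = 0" using d0 c' iso by (simp_all add: d1_def fs)
  obtain m where m: "h (d1 + scale m b) (d1 + scale m b) = 0"
    by (rule isotropic_adjust[OF iso(2) form_sym1[OF d1(2)]])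
  define d where "d = d1 + scale m b"
  have d: "h d d = 0" "h d b = 1" "h d a = 0" "h d c = 0" using m d1 c' iso ba by (simp_all add: d_def fs)
  note d' = form_sym1[OF d(2)] form_sym0[OF d(3)] form_sym0[OF d(4)]
  obtain x where x: "x \<notin> comb [a, b, c, d]" by (rule ex_outside[of "[a, b, c, d]"]) simp
  define u where "u = x - scale (h x c) a - scale (h x d) b - scale (h x a) c - scale (h x b) d"
  have u: "h u a = 0" "h u b = 0" "h u c = 0" "h u d = 0"
    using iso ba c c' d d' by (simp_all add: u_def fs)
  note u' = form_sym0[OF u(1)] form_sym0[OF u(2)] form_sym0[OF u(3)] form_sym0[OF u(4)]
  have u0: "u \<noteq> 0"
  proof
    assume "u = 0"
    then have "x = scale (h x c) a + scale (h x d) b + scale (h x a) c + scale (h x b) d"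
      by (simp add: u_def algebra_simps)
    then show False using x unfolding comb4 by blast
  qed
  have uu: "h u u \<noteq> 0"
  proof
    assume uu: "h u u = 0"
    define w where "w = (\<lambda>i. [a, b, u, d, c] ! i)"
    have w: "(\<Sum>i<5. scale (e i) (w i)) = scale (e 0) a + scale (e 1) b + scale (e 2) u + scale (e 3) d + scale (e 4) c" for e
      by (simp add: w_def lessThan_5 add.assoc)
    have "h u y = 0" for y
    proof -
      obtain e where e: "y = (\<Sum>i<5. scale (e i) (w i))"
      proof (rule five_spanning[of w y])
        fix e assume "(\<Sum>i<5. scale (e i) (w i)) = 0"
        then have z: "scale (e 0) a + scale (e 1) b + scale (e 2) u + scale (e 3) d + scale (e 4) c = 0"
          unfolding w .
        have "e 4 = 0" using arg_cong[OF z, of "\<lambda>z. h z a"] iso ba c d u by (simp add: fs)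
        moreover have "e 3 = 0" using arg_cong[OF z, of "\<lambda>z. h z b"] iso ba c d u by (simp add: fs)
        moreover have "e 1 = 0" using arg_cong[OF z, of "\<lambda>z. h z d"] iso ba c c' d d' u u' by (simp add: fs)
        moreover have "e 0 = 0" using arg_cong[OF z, of "\<lambda>z. h z c"] iso ba c c' d d' u u' by (simp add: fs)
        ultimately show "\<forall>i<5. e i = 0"
          using z u0 by (simp add: numeral_eq_Suc All_less_Suc)
      qed
      then show ?thesis unfolding w using u uu by (simp add: fs)
    qed
    then have "u = 0" by (rule form_nondegenerate)
    with u0 show False ..
  qed
  have "(1 / h u u) ^ q = 1 / h u u" by (simp add: power_divide h_self)
  moreover have "1 / h u u \<noteq> 0" using uu by simp
  ultimately obtain s where s: "s * s ^ q = 1 / h u u" by (rule norm_ex)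
  define u1 where "u1 = scale s u"
  have "h u1 u1 = s * s ^ q * h u u" by (simp add: u1_def fs mult_ac)
  then have u11: "h u1 u1 = 1" using s uu by simp
  have u1: "h u1 a = 0" "h u1 b = 0" "h u1 c = 0" "h u1 d = 0"
    "h a u1 = 0" "h b u1 = 0" "h c u1 = 0" "h d u1 = 0"
    using u u' by (simp_all add: u1_def fs)
  define v where "v = (\<lambda>i. [a, b, u1, d, c] ! i)"
  have "frame v"
    unfolding frame_def v_def using iso ba c c' d d' u1 u11
    by (simp add: numeral_eq_Suc All_less_Suc)
  then show thesis by (rule that) (simp_all add: v_def)
qed

lemma outside_pair: assumes "x \<noteq> 0" "y \<notin> comb [x]" shows "indep2 x y"
  unfolding indep2_def
proof (intro allI impI)
  fix \<alpha> \<beta> assume e: "scale \<alpha> x + scale \<beta> y = 0"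
  have "\<beta> = 0"
  proof (rule ccontr)
    assume b: "\<beta> \<noteq> 0"
    have "y = scale (1 / \<beta>) (scale \<beta> y)" using b by simp
    also have "scale \<beta> y = scale (- \<alpha>) x" using e by (simp add: eq_neg_iff_add_eq_0 add.commute)
    finally have "y = scale (1 / \<beta> * - \<alpha>) x" by (simp only: scale_scale)
    then have "\<exists>c. y = scale c x" by (rule exI)
    then show False using assms(2) by (simp add: image_iff)
  qed
  then show "\<alpha> = 0 \<and> \<beta> = 0" using e assms(1) by simp
qed

text \<open>Any two independent vectors have an isotropic combination a. A second one is found in a
  plane inside the perpendicular space of a that does not contain a.\<close>

lemma ex_frame: "\<exists>v. frame v"
proof -
  obtain x where "x \<notin> comb []" by (rule ex_outside[of "[]"]) simp
  then have x: "x \<noteq> 0" by simp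
  obtain y where y: "y \<notin> comb [x]" by (rule ex_outside[of "[x]"]) simp
  have i: "scale \<alpha> x + scale \<beta> y = 0 \<Longrightarrow> \<alpha> = 0 \<and> \<beta> = 0" for \<alpha> \<beta>
    using outside_pair[OF x y] unfolding indep2_def by blast
  obtain \<alpha> \<beta> where ab: "\<alpha> \<noteq> 0 \<or> \<beta> \<noteq> 0" "h (scale \<alpha> x + scale \<beta> y) (scale \<alpha> x + scale \<beta> y) = 0"
    by (rule isotropic_in_pair[OF i])
  define a where "a = scale \<alpha> x + scale \<beta> y"
  have a0: "a \<noteq> 0" using i[of \<alpha> \<beta>] ab(1) unfolding a_def by blast
  have aa: "h a a = 0" unfolding a_def by (rule ab(2))
  obtain c where c: "h c a = 1" by (rule dual_vector1[OF a0])
  obtain x1 where x1: "x1 \<notin> comb [a, c]" by (rule ex_outside[of "[a, c]"]) simp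
  obtain y1 where y1: "y1 \<notin> comb [x1, a, c]" by (rule ex_outside[of "[x1, a, c]"]) simp
  define x2 where "x2 = x1 - scale (h x1 a) c"
  define y2 where "y2 = y1 - scale (h y1 a) c"
  have xa: "h x2 a = 0" "h y2 a = 0" using c by (simp_all add: x2_def y2_def fs)
  have j: "\<alpha> = 0 \<and> \<beta> = 0 \<and> \<gamma> = 0" if e: "scale \<alpha> x2 + scale \<beta> y2 + scale \<gamma> a = 0" for \<alpha> \<beta> \<gamma>
  proof -
    have "\<beta> = 0"
    proof (rule ccontr)
      assume b: "\<beta> \<noteq> 0"
      have "y2 = scale (1 / \<beta>) (scale \<beta> y2)" using b by simp
      also have "scale \<beta> y2 = - (scale \<alpha> x2 + scale \<gamma> a)" using e by (simp add: eq_neg_iff_add_eq_0 algebra_simps)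
      finally have "y1 = scale (1 / \<beta>) (- (scale \<alpha> x2 + scale \<gamma> a)) + scale (h y1 a) c"
        unfolding y2_def by (simp add: algebra_simps)
      also have "\<dots> = scale (- \<alpha> / \<beta>) x1 + scale (- \<gamma> / \<beta>) a + scale (\<alpha> / \<beta> * h x1 a + h y1 a) c"
        unfolding x2_def
        by (simp add: scale_right_diff_distrib scale_right_distrib scale_left_distrib algebra_simps)
      finally show False using y1 unfolding comb3 by blast
    qed
    moreover have "\<alpha> = 0"
    proof (rule ccontr)
      assume b: "\<alpha> \<noteq> 0"
      have "x2 = scale (1 / \<alpha>) (scale \<alpha> x2)" using b by simp
      also have "scale \<alpha> x2 = - (scale \<gamma> a)" using e \<open>\<beta> = 0\<close> by (simp add: eq_neg_iff_add_eq_0)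
      finally have "x1 = scale (- \<gamma> / \<alpha>) a + scale (h x1 a) c"
        unfolding x2_def by (simp add: algebra_simps)
      then show False using x1 unfolding comb2 by blast
    qed
    ultimately show ?thesis using e a0 by simp
  qed
  have k: "scale \<alpha> x2 + scale \<beta> y2 = 0 \<Longrightarrow> \<alpha> = 0 \<and> \<beta> = 0" for \<alpha> \<beta>
    using j[of \<alpha> \<beta> 0] by simp
  obtain \<mu> \<nu> where mn: "\<mu> \<noteq> 0 \<or> \<nu> \<noteq> 0" "h (scale \<mu> x2 + scale \<nu> y2) (scale \<mu> x2 + scale \<nu> y2) = 0"
    by (rule isotropic_in_pair[OF k])
  define b where "b = scale \<mu> x2 + scale \<nu> y2"
  have bb: "h b b = 0" unfolding b_def by (rule mn(2))
  have "h b a = 0" using xa by (simp add: b_def fs)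
  then have ab0: "h a b = 0" by (rule form_sym0)
  have ind: "indep2 a b" unfolding indep2_def
  proof (intro allI impI)
    fix \<gamma> \<beta> assume "scale \<gamma> a + scale \<beta> b = 0"
    then have "scale (\<beta> * \<mu>) x2 + scale (\<beta> * \<nu>) y2 + scale \<gamma> a = 0"
      by (simp add: b_def scale_right_distrib algebra_simps)
    from j[OF this] show "\<gamma> = 0 \<and> \<beta> = 0" using mn(1) by auto
  qed
  obtain v where "frame v" by (rule pair_frame[OF aa bb ab0 ind])
  then show ?thesis by blast
qed

lemma frame_indep2: assumes b: "frame b" shows "indep2 (b 0) (b 1)"
  unfolding indep2_def
proof (intro allI impI)
  fix \<alpha> \<beta> assume z: "scale \<alpha> (b 0) + scale \<beta> (b 1) = 0"
  have "\<alpha> = 0" using arg_cong[OF z, of "\<lambda>z. h z (b 4)"] b by (simp add: fs frame_def)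
  moreover have "\<beta> = 0" using arg_cong[OF z, of "\<lambda>z. h z (b 3)"] b by (simp add: fs frame_def)
  ultimately show "\<alpha> = 0 \<and> \<beta> = 0" ..
qed

lemma comb2_span: "comb [a, b] = span {a, b}"
proof (rule Set.set_eqI)
  fix x
  have "x \<in> span {a, b} \<longleftrightarrow> (\<exists>k l. x - scale k a = scale l b)"
    by (simp add: span_insert span_singleton image_iff)
  also have "\<dots> \<longleftrightarrow> (\<exists>k l. x = scale k a + scale l b)" by (simp add: diff_eq_eq add.commute)
  finally show "x \<in> comb [a, b] \<longleftrightarrow> x \<in> span {a, b}" unfolding comb2 by (rule sym)
qed

lemma dual_point_frame:
  assumes "Z \<in> dual_points" obtains b where "frame b" "Z = comb [b 0, b 1]"
proof -
  have Z: "subspace Z" "dim Z = 2" "\<forall>x\<in>Z. \<forall>y\<in>Z. h x y = 0"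
    using assms unfolding dual_points_def totally_isotropic_def by blast+
  obtain B where B: "B \<subseteq> Z" "independent B" "Z \<subseteq> span B" "card B = dim Z" by (rule basis_exists[of Z])
  have "card B = 2" using B(4) Z(2) by simp
  then obtain a b where ab: "B = {a, b}" "a \<noteq> b" unfolding card_2_iff by blast
  have "span B \<subseteq> Z" by (rule span_minimal[OF B(1) Z(1)])
  then have ZB: "Z = comb [a, b]" using B(3) unfolding comb2_span ab(1) by simp
  have "indep2 a b" unfolding indep2_def
  proof (intro allI impI)
    fix \<alpha> \<beta> assume e: "scale \<alpha> a + scale \<beta> b = 0"
    define u where "u = (\<lambda>x. if x = a then \<alpha> else \<beta>)"
    have s: "(\<Sum>x\<in>B. scale (u x) x) = 0" using e ab by (simp add: u_def)
    have "u a = 0" using independentD[OF B(2) _ subset_refl s, of a] ab by simp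
    moreover have "u b = 0" using independentD[OF B(2) _ subset_refl s, of b] ab by simp
    ultimately show "\<alpha> = 0 \<and> \<beta> = 0" using ab(2) by (simp add: u_def)
  qed
  moreover have "a \<in> Z" "b \<in> Z" using B(1) ab by simp_all
  ultimately obtain v where "frame v" "v 0 = a" "v 1 = b" using Z(3) by (elim pair_frame[of a b, rotated 3]) simp_all
  then show thesis using that[of v] ZB by simp
qed

lemma frame_dual_point: assumes b: "frame b" shows "comb [b 0, b 1] \<in> dual_points"
proof -
  have h0: "h (b 0) (b 0) = 0" "h (b 0) (b 1) = 0" "h (b 1) (b 0) = 0" "h (b 1) (b 1) = 0"
    using b by (simp_all add: frame_def)
  have ne: "b 0 \<noteq> b 1"
  proof
    assume "b 0 = b 1"
    then have "scale 1 (b 0) + scale (-1) (b 1) = 0" by simp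
    then show False using frame_indep2[OF b] unfolding indep2_def by (metis zero_neq_one)
  qed
  have "independent {b 0, b 1}"
  proof (rule independent_if_scalars_zero)
    fix f x assume s: "(\<Sum>x\<in>{b 0, b 1}. scale (f x) x) = 0" and x: "x \<in> {b 0, b 1}"
    have "scale (f (b 0)) (b 0) + scale (f (b 1)) (b 1) = 0" using s ne by simp
    then have "f (b 0) = 0 \<and> f (b 1) = 0" using frame_indep2[OF b] unfolding indep2_def by blast
    then show "f x = 0" using x by auto
  qed simp
  then have "dim (span {b 0, b 1}) = 2" using ne by (simp add: dim_eq_card_independent)
  moreover have "\<forall>x\<in>comb [b 0, b 1]. \<forall>y\<in>comb [b 0, b 1]. h x y = 0"
    by (auto simp: comb2 fs h0 simp del: One_nat_def)
  ultimately show ?thesis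
    unfolding dual_points_def totally_isotropic_def comb2_span by simp
qed

end

section \<open>Counting points modulo p by transvections\<close>

lemma free_action_dvd_card:
  fixes act :: "'g :: ab_group_add \<Rightarrow> 'x \<Rightarrow> 'x"
  assumes X: "finite X" and T: "\<forall>s\<in>T. \<forall>r\<in>T. s - r \<in> T" "0 \<in> T"
    and closed: "\<forall>s\<in>T. \<forall>x\<in>X. act s x \<in> X"
    and zero: "\<forall>x\<in>X. act 0 x = x"
    and add: "\<forall>s\<in>T. \<forall>r\<in>T. \<forall>x\<in>X. act s (act r x) = act (s + r) x"
    and free: "\<forall>s\<in>T. \<forall>x\<in>X. act s x = x \<longrightarrow> s = 0"
  shows "card T dvd card X"
proof -
  let ?R = "{(x, y). x \<in> X \<and> (\<exists>s\<in>T. y = act s x)}"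
  have neg: "- s \<in> T" if "s \<in> T" for s using T(1)[rule_format, OF T(2) that] by simp
  have plus: "s + r \<in> T" if "s \<in> T" "r \<in> T" for s r using T(1)[rule_format, OF that(1) neg[OF that(2)]] by simp
  have inv: "act (- s) (act s x) = x" if "s \<in> T" "x \<in> X" for s x
    using add neg zero that by simp
  have "equiv X ?R"
  proof (rule equivI)
    show "?R \<subseteq> X \<times> X" using closed by blast
    show "refl_on X ?R"
    proof (rule refl_onI)
      fix x assume "x \<in> X"
      then have "x = act 0 x" using zero by simp
      then show "(x, x) \<in> ?R" using T(2) \<open>x \<in> X\<close> by blast
    qed
    show "sym ?R"
    proof (rule symI)
      fix x y assume "(x, y) \<in> ?R"
      then obtain s where s: "x \<in> X" "s \<in> T" "y = act s x" by blast
      then have "y \<in> X" "x = act (- s) y" using closed inv by simp_all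
      then show "(y, x) \<in> ?R" using neg[OF s(2)] by blast
    qed
    show "trans ?R"
    proof (rule transI)
      fix x y z assume "(x, y) \<in> ?R" "(y, z) \<in> ?R"
      then obtain s r where s: "x \<in> X" "s \<in> T" "y = act s x" "r \<in> T" "z = act r y" by blast
      then have "z = act (r + s) x" using add by simp
      then show "(x, z) \<in> ?R" using s(1) plus[OF s(4,2)] by blast
    qed
  qed
  moreover have "card T dvd card Y" if Y: "Y \<in> X // ?R" for Y
  proof -
    obtain x where x: "x \<in> X" "Y = ?R `` {x}" using Y by (rule quotientE)
    have "Y = (\<lambda>s. act s x) ` T" using x by auto
    moreover have "inj_on (\<lambda>s. act s x) T"
    proof (rule inj_onI)
      fix s r assume s: "s \<in> T" "r \<in> T" "act s x = act r x"
      have "act (- r) (act s x) = x" unfolding s(3) by (rule inv[OF s(2) x(1)])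
      then have "act (- r + s) x = x" using add neg[OF s(2)] s(1) x(1) by simp
      then have "- r + s = 0" using free plus[OF neg[OF s(2)] s(1)] x(1) by blast
      then show "s = r" by (simp add: add_eq_0_iff)
    qed
    ultimately show ?thesis by (simp add: card_image)
  qed
  ultimately show ?thesis by (intro equiv_imp_dvd_card[OF X])
qed

context herm5
begin

text \<open>The perpendicular space of the plane is spanned by \<open>b 0\<close>,
  \<open>b 1\<close>, \<open>b 2\<close>, and there the norm only depends on the last coefficient.
  Hence the plane is a maximal isotropic subspace.\<close>

lemma isotropic_perp:
  assumes b: "frame b" and z: "h z z = 0" "h z (b 0) = 0" "h z (b 1) = 0"
  shows "z \<in> comb [b 0, b 1]"
proof -
  define \<alpha> \<beta> \<gamma> where abc: "\<alpha> = h z (b 4)" "\<beta> = h z (b 3)" "\<gamma> = h z (b 2)"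
  have e: "z = scale \<alpha> (b 0) + scale \<beta> (b 1) + scale \<gamma> (b 2)"
    unfolding abc by (subst frame_expansion[OF b, of z])
      (simp add: lessThan_5 z(2) z(3)[unfolded One_nat_def] add.assoc)
  have "h (b 2) z = h z (b 2) ^ q" by (rule form_hermitian)
  then have "h (b 2) z = \<gamma> ^ q" unfolding abc .
  then have "h (scale \<alpha> (b 0) + scale \<beta> (b 1) + scale \<gamma> (b 2)) z = \<gamma> * \<gamma> ^ q"
    using form_sym0[OF z(2)] form_sym0[OF z(3)] by (simp only: form_add_left form_scale_left mult_zero_right add_0)
  then have "\<gamma> * \<gamma> ^ q = 0" using z(1) by (simp only: e[symmetric])
  then have "\<gamma> = 0" by auto
  then have "z = scale \<alpha> (b 0) + scale \<beta> (b 1)" using e by (simp only: scale_zero_left add_0_right)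
  then show ?thesis unfolding comb2 by (intro exI)
qed

lemma comb2_form: "x \<in> comb [a, b] \<Longrightarrow> h a y = 0 \<Longrightarrow> h b y = 0 \<Longrightarrow> h x y = 0"
  by (auto simp: comb2 fs simp del: comb_Suc)

text \<open>A dependence between the rows of the Gram matrix gives a nonzero vector of the first
  plane that is perpendicular to the second, and by \<open>isotropic_perp\<close> it lies in the
  second.\<close>

lemma opposite_iff:
  assumes b: "frame b" "frame b'"
  shows "comb [b 0, b 1] \<inter> comb [b' 0, b' 1] = {0} \<longleftrightarrow> gram b b' \<noteq> 0"
proof
  assume g: "gram b b' \<noteq> 0"
  have "x = 0" if x: "x \<in> comb [b 0, b 1]" "x \<in> comb [b' 0, b' 1]" for x
  proof -
    obtain \<alpha> \<beta> where e: "x = scale \<alpha> (b 0) + scale \<beta> (b 1)" using x(1) unfolding comb2 by blast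
    have "h x (b' 0) = 0" "h x (b' 1) = 0"
      using b(2) by (simp_all add: comb2_form[OF x(2)] frame_def)
    then have z: "\<alpha> * h (b 0) (b' 0) + \<beta> * h (b 1) (b' 0) = 0" "\<alpha> * h (b 0) (b' 1) + \<beta> * h (b 1) (b' 1) = 0"
      unfolding e by (simp_all add: fs del: One_nat_def)
    have "\<alpha> * gram b b' = (\<alpha> * h (b 0) (b' 0) + \<beta> * h (b 1) (b' 0)) * h (b 1) (b' 1)
        - (\<alpha> * h (b 0) (b' 1) + \<beta> * h (b 1) (b' 1)) * h (b 1) (b' 0)"
      unfolding gram_def by (simp only: algebra_simps)
    then have "\<alpha> = 0" using z g by simp
    have "\<beta> * gram b b' = (\<alpha> * h (b 0) (b' 1) + \<beta> * h (b 1) (b' 1)) * h (b 0) (b' 0)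
        - (\<alpha> * h (b 0) (b' 0) + \<beta> * h (b 1) (b' 0)) * h (b 0) (b' 1)"
      unfolding gram_def by (simp only: algebra_simps)
    then have "\<beta> = 0" using z g by simp
    with \<open>\<alpha> = 0\<close> show ?thesis using e by simp
  qed
  moreover have "0 \<in> comb [a, c]" for a c unfolding comb2_span by (rule span_zero)
  ultimately show "comb [b 0, b 1] \<inter> comb [b' 0, b' 1] = {0}" by blast
next
  assume e: "comb [b 0, b 1] \<inter> comb [b' 0, b' 1] = {0}"
  show "gram b b' \<noteq> 0"
  proof
    assume g: "gram b b' = 0"
    have "\<exists>\<alpha> \<beta>. (\<alpha> \<noteq> 0 \<or> \<beta> \<noteq> 0) \<and> \<alpha> * h (b 0) (b' 0) + \<beta> * h (b 1) (b' 0) = 0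
        \<and> \<alpha> * h (b 0) (b' 1) + \<beta> * h (b 1) (b' 1) = 0"
    proof (cases "h (b 0) (b' 0) = 0 \<and> h (b 1) (b' 0) = 0")
      case True
      show ?thesis
      proof (cases "h (b 1) (b' 1) = 0 \<and> h (b 0) (b' 1) = 0")
        case True': True
        then show ?thesis using True by (intro exI[of _ 1] exI[of _ 0]) simp
      next
        case False
        then show ?thesis using True
          by (intro exI[of _ "h (b 1) (b' 1)"] exI[of _ "- h (b 0) (b' 1)"]) auto
      qed
    next
      case False
      then show ?thesis using g unfolding gram_def
        by (intro exI[of _ "h (b 1) (b' 0)"] exI[of _ "- h (b 0) (b' 0)"]) (auto simp: algebra_simps)
    qed
    then obtain \<alpha> \<beta> where ab: "\<alpha> \<noteq> 0 \<or> \<beta> \<noteq> 0" "\<alpha> * h (b 0) (b' 0) + \<beta> * h (b 1) (b' 0) = 0"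
        "\<alpha> * h (b 0) (b' 1) + \<beta> * h (b 1) (b' 1) = 0" by blast
    define z where "z = scale \<alpha> (b 0) + scale \<beta> (b 1)"
    have h0: "h (b 0) (b 0) = 0" "h (b 0) (b 1) = 0" "h (b 1) (b 0) = 0" "h (b 1) (b 1) = 0"
      using b by (simp_all add: frame_def)
    have "z \<in> comb [b' 0, b' 1]"
      by (rule isotropic_perp[OF b(2)]) (use ab h0 in \<open>simp_all add: z_def fs del: One_nat_def\<close>)
    moreover have "z \<in> comb [b 0, b 1]" unfolding comb2 z_def by (intro exI, rule refl)
    ultimately have "z = 0" using e by blast
    then show False using frame_indep2[OF b(1)] ab(1) unfolding indep2_def z_def by blast
  qed
qed

text \<open>A transvection with centre z; it is unitary for isotropic z and s of trace 0.\<close>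

definition shear :: "'v \<Rightarrow> 'k \<Rightarrow> 'v \<Rightarrow> 'v" where
  "shear z s x = x + scale (s * h x z) z"

definition sh :: "'v \<Rightarrow> 'k \<Rightarrow> 'v set \<Rightarrow> 'v set" where "sh z s Z = shear z s ` Z"

lemma shear_add: "shear z s (x + y) = shear z s x + shear z s y"
  by (simp add: shear_def fs distrib_left scale_left_distrib)

lemma shear_scale: "shear z s (scale a x) = scale a (shear z s x)"
  by (simp add: shear_def fs scale_right_distrib mult.left_commute)

lemma shear_shear: "h z z = 0 \<Longrightarrow> shear z s (shear z r x) = shear z (s + r) x"
  by (simp add: shear_def fs distrib_right scale_left_distrib algebra_simps)

lemma shear_0: "shear z 0 x = x" by (simp add: shear_def)

lemma shear_form: assumes "h z z = 0" "s \<in> TR" shows "h (shear z s x) (shear z s y) = h x y"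
proof -
  have c: "h z y = h y z ^ q" by (rule form_hermitian)
  have "h (shear z s x) (shear z s y) = h x y + (s + s ^ q) * (h x z * h y z ^ q)"
    using assms(1) by (simp add: shear_def fs power_mult_distrib c algebra_simps)
  then show ?thesis using assms(2) by (simp add: TR_def)
qed

lemma sh_point: assumes z: "h z z = 0" "s \<in> TR" and Z: "Z \<in> dual_points" shows "sh z s Z \<in> dual_points"
proof -
  obtain b where b: "frame b" "Z = comb [b 0, b 1]" by (rule dual_point_frame[OF Z])
  have "frame (\<lambda>i. shear z s (b i))" using b(1) unfolding frame_def shear_form[OF z] .
  from frame_dual_point[OF this] have "comb [shear z s (b 0), shear z s (b 1)] \<in> dual_points" .
  moreover have "sh z s Z = comb [shear z s (b 0), shear z s (b 1)]"
  proof (rule Set.set_eqI)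
    fix y
    have "y \<in> sh z s Z \<longleftrightarrow> (\<exists>\<alpha> \<beta>. y = shear z s (scale \<alpha> (b 0) + scale \<beta> (b 1)))"
      unfolding sh_def b(2) image_iff Bex_def comb2 by blast
    then show "y \<in> sh z s Z \<longleftrightarrow> y \<in> comb [shear z s (b 0), shear z s (b 1)]"
      unfolding comb2 shear_add shear_scale .
  qed
  ultimately show ?thesis by simp
qed

lemma dual_points_sub: "Z \<in> dual_points \<Longrightarrow> subspace Z" "Z \<in> dual_points \<Longrightarrow> x \<in> Z \<Longrightarrow> y \<in> Z \<Longrightarrow> h x y = 0"
  unfolding dual_points_def totally_isotropic_def by blast+

lemma perp_mem: assumes Z: "Z \<in> dual_points" and z: "h z z = 0" "\<forall>x\<in>Z. h x z = 0" shows "z \<in> Z"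
proof -
  obtain b where b: "frame b" "Z = comb [b 0, b 1]" by (rule dual_point_frame[OF Z])
  have "b 0 \<in> Z" "b 1 \<in> Z" unfolding b(2) comb2_span by (simp_all add: span_base)
  then have "h z (b 0) = 0" "h z (b 1) = 0" using z(2) form_sym0 by blast+
  then show ?thesis using isotropic_perp[OF b(1) z(1)] b(2) by simp
qed

lemma finite_points: "finite dual_points"
proof -
  have "finite (Pow (UNIV :: 'v set))" using card_V(1) by (simp only: finite_Pow_iff)
  then show ?thesis by (rule finite_subset[rotated]) (simp only: Pow_UNIV subset_UNIV)
qed

lemma TR_diff: "\<forall>s\<in>TR. \<forall>r\<in>TR. s - r \<in> TR"
proof (intro ballI)
  fix s r assume "s \<in> TR" "r \<in> TR"
  moreover have "(s - r) + (s - r) ^ q = (s + s ^ q) - (r + r ^ q)" by (simp add: q_diff)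
  ultimately show "s - r \<in> TR" by (simp add: TR_def)
qed

text \<open>The q transvections with centre z act freely: a point that misses z contains some x not
  perpendicular to z, and if a nontrivial transvection fixed the point, the difference of x and its
  image would put z into it.\<close>

lemma shear_count:
  assumes z: "h z z = 0" and X: "X \<subseteq> dual_points" "\<forall>Z\<in>X. z \<notin> Z"
    and closed: "\<forall>s\<in>TR. \<forall>Z\<in>X. sh z s Z \<in> X"
  shows "p dvd card X"
proof -
  have "card TR dvd card X"
  proof (rule free_action_dvd_card[where act = "sh z"])
    show "finite X" by (rule finite_subset[OF X(1) finite_points])
    show "\<forall>s\<in>TR. \<forall>r\<in>TR. s - r \<in> TR" "0 \<in> TR" by (rule TR_diff, rule TR_0)
    show "\<forall>s\<in>TR. \<forall>Z\<in>X. sh z s Z \<in> X" by (rule closed)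
    show "\<forall>Z\<in>X. sh z 0 Z = Z" by (simp add: sh_def shear_0)
    show "\<forall>s\<in>TR. \<forall>r\<in>TR. \<forall>Z\<in>X. sh z s (sh z r Z) = sh z (s + r) Z"
      by (simp add: sh_def image_image shear_shear[OF z])
    show "\<forall>s\<in>TR. \<forall>Z\<in>X. sh z s Z = Z \<longrightarrow> s = 0"
    proof (intro ballI impI, rule ccontr)
      fix s Z assume s: "s \<in> TR" and Z: "Z \<in> X" and e: "sh z s Z = Z" and s0: "s \<noteq> 0"
      have ZP: "Z \<in> dual_points" and zZ: "z \<notin> Z" using Z X by blast+
      then obtain x where x: "x \<in> Z" "h x z \<noteq> 0" using perp_mem[OF ZP z] by blast
      have "shear z s x \<in> Z" using e x(1) unfolding sh_def by blast
      then have "shear z s x - x \<in> Z" by (intro subspace_diff dual_points_sub ZP x)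
      then have "scale (s * h x z) z \<in> Z" by (simp add: shear_def)
      then have "scale (1 / (s * h x z)) (scale (s * h x z) z) \<in> Z"
        by (rule subspace_scale[OF dual_points_sub(1)[OF ZP]])
      then show False using zZ s0 x(2) by simp
    qed
  qed
  moreover have "p dvd q" unfolding q using t by (intro dvd_power) simp
  then have "p dvd card TR" by (simp only: card_TR)
  ultimately show ?thesis by (rule dvd_trans[rotated])
qed

lemma frame_iso: assumes "frame b" shows "h (b 0) (b 0) = 0" "h (b 1) (b 1) = 0" "h (b 0) (b 1) = 0"
  using assms by (simp_all add: frame_def)

lemma shear_mem_iff:
  assumes z: "h z z = 0" and w: "h w z = 0"
  shows "w \<in> sh z s Z \<longleftrightarrow> w \<in> Z"
proof -
  have "shear z s w = w" using w by (simp add: shear_def)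
  moreover have "shear z (- s) (shear z s x) = x" for x using shear_shear[OF z, of "- s" s] by (simp add: shear_0)
  ultimately show ?thesis unfolding sh_def by (metis image_iff)
qed

text \<open>The points that miss \<open>b 0\<close>, and those that contain \<open>b 0\<close> but
  miss \<open>b 1\<close>, fall into free orbits of transvections. One point is left, the span of
  \<open>b 0\<close> and \<open>b 1\<close>.\<close>

lemma dual_points_mod_p: "[card dual_points = 1] (mod p)"
proof -
  obtain b where b: "frame b" using ex_frame by blast
  note iso = frame_iso[OF b]
  have i10: "h (b 1) (b 0) = 0" by (rule form_sym0[OF iso(3)])
  let ?X = "{Z \<in> dual_points. b 0 \<notin> Z}" and ?Y = "{Z \<in> dual_points. b 0 \<in> Z \<and> b 1 \<notin> Z}"
    and ?Z = "comb [b 0, b 1]"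
  have X: "p dvd card ?X"
    by (rule shear_count[OF iso(1)]) (auto simp: sh_point iso shear_mem_iff)
  have Y: "p dvd card ?Y"
    by (rule shear_count[OF iso(2)]) (auto simp: sh_point iso shear_mem_iff simp del: One_nat_def)
  have mem: "Z = ?Z" if Z: "Z \<in> dual_points" "b 0 \<in> Z" "b 1 \<in> Z" for Z
  proof
    show "?Z \<subseteq> Z" unfolding comb2_span by (intro span_minimal dual_points_sub Z) (use Z in simp)
    show "Z \<subseteq> ?Z"
    proof
      fix x assume "x \<in> Z"
      then show "x \<in> ?Z" using dual_points_sub(2)[OF Z(1)] Z by (intro isotropic_perp[OF b]) blast+
    qed
  qed
  have b01: "b 0 \<in> ?Z" "b 1 \<in> ?Z" unfolding comb2_span by (simp_all add: span_base)
  have "dual_points = ?X \<union> ?Y \<union> {?Z}"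
    using mem frame_dual_point[OF b] by blast
  then have "card dual_points = card (?X \<union> ?Y \<union> {?Z})" by simp
  also have "\<dots> = card (?X \<union> ?Y) + card {?Z}"
    by (rule card_Un_disjoint) (use finite_points b01 in \<open>auto simp del: comb_Suc\<close>)
  also have "card (?X \<union> ?Y) = card ?X + card ?Y"
    by (rule card_Un_disjoint) (use finite_points in auto)
  finally have e: "card dual_points = (card ?X + card ?Y) + 1" by simp
  have "p dvd card ?X + card ?Y" using X Y by (rule dvd_add)
  then have "[card ?X + card ?Y = 0] (mod p)" by (simp add: cong_0_iff)
  from cong_add[OF this cong_refl[of 1]] show ?thesis unfolding e by simp
qed

text \<open>Transvections with centre in Z fix Z pointwise and therefore preserve disjointness from
  Z.\<close>

lemma opposite_count: assumes Z: "Z \<in> dual_points" shows "p dvd card {Z' \<in> dual_points. Z \<inter> Z' = {0}}"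
proof -
  obtain b where b: "frame b" "Z = comb [b 0, b 1]" by (rule dual_point_frame[OF Z])
  note iso = frame_iso[OF b(1)]
  have m: "b 0 \<in> Z" unfolding b(2) comb2_span by (simp add: span_base)
  have n0: "b 0 \<noteq> 0"
  proof
    assume "b 0 = 0"
    then have "scale 1 (b 0) + scale 0 (b 1) = 0" by simp
    then show False using frame_indep2[OF b(1)] unfolding indep2_def by (metis zero_neq_one)
  qed
  have "Z \<inter> sh (b 0) s Z' = Z \<inter> Z'" if "s \<in> TR" for s Z'
    using shear_mem_iff[OF iso(1)] dual_points_sub(2)[OF Z _ m] by blast
  then show ?thesis
    by (intro shear_count[OF iso(1)]) (use m n0 in \<open>auto simp: sh_point iso\<close>)
qed

end

section \<open>Ranks of matrices over finite fields\<close>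

text \<open>Factorizations and dual pairs of functions bound the rank in a form that is stable under field
  extensions and needs no choice of an enumeration.\<close>

definition rank_le :: "'x set \<Rightarrow> 'y set \<Rightarrow> ('x \<Rightarrow> 'y \<Rightarrow> 'k :: field) \<Rightarrow> 'l set \<Rightarrow> bool" where
  "rank_le X Y M \<Lambda> \<longleftrightarrow> (\<exists>A E. \<forall>x\<in>X. \<forall>y\<in>Y. M x y = (\<Sum>l\<in>\<Lambda>. A l x * E l y))"

definition rank_ge :: "'x set \<Rightarrow> 'y set \<Rightarrow> ('x \<Rightarrow> 'y \<Rightarrow> 'k :: field) \<Rightarrow> 'l set \<Rightarrow> bool" where
  "rank_ge X Y M \<Lambda> \<longleftrightarrow> (\<exists>U W. \<forall>l\<in>\<Lambda>. \<forall>m\<in>\<Lambda>.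
     (\<Sum>x\<in>X. \<Sum>y\<in>Y. U l x * M x y * W m y) = (if l = m then 1 else 0))"

lemma rank_le_comp:
  assumes "rank_le X Y M \<Lambda>" "f ` X' \<subseteq> X" "g ` Y' \<subseteq> Y" "\<forall>x\<in>X'. \<forall>y\<in>Y'. N x y = M (f x) (g y)"
  shows "rank_le X' Y' N \<Lambda>"
proof -
  obtain A E where A: "\<forall>x\<in>X. \<forall>y\<in>Y. M x y = (\<Sum>l\<in>\<Lambda>. A l x * E l y)"
    using assms(1) unfolding rank_le_def by blast
  have "N x y = (\<Sum>l\<in>\<Lambda>. A l (f x) * E l (g y))" if "x \<in> X'" "y \<in> Y'" for x y
  proof -
    have "f x \<in> X" "g y \<in> Y" using that assms(2,3) by blast+
    then show ?thesis using A assms(4) that by simp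
  qed
  then show ?thesis unfolding rank_le_def
    by (intro exI[of _ "\<lambda>l x. A l (f x)"] exI[of _ "\<lambda>l y. E l (g y)"]) blast
qed

lemma sum_push:
  fixes F :: "'x \<Rightarrow> 'k :: comm_ring_1"
  assumes "finite X'" "finite X" "f ` X' \<subseteq> X"
  shows "(\<Sum>x\<in>X. (\<Sum>x'\<in>{x' \<in> X'. f x' = x}. u x') * F x) = (\<Sum>x'\<in>X'. u x' * F (f x'))"
proof -
  have "(\<Sum>x'\<in>X'. u x' * F (f x')) = (\<Sum>x\<in>X. \<Sum>x'\<in>{x' \<in> X'. f x' = x}. u x' * F (f x'))"
    by (rule sum.group[symmetric, OF assms])
  also have "\<dots> = (\<Sum>x\<in>X. (\<Sum>x'\<in>{x' \<in> X'. f x' = x}. u x') * F x)"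
    by (intro sum.cong refl) (simp add: sum_distrib_right)
  finally show ?thesis by (rule sym)
qed

lemma sum_bilinear:
  "(\<Sum>x\<in>X. \<Sum>y\<in>Y. u x * M x y * w y) = (\<Sum>x\<in>X. u x * (\<Sum>y\<in>Y. w y * M x y :: 'k :: comm_ring_1))"
  by (simp add: sum_distrib_left mult_ac)

lemma rank_ge_comp:
  assumes ge: "rank_ge X' Y' N \<Lambda>" and fin: "finite X'" "finite X" "finite Y'" "finite Y"
    and f: "f ` X' \<subseteq> X" and g: "g ` Y' \<subseteq> Y" and N: "\<forall>x\<in>X'. \<forall>y\<in>Y'. N x y = M (f x) (g y)"
  shows "rank_ge X Y M \<Lambda>"
proof -
  obtain U W where UW: "\<forall>l\<in>\<Lambda>. \<forall>m\<in>\<Lambda>. (\<Sum>x\<in>X'. \<Sum>y\<in>Y'. U l x * N x y * W m y) = (if l = m then 1 else 0)"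
    using ge unfolding rank_ge_def by blast
  \<comment> \<open>The coefficient functions are pushed forward along f and g by summation over the
    fibres.\<close>
  let ?U = "\<lambda>l x. \<Sum>x'\<in>{x' \<in> X'. f x' = x}. U l x'" and ?W = "\<lambda>m y. \<Sum>y'\<in>{y' \<in> Y'. g y' = y}. W m y'"
  have "(\<Sum>x\<in>X. \<Sum>y\<in>Y. ?U l x * M x y * ?W m y) = (\<Sum>x\<in>X'. \<Sum>y\<in>Y'. U l x * N x y * W m y)" for l m
  proof -
    have "(\<Sum>x\<in>X. \<Sum>y\<in>Y. ?U l x * M x y * ?W m y) = (\<Sum>x\<in>X'. U l x * (\<Sum>y\<in>Y'. W m y * M (f x) (g y)))"
      unfolding sum_bilinear sum_push[OF fin(3,4) g] by (rule sum_push[OF fin(1,2) f])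
    also have "\<dots> = (\<Sum>x\<in>X'. U l x * (\<Sum>y\<in>Y'. W m y * N x y))"
      using N by (intro sum.cong refl arg_cong2[where f = "(*)"]) simp
    finally show ?thesis unfolding sum_bilinear .
  qed
  then show ?thesis unfolding rank_ge_def using UW by (intro exI[of _ ?U] exI[of _ ?W]) simp
qed

text \<open>The two families yield matrices P and Q with P Q = 1 and inner index in \<Lambda>, so
  the coordinate space over \<Lambda>' embeds into that over \<Lambda>.\<close>

lemma rank_ge_le:
  fixes M :: "'x \<Rightarrow> 'y \<Rightarrow> 'k :: {field, finite}"
  assumes ge: "rank_ge X Y M \<Lambda>'" and le: "rank_le X Y M \<Lambda>" and fin: "finite \<Lambda>" "finite \<Lambda>'"
  shows "card \<Lambda>' \<le> card \<Lambda>"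
proof -
  obtain A E where A: "\<forall>x\<in>X. \<forall>y\<in>Y. M x y = (\<Sum>i\<in>\<Lambda>. A i x * E i y)"
    using le unfolding rank_le_def by blast
  obtain U W where UW: "\<forall>l\<in>\<Lambda>'. \<forall>m\<in>\<Lambda>'. (\<Sum>x\<in>X. \<Sum>y\<in>Y. U l x * M x y * W m y) = (if l = m then 1 else 0)"
    using ge unfolding rank_ge_def by blast
  define P where "P l i = (\<Sum>x\<in>X. U l x * A i x)" for l i
  define Q where "Q i m = (\<Sum>y\<in>Y. E i y * W m y)" for i m
  have PQ: "(\<Sum>i\<in>\<Lambda>. P l i * Q i m) = (if l = m then 1 else 0)" if "l \<in> \<Lambda>'" "m \<in> \<Lambda>'" for l m
  proof -
    have "(\<Sum>i\<in>\<Lambda>. P l i * Q i m) = (\<Sum>i\<in>\<Lambda>. \<Sum>x\<in>X. \<Sum>y\<in>Y. U l x * A i x * (E i y * W m y))"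
      unfolding P_def Q_def sum_product ..
    also have "\<dots> = (\<Sum>x\<in>X. \<Sum>i\<in>\<Lambda>. \<Sum>y\<in>Y. U l x * A i x * (E i y * W m y))" by (rule sum.swap)
    also have "\<dots> = (\<Sum>x\<in>X. \<Sum>y\<in>Y. \<Sum>i\<in>\<Lambda>. U l x * A i x * (E i y * W m y))"
      by (intro sum.cong refl) (rule sum.swap)
    also have "\<dots> = (\<Sum>x\<in>X. \<Sum>y\<in>Y. U l x * M x y * W m y)"
      using A by (intro sum.cong refl) (simp add: sum_distrib_left sum_distrib_right mult_ac)
    finally show ?thesis using UW that by simp
  qed
  let ?f = "\<lambda>c. \<lambda>i\<in>\<Lambda>. \<Sum>l\<in>\<Lambda>'. c l * P l i"
  have rec: "(\<Sum>i\<in>\<Lambda>. ?f c i * Q i m) = c m" if m: "m \<in> \<Lambda>'" for c m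
  proof -
    have "(\<Sum>i\<in>\<Lambda>. ?f c i * Q i m) = (\<Sum>i\<in>\<Lambda>. \<Sum>l\<in>\<Lambda>'. c l * (P l i * Q i m))"
      by (intro sum.cong refl) (simp add: sum_distrib_right mult.assoc)
    also have "\<dots> = (\<Sum>l\<in>\<Lambda>'. c l * (\<Sum>i\<in>\<Lambda>. P l i * Q i m))"
      by (simp add: sum.swap[of _ \<Lambda>] sum_distrib_left)
    also have "\<dots> = (\<Sum>l\<in>\<Lambda>'. if l = m then c l else 0)"
      using PQ m by (intro sum.cong refl) simp
    finally show ?thesis using m fin(2) by simp
  qed
  have "inj_on ?f (\<Lambda>' \<rightarrow>\<^sub>E UNIV)"
  proof (rule inj_onI)
    fix c d assume c: "c \<in> \<Lambda>' \<rightarrow>\<^sub>E UNIV" and d: "d \<in> \<Lambda>' \<rightarrow>\<^sub>E UNIV" and e: "?f c = ?f d"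
    have "c m = d m" if "m \<in> \<Lambda>'" for m using rec[OF that, of c] rec[OF that, of d] unfolding e by simp
    then show "c = d" using c d by (intro PiE_ext) auto
  qed
  then have "card (\<Lambda>' \<rightarrow>\<^sub>E (UNIV :: 'k set)) \<le> card (\<Lambda> \<rightarrow>\<^sub>E (UNIV :: 'k set))"
    by (rule card_inj_on_le) (auto simp: fin finite_PiE)
  then have "CARD('k) ^ card \<Lambda>' \<le> CARD('k) ^ card \<Lambda>" by (simp add: card_PiE fin)
  moreover have "1 < CARD('k)"
  proof -
    have "card {0, 1 :: 'k} \<le> CARD('k)" by (rule card_mono) simp_all
    then show ?thesis by simp
  qed
  ultimately show ?thesis by (rule power_le_imp_le_exp[rotated])
qed

text \<open>\<open>interpolation_set\<close> applied to the span of the functions \<open>A l\<close>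
  gives a set J of points with a dual basis; the coefficients of this basis in terms of the
  \<open>A l\<close> are the functions sought.\<close>

lemma dual_functions:
  fixes A :: "'l \<Rightarrow> 'x \<Rightarrow> 'k :: {field, finite}"
  assumes fin: "finite X" "finite \<Lambda>"
    and ind: "\<And>c. (\<forall>x\<in>X. (\<Sum>l\<in>\<Lambda>. c l * A l x) = 0) \<Longrightarrow> \<forall>l\<in>\<Lambda>. c l = 0"
  obtains U where "\<forall>l\<in>\<Lambda>. \<forall>m\<in>\<Lambda>. (\<Sum>x\<in>X. U l x * A m x) = (if l = m then 1 else 0)"
proof -
  define S where "S = {f. \<exists>c. f = (\<lambda>x. if x \<in> X then \<Sum>l\<in>\<Lambda>. c l * A l x else 0)}"
  have SI: "(\<lambda>x. if x \<in> X then \<Sum>l\<in>\<Lambda>. c l * A l x else 0) \<in> S" for c unfolding S_def by blast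
  have S_supp: "f \<in> S \<Longrightarrow> f x \<noteq> 0 \<Longrightarrow> x \<in> X" for f x by (auto simp: S_def split: if_splits)
  have S_zero: "(\<lambda>_. 0) \<in> S" using SI[of "\<lambda>_. 0"] by (simp cong: if_cong)
  have S_add: "(\<lambda>x. f x + g x) \<in> S" if f: "f \<in> S" and g: "g \<in> S" for f g
  proof -
    obtain c where c: "f = (\<lambda>x. if x \<in> X then \<Sum>l\<in>\<Lambda>. c l * A l x else 0)"
      using f unfolding S_def mem_Collect_eq by (rule exE)
    obtain d where "g = (\<lambda>x. if x \<in> X then \<Sum>l\<in>\<Lambda>. d l * A l x else 0)"
      using g unfolding S_def mem_Collect_eq by (rule exE)
    with c have "(\<lambda>x. f x + g x) = (\<lambda>x. if x \<in> X then \<Sum>l\<in>\<Lambda>. (c l + d l) * A l x else 0)"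
      by (simp add: fun_eq_iff distrib_right sum.distrib)
    then show ?thesis using SI by simp
  qed
  have S_scale: "(\<lambda>x. a * f x) \<in> S" if f: "f \<in> S" for f a
  proof -
    obtain c where "f = (\<lambda>x. if x \<in> X then \<Sum>l\<in>\<Lambda>. c l * A l x else 0)"
      using f unfolding S_def mem_Collect_eq by (rule exE)
    then have "(\<lambda>x. a * f x) = (\<lambda>x. if x \<in> X then \<Sum>l\<in>\<Lambda>. (a * c l) * A l x else 0)"
      by (simp add: fun_eq_iff sum_distrib_left mult.assoc)
    then show ?thesis using SI by simp
  qed
  obtain J b where J: "J \<subseteq> X" and b: "\<And>i. i \<in> J \<Longrightarrow> b i \<in> S"
    and ex: "\<And>f x. f \<in> S \<Longrightarrow> f x = (\<Sum>i\<in>J. f i * b i x)"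
    by (rule interpolation_set[OF fin(1) S_supp S_zero S_add S_scale]) (assumption+, rule that)
  have "\<forall>i. \<exists>c. i \<in> J \<longrightarrow> b i = (\<lambda>x. if x \<in> X then \<Sum>l\<in>\<Lambda>. c l * A l x else 0)"
    using b unfolding S_def mem_Collect_eq by (simp only: HOL.ex_simps simp_thms) simp
  then obtain C where "\<forall>i. i \<in> J \<longrightarrow> b i = (\<lambda>x. if x \<in> X then \<Sum>l\<in>\<Lambda>. C i l * A l x else 0)"
    unfolding choice_iff by blast
  then have C: "b i x = (\<Sum>l\<in>\<Lambda>. C i l * A l x)" if "i \<in> J" "x \<in> X" for i x using that by simp
  have delta: "(\<Sum>i\<in>J. C i l * A m i) = (if l = m then 1 else 0)" if l: "l \<in> \<Lambda>" "m \<in> \<Lambda>" for l m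
  proof -
    define c where "c l = (\<Sum>i\<in>J. A m i * C i l) - (if l = m then 1 else 0)" for l
    have "(\<Sum>l\<in>\<Lambda>. c l * A l x) = 0" if x: "x \<in> X" for x
    proof -
      have dl: "(\<Sum>l\<in>\<Lambda>. (if l = m then 1 else 0) * A l x) = A m x" for x
      proof -
        have "(\<Sum>l\<in>\<Lambda>. (if l = m then 1 else 0) * A l x) = (\<Sum>l\<in>\<Lambda>. if l = m then A l x else 0)"
          by (rule sum.cong) auto
        then show ?thesis using l fin(2) by simp
      qed
      have "(if x \<in> X then \<Sum>l\<in>\<Lambda>. (if l = m then 1 else 0) * A l x else 0)
          = (\<Sum>i\<in>J. (if i \<in> X then \<Sum>l\<in>\<Lambda>. (if l = m then 1 else 0) * A l i else 0) * b i x)"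
        by (rule ex[OF SI])
      then have "A m x = (\<Sum>i\<in>J. (if i \<in> X then A m i else 0) * b i x)" unfolding dl using x by simp
      also have "\<dots> = (\<Sum>i\<in>J. A m i * b i x)" using J by (intro sum.cong refl) auto
      also have "\<dots> = (\<Sum>i\<in>J. \<Sum>l\<in>\<Lambda>. A m i * C i l * A l x)"
        using C[OF _ x] by (intro sum.cong refl) (simp add: sum_distrib_left mult.assoc)
      also have "\<dots> = (\<Sum>l\<in>\<Lambda>. (\<Sum>i\<in>J. A m i * C i l) * A l x)"
        by (simp add: sum.swap[of _ J] sum_distrib_right)
      finally show ?thesis unfolding c_def left_diff_distrib sum_subtractf dl by simp
    qed
    then have "c l = 0" using ind[of c] l(1) by blast
    then show ?thesis by (simp add: c_def mult.commute)
  qed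
  let ?U = "\<lambda>l x. if x \<in> J then C x l else 0"
  have "(\<Sum>x\<in>X. ?U l x * A m x) = (\<Sum>i\<in>J. C i l * A m i)" for l m
    by (rule sum.mono_neutral_cong_right[OF fin(1) J]) auto
  then show thesis using that[of ?U] delta by simp
qed

lemma rank_ge_factor:
  fixes M :: "'x \<Rightarrow> 'y \<Rightarrow> 'k :: field"
  assumes fin: "finite \<Lambda>" and M: "\<forall>x\<in>X. \<forall>y\<in>Y. M x y = (\<Sum>l\<in>\<Lambda>. A l x * E l y)"
    and U: "\<forall>l\<in>\<Lambda>. \<forall>m\<in>\<Lambda>. (\<Sum>x\<in>X. U l x * A m x) = (if l = m then 1 else 0)"
    and W: "\<forall>l\<in>\<Lambda>. \<forall>m\<in>\<Lambda>. (\<Sum>y\<in>Y. W l y * E m y) = (if l = m then 1 else 0)"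
  shows "rank_ge X Y M \<Lambda>"
proof -
  have "(\<Sum>x\<in>X. \<Sum>y\<in>Y. U l x * M x y * W m y) = (if l = m then 1 else 0)" if l: "l \<in> \<Lambda>" "m \<in> \<Lambda>" for l m
  proof -
    have "(\<Sum>x\<in>X. \<Sum>y\<in>Y. U l x * M x y * W m y) = (\<Sum>x\<in>X. \<Sum>y\<in>Y. \<Sum>i\<in>\<Lambda>. U l x * A i x * (W m y * E i y))"
      using M by (intro sum.cong refl) (simp add: sum_distrib_left sum_distrib_right mult_ac)
    also have "\<dots> = (\<Sum>x\<in>X. \<Sum>i\<in>\<Lambda>. \<Sum>y\<in>Y. U l x * A i x * (W m y * E i y))"
      by (intro sum.cong refl) (rule sum.swap)
    also have "\<dots> = (\<Sum>i\<in>\<Lambda>. \<Sum>x\<in>X. \<Sum>y\<in>Y. U l x * A i x * (W m y * E i y))" by (rule sum.swap)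
    also have "\<dots> = (\<Sum>i\<in>\<Lambda>. (\<Sum>x\<in>X. U l x * A i x) * (\<Sum>y\<in>Y. W m y * E i y))" by (simp only: sum_product)
    also have "\<dots> = (\<Sum>i\<in>\<Lambda>. if i = l then (if l = m then 1 else 0) else 0)"
      using U W l by (intro sum.cong refl) auto
    finally show ?thesis using fin l(1) by simp
  qed
  then show ?thesis unfolding rank_ge_def by blast
qed

text \<open>A maximal independent set of columns serves as the index set.\<close>

lemma mat_rank:
  fixes A :: "'f :: field mat"
  assumes A: "A \<in> carrier_mat n nc"
  obtains \<Lambda> :: "'f vec set" where "finite \<Lambda>" "card \<Lambda> = vec_space.rank n A"
    "rank_le {..<n} {..<nc} (\<lambda>i j. A $$ (i, j)) \<Lambda>"
    "\<forall>c. (\<forall>i<n. (\<Sum>s\<in>\<Lambda>. c s * s $ i) = 0) \<longrightarrow> (\<forall>s\<in>\<Lambda>. c s = 0)"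
    "\<forall>s\<in>\<Lambda>. \<exists>j<nc. \<forall>i<n. s $ i = A $$ (i, j)"
proof -
  interpret V: vec_space "TYPE('f)" n .
  let ?P = "\<lambda>T. T \<subseteq> set (cols A) \<and> V.lin_indpt T"
  have "V.lin_indpt {}" by (simp add: V.lin_dep_def)
  then obtain S where S: "maximal S ?P"
    using maximal_exists_superset[of "set (cols A)" ?P "{}"] by auto
  then have S1: "S \<subseteq> set (cols A)" "V.lin_indpt S" unfolding maximal_def by blast+
  have colc: "set (cols A) \<subseteq> carrier_vec n" using cols_dim A by blast
  have Sc: "S \<subseteq> carrier_vec n" using S1 colc by blast
  have fS: "finite S" using S1(1) by (rule finite_subset) simp
  have span: "\<exists>a. \<forall>i<n. A $$ (i, j) = (\<Sum>s\<in>S. s $ i * a s)" if j: "j < nc" for j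
  proof -
    have cj: "col A j \<in> set (cols A)" using j A by (auto simp: cols_def)
    have "col A j \<in> V.span S"
    proof (cases "col A j \<in> S")
      case True
      then show ?thesis using V.in_own_span[of S] Sc by auto
    next
      case False
      have "\<not> ?P (S \<union> {col A j})" using S False unfolding maximal_def by blast
      then have "V.lin_dep (S \<union> {col A j})" using S1(1) cj by blast
      then show ?thesis using V.lin_dep_iff_in_span[of S "col A j"] Sc S1(2) False cj colc by auto
    qed
    then obtain a where a: "V.lincomb a S = col A j" using V.finite_in_span[OF fS] Sc by auto
    have "A $$ (i, j) = (\<Sum>s\<in>S. s $ i * a s)" if i: "i < n" for i
      using V.lincomb_index[OF i Sc, of a] a i j A by (simp add: mult.commute)
    then show ?thesis by blast
  qed
  then obtain a where a: "\<forall>j<nc. \<forall>i<n. A $$ (i, j) = (\<Sum>s\<in>S. s $ i * a j s)" by metis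
  show thesis
  proof (rule that[of S])
    show "finite S" by (rule fS)
    show "card S = V.rank A" using V.rank_card_indpt[OF A S] by simp
    show "rank_le {..<n} {..<nc} (\<lambda>i j. A $$ (i, j)) S"
      unfolding rank_le_def by (intro exI[of _ "\<lambda>s i. s $ i"] exI[of _ "\<lambda>s j. a j s"]) (use a in auto)
    have "\<forall>s\<in>S. c s = 0" if "\<forall>i<n. (\<Sum>s\<in>S. c s * s $ i) = 0" for c
    proof -
      have "V.lincomb c S = 0\<^sub>v n"
        by (rule eq_vecI) (use that V.lincomb_index[OF _ Sc, of _ c] V.lincomb_dim[OF fS Sc, of c] in auto)
      then have "c \<in> S \<rightarrow> {0}" using V.not_lindepD[OF S1(2) fS subset_refl, of c] by simp
      then show ?thesis by auto
    qed
    then show "\<forall>c. (\<forall>i<n. (\<Sum>s\<in>S. c s * s $ i) = 0) \<longrightarrow> (\<forall>s\<in>S. c s = 0)" by blast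
    show "\<forall>s\<in>S. \<exists>j<nc. \<forall>i<n. s $ i = A $$ (i, j)"
    proof
      fix s assume s: "s \<in> S"
      have "s \<in> col A ` {..<nc}" using s S1(1) A by (auto simp: cols_def)
      then obtain j where "j < nc" "s = col A j" by blast
      then show "\<exists>j<nc. \<forall>i<n. s $ i = A $$ (i, j)" using A by auto
    qed
  qed
qed

lemma mat_rank_le_ge:
  fixes A :: "'f :: {field, finite} mat"
  assumes A: "A \<in> carrier_mat n nc"
  obtains \<Lambda> :: "'f vec set" where "finite \<Lambda>" "card \<Lambda> = vec_space.rank n A"
    "rank_le {..<n} {..<nc} (\<lambda>i j. A $$ (i, j)) \<Lambda>" "rank_ge {..<n} {..<nc} (\<lambda>i j. A $$ (i, j)) \<Lambda>"
proof -
  obtain \<Lambda> :: "'f vec set" where L: "finite \<Lambda>" "card \<Lambda> = vec_space.rank n A"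
    "rank_le {..<n} {..<nc} (\<lambda>i j. A $$ (i, j)) \<Lambda>"
    and ind: "\<forall>c. (\<forall>i<n. (\<Sum>s\<in>\<Lambda>. c s * s $ i) = 0) \<longrightarrow> (\<forall>s\<in>\<Lambda>. c s = 0)"
    and col: "\<forall>s\<in>\<Lambda>. \<exists>j<nc. \<forall>i<n. s $ i = A $$ (i, j)"
    by (rule mat_rank[OF A])
  obtain U where U: "\<forall>s\<in>\<Lambda>. \<forall>s'\<in>\<Lambda>. (\<Sum>i\<in>{..<n}. U s i * s' $ i) = (if s = s' then 1 else 0)"
    by (rule dual_functions[of "{..<n}" \<Lambda> "\<lambda>s i. s $ i"]) (use L(1) ind in auto)
  have "\<forall>s. \<exists>j. s \<in> \<Lambda> \<longrightarrow> j < nc \<and> (\<forall>i<n. s $ i = A $$ (i, j))" using col by blast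
  then obtain j where j: "\<forall>s. s \<in> \<Lambda> \<longrightarrow> j s < nc \<and> (\<forall>i<n. s $ i = A $$ (i, j s))"
    unfolding choice_iff by blast
  have "(\<Sum>i\<in>{..<n}. \<Sum>k\<in>{..<nc}. U s i * A $$ (i, k) * (if k = j s' then 1 else 0)) = (if s = s' then 1 else 0)"
    if s: "s \<in> \<Lambda>" "s' \<in> \<Lambda>" for s s'
  proof -
    have js: "j s' < nc" using j s by blast
    have "(\<Sum>k\<in>{..<nc}. U s i * A $$ (i, k) * (if k = j s' then 1 else 0)) = U s i * s' $ i" if i: "i < n" for i
    proof -
      have "(\<Sum>k\<in>{..<nc}. U s i * A $$ (i, k) * (if k = j s' then 1 else 0)) =
          (\<Sum>k\<in>{..<nc}. if k = j s' then U s i * A $$ (i, k) else 0)" by (rule sum.cong) auto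
      also have "\<dots> = U s i * A $$ (i, j s')" using js by simp
      also have "A $$ (i, j s') = s' $ i" using j s(2) i by simp
      finally show ?thesis .
    qed
    then have "(\<Sum>i\<in>{..<n}. \<Sum>k\<in>{..<nc}. U s i * A $$ (i, k) * (if k = j s' then 1 else 0)) =
        (\<Sum>i\<in>{..<n}. U s i * s' $ i)" by (intro sum.cong refl) simp
    also have "\<dots> = (if s = s' then 1 else 0)" by (rule U[rule_format, OF s])
    finally show ?thesis .
  qed
  then have "rank_ge {..<n} {..<nc} (\<lambda>i j. A $$ (i, j)) \<Lambda>" unfolding rank_ge_def
    by (intro exI[of _ U] exI[of _ "\<lambda>s' k. if k = j s' then 1 else 0"] ballI)
  with L show thesis by (rule that)
qed

text \<open>Vanishing row and column sums make the constant functions orthogonal to everything under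
  M, and as the size of X is 1 in the field, constants split off as a summand of dimension one. The
  old dual functions are shifted by constants to have sum 0, with a sign on one side because of
  -M.\<close>

lemma rank_complement:
  fixes M :: "'x \<Rightarrow> 'x \<Rightarrow> 'k :: field"
    and \<Lambda> :: "'l set"
  assumes fin: "finite X" "finite \<Lambda>" and X: "of_nat (card X) = (1 :: 'k)"
    and row: "\<forall>x\<in>X. (\<Sum>y\<in>X. M x y) = 0" and col: "\<forall>y\<in>X. (\<Sum>x\<in>X. M x y) = 0"
  shows "rank_le X X M \<Lambda> \<Longrightarrow> rank_le X X (\<lambda>x y. 1 - M x y) (insert None (Some ` \<Lambda>))"
    and "rank_ge X X M \<Lambda> \<Longrightarrow> rank_ge X X (\<lambda>x y. 1 - M x y) (insert None (Some ` \<Lambda>))"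
proof -
  have sL: "(\<Sum>l\<in>insert None (Some ` \<Lambda>). f l) = f None + (\<Sum>l\<in>\<Lambda>. f (Some l))" for f :: "'l option \<Rightarrow> 'k"
    using fin by (subst sum.insert) (auto simp: sum.reindex)
  {
    assume "rank_le X X M \<Lambda>"
    then obtain A E where A: "\<forall>x\<in>X. \<forall>y\<in>X. M x y = (\<Sum>l\<in>\<Lambda>. A l x * E l y)" unfolding rank_le_def by blast
    let ?A = "\<lambda>l x. case l of None \<Rightarrow> 1 | Some l \<Rightarrow> - A l x"
      and ?E = "\<lambda>l y. case l of None \<Rightarrow> 1 | Some l \<Rightarrow> E l y"
    show "rank_le X X (\<lambda>x y. 1 - M x y) (insert None (Some ` \<Lambda>))"
      unfolding rank_le_def sL using A by (intro exI[of _ ?A] exI[of _ ?E]) (simp add: sum_negf)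
  next
    assume "rank_ge X X M \<Lambda>"
    then obtain U W where UW: "\<forall>l\<in>\<Lambda>. \<forall>m\<in>\<Lambda>. (\<Sum>x\<in>X. \<Sum>y\<in>X. U l x * M x y * W m y) = (if l = m then 1 else 0)"
      unfolding rank_ge_def by blast
    define u w where "u l = (\<Sum>x\<in>X. U l x)" and "w l = (\<Sum>x\<in>X. W l x)" for l
    have M1: "(\<Sum>x\<in>X. \<Sum>y\<in>X. a * M x y * f y) = 0" for a f
    proof -
      have "(\<Sum>x\<in>X. \<Sum>y\<in>X. a * M x y * f y) = (\<Sum>y\<in>X. \<Sum>x\<in>X. a * M x y * f y)" by (rule sum.swap)
      also have "\<dots> = (\<Sum>y\<in>X. a * (\<Sum>x\<in>X. M x y) * f y)" by (simp only: sum_distrib_left sum_distrib_right)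
      finally show ?thesis using col by simp
    qed
    have M2: "(\<Sum>x\<in>X. \<Sum>y\<in>X. f x * M x y * a) = 0" for a f
    proof -
      have "(\<Sum>x\<in>X. \<Sum>y\<in>X. f x * M x y * a) = (\<Sum>x\<in>X. f x * (\<Sum>y\<in>X. M x y) * a)"
        by (simp only: sum_distrib_left sum_distrib_right)
      then show ?thesis using row by simp
    qed
    have key: "(\<Sum>x\<in>X. \<Sum>y\<in>X. f x * (1 - M x y) * g y) = (\<Sum>x\<in>X. f x) * (\<Sum>y\<in>X. g y) - (\<Sum>x\<in>X. \<Sum>y\<in>X. f x * M x y * g y)"
      for f g by (simp add: sum_product algebra_simps sum_subtractf)
    let ?U = "\<lambda>l x. case l of None \<Rightarrow> 1 | Some l \<Rightarrow> u l - U l x"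
      and ?W = "\<lambda>l y. case l of None \<Rightarrow> 1 | Some l \<Rightarrow> W l y - w l"
    have s0: "(\<Sum>x\<in>X. u l - U l x) = 0" "(\<Sum>x\<in>X. W l x - w l) = 0" for l
      using X by (simp_all add: sum_subtractf u_def[symmetric] w_def[symmetric])
    have "(\<Sum>x\<in>X. \<Sum>y\<in>X. ?U l x * (1 - M x y) * ?W m y) = (if l = m then 1 else 0)"
      if "l \<in> insert None (Some ` \<Lambda>)" "m \<in> insert None (Some ` \<Lambda>)" for l m
    proof (cases l)
      case None
      note l = None
      show ?thesis
      proof (cases m)
        case None
        then show ?thesis unfolding key using l M1[of 1 "\<lambda>_. 1"] X by simp
      next
        case (Some m')
        then show ?thesis unfolding key using l M1[of 1 "\<lambda>y. W m' y - w m'"] by (simp add: s0)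
      qed
    next
      case (Some l')
      note l = Some
      show ?thesis
      proof (cases m)
        case None
        then show ?thesis unfolding key using l M2[of "\<lambda>x. u l' - U l' x" 1] by (simp add: s0)
      next
        case (Some m')
        have "(\<Sum>x\<in>X. \<Sum>y\<in>X. (u l' - U l' x) * M x y * (W m' y - w m')) =
            (\<Sum>x\<in>X. \<Sum>y\<in>X. u l' * M x y * (W m' y - w m')) - (\<Sum>x\<in>X. \<Sum>y\<in>X. U l' x * M x y * W m' y)
              + (\<Sum>x\<in>X. \<Sum>y\<in>X. U l' x * M x y * w m')"
          by (simp add: algebra_simps sum_subtractf sum.distrib)
        also have "\<dots> = - (if l' = m' then 1 else 0)"
          unfolding M1 M2 using UW l Some that by auto
        finally show ?thesis unfolding key using l Some by (simp add: s0)
      qed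
    qed
    then show "rank_ge X X (\<lambda>x y. 1 - M x y) (insert None (Some ` \<Lambda>))"
      unfolding rank_ge_def by (intro exI[of _ ?U] exI[of _ ?W] ballI)
  }
qed

lemma rank_le_hom:
  assumes hom: "comm_ring_hom \<phi>" and le: "rank_le X Y M \<Lambda>" shows "rank_le X Y (\<lambda>x y. \<phi> (M x y)) \<Lambda>"
proof -
  interpret comm_ring_hom \<phi> by (rule hom)
  obtain A E where "\<forall>x\<in>X. \<forall>y\<in>Y. M x y = (\<Sum>l\<in>\<Lambda>. A l x * E l y)" using le unfolding rank_le_def by blast
  then show ?thesis unfolding rank_le_def
    by (intro exI[of _ "\<lambda>l x. \<phi> (A l x)"] exI[of _ "\<lambda>l x. \<phi> (E l x)"]) (simp add: hom_sum hom_mult)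
qed

lemma rank_ge_hom:
  assumes hom: "comm_ring_hom \<phi>" and ge: "rank_ge X Y M \<Lambda>" shows "rank_ge X Y (\<lambda>x y. \<phi> (M x y)) \<Lambda>"
proof -
  interpret comm_ring_hom \<phi> by (rule hom)
  obtain U W where UW: "\<forall>l\<in>\<Lambda>. \<forall>m\<in>\<Lambda>. (\<Sum>x\<in>X. \<Sum>y\<in>Y. U l x * M x y * W m y) = (if l = m then 1 else 0)"
    using ge unfolding rank_ge_def by blast
  have "(\<Sum>x\<in>X. \<Sum>y\<in>Y. \<phi> (U l x) * \<phi> (M x y) * \<phi> (W m y)) = \<phi> (\<Sum>x\<in>X. \<Sum>y\<in>Y. U l x * M x y * W m y)" for l m
    by (simp add: hom_sum hom_mult)
  then show ?thesis unfolding rank_ge_def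
    by (intro exI[of _ "\<lambda>l x. \<phi> (U l x)"] exI[of _ "\<lambda>l x. \<phi> (W l x)"]) (simp add: UW)
qed

section \<open>The rank of the disjointness matrix\<close>

context char_p
begin

text \<open>The complement in the top monomial with e and y exchanged; through it
  \<open>db_star\<close> recovers \<open>db\<close> from \<open>cb\<close>.\<close>

definition star :: "exps \<Rightarrow> exps" where "star l = map (\<lambda>(a, b). (p - 1 - b, p - 1 - a)) l"

lemma deg_star:
  assumes "trunc l"
  shows "trunc (star l) \<and> deg1 (star l) = int (length l) * (int p - 1) - deg2 l \<and>
    deg2 (star l) = int (length l) * (int p - 1) - deg1 l"
  using assms
proof (induction l)
  case Nil
  then show ?case by (simp add: star_def)
next
  case (Cons x l)
  have "star (x # l) = (p - 1 - snd x, p - 1 - fst x) # star l" by (simp add: star_def split: prod.splits)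
  then show ?case using Cons p_pos by (simp add: algebra_simps of_nat_diff)
qed

lemma star_II: assumes "l \<in> II" shows "star l \<in> II"
  using assms deg_star[of l] by (auto simp: LL_def star_def)

lemma theta_star: assumes "l \<in> II" shows "theta (star l) = theta l"
proof (cases "p = 2")
  case False
  then show ?thesis by (simp add: theta_def)
next
  case True
  have "fst x + snd x = 1 \<longleftrightarrow> (p - 1 - snd x) + (p - 1 - fst x) = 1" if "x \<in> set l" for x
  proof -
    have "fst x < p" "snd x < p" using II(3)[OF assms] that by (auto simp: trunc_def)
    then show ?thesis unfolding True by auto
  qed
  then have a: "(\<forall>x\<in>set (star l). fst x + snd x = 1) \<longleftrightarrow> (\<forall>x\<in>set l. fst x + snd x = 1)"
    by (simp add: star_def case_prod_unfold)
  have d: "deg1 l = 2" "deg1 (star l) = 2" "length l = 5" "length (star l) = 5"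
  proof -
    have ip: "int p = 2" using True by simp
    have "length l = 5 \<and> deg1 l = 2 * int p - 2" using assms unfolding LL_def by blast
    moreover have "length (star l) = 5 \<and> deg1 (star l) = 2 * int p - 2"
      using star_II[OF assms] unfolding LL_def by blast
    ultimately show "deg1 l = 2" "deg1 (star l) = 2" "length l = 5" "length (star l) = 5"
      unfolding ip by simp_all
  qed
  show ?thesis unfolding theta_def TT_def mem_Collect_eq a by (simp add: d)
qed

lemma sum_theta: assumes "\<psi> \<in> EE" shows "(\<Sum>l\<in>II. \<psi> l * theta l) = 0"
proof (cases "p = 2")
  case False
  then show ?thesis by (simp add: theta_def)
next
  case True
  have "(\<Sum>l\<in>II. \<psi> l * theta l) = (\<Sum>l\<in>II. if l \<in> TT 5 2 then \<psi> l else 0)"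
    unfolding theta_def using True by (intro sum.cong refl) simp
  also have "\<dots> = (\<Sum>l\<in>TT 5 2. \<psi> l)" using TT_II[OF True] by (simp add: sum.If_cases II Int_absorb1)
  also have "\<dots> = 0" by (rule sum_TT_EE[OF True assms])
  finally show ?thesis .
qed

end

lemma geometric_nat: "0 < p \<Longrightarrow> (\<Sum>j<t. p ^ j) * (p - 1) + 1 = (p :: nat) ^ t"
proof (induction t)
  case (Suc t)
  then have "(\<Sum>j<Suc t. p ^ j) * (p - 1) + 1 = p ^ t + p ^ t * (p - 1)" by (simp add: distrib_right)
  also have "\<dots> = p ^ t * (1 + (p - 1))" by (simp add: distrib_left)
  finally show ?case using Suc.prems by simp
qed simp

context witt
begin

lemma db_star: assumes l: "l \<in> II" shows "db b l = cb b (star l)"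
proof -
  have len: "length l = 5" and tr: "trunc l" using II(2,3)[OF l] .
  have lt: "fst (l ! i) < p" "snd (l ! i) < p" if "i < 5" for i
    using tr len that by (auto simp: trunc_def)
  have top: "TopE = expo l + flip (expo (star l))"
  proof
    fix x :: "nat \<times> bool"
    obtain i c where x: "x = (i, c)" by force
    show "TopE x = (expo l + flip (expo (star l))) x"
      using lt[of i] len by (cases c) (auto simp: x TopE_def expo_def flip_def star_def case_prod_unfold)
  qed
  have "db b l = cf (sbst sw (WW b)) (flip (expo (star l)))" unfolding db_def top by (rule lookup_MM_mult)
  also have "\<dots> = cf (WW b) (expo (star l))" by (rule cf_sw[OF bihom_WW])
  finally show ?thesis using star_II[OF l] by (simp add: cb_def cff_def)
qed

text \<open>The projection of \<open>cb b\<close> to \<open>EE0\<close> along \<open>theta\<close>;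
  pairing with \<open>db\<close> does not see the difference by \<open>theta_db\<close>.\<close>

definition cbar :: "(nat \<Rightarrow> 'v) \<Rightarrow> exps \<Rightarrow> 'k" where "cbar b l = cb b l - cb b iota1 * theta l"

lemma cbar_EE0: "cbar b \<in> EE0"
proof -
  have "cbar b = (\<lambda>l. cb b l - cb b iota1 * theta l)" by (rule HOL.ext) (rule cbar_def)
  then show ?thesis using EE_project[OF cb_EE[of b]] by simp
qed

lemma pairing_cbar: assumes "frame b" "frame b'"
  shows "(\<Sum>l\<in>II. cbar b l * db b' l) = (gram b b' * gram b' b) ^ (p - 1) * (gg False b' * gg True b)"
proof -
  have "(\<Sum>l\<in>II. cbar b l * db b' l) = (\<Sum>l\<in>II. cb b l * db b' l) - cb b iota1 * (\<Sum>l\<in>II. theta l * db b' l)"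
    by (simp add: cbar_def left_diff_distrib sum_subtractf sum_distrib_left mult.assoc)
  then show ?thesis unfolding theta_db pairing_cb[OF assms] by simp
qed

lemma EE0_EE: "\<psi> \<in> EE0 \<Longrightarrow> \<psi> \<in> EE" by (simp add: EE0_def)

lemma dual_cbar: assumes "\<psi> \<in> EE0" shows "(\<Sum>l\<in>II. \<psi> l * db b l) = (\<Sum>l\<in>II. \<psi> l * cbar b (star l))"
proof -
  have "(\<Sum>l\<in>II. \<psi> l * cbar b (star l)) = (\<Sum>l\<in>II. \<psi> l * db b l - cb b iota1 * (\<psi> l * theta l))"
    by (rule sum.cong[OF refl]) (simp add: cbar_def db_star theta_star right_diff_distrib)
  also have "\<dots> = (\<Sum>l\<in>II. \<psi> l * db b l) - cb b iota1 * (\<Sum>l\<in>II. \<psi> l * theta l)"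
    by (simp add: sum_subtractf sum_distrib_left)
  finally show ?thesis by (simp add: sum_theta[OF EE0_EE[OF assms]])
qed

text \<open>Restricting Witt bases to their five indices yields a finite index set for the
  matrix.\<close>

definition FRM :: "(nat \<Rightarrow> 'v) set" where "FRM = {b \<in> {..<5} \<rightarrow>\<^sub>E UNIV. frame b}"

lemma frame_restrict: "frame (restrict b {..<5}) = frame b" by (simp add: frame_def)

lemma restrict_FRM: "frame b \<Longrightarrow> restrict b {..<5} \<in> FRM" by (simp add: FRM_def frame_restrict)

lemma WW_restrict: "WW (restrict b {..<5}) = WW b" by (simp add: WW_def)

lemma db_restrict: "db (restrict b {..<5}) l = db b l" by (simp add: db_def WW_restrict)

lemma finite_FRM: "finite (UNIV :: 'v set) \<Longrightarrow> finite FRM"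
  by (rule finite_subset[of _ "{..<5} \<rightarrow>\<^sub>E UNIV"]) (auto simp: FRM_def intro!: finite_PiE)

lemma gram_conj: "gram b' b = gram b b' ^ q"
proof -
  have "gram b b' ^ q = h (b 0) (b' 0) ^ q * h (b 1) (b' 1) ^ q - h (b 0) (b' 1) ^ q * h (b 1) (b' 0) ^ q"
    unfolding gram_def q by (simp only: frobenius_diff power_mult_distrib)
  also have "\<dots> = h (b' 0) (b 0) * h (b' 1) (b 1) - h (b' 1) (b 0) * h (b' 0) (b 1)"
    by (simp only: form_hermitian[symmetric])
  finally show ?thesis by (simp only: gram_def mult.commute)
qed

lemma gram_power: "(\<Prod>j<t. ((gram b b' * gram b' b) ^ (p - 1)) ^ (p ^ j)) = (if gram b b' \<noteq> 0 then 1 else 0)"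
proof -
  define g where "g = gram b b'"
  have p1: "p > 1" using prime_gt_1_nat[OF prime_p] .
  have S: "(\<Sum>j<t. p ^ j) * (p - 1) + 1 = q" unfolding q using p1 by (intro geometric_nat) simp
  have "(\<Prod>j<t. ((g * g ^ q) ^ (p - 1)) ^ (p ^ j)) = ((g * g ^ q) ^ (p - 1)) ^ (\<Sum>j<t. p ^ j)"
    by (simp only: power_sum)
  also have "\<dots> = (g ^ (q + 1)) ^ ((\<Sum>j<t. p ^ j) * (p - 1))"
    by (simp add: power_mult[symmetric] mult.commute)
  also have "(\<Sum>j<t. p ^ j) * (p - 1) = q - 1" using S by simp
  also have "(g ^ (q + 1)) ^ (q - 1) = g ^ (q ^ 2 - 1)"
  proof -
    have "(q + 1) * (q - 1) = q ^ 2 - 1" using S by (cases q) (simp_all add: power2_eq_square)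
    then show ?thesis by (simp only: power_mult[symmetric])
  qed
  finally have e: "(\<Prod>j<t. ((g * g ^ q) ^ (p - 1)) ^ (p ^ j)) = g ^ (q ^ 2 - 1)" .
  have "q \<ge> 2"
  proof -
    have "p ^ 1 \<le> p ^ t" using t p1 by (intro power_increasing) auto
    then have "p \<le> q" unfolding q by simp
    then show ?thesis using p1 by simp
  qed
  then have "2 ^ 2 \<le> q ^ 2" by (rule power_mono) simp
  then have q2: "q ^ 2 - 1 \<noteq> 0" "Suc (q ^ 2 - 1) = q ^ 2" by simp_all
  have "g ^ (q ^ 2 - 1) = (if g \<noteq> 0 then 1 else 0)"
  proof (cases "g = 0")
    case False
    have "g * g ^ (q ^ 2 - 1) = g" unfolding power_Suc[symmetric] q2(2) by (rule power_q_q)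
    then show ?thesis using False by simp
  qed (use q2 in simp)
  then show ?thesis unfolding gram_conj[of b' b] g_def[symmetric] e .
qed

section \<open>Factorization through tensors of twisted vectors\<close>

context
  fixes J :: "exps set" and \<beta> :: "exps \<Rightarrow> exps \<Rightarrow> 'k"
  assumes J: "finite J" and \<beta>: "\<forall>i\<in>J. \<beta> i \<in> EE0"
    and delta: "\<forall>i\<in>J. \<forall>j\<in>J. \<beta> i j = (if i = j then 1 else 0)"
    and interp: "\<forall>f\<in>EE0. \<forall>x. f x = (\<Sum>i\<in>J. f i * \<beta> i x)"
begin

definition eb :: "exps \<Rightarrow> (nat \<Rightarrow> 'v) \<Rightarrow> 'k" where "eb i b = (\<Sum>l\<in>II. \<beta> i l * db b l)"

definition AA :: "(nat \<Rightarrow> exps) \<Rightarrow> (nat \<Rightarrow> 'v) \<Rightarrow> 'k" where "AA L b = (\<Prod>j<t. cbar b (L j) ^ (p ^ j))"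

definition BB :: "(nat \<Rightarrow> exps) \<Rightarrow> (nat \<Rightarrow> 'v) \<Rightarrow> 'k" where "BB L b = (\<Prod>j<t. eb (L j) b ^ (p ^ j))"

abbreviation LA :: "(nat \<Rightarrow> exps) set" where "LA \<equiv> {..<t} \<rightarrow>\<^sub>E J"

lemma finite_LA: "finite LA" by (intro finite_PiE J) simp_all

lemma cbar_interp: "cbar b x = (\<Sum>i\<in>J. cbar b i * \<beta> i x)"
  using interp cbar_EE0 by blast

lemma pairing_J: assumes "frame b" "frame b'"
  shows "(\<Sum>i\<in>J. cbar b i * eb i b') = (gram b b' * gram b' b) ^ (p - 1) * (gg False b' * gg True b)"
proof -
  have "(\<Sum>i\<in>J. cbar b i * eb i b') = (\<Sum>i\<in>J. \<Sum>l\<in>II. cbar b i * \<beta> i l * db b' l)"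
    by (simp add: eb_def sum_distrib_left mult.assoc)
  also have "\<dots> = (\<Sum>l\<in>II. \<Sum>i\<in>J. cbar b i * \<beta> i l * db b' l)" by (rule sum.swap)
  also have "\<dots> = (\<Sum>l\<in>II. cbar b l * db b' l)"
    by (rule sum.cong[OF refl]) (simp only: sum_distrib_right[symmetric] cbar_interp[symmetric])
  finally show ?thesis by (simp only: pairing_cbar[OF assms])
qed

lemma eb_cbar: assumes "i \<in> J"
  shows "eb i b = (\<Sum>i'\<in>J. (\<Sum>l\<in>II. \<beta> i l * \<beta> i' (star l)) * cbar b i')"
proof -
  have "eb i b = (\<Sum>l\<in>II. \<beta> i l * cbar b (star l))"
    unfolding eb_def using \<beta> assms by (intro dual_cbar) blast
  also have "\<dots> = (\<Sum>l\<in>II. \<Sum>i'\<in>J. \<beta> i l * \<beta> i' (star l) * cbar b i')"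
    by (rule sum.cong[OF refl], subst cbar_interp) (simp add: sum_distrib_left mult_ac)
  also have "\<dots> = (\<Sum>i'\<in>J. (\<Sum>l\<in>II. \<beta> i l * \<beta> i' (star l)) * cbar b i')"
    by (simp add: sum.swap[of _ II] sum_distrib_right)
  finally show ?thesis .
qed

text \<open>The matrix of the pairing on the tensor power in the basis \<beta>, twisted slot by
  slot; it expresses the \<open>BB\<close> through the \<open>AA\<close>.\<close>

definition GM :: "(nat \<Rightarrow> exps) \<Rightarrow> (nat \<Rightarrow> exps) \<Rightarrow> 'k" where
  "GM L L' = (\<Prod>j<t. (\<Sum>l\<in>II. \<beta> (L j) l * \<beta> (L' j) (star l)) ^ (p ^ j))"

lemma BB_AA: assumes "L \<in> LA" shows "BB L b = (\<Sum>L'\<in>LA. GM L L' * AA L' b)"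
proof -
  have "BB L b = (\<Prod>j<t. \<Sum>i'\<in>J. (\<Sum>l\<in>II. \<beta> (L j) l * \<beta> i' (star l)) ^ (p ^ j) * cbar b i' ^ (p ^ j))"
    unfolding BB_def
  proof (rule prod.cong[OF refl])
    fix j assume "j \<in> {..<t}"
    then have "L j \<in> J" using assms by auto
    then show "eb (L j) b ^ (p ^ j) = (\<Sum>i'\<in>J. (\<Sum>l\<in>II. \<beta> (L j) l * \<beta> i' (star l)) ^ (p ^ j) * cbar b i' ^ (p ^ j))"
      by (simp only: eb_cbar frobenius_sum power_mult_distrib)
  qed
  also have "\<dots> = (\<Sum>L'\<in>LA. \<Prod>j<t. (\<Sum>l\<in>II. \<beta> (L j) l * \<beta> (L' j) (star l)) ^ (p ^ j) * cbar b (L' j) ^ (p ^ j))"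
    by (rule prod_sum_PiE) (simp_all add: J)
  finally show ?thesis by (simp only: GM_def AA_def prod.distrib)
qed

lemma pairing_AA_BB: assumes "frame b" "frame b'"
  shows "(\<Sum>L\<in>LA. AA L b * BB L b') = (if gram b b' \<noteq> 0 then 1 else 0) *
     ((\<Prod>j<t. gg False b' ^ (p ^ j)) * (\<Prod>j<t. gg True b ^ (p ^ j)))"
proof -
  have "(\<Sum>L\<in>LA. AA L b * BB L b') = (\<Sum>L\<in>LA. \<Prod>j<t. cbar b (L j) ^ (p ^ j) * eb (L j) b' ^ (p ^ j))"
    by (simp only: AA_def BB_def prod.distrib)
  also have "\<dots> = (\<Prod>j<t. \<Sum>i\<in>J. cbar b i ^ (p ^ j) * eb i b' ^ (p ^ j))"
    by (rule prod_sum_PiE[symmetric]) (simp_all add: J)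
  also have "\<dots> = (\<Prod>j<t. (\<Sum>i\<in>J. cbar b i * eb i b') ^ (p ^ j))"
    by (simp only: frobenius_sum power_mult_distrib)
  also have "\<dots> = (\<Prod>j<t. ((gram b b' * gram b' b) ^ (p - 1)) ^ (p ^ j)) *
      ((\<Prod>j<t. gg False b' ^ (p ^ j)) * (\<Prod>j<t. gg True b ^ (p ^ j)))"
    by (simp only: pairing_J[OF assms] power_mult_distrib prod.distrib)
  finally show ?thesis by (simp only: gram_power)
qed

lemma J_II0: assumes "i \<in> J" shows "i \<in> II0"
proof -
  have "\<beta> i i = 1" using delta assms by simp
  moreover have "\<beta> i \<in> EE0" using \<beta> assms by blast
  ultimately show ?thesis using EE0_II0[of "\<beta> i" i] by simp
qed

lemma eb_II0: assumes "i \<in> J" shows "eb i b = (\<Sum>l\<in>II0. \<beta> i l * db b l)"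
  unfolding eb_def
proof (rule sum_II0)
  fix l assume "l \<notin> II0"
  moreover have "\<beta> i \<in> EE0" using \<beta> assms by blast
  ultimately have "\<beta> i l = 0" using EE0_II0[of "\<beta> i" l] by blast
  then show "\<beta> i l * db b l = 0" by simp
qed

text \<open>The coefficients of a relation define a tensor f that is orthogonal to all Witt bases
  and is 0 by \<open>YY_zero\<close>. Since \<beta> is dual to the coordinates in J, its values
  there are the coefficients.\<close>

lemma BB_independent:
  assumes trace: "\<exists>e. e + e ^ q = (-1 :: 'k)" and z: "\<forall>b\<in>FRM. (\<Sum>L\<in>LA. c L * BB L b) = 0"
  shows "\<forall>L\<in>LA. c L = 0"
proof
  fix L0 assume L0: "L0 \<in> LA"
  define f where "f M = (if M \<in> TP then \<Sum>L\<in>LA. c L * (\<Prod>j<t. \<beta> (L j) (M j) ^ (p ^ j)) else 0)" for M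
  have Lj: "L j \<in> J" if "L \<in> LA" "j < t" for L j using that by auto
  have bz: "\<beta> i l = 0" if "i \<in> J" "l \<notin> II0" for i l
  proof -
    have "\<beta> i \<in> EE0" using \<beta> that by blast
    then show ?thesis using EE0_II0[of "\<beta> i" l] that by blast
  qed
  have tg: "tgood f" unfolding tgood_def
  proof (intro conjI allI impI ballI)
    show "M \<in> TP" if "f M \<noteq> 0" for M using that by (auto simp: f_def split: if_splits)
    fix M j assume M: "M \<in> TP" and j: "j < t"
    have "(\<lambda>l. f (M(j := l))) = (\<lambda>l. \<Sum>L\<in>LA. (c L * (\<Prod>k\<in>{..<t} - {j}. \<beta> (L k) (M k) ^ (p ^ k))) * \<beta> (L j) l ^ (p ^ j))"
    proof (rule HOL.ext)
      fix l
      have s: "(\<Prod>k<t. \<beta> (L k) ((M(j := l)) k) ^ (p ^ k)) =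
          \<beta> (L j) l ^ (p ^ j) * (\<Prod>k\<in>{..<t} - {j}. \<beta> (L k) (M k) ^ (p ^ k))" for L
        using j by (subst prod.remove[of _ j]) auto
      show "f (M(j := l)) = (\<Sum>L\<in>LA. (c L * (\<Prod>k\<in>{..<t} - {j}. \<beta> (L k) (M k) ^ (p ^ k))) * \<beta> (L j) l ^ (p ^ j))"
      proof (cases "l \<in> II0")
        case True
        then show ?thesis unfolding f_def s using TP_upd[OF M j] by (simp add: mult_ac)
      next
        case False
        then have "\<beta> (L j) l ^ (p ^ j) = 0" if "L \<in> LA" for L using bz[OF Lj[OF that j]] p_pos by simp
        then show ?thesis unfolding f_def using TP_upd[OF M j] False by simp
      qed
    qed
    moreover have "(\<lambda>l. \<Sum>L\<in>LA. (c L * (\<Prod>k\<in>{..<t} - {j}. \<beta> (L k) (M k) ^ (p ^ k))) * \<beta> (L j) l ^ (p ^ j)) \<in> EE0"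
    proof (rule EE0_sum[OF finite_LA])
      fix L assume "L \<in> LA"
      then have "\<beta> (L j) \<in> EE0" using \<beta> Lj j by blast
      then show "(\<lambda>l. \<beta> (L j) l ^ (p ^ j)) \<in> EE0" by (rule EE0_frobenius)
    qed
    ultimately show "(\<lambda>l. f (M(j := l))) \<in> EE0" by simp
  qed
  have pr: "pr f b = (\<Sum>L\<in>LA. c L * BB L b)" for b
  proof -
    have "pr f b = (\<Sum>M\<in>TP. \<Sum>L\<in>LA. c L * (\<Prod>j<t. \<beta> (L j) (M j) ^ (p ^ j) * db b (M j) ^ (p ^ j)))"
      unfolding pr_def f_def by (intro sum.cong refl) (simp add: sum_distrib_right prod.distrib mult.assoc)
    also have "\<dots> = (\<Sum>L\<in>LA. c L * (\<Sum>M\<in>TP. \<Prod>j<t. \<beta> (L j) (M j) ^ (p ^ j) * db b (M j) ^ (p ^ j)))"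
      by (simp add: sum.swap[of _ TP] sum_distrib_left)
    also have "\<dots> = (\<Sum>L\<in>LA. c L * BB L b)"
    proof (rule sum.cong[OF refl])
      fix L assume L: "L \<in> LA"
      have "(\<Sum>M\<in>TP. \<Prod>j<t. \<beta> (L j) (M j) ^ (p ^ j) * db b (M j) ^ (p ^ j)) =
          (\<Prod>j<t. \<Sum>l\<in>II0. \<beta> (L j) l ^ (p ^ j) * db b l ^ (p ^ j))"
        unfolding TP_def by (rule prod_sum_PiE[symmetric]) (simp_all add: finite_II0)
      also have "\<dots> = BB L b" unfolding BB_def
      proof (rule prod.cong[OF refl])
        fix j assume "j \<in> {..<t}"
        then have "L j \<in> J" using Lj[OF L] by simp
        then show "(\<Sum>l\<in>II0. \<beta> (L j) l ^ (p ^ j) * db b l ^ (p ^ j)) = eb (L j) b ^ (p ^ j)"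
          by (simp only: eb_II0 frobenius_sum power_mult_distrib)
      qed
      finally show "c L * (\<Sum>M\<in>TP. \<Prod>j<t. \<beta> (L j) (M j) ^ (p ^ j) * db b (M j) ^ (p ^ j)) = c L * BB L b" by simp
    qed
    finally show ?thesis .
  qed
  have "pr f b = 0" if "frame b" for b
  proof -
    have "pr f (restrict b {..<5}) = 0" unfolding pr using z restrict_FRM[OF that] by blast
    then show ?thesis unfolding pr_def db_restrict .
  qed
  then have "f \<in> YY" unfolding YY_def using tg by blast
  then have f0: "f L0 = 0" by (rule YY_zero[OF trace])
  have L0T: "L0 \<in> TP" using L0 J_II0 unfolding TP_def by (auto simp: PiE_iff)
  have "f L0 = (\<Sum>L\<in>LA. if L = L0 then c L else 0)"
    unfolding f_def if_P[OF L0T]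
  proof (rule sum.cong[OF refl])
    fix L assume L: "L \<in> LA"
    show "c L * (\<Prod>j<t. \<beta> (L j) (L0 j) ^ (p ^ j)) = (if L = L0 then c L else 0)"
    proof (cases "L = L0")
      case True
      then show ?thesis using delta Lj[OF L0] by simp
    next
      case False
      then obtain j where j: "j < t" "L j \<noteq> L0 j"
      proof -
        assume th: "\<And>j. j < t \<Longrightarrow> L j \<noteq> L0 j \<Longrightarrow> thesis"
        have "\<exists>j<t. L j \<noteq> L0 j"
        proof (rule ccontr)
          assume n: "\<not> (\<exists>j<t. L j \<noteq> L0 j)"
          have "L = L0" by (rule PiE_ext[OF L L0]) (use n in auto)
          with False show False ..
        qed
        then show thesis using th by blast
      qed
      have "\<beta> (L j) (L0 j) ^ (p ^ j) = 0" using delta Lj[OF L j(1)] Lj[OF L0 j(1)] j(2) p_pos by simp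
      then have "(\<Prod>j<t. \<beta> (L j) (L0 j) ^ (p ^ j)) = 0" using j(1) by (intro prod_zero) auto
      then show ?thesis using False by simp
    qed
  qed
  also have "\<dots> = c L0" using L0 finite_LA by simp
  finally show "c L0 = 0" using f0 by simp
qed

text \<open>Independence of the \<open>BB\<close> makes the linear map given by \<open>GM\<close>
  injective, hence bijective on a finite space. So each relation among the \<open>AA\<close> comes
  from one among the \<open>BB\<close>.\<close>

lemma AA_independent:
  assumes trace: "\<exists>e. e + e ^ q = (-1 :: 'k)" and z: "\<forall>b\<in>FRM. (\<Sum>L\<in>LA. y L * AA L b) = 0"
  shows "\<forall>L\<in>LA. y L = 0"
proof -
  let ?\<Phi> = "\<lambda>x. \<lambda>L'\<in>LA. \<Sum>L\<in>LA. x L * GM L L'" and ?V = "LA \<rightarrow>\<^sub>E (UNIV :: 'k set)"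
  have B: "(\<Sum>L\<in>LA. x L * BB L b) = (\<Sum>L'\<in>LA. (\<Sum>L\<in>LA. x L * GM L L') * AA L' b)" for x b
  proof -
    have "(\<Sum>L\<in>LA. x L * BB L b) = (\<Sum>L\<in>LA. \<Sum>L'\<in>LA. x L * GM L L' * AA L' b)"
      by (rule sum.cong[OF refl]) (simp add: BB_AA sum_distrib_left mult.assoc)
    also have "\<dots> = (\<Sum>L'\<in>LA. \<Sum>L\<in>LA. x L * GM L L' * AA L' b)" by (rule sum.swap)
    finally show ?thesis by (simp only: sum_distrib_right)
  qed
  have fV: "finite ?V" by (intro finite_PiE finite_LA) simp
  have inj: "inj_on ?\<Phi> ?V"
  proof (rule inj_onI)
    fix x x' assume x: "x \<in> ?V" and x': "x' \<in> ?V" and e: "?\<Phi> x = ?\<Phi> x'"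
    have "(\<Sum>L\<in>LA. (x L - x' L) * GM L L') = 0" if "L' \<in> LA" for L'
      using fun_cong[OF e, of L'] that by (simp add: left_diff_distrib sum_subtractf)
    then have "\<forall>b\<in>FRM. (\<Sum>L\<in>LA. (x L - x' L) * BB L b) = 0" unfolding B by simp
    then have "\<forall>L\<in>LA. x L - x' L = 0" by (rule BB_independent[OF trace])
    then show "x = x'" using x x' by (intro PiE_ext) auto
  qed
  have "?\<Phi> ` ?V = ?V" 
  proof (rule endo_inj_surj[OF fV _ inj], rule image_subsetI)
    fix x show "?\<Phi> x \<in> ?V" by (simp only: restrict_PiE) simp
  qed
  moreover have "restrict y LA \<in> ?V" by (simp only: restrict_PiE) simp
  ultimately have "restrict y LA \<in> ?\<Phi> ` ?V" by simp
  then obtain x where x: "restrict y LA = ?\<Phi> x" by (rule imageE)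
  have yx: "y L' = (\<Sum>L\<in>LA. x L * GM L L')" if "L' \<in> LA" for L'
    using fun_cong[OF x, of L'] that by simp
  have "(\<Sum>L\<in>LA. x L * BB L b) = (\<Sum>L\<in>LA. y L * AA L b)" for b
    unfolding B by (rule sum.cong[OF refl]) (simp only: yx)
  then have "\<forall>b\<in>FRM. (\<Sum>L\<in>LA. x L * BB L b) = 0" using z by simp
  then have "\<forall>L\<in>LA. x L = 0" by (rule BB_independent[OF trace])
  then show ?thesis using yx by simp
qed

text \<open>Dividing by the nonzero products \<open>sA\<close> and \<open>sB\<close> turns the
  pairing of \<open>AA\<close> with \<open>BB\<close> into the indicator of a nonzero determinant.
  Independence of both families then excludes a smaller factorization.\<close>

lemma opposite_rank_J:
  assumes fV: "finite (UNIV :: 'v set)" and trace: "\<exists>e. e + e ^ q = (-1 :: 'k)"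
  shows "rank_le FRM FRM (\<lambda>b b'. if gram b b' \<noteq> 0 then 1 else 0 :: 'k) LA"
    and "rank_ge FRM FRM (\<lambda>b b'. if gram b b' \<noteq> 0 then 1 else 0 :: 'k) LA"
proof -
  define sA sB where "sA b = (\<Prod>j<t. gg True b ^ (p ^ j))" and "sB b = (\<Prod>j<t. gg False b ^ (p ^ j))" for b
  have nz: "sA b \<noteq> 0 \<and> sB b \<noteq> 0" if "b \<in> FRM" for b
    using gg_nonzero[of b] that by (simp add: sA_def sB_def FRM_def)
  have M: "\<forall>b\<in>FRM. \<forall>b'\<in>FRM. (if gram b b' \<noteq> 0 then 1 else 0) = (\<Sum>L\<in>LA. (AA L b / sA b) * (BB L b' / sB b'))"
  proof (intro ballI)
    fix b b' assume b: "b \<in> FRM" "b' \<in> FRM"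
    have "(\<Sum>L\<in>LA. (AA L b / sA b) * (BB L b' / sB b')) = (\<Sum>L\<in>LA. AA L b * BB L b') / (sB b' * sA b)"
      by (simp add: sum_divide_distrib mult.commute)
    also have "\<dots> = (if gram b b' \<noteq> 0 then 1 else 0)"
      using b nz[OF b(1)] nz[OF b(2)] unfolding sA_def sB_def by (subst pairing_AA_BB) (auto simp: FRM_def)
    finally show "(if gram b b' \<noteq> 0 then 1 else 0) = (\<Sum>L\<in>LA. (AA L b / sA b) * (BB L b' / sB b'))" by (rule sym)
  qed
  show "rank_le FRM FRM (\<lambda>b b'. if gram b b' \<noteq> 0 then 1 else 0 :: 'k) LA"
    unfolding rank_le_def using M by (intro exI[of _ "\<lambda>L b. AA L b / sA b"] exI[of _ "\<lambda>L b. BB L b / sB b"])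
  have quot: "\<forall>b\<in>FRM. (\<Sum>L\<in>LA. c L * F L b) = 0"
    if s: "\<forall>b\<in>FRM. s b \<noteq> 0" and e: "\<forall>b\<in>FRM. (\<Sum>L\<in>LA. c L * (F L b / s b)) = 0"
    for c :: "(nat \<Rightarrow> exps) \<Rightarrow> 'k" and F :: "(nat \<Rightarrow> exps) \<Rightarrow> (nat \<Rightarrow> 'v) \<Rightarrow> 'k" and s
  proof
    fix b assume b: "b \<in> FRM"
    have "(\<Sum>L\<in>LA. c L * F L b) / s b = (\<Sum>L\<in>LA. c L * (F L b / s b))" by (simp add: sum_divide_distrib)
    also have "\<dots> = 0" by (rule bspec[OF e b])
    finally show "(\<Sum>L\<in>LA. c L * F L b) = 0" using bspec[OF s b] by simp
  qed
  have nzA: "\<forall>b\<in>FRM. sA b \<noteq> 0" and nzB: "\<forall>b\<in>FRM. sB b \<noteq> 0" using nz by blast+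
  obtain U where U: "\<forall>l\<in>LA. \<forall>m\<in>LA. (\<Sum>b\<in>FRM. U l b * (AA m b / sA b)) = (if l = m then 1 else 0)"
  proof (rule dual_functions[OF finite_FRM[OF fV] finite_LA, of "\<lambda>L b. AA L b / sA b"])
    fix c assume "\<forall>b\<in>FRM. (\<Sum>l\<in>LA. c l * (AA l b / sA b)) = 0"
    then show "\<forall>l\<in>LA. c l = 0" by (rule AA_independent[OF trace quot[OF nzA]])
  qed
  obtain W where W: "\<forall>l\<in>LA. \<forall>m\<in>LA. (\<Sum>b\<in>FRM. W l b * (BB m b / sB b)) = (if l = m then 1 else 0)"
  proof (rule dual_functions[OF finite_FRM[OF fV] finite_LA, of "\<lambda>L b. BB L b / sB b"])
    fix c assume "\<forall>b\<in>FRM. (\<Sum>l\<in>LA. c l * (BB l b / sB b)) = 0"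
    then show "\<forall>l\<in>LA. c l = 0" by (rule BB_independent[OF trace quot[OF nzB]])
  qed
  show "rank_ge FRM FRM (\<lambda>b b'. if gram b b' \<noteq> 0 then 1 else 0 :: 'k) LA"
    by (rule rank_ge_factor[OF finite_LA M U W])
qed

end

lemma opposite_rank:
  assumes fV: "finite (UNIV :: 'v set)" and trace: "\<exists>e. e + e ^ q = (-1 :: 'k)"
  obtains \<Lambda> :: "(nat \<Rightarrow> exps) set" where "finite \<Lambda>" "card \<Lambda> = N1 ^ t"
    "rank_le FRM FRM (\<lambda>b b'. if gram b b' \<noteq> 0 then 1 else 0 :: 'k) \<Lambda>"
    "rank_ge FRM FRM (\<lambda>b b'. if gram b b' \<noteq> 0 then 1 else 0 :: 'k) \<Lambda>"
proof (rule EE0_interpolation)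
  fix J b assume J: "card J = N1" "finite J" and a: "\<And>i. i \<in> J \<Longrightarrow> b i \<in> EE0"
    "\<And>i j. i \<in> J \<Longrightarrow> j \<in> J \<Longrightarrow> b i j = (if i = j then 1 else 0)"
    "\<And>f x. f \<in> EE0 \<Longrightarrow> f x = (\<Sum>i\<in>J. f i * b i x)"
  have a': "\<forall>i\<in>J. b i \<in> EE0" "\<forall>i\<in>J. \<forall>j\<in>J. b i j = (if i = j then 1 else 0)"
    "\<forall>f\<in>EE0. \<forall>x. f x = (\<Sum>i\<in>J. f i * b i x)"
    by (intro ballI a(1), assumption) (intro ballI a(2), assumption+, intro ballI allI a(3), assumption)
  show thesis
  proof (rule that[of "{..<t} \<rightarrow>\<^sub>E J"])
    show "finite ({..<t} \<rightarrow>\<^sub>E J)" using J by (intro finite_PiE) simp_all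
    show "card ({..<t} \<rightarrow>\<^sub>E J) = N1 ^ t" using J by (simp add: card_PiE)
  qed (rule opposite_rank_J[OF J(2) a' fV trace])+
qed

end

section \<open>The rank of the incidence matrix\<close>

lemma CHAR_of_card:
  assumes "prime p" "CARD('a :: {field, finite}) = p ^ n" shows "CHAR('a) = p"
proof -
  have "CHAR('a) > 0" by (rule finite_imp_CHAR_pos) simp
  then have "prime CHAR('a)" by (rule prime_CHAR_semidom)
  moreover have "CHAR('a) dvd p ^ n" using CHAR_dvd_CARD[where 'a = 'a] assms(2) by simp
  ultimately show ?thesis using assms(1) by (metis prime_dvd_power primes_dvd_imp_eq)
qed

text \<open>Every element of the field with p elements is the image of a natural number, and
  equality of such images means congruence modulo p in both fields.\<close>

lemma prime_field_hom:
  assumes p: "prime p" and f: "CARD('f :: {field, finite}) = p" and k: "CHAR('k :: {field, finite}) = p"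
  obtains \<phi> :: "'f :: {field, finite} \<Rightarrow> 'k :: {field, finite}" where "comm_ring_hom \<phi>"
proof -
  have cf: "CHAR('f) = p" by (rule CHAR_of_card[OF p, of 1]) (simp add: f)
  have eq: "(of_nat m :: 'k) = of_nat n \<longleftrightarrow> (of_nat m :: 'f) = of_nat n" for m n
    unfolding of_nat_eq_iff_cong_CHAR cf k ..
  have "inj_on (of_nat :: nat \<Rightarrow> 'f) {..<p}"
    by (rule inj_onI) (simp add: of_nat_eq_iff_cong_CHAR cf cong_less_modulus_unique_nat)
  then have "card ((of_nat :: nat \<Rightarrow> 'f) ` {..<p}) = CARD('f)" by (simp add: card_image f)
  then have "(of_nat :: nat \<Rightarrow> 'f) ` {..<p} = UNIV" by (intro card_subset_eq) simp_all
  then have surj: "\<exists>n. x = of_nat n" for x :: 'f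
  proof -
    assume "(of_nat :: nat \<Rightarrow> 'f) ` {..<p} = UNIV"
    then have "x \<in> (of_nat :: nat \<Rightarrow> 'f) ` {..<p}" by simp
    then obtain n where "x = of_nat n" by (rule imageE)
    then show ?thesis by (rule exI)
  qed
  define \<phi> :: "'f \<Rightarrow> 'k" where "\<phi> x = of_nat (SOME n. x = of_nat n)" for x
  have phi: "\<phi> (of_nat n) = of_nat n" for n
  proof -
    have "(of_nat n :: 'f) = of_nat (SOME m. (of_nat n :: 'f) = of_nat m)" by (rule someI[of _ n]) simp
    then show ?thesis unfolding \<phi>_def eq by (rule sym)
  qed
  have add: "\<phi> (x + y) = \<phi> x + \<phi> y" for x y
  proof -
    obtain m n where "x = of_nat m" "y = of_nat n" using surj[of x] surj[of y] by blast
    then show ?thesis by (simp only: of_nat_add[symmetric] phi)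
  qed
  have mult: "\<phi> (x * y) = \<phi> x * \<phi> y" for x y
  proof -
    obtain m n where "x = of_nat m" "y = of_nat n" using surj[of x] surj[of y] by blast
    then show ?thesis by (simp only: of_nat_mult[symmetric] phi)
  qed
  have "\<phi> 0 = 0" "\<phi> 1 = 1" using phi[of 0] phi[of 1] by simp_all
  then have "comm_ring_hom \<phi>" by unfold_locales (simp_all add: add mult)
  then show thesis by (rule that)
qed

context herm5
begin

definition meets :: "'v set \<Rightarrow> 'v set \<Rightarrow> 'k" where "meets Z Z' = (if Z \<inter> Z' \<noteq> {0} then 1 else 0)"

text \<open>The bounds on the rank pass along maps of the index sets, so Witt bases and points give
  the same rank although many bases share a point. The remaining 1 comes from
  \<open>rank_complement\<close>.\<close>

lemma meets_rank:
  obtains \<Lambda> :: "(nat \<Rightarrow> exps) option set" where "finite \<Lambda>" "card \<Lambda> = 1 + N1 ^ t"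
    "rank_le dual_points dual_points meets \<Lambda>" "rank_ge dual_points dual_points meets \<Lambda>"
proof -
  obtain v where v: "frame v" using ex_frame by blast
  interpret W: witt scale q h p ty t v
    by unfold_locales (rule q, rule t, rule v, rule frame_expansion)
  let ?G = "\<lambda>b b'. if gram b b' \<noteq> 0 then 1 else 0 :: 'k" and ?O = "\<lambda>Z Z'. 1 - meets Z Z'"
  obtain \<Lambda> :: "(nat \<Rightarrow> exps) set" where L: "finite \<Lambda>" "card \<Lambda> = N1 ^ t"
    "rank_le W.FRM W.FRM ?G \<Lambda>" "rank_ge W.FRM W.FRM ?G \<Lambda>"
    by (rule W.opposite_rank[OF card_V(1) trace_minus_one])
  define pt where "pt b = comb [b 0, b 1]" for b :: "nat \<Rightarrow> 'v"
  have pt_FRM: "pt ` W.FRM \<subseteq> dual_points" using frame_dual_point by (auto simp: pt_def W.FRM_def simp del: comb_Suc)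
  have O_pt: "?G b b' = ?O (pt b) (pt b')" if "frame b" "frame b'" for b b'
    using opposite_iff[OF that] by (simp add: meets_def pt_def del: comb_Suc One_nat_def)
  have "\<forall>Z. \<exists>b. Z \<in> dual_points \<longrightarrow> frame b \<and> Z = pt b"
  proof
    fix Z show "\<exists>b. Z \<in> dual_points \<longrightarrow> frame b \<and> Z = pt b"
    proof (cases "Z \<in> dual_points")
      case True
      then obtain b where "frame b" "Z = comb [b 0, b 1]" by (rule dual_point_frame)
      then show ?thesis unfolding pt_def by blast
    qed simp
  qed
  then obtain fr where fr: "\<forall>Z. Z \<in> dual_points \<longrightarrow> frame (fr Z) \<and> Z = pt (fr Z)"
    unfolding choice_iff by blast
  let ?f = "\<lambda>Z. restrict (fr Z) {..<5}"
  have pt_restrict: "pt (restrict b {..<5}) = pt b" for b by (simp add: pt_def del: comb_Suc)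
  have "rank_le dual_points dual_points ?O \<Lambda>"
  proof (rule rank_le_comp[OF L(3), of ?f _ ?f])
    show s: "?f ` dual_points \<subseteq> W.FRM" using fr W.restrict_FRM by blast
    then show "?f ` dual_points \<subseteq> W.FRM" .
    show "\<forall>Z\<in>dual_points. \<forall>Z'\<in>dual_points. ?O Z Z' = ?G (?f Z) (?f Z')"
    proof (intro ballI)
      fix Z Z' assume Z: "Z \<in> dual_points" "Z' \<in> dual_points"
      have "frame (?f Z)" "frame (?f Z')" using fr Z by (simp_all add: W.frame_restrict)
      from O_pt[OF this] show "?O Z Z' = ?G (?f Z) (?f Z')" unfolding pt_restrict using fr Z by simp
    qed
  qed
  moreover have "rank_ge dual_points dual_points ?O \<Lambda>"
  proof (rule rank_ge_comp[OF L(4) _ _ _ _ pt_FRM pt_FRM])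
    show "\<forall>b\<in>W.FRM. \<forall>b'\<in>W.FRM. ?G b b' = ?O (pt b) (pt b')"
      using O_pt unfolding W.FRM_def by blast
  qed (simp_all add: finite_points W.finite_FRM card_V(1))
  moreover have one: "of_nat (card dual_points) = (1 :: 'k)"
    using dual_points_mod_p of_nat_eq_iff_cong_CHAR[where 'a = 'k, of "card dual_points" 1] char_k by simp
  moreover have row: "(\<Sum>Z'\<in>dual_points. ?O Z Z') = 0" if "Z \<in> dual_points" for Z
  proof -
    have "(\<Sum>Z'\<in>dual_points. ?O Z Z') = (\<Sum>Z'\<in>dual_points. if Z \<inter> Z' = {0} then 1 else 0)"
      by (rule sum.cong) (simp_all add: meets_def)
    also have "\<dots> = of_nat (card {Z' \<in> dual_points. Z \<inter> Z' = {0}})"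
      by (simp add: sum.If_cases finite_points Int_def)
    also have "\<dots> = 0" using opposite_count[OF that] char_k by (simp add: of_nat_eq_0_iff_char_dvd)
    finally show ?thesis .
  qed
  have sym: "meets Z Z' = meets Z' Z" for Z Z' by (simp add: meets_def Int_commute)
  have row': "\<forall>Z\<in>dual_points. (\<Sum>Z'\<in>dual_points. ?O Z Z') = 0" using row by blast
  have col': "\<forall>Z'\<in>dual_points. (\<Sum>Z\<in>dual_points. ?O Z Z') = 0"
  proof
    fix Z' assume Z': "Z' \<in> dual_points"
    have "(\<Sum>Z\<in>dual_points. ?O Z Z') = (\<Sum>Z\<in>dual_points. ?O Z' Z)"
      by (intro sum.cong refl arg_cong[where f = "\<lambda>x. 1 - x"] sym)
    then show "(\<Sum>Z\<in>dual_points. ?O Z Z') = 0" using row[OF Z'] by simp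
  qed
  note compl = rank_complement[OF finite_points L(1) one row' col']
  have mm: "(\<lambda>Z Z'. 1 - ?O Z Z') = meets" by (simp add: fun_eq_iff)
  show thesis
  proof (rule that[of "insert None (Some ` \<Lambda>)"])
    show "finite (insert None (Some ` \<Lambda>))" using L(1) by simp
    have "card (insert None (Some ` \<Lambda>)) = Suc (card (Some ` \<Lambda>))" using L(1) by (intro card_insert_disjoint) auto
    then show "card (insert None (Some ` \<Lambda>)) = 1 + N1 ^ t" using L(2) by (simp add: card_image)
    show "rank_le dual_points dual_points meets (insert None (Some ` \<Lambda>))"
      using compl(1)[OF \<open>rank_le dual_points dual_points ?O \<Lambda>\<close>] unfolding mm .
    show "rank_ge dual_points dual_points meets (insert None (Some ` \<Lambda>))"
      using compl(2)[OF \<open>rank_ge dual_points dual_points ?O \<Lambda>\<close>] unfolding mm .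
  qed
qed

text \<open>The matrix lives over the prime field and the bounds over the larger one; factorizations
  and dual pairs both survive the embedding, so the ranks agree. Columns are matched with points by
  choosing one point for each polar hyperplane.\<close>

lemma incidence_rank:
  fixes A :: "'f :: {field, finite} mat"
  assumes f: "CARD('f) = p"
    and Ps: "set Ps = dual_points" and Hs: "set Hs = polar_hyperplanes"
    and A: "A = incidence_mat Ps Hs"
  shows "vec_space.rank (length Ps) A = 1 + N1 ^ t"
proof -
  obtain \<phi> :: "'f \<Rightarrow> 'k" where hom: "comm_ring_hom \<phi>" by (rule prime_field_hom[OF prime_p f char_k])
  interpret phi: comm_ring_hom \<phi> by (rule hom)
  obtain \<Lambda> :: "(nat \<Rightarrow> exps) option set" where L: "finite \<Lambda>" "card \<Lambda> = 1 + N1 ^ t"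
    "rank_le dual_points dual_points meets \<Lambda>" "rank_ge dual_points dual_points meets \<Lambda>"
    by (rule meets_rank)
  have Ac: "A \<in> carrier_mat (length Ps) (length Hs)" unfolding A incidence_mat_def by simp
  obtain \<Lambda>' :: "'f vec set" where L': "finite \<Lambda>'" "card \<Lambda>' = vec_space.rank (length Ps) A"
    "rank_le {..<length Ps} {..<length Hs} (\<lambda>i j. A $$ (i, j)) \<Lambda>'"
    "rank_ge {..<length Ps} {..<length Hs} (\<lambda>i j. A $$ (i, j)) \<Lambda>'"
    by (rule mat_rank_le_ge[OF Ac])
  let ?M = "\<lambda>i j. \<phi> (A $$ (i, j))"
  have M: "?M i j = meets (Ps ! i) Z'" if "i < length Ps" "j < length Hs" "Z' \<in> dual_points" "Hs ! j = polar_hyperplane Z'" for i j Z'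
  proof -
    have "Ps ! i \<in> dual_points" using that(1) Ps nth_mem by blast
    then have "Ps ! i \<in> Hs ! j \<longleftrightarrow> Ps ! i \<inter> Z' \<noteq> {0}"
      unfolding that(4) polar_hyperplane_eq[OF that(3)] by (simp add: Int_commute)
    then show ?thesis using that(1,2) unfolding A incidence_mat_def meets_def by simp
  qed
  have "\<forall>Z. \<exists>i. Z \<in> dual_points \<longrightarrow> i < length Ps \<and> Ps ! i = Z" using Ps by (metis in_set_conv_nth)
  then obtain f where f: "\<forall>Z. Z \<in> dual_points \<longrightarrow> f Z < length Ps \<and> Ps ! f Z = Z" unfolding choice_iff by blast
  have "\<forall>Z. \<exists>j. Z \<in> dual_points \<longrightarrow> j < length Hs \<and> Hs ! j = polar_hyperplane Z"
    using Hs unfolding polar_hyperplanes_def by (metis image_eqI in_set_conv_nth)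
  then obtain g where g: "\<forall>Z. Z \<in> dual_points \<longrightarrow> g Z < length Hs \<and> Hs ! g Z = polar_hyperplane Z"
    unfolding choice_iff by blast
  have "\<forall>j. \<exists>Z. j < length Hs \<longrightarrow> Z \<in> dual_points \<and> Hs ! j = polar_hyperplane Z"
  proof
    fix j show "\<exists>Z. j < length Hs \<longrightarrow> Z \<in> dual_points \<and> Hs ! j = polar_hyperplane Z"
    proof (cases "j < length Hs")
      case True
      then have "Hs ! j \<in> polar_hyperplane ` dual_points" using Hs nth_mem unfolding polar_hyperplanes_def by blast
      then show ?thesis by blast
    qed simp
  qed
  then obtain z where z: "\<forall>j. j < length Hs \<longrightarrow> z j \<in> dual_points \<and> Hs ! j = polar_hyperplane (z j)"
    unfolding choice_iff by blast
  have "rank_le dual_points dual_points meets \<Lambda>'"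
  proof (rule rank_le_comp[OF rank_le_hom[OF hom L'(3)], of f _ g])
    show "f ` dual_points \<subseteq> {..<length Ps}" "g ` dual_points \<subseteq> {..<length Hs}" using f g by auto
    show "\<forall>Z\<in>dual_points. \<forall>Z'\<in>dual_points. meets Z Z' = ?M (f Z) (g Z')"
    proof (intro ballI)
      fix Z Z' assume "Z \<in> dual_points" "Z' \<in> dual_points"
      then show "meets Z Z' = ?M (f Z) (g Z')" using M[of "f Z" "g Z'" Z'] f g by simp
    qed
  qed
  from rank_ge_le[OF L(4) this L'(1) L(1)] have "1 + N1 ^ t \<le> vec_space.rank (length Ps) A"
    unfolding L(2) L'(2) .
  moreover have "rank_le {..<length Ps} {..<length Hs} ?M \<Lambda>"
  proof (rule rank_le_comp[OF L(3), of "\<lambda>i. Ps ! i" _ z])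
    show "(\<lambda>i. Ps ! i) ` {..<length Ps} \<subseteq> dual_points" using Ps nth_mem by auto
    show "z ` {..<length Hs} \<subseteq> dual_points" using z by auto
    show "\<forall>i\<in>{..<length Ps}. \<forall>j\<in>{..<length Hs}. ?M i j = meets (Ps ! i) (z j)"
    proof (intro ballI)
      fix i j assume "i \<in> {..<length Ps}" "j \<in> {..<length Hs}"
      then show "?M i j = meets (Ps ! i) (z j)" using M[of i j "z j"] z by simp
    qed
  qed
  from rank_ge_le[OF rank_ge_hom[OF hom L'(4)] this L(1) L'(1)] have "vec_space.rank (length Ps) A \<le> 1 + N1 ^ t"
    unfolding L(2) L'(2) .
  ultimately show ?thesis by simp
qed

end

theorem theorem1p9:
  fixes p q t :: nat
    and scale :: "'k :: {field, finite} \<Rightarrow> 'v :: ab_group_add \<Rightarrow> 'v"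
    and h :: "'v \<Rightarrow> 'v \<Rightarrow> 'k"
    and Ps :: "'v set list"
    and Hs :: "'v set set list"
    and A\<^sub>1\<^sub>1 :: "'f :: {field, finite} mat"
  assumes "prime p" and "t \<ge> 1" and "q = p ^ t"
    and "hermitian_space scale q h"
    and "vector_space.dim scale (UNIV :: 'v set) = 5"
    and "distinct Ps" and "set Ps = hermitian_space.dual_points scale h"
    and "distinct Hs" and "set Hs = hermitian_space.polar_hyperplanes scale h"
    and "CARD('f) = p"
    and "A\<^sub>1\<^sub>1 = incidence_mat Ps Hs"
  shows "(p > 2 \<longrightarrow>
           real (vec_space.rank (length Ps) A\<^sub>1\<^sub>1) =
             1 + (real p * (real p + 1) / 32 * (real ((2 * p + 2) choose 3))\<^sup>2
                  - real p * (real p - 1) / 32 * (real ((2 * p) choose 3))\<^sup>2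
                  + real p / 2 * (real ((p + 1) choose 3))\<^sup>2) ^ t) \<and>
         (p = 2 \<longrightarrow> vec_space.rank (length Ps) A\<^sub>1\<^sub>1 = 1 + 74 ^ t)"
proof -
  interpret H: hermitian_space scale q h by fact
  have "CARD('k) = p ^ (t * 2)" using H.card_field assms(3) by (simp add: power_mult)
  then have char: "CHAR('k) = p" by (rule CHAR_of_card[OF assms(1)])
  interpret C: char_p p "TYPE('k)" by unfold_locales (rule assms(1), rule char)
  interpret G: herm5 scale q h p "TYPE('k)" t
    by unfold_locales (rule assms(3), rule assms(2), rule assms(5))
  have rank: "vec_space.rank (length Ps) A\<^sub>1\<^sub>1 = 1 + C.N1 ^ t"
    by (rule G.incidence_rank[OF assms(10,7,9,11)])
  show ?thesis
  proof (intro conjI impI)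
    assume "p > 2"
    then have "C.N1 = C.N0" by (simp add: C.N1_def)
    then show "real (vec_space.rank (length Ps) A\<^sub>1\<^sub>1) =
             1 + (real p * (real p + 1) / 32 * (real ((2 * p + 2) choose 3))\<^sup>2
                  - real p * (real p - 1) / 32 * (real ((2 * p) choose 3))\<^sup>2
                  + real p / 2 * (real ((p + 1) choose 3))\<^sup>2) ^ t"
      unfolding rank by (simp only: C.N0_eq[symmetric] of_nat_add of_nat_power of_nat_1)
  next
    assume "p = 2"
    then have "C.N1 = 74" unfolding C.N1_def by (rule if_P)
    then show "vec_space.rank (length Ps) A\<^sub>1\<^sub>1 = 1 + 74 ^ t" unfolding rank by simp
  qed
qed

end
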